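(* Let $\mathcal{P}$ be an admissible polytopic mesh of $\Omega$ and $\mathcal{T}=\bigcup_{K\in\mathcal{P}}\mathcal{T}_K$ an admissible simplicial submesh (in the sense of the context). Let $\mathcal{T}_K^\partial:=\{T\in\mathcal{T}_K:\ \exists\text{ face } f\subset\partial T\cap\partial K\}$ and choose the piecewise constant function $\alpha$ in the stabilisation form $s$ as $$\alpha|_K:=\gamma\max\Big\{1,\ \frac{H_K}{8C_{\rm star}}\max_{T\in\mathcal{T}_K^\partial}\frac{|f|}{|T|}\Big\},\qquad K\in\mathcal{P},$$ (where $f$ denotes a face of $T$ with $f\subset\partial T\cap\partial K$), with $\gamma\ge25\,C_{\rm equiv}$. Let $T:V_{\mathcal{P}}\to[V_{\mathcal{P}}]'$ be defined by $$[Tu_H,v_H]:=a_{DG}(\mathcal{E}^+(u_H),v_H)+s(\mathcal{E}^-(u_H),v_H),\qquad u_H,v_H\in V_{\mathcal{P}}.$$ Then $T$ is continuous and strongly monotone (i.e. there is $c>0$ with $[Tv_H-Tw_H,v_H-w_H]\ge c\,|||v_H-w_H|||_{\mathcal{P}}^2$ for all $v_H,w_H\in V_{\mathcal{P}}$). Consequently, the problem: find $u_H\in V_{\mathcal{P}}$ such that $$a_{DG}(\mathcal{E}^+(u_H),v_H)+s(\mathcal{E}^-(u_H),v_H)=\ell(v_H)\qquad\forall v_H\in V_{\mathcal{P}},$$ has a unique solution $u_H\in V_{\mathcal{P}}$.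
   Context: Setting. $\Omega\subset\mathbb{R}^d$, $d\in\{2,3\}$, is an open bounded polygonal/polyhedral domain; $\kappa>0$ is a given constant. $\mu\in L^\infty(\Omega)$, $\mu\ge0$ a.e.; $\mathcal{D}\in[L^\infty(\Omega)]^{d\times d}$ is symmetric and uniformly positive definite ($y^\top\mathcal{D}(x)y\ge\mathcal{D}_0\,y^\top y$ for some $\mathcal{D}_0>0$, all $y$, a.e. $x$). $\|\mathcal{D}\|_{0,\infty,K}$ is the $L^\infty(K)$ norm of the matrix (operator) norm; it is implicit that one-sided traces of $\mathcal{D}$ on faces of (sub)elements in $K$ are well defined and bounded by $\|\mathcal{D}\|_{0,\infty,K}$. $\ell(v_H):=\langle f,v_H\rangle_\Omega$ for a given source $f$ regular enough (e.g. $f\in L^2(\Omega)$, $\ell(v_H)=\int_\Omega fv_H\,dx$) that $\ell$ is a linear functional on $V_{\mathcal{P}}$. Polytopic mesh. $\mathcal{P}$ is a subdivision of $\Omega$ into disjoint polygonal/polyhedral elements $K$, $H_K:=\mathrm{diam}(K)$, $\Gamma_{\mathcal{P}}:=\bigcup_K\partial K$. Admissible: (a) each $K$ is star-shaped with respect to a ball of radius $\rho_K$ with $H_K\le C_{\rm star}\rho_K$; (b) $H_{K'}\le C_{\rm qu}H_K$ for all face neighbours $K'$ of $K$, with a constant $C_{\rm qu}\ge1$. $\omega_K$ is the set (union) of elements $K'\in\mathcal{P}$ sharing a facet with $K$ ($K$ included). Submesh. Each $K\in\mathcal{P}$ is subdivided into a finite (locally conforming) collection $\mathcal{T}_K$ of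 simplices, chosen independently for different $K$; $\mathcal{T}:=\bigcup_K\mathcal{T}_K$; for a simplex $T\in\mathcal{T}$ (not to be confused with the operator $T$), $h_T:=\mathrm{diam}(T)$ and $\rho_T$ is its inradius. Admissible: (a) $h_T\le C_{\rm sh}\rho_T$ for all $T\in\mathcal{T}$; (b) if $T\in\mathcal{T}_K$ has a facet $f\subset\partial K$ and $K'\in\mathcal{P}$ is the neighbouring element with $f\subset K\cap K'$, then $h_T\le H_{K'}$. Spaces. For $k\ge1$: $V_{\mathcal{P}}:=\{v\in L^2(\Omega):v|_K\in\mathbb{P}_k(K)\ \forall K\in\mathcal{P}\}$, with dual $[V_{\mathcal{P}}]'$ and duality pairing $[\cdot,\cdot]$; $W_K:=\{v\in C^0(K):v|_T\in\mathbb{P}_k(T)\ \forall T\in\mathcal{T}_K\}$; $W_{\mathcal{T}}:=\bigoplus_KW_K\supset V_{\mathcal{P}}$. $\{\boldsymbol{x}_i^T\}_{i=1}^{m_{k,d}}$ and $\{\phi_i^T\}$, $m_{k,d}=\binom{k+d}{d}$, are the degree-$k$ Lagrange nodes and basis functions of $T$. Recovery operators. For $v_H\in V_{\mathcal{P}}$, $\mathcal{E}^+(v_H)\in W_{\mathcal{T}}$ is given on each $T\in\mathcal{T}_K$, $K\in\mathcal{P}$, by $\mathcal{E}^+(v_H)|_T=\sum_{i=1}^{m_{k,d}}\max\{0,\min\{v_H|_K(\boldsymbol{x}_i^T),\kappa\}\}\phi_i^T$, and $\mathcal{E}^-(v_H):=v_H-\mathcal{E}^+(v_H)$. Forms and norms.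 On an interior face shared by $K_\pm$ (traces from $K_\pm$, outward unit normals $\mathbf{n}_\pm$): $\{\!\{\mathbf{q}\}\!\}:=\frac12(\mathbf{q}_++\mathbf{q}_-)$, $[\![v]\!]:=v_+\mathbf{n}_++v_-\mathbf{n}_-$; on boundary faces $\{\!\{\mathbf{q}\}\!\}:=\mathbf{q}$, $[\![v]\!]:=v\mathbf{n}$. For each face $F\subset\partial K_+\cap\partial K_-$ ($K_-=\emptyset$ for boundary faces), $\sigma_{\mathcal{P}}|_F:=8C_{\rm star}k(k-1+d)d^{-1}\max_{*\in\{+,-\}}\delta_{K_*}H_{K_*}^{-1}$, $\delta_{K_*}:=\|\mathcal{D}\|_{0,\infty,K_*}^2\|\mathcal{D}^{-1}\|_{0,\infty,K_*}$. With $\theta\in[-1,1]$ fixed and $\nabla_{\mathcal{P}}$ the broken gradient over $\mathcal{P}$, $$a_{DG}(w,v):=\int_\Omega(\mathcal{D}\nabla_{\mathcal{P}}w\cdot\nabla_{\mathcal{P}}v+\mu wv)\,dx+\int_{\Gamma_{\mathcal{P}}}\sigma_{\mathcal{P}}[\![w]\!]\cdot[\![v]\!]\,ds-\int_{\Gamma_{\mathcal{P}}}\big(\{\!\{\mathcal{D}\nabla w\}\!\}\cdot[\![v]\!]+\theta\{\!\{\mathcal{D}\nabla v\}\!\}\cdot[\![w]\!]\big)ds$$ (also used for arguments in $W_{\mathcal{T}}$), and $$|||v|||_{\mathcal{P}}:=\big(\|\mathcal{D}^{1/2}\nabla_{\mathcal{P}}v\|_{0,\Omega}^2+\|\sqrt\mu\,v\|_{0,\Omega}^2+\|\sqrt{\sigma_{\mathcal{P}}}[\![v]\!]\|_{0,\Gamma_{\mathcal{P}}}^2\big)^{1/2}.$$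 Stabilisation: for $w_h,v_h\in W_{\mathcal{T}}$, $$s(w_h,v_h):=\sum_{K\in\mathcal{P}}\alpha|_K\sum_{T\in\mathcal{T}_K}\sum_{i=1}^{m_{k,d}}\big(\mathcal{D}_{\omega_K}h_T^{d-2}+\mu_Th_T^d\big)w_h(\boldsymbol{x}_i^T)v_h(\boldsymbol{x}_i^T),\qquad\|v_h\|_s:=\sqrt{s(v_h,v_h)},$$ with $\mathcal{D}_{\omega_K}:=\|\mathcal{D}\|_{0,\infty,\omega_K}$, $\mu_T:=\|\mu\|_{0,\infty,T}$, nodal values on $T\in\mathcal{T}_K$ taken from within $K$. Constant. $C_{\rm equiv}>0$ is a constant for which $|||v_h|||_{\mathcal{P}}^2\le C_{\rm equiv}\|\alpha^{-1/2}v_h\|_s^2$ for all $v_h\in W_{\mathcal{T}}$ (the right-hand side does not depend on $\alpha$). *)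

theory Defs
  imports "HOL-Analysis.Analysis" "HOL-Probability.Essential_Supremum"
begin

section \<open>Polytopic meshes and simplicial submeshes\<close>

definition polyhedral :: "(real^'n) set \<Rightarrow> bool" where
  "polyhedral S \<longleftrightarrow> (\<exists>\<Q>. finite \<Q> \<and> \<Q> \<noteq> {} \<and> S = \<Union>\<Q> \<and>
     (\<forall>Q\<in>\<Q>. polytope Q \<and> aff_dim Q = int CARD('n)))"

text \<open>The condition on the interior of the closure excludes slits: a domain lies locally on one
  side of the flat parts of its boundary. No convexity and no Lipschitz property is required.\<close>

definition polyhedral_domain :: "(real^'n) set \<Rightarrow> bool" where
  "polyhedral_domain \<Omega> \<longleftrightarrow> open \<Omega> \<and> connected \<Omega> \<and> \<Omega> \<noteq> {} \<and> bounded \<Omega> \<and>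
     \<Omega> = interior (closure \<Omega>) \<and> polyhedral (closure \<Omega>)"

definition star_shaped_wrt_ball :: "(real^'n) set \<Rightarrow> real \<Rightarrow> bool" where
  "star_shaped_wrt_ball K \<rho> \<longleftrightarrow> \<rho> > 0 \<and>
     (\<exists>c. ball c \<rho> \<subseteq> K \<and> (\<forall>x\<in>K. \<forall>y\<in>ball c \<rho>. closed_segment x y \<subseteq> K))"

text \<open>Elements are closed sets with disjoint interiors.\<close>

definition subdivision_of :: "(real^'n) set set \<Rightarrow> (real^'n) set \<Rightarrow> bool" where
  "subdivision_of \<P> \<Omega> \<longleftrightarrow> finite \<P> \<and> (\<forall>K\<in>\<P>. polyhedral K) \<and> \<Union>\<P> = closure \<Omega> \<and>
     (\<forall>K\<in>\<P>. \<forall>K'\<in>\<P>. K \<noteq> K' \<longrightarrow> interior K \<inter> interior K' = {})"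

definition adjacent :: "(real^'n) set set \<Rightarrow> (real^'n) set \<Rightarrow> (real^'n) set set" where
  "adjacent \<P> F = {K\<in>\<P>. F \<subseteq> frontier K}"

text \<open>A set of faces of \<open>\<P>\<close>. Faces are convex flat pieces of the skeleton on which the pair of
  adjacent elements is constant; a flat interface that is not convex is represented by several
  faces, which changes neither the integrals over the skeleton nor the face neighbours. Hanging
  nodes are allowed.\<close>

definition mesh_faces :: "(real^'n) set \<Rightarrow> (real^'n) set set \<Rightarrow> (real^'n) set set \<Rightarrow> bool" where
  "mesh_faces \<Omega> \<P> \<F> \<longleftrightarrow> finite \<F> \<and> \<Union>\<F> = (\<Union>K\<in>\<P>. frontier K) \<and>
     (\<forall>F\<in>\<F>. polytope F \<and> aff_dim F = int CARD('n) - 1) \<and>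
     (\<forall>F\<in>\<F>. \<forall>F'\<in>\<F>. F \<noteq> F' \<longrightarrow> aff_dim (F \<inter> F') < int CARD('n) - 1) \<and>
     (\<forall>F\<in>\<F>. (\<exists>K1 K2. K1 \<noteq> K2 \<and> adjacent \<P> F = {K1, K2}) \<or>
             (F \<subseteq> frontier \<Omega> \<and> (\<exists>K. adjacent \<P> F = {K})))"

definition face_neighbours ::
  "(real^'n) set set \<Rightarrow> (real^'n) set set \<Rightarrow> (real^'n) set \<Rightarrow> (real^'n) set set" where
  "face_neighbours \<P> \<F> K = {K'\<in>\<P>. K' \<noteq> K \<and> (\<exists>F\<in>\<F>. {K, K'} \<subseteq> adjacent \<P> F)}"

definition patch :: "(real^'n) set set \<Rightarrow> (real^'n) set set \<Rightarrow> (real^'n) set \<Rightarrow> (real^'n) set" where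
  "patch \<P> \<F> K = K \<union> \<Union>(face_neighbours \<P> \<F> K)"

definition admissible_mesh ::
  "(real^'n) set \<Rightarrow> (real^'n) set set \<Rightarrow> (real^'n) set set \<Rightarrow> real \<Rightarrow> real \<Rightarrow> bool" where
  "admissible_mesh \<Omega> \<P> \<F> Cstar Cqu \<longleftrightarrow> subdivision_of \<P> \<Omega> \<and> mesh_faces \<Omega> \<P> \<F> \<and>
     (\<forall>K\<in>\<P>. \<exists>\<rho>. star_shaped_wrt_ball K \<rho> \<and> diameter K \<le> Cstar * \<rho>) \<and>
     Cqu \<ge> 1 \<and> (\<forall>K\<in>\<P>. \<forall>K'\<in>face_neighbours \<P> \<F> K. diameter K' \<le> Cqu * diameter K)"

definition inradius :: "(real^'n) set \<Rightarrow> real" where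
  "inradius T = Sup {r. 0 \<le> r \<and> (\<exists>c. cball c r \<subseteq> T)}"

text \<open>\<open>\<T> K\<close> is the local submesh of the element \<open>K\<close>; the local submeshes of neighbouring elements
  need not match.\<close>

definition admissible_submesh ::
  "(real^'n) set set \<Rightarrow> ((real^'n) set \<Rightarrow> (real^'n) set set) \<Rightarrow> real \<Rightarrow> bool" where
  "admissible_submesh \<P> \<T> Csh \<longleftrightarrow>
     (\<forall>K\<in>\<P>. triangulation (\<T> K) \<and> (\<forall>T\<in>\<T> K. int CARD('n) simplex T) \<and> \<Union>(\<T> K) = K) \<and>
     (\<forall>K\<in>\<P>. \<forall>T\<in>\<T> K. diameter T \<le> Csh * inradius T) \<and>
     (\<forall>K\<in>\<P>. \<forall>T\<in>\<T> K. \<forall>f. f facet_of T \<and> f \<subseteq> frontier K \<longrightarrow>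
        (\<forall>K'\<in>\<P>. K' \<noteq> K \<and> f \<subseteq> K \<inter> K' \<longrightarrow> diameter T \<le> diameter K'))"

section \<open>Integration over flat faces, outward normals\<close>

text \<open>The (completed) Lebesgue measure of dimension \<open>d - 1\<close> on a compact set \<open>F\<close> whose affine hull is
  a hyperplane: by Fubini it is the image of the Lebesgue measure on the prism of thickness 1 with
  mid-surface \<open>F\<close> under the orthogonal projection onto the hyperplane.\<close>

definition prism :: "(real^'n) set \<Rightarrow> (real^'n) set" where
  "prism F = {z. closest_point (affine hull F) z \<in> F \<and>
                 dist z (closest_point (affine hull F) z) \<le> 1 / 2}"

definition face_measure :: "(real^'n) set \<Rightarrow> (real^'n) measure" where
  "face_measure F = completion
     (distr (restrict_space lborel (prism F)) borel (closest_point (affine hull F)))"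

definition face_area :: "(real^'n) set \<Rightarrow> real" where
  "face_area F = measure (face_measure F) F"

definition outward_normal :: "(real^'n) set \<Rightarrow> (real^'n) set \<Rightarrow> real^'n" where
  "outward_normal K F = (THE n. norm n = 1 \<and> (\<forall>x\<in>F. \<forall>y\<in>F. n \<bullet> (x - y) = 0) \<and>
     (\<forall>x\<in>rel_interior F. \<forall>\<^sub>F t in at_right 0. x - t *\<^sub>R n \<in> K \<and> x + t *\<^sub>R n \<notin> K))"

section \<open>Coefficients\<close>

definition mat_norm :: "real^'n^'n \<Rightarrow> real" where
  "mat_norm A = onorm (\<lambda>y. A *v y)"

definition mat_sqrt :: "real^'n^'n \<Rightarrow> real^'n^'n" where
  "mat_sqrt A = (SOME S. transpose S = S \<and> (\<forall>y. 0 \<le> y \<bullet> (S *v y)) \<and> S ** S = A)"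

definition L_infty :: "(real^'n) set \<Rightarrow> (real^'n \<Rightarrow> 'b::{real_normed_vector,second_countable_topology}) \<Rightarrow> bool" where
  "L_infty S f \<longleftrightarrow> f \<in> borel_measurable (lebesgue_on S) \<and>
     (\<exists>C. AE x in lebesgue_on S. norm (f x) \<le> C)"

text \<open>For nonnegative \<open>g\<close>.\<close>

definition Linf_norm :: "(real^'n) set \<Rightarrow> (real^'n \<Rightarrow> real) \<Rightarrow> real" where
  "Linf_norm S g = enn2real (esssup (lebesgue_on S) (\<lambda>x. ennreal (g x)))"

definition mat_Linf_norm :: "(real^'n) set \<Rightarrow> (real^'n \<Rightarrow> real^'n^'n) \<Rightarrow> real" where
  "mat_Linf_norm S D = Linf_norm S (\<lambda>x. mat_norm (D x))"

definition diffusion_coefficient :: "(real^'n) set \<Rightarrow> (real^'n \<Rightarrow> real^'n^'n) \<Rightarrow> bool" where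
  "diffusion_coefficient \<Omega> D \<longleftrightarrow> L_infty \<Omega> D \<and>
     (AE x in lebesgue_on \<Omega>. transpose (D x) = D x) \<and>
     (\<exists>D0>0. AE x in lebesgue_on \<Omega>. \<forall>y. D0 * (y \<bullet> y) \<le> y \<bullet> (D x *v y))"

text \<open>The trace from within \<open>K\<close> is the one-sided Lebesgue value. It does not depend on the
  representative of \<open>D\<close>, and equals the one-sided limit whenever the latter exists.\<close>

definition has_trace :: "(real^'n \<Rightarrow> real^'n^'n) \<Rightarrow> (real^'n) set \<Rightarrow> real^'n \<Rightarrow> real^'n^'n \<Rightarrow> bool" where
  "has_trace D K x A \<longleftrightarrow>
     ((\<lambda>r. (LINT y:(K \<inter> ball x r)|lebesgue. (norm (D y - A))) / measure lebesgue (K \<inter> ball x r))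
        \<longlongrightarrow> 0) (at_right 0)"

definition trace_from :: "(real^'n) set \<Rightarrow> (real^'n \<Rightarrow> real^'n^'n) \<Rightarrow> real^'n \<Rightarrow> real^'n^'n" where
  "trace_from K D x = (THE A. has_trace D K x A)"

definition traces_well_defined ::
  "(real^'n) set set \<Rightarrow> (real^'n) set set \<Rightarrow> (real^'n \<Rightarrow> real^'n^'n) \<Rightarrow> bool" where
  "traces_well_defined \<P> \<F> D \<longleftrightarrow> (\<forall>F\<in>\<F>. \<forall>K\<in>adjacent \<P> F.
     trace_from K D \<in> borel_measurable (face_measure F) \<and>
     (AE x in face_measure F. (\<exists>A. has_trace D K x A) \<and>
        mat_norm (trace_from K D x) \<le> mat_Linf_norm K D))"

section \<open>Discrete spaces\<close>

definition poly_space :: "nat \<Rightarrow> (real^'n \<Rightarrow> real) set" where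
  "poly_space k = {p. \<exists>c. p = (\<lambda>x. \<Sum>a | (\<Sum>i\<in>UNIV. a i) \<le> k. c a * (\<Prod>i\<in>UNIV. (x $ i) ^ a i))}"

text \<open>A broken function is a family \<open>v\<close> with \<open>v K\<close> its restriction to the closed element \<open>K\<close>, so that
  traces from different elements are kept apart; values for irrelevant arguments are 0. As elements
  overlap only in null sets, this is the usual identification of a piecewise polynomial function in
  \<open>L\<^sup>2\<close> with its restrictions, and equality of families is equality almost everywhere.\<close>

type_synonym 'n broken = "(real^'n) set \<Rightarrow> real^'n \<Rightarrow> real"

definition zero_outside :: "(real^'n) set set \<Rightarrow> 'n broken \<Rightarrow> bool" where
  "zero_outside \<P> v \<longleftrightarrow> (\<forall>K x. K \<notin> \<P> \<or> x \<notin> K \<longrightarrow> v K x = 0)"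

definition V_space :: "(real^'n) set set \<Rightarrow> nat \<Rightarrow> 'n broken set" where
  "V_space \<P> k = {v. zero_outside \<P> v \<and> (\<forall>K\<in>\<P>. \<exists>p\<in>poly_space k. \<forall>x\<in>K. v K x = p x)}"

definition W_space ::
  "(real^'n) set set \<Rightarrow> ((real^'n) set \<Rightarrow> (real^'n) set set) \<Rightarrow> nat \<Rightarrow> 'n broken set" where
  "W_space \<P> \<T> k = {v. zero_outside \<P> v \<and> (\<forall>K\<in>\<P>. continuous_on K (v K) \<and>
     (\<forall>T\<in>\<T> K. \<exists>p\<in>poly_space k. \<forall>x\<in>T. v K x = p x))}"

definition linear_functional_on :: "'n broken set \<Rightarrow> ('n broken \<Rightarrow> real) \<Rightarrow> bool" where
  "linear_functional_on V \<phi> \<longleftrightarrow> (\<forall>u\<in>V. \<forall>v\<in>V. \<forall>a b.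
     \<phi> (\<lambda>K x. a * u K x + b * v K x) = a * \<phi> u + b * \<phi> v)"

definition dual_space :: "'n broken set \<Rightarrow> ('n broken \<Rightarrow> real) \<Rightarrow> ('n broken \<Rightarrow> real) set" where
  "dual_space V nrm = {\<phi>. linear_functional_on V \<phi> \<and> (\<exists>C. \<forall>v\<in>V. \<bar>\<phi> v\<bar> \<le> C * nrm v)}"

definition dual_norm :: "'n broken set \<Rightarrow> ('n broken \<Rightarrow> real) \<Rightarrow> ('n broken \<Rightarrow> real) \<Rightarrow> real" where
  "dual_norm V nrm \<phi> = (SUP v\<in>{v\<in>V. nrm v \<le> 1}. \<bar>\<phi> v\<bar>)"

definition lagrange_nodes :: "nat \<Rightarrow> (real^'n) set \<Rightarrow> (real^'n) set" where
  "lagrange_nodes k T = (let V = {v. v extreme_point_of T} in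
     {\<Sum>v\<in>V. (real (a v) / real k) *\<^sub>R v | a :: real^'n \<Rightarrow> nat. (\<Sum>v\<in>V. a v) = k})"

definition lagrange_basis :: "nat \<Rightarrow> (real^'n) set \<Rightarrow> real^'n \<Rightarrow> real^'n \<Rightarrow> real" where
  "lagrange_basis k T z = (THE p. p \<in> poly_space k \<and>
     (\<forall>y\<in>lagrange_nodes k T. p y = (if y = z then 1 else 0)))"

definition E_plus ::
  "(real^'n) set set \<Rightarrow> ((real^'n) set \<Rightarrow> (real^'n) set set) \<Rightarrow> nat \<Rightarrow> real \<Rightarrow> 'n broken \<Rightarrow> 'n broken" where
  "E_plus \<P> \<T> k \<kappa> v = (THE w. w \<in> W_space \<P> \<T> k \<and> (\<forall>K\<in>\<P>. \<forall>T\<in>\<T> K. \<forall>x\<in>T.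
     w K x = (\<Sum>z\<in>lagrange_nodes k T. max 0 (min (v K z) \<kappa>) * lagrange_basis k T z x)))"

definition E_minus ::
  "(real^'n) set set \<Rightarrow> ((real^'n) set \<Rightarrow> (real^'n) set set) \<Rightarrow> nat \<Rightarrow> real \<Rightarrow> 'n broken \<Rightarrow> 'n broken" where
  "E_minus \<P> \<T> k \<kappa> v = v - E_plus \<P> \<T> k \<kappa> v"

section \<open>Forms and norms\<close>

text \<open>The derivative is taken within the closed element. At interior points this is the ordinary
  gradient; at almost every boundary point it is the trace from \<open>K\<close> of the piecewise gradient.\<close>

definition grad_in :: "'n::finite broken \<Rightarrow> (real^'n) set \<Rightarrow> real^'n \<Rightarrow> real^'n" where
  "grad_in v K x = (SOME g. (v K has_derivative (\<lambda>h. g \<bullet> h)) (at x within K))"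

text \<open>Summing over the adjacent elements covers interior faces (two elements) and boundary faces
  (one element) simultaneously.\<close>

definition jump :: "(real^'n) set set \<Rightarrow> (real^'n) set \<Rightarrow> 'n broken \<Rightarrow> real^'n \<Rightarrow> real^'n" where
  "jump \<P> F v x = (\<Sum>K\<in>adjacent \<P> F. v K x *\<^sub>R outward_normal K F)"

definition flux_average ::
  "(real^'n) set set \<Rightarrow> (real^'n) set \<Rightarrow> (real^'n \<Rightarrow> real^'n^'n) \<Rightarrow> 'n broken \<Rightarrow> real^'n \<Rightarrow> real^'n" where
  "flux_average \<P> F D v x =
     (1 / real (card (adjacent \<P> F))) *\<^sub>R (\<Sum>K\<in>adjacent \<P> F. trace_from K D x *v grad_in v K x)"

definition delta :: "(real^'n \<Rightarrow> real^'n^'n) \<Rightarrow> (real^'n) set \<Rightarrow> real" where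
  "delta D K = (mat_Linf_norm K D)\<^sup>2 * mat_Linf_norm K (\<lambda>x. matrix_inv (D x))"

definition penalty ::
  "(real^'n) set set \<Rightarrow> (real^'n \<Rightarrow> real^'n^'n) \<Rightarrow> nat \<Rightarrow> real \<Rightarrow> (real^'n) set \<Rightarrow> real" where
  "penalty \<P> D k Cstar F = 8 * Cstar * real k * (real k - 1 + real CARD('n)) / real CARD('n) *
     Max ((\<lambda>K. delta D K / diameter K) ` adjacent \<P> F)"

definition a_DG :: "(real^'n) set set \<Rightarrow> (real^'n) set set \<Rightarrow> (real^'n \<Rightarrow> real^'n^'n) \<Rightarrow>
    (real^'n \<Rightarrow> real) \<Rightarrow> nat \<Rightarrow> real \<Rightarrow> real \<Rightarrow> 'n broken \<Rightarrow> 'n broken \<Rightarrow> real" where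
  "a_DG \<P> \<F> D \<mu> k Cstar \<theta> w v =
     (\<Sum>K\<in>\<P>. LINT x:K|lebesgue.
        ((D x *v grad_in w K x) \<bullet> grad_in v K x + \<mu> x * w K x * v K x))
   + (\<Sum>F\<in>\<F>. LINT x:F|face_measure F.
        (penalty \<P> D k Cstar F * (jump \<P> F w x \<bullet> jump \<P> F v x)))
   - (\<Sum>F\<in>\<F>. LINT x:F|face_measure F.
        (flux_average \<P> F D w x \<bullet> jump \<P> F v x + \<theta> * (flux_average \<P> F D v x \<bullet> jump \<P> F w x)))"

definition dg_norm :: "(real^'n) set set \<Rightarrow> (real^'n) set set \<Rightarrow> (real^'n \<Rightarrow> real^'n^'n) \<Rightarrow>
    (real^'n \<Rightarrow> real) \<Rightarrow> nat \<Rightarrow> real \<Rightarrow> 'n broken \<Rightarrow> real" where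
  "dg_norm \<P> \<F> D \<mu> k Cstar v = sqrt (
     (\<Sum>K\<in>\<P>. LINT x:K|lebesgue. ((norm (mat_sqrt (D x) *v grad_in v K x))\<^sup>2))
   + (\<Sum>K\<in>\<P>. LINT x:K|lebesgue. ((sqrt (\<mu> x) * v K x)\<^sup>2))
   + (\<Sum>F\<in>\<F>. LINT x:F|face_measure F.
        ((norm (sqrt (penalty \<P> D k Cstar F) *\<^sub>R jump \<P> F v x))\<^sup>2)))"

definition stab :: "(real^'n) set set \<Rightarrow> (real^'n) set set \<Rightarrow> ((real^'n) set \<Rightarrow> (real^'n) set set) \<Rightarrow>
    (real^'n \<Rightarrow> real^'n^'n) \<Rightarrow> (real^'n \<Rightarrow> real) \<Rightarrow> nat \<Rightarrow> ((real^'n) set \<Rightarrow> real) \<Rightarrow>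
    'n broken \<Rightarrow> 'n broken \<Rightarrow> real" where
  "stab \<P> \<F> \<T> D \<mu> k \<alpha> w v = (\<Sum>K\<in>\<P>. \<alpha> K * (\<Sum>T\<in>\<T> K. \<Sum>z\<in>lagrange_nodes k T.
     (mat_Linf_norm (patch \<P> \<F> K) D * diameter T ^ (CARD('n) - 2)
      + Linf_norm T (\<lambda>x. \<bar>\<mu> x\<bar>) * diameter T ^ CARD('n)) * w K z * v K z))"

definition stab_norm :: "(real^'n) set set \<Rightarrow> (real^'n) set set \<Rightarrow> ((real^'n) set \<Rightarrow> (real^'n) set set) \<Rightarrow>
    (real^'n \<Rightarrow> real^'n^'n) \<Rightarrow> (real^'n \<Rightarrow> real) \<Rightarrow> nat \<Rightarrow> ((real^'n) set \<Rightarrow> real) \<Rightarrow>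
    'n broken \<Rightarrow> real" where
  "stab_norm \<P> \<F> \<T> D \<mu> k \<alpha> v = sqrt (stab \<P> \<F> \<T> D \<mu> k \<alpha> v v)"

text \<open>The maximum runs over all pairs of a simplex and a facet of it lying on the boundary of \<open>K\<close>.\<close>

definition stab_weight ::
  "((real^'n) set \<Rightarrow> (real^'n) set set) \<Rightarrow> real \<Rightarrow> real \<Rightarrow> (real^'n) set \<Rightarrow> real" where
  "stab_weight \<T> Cstar \<gamma> K = \<gamma> * max 1 (diameter K / (8 * Cstar) *
     Max {face_area f / measure lebesgue T | T f. T \<in> \<T> K \<and> f facet_of T \<and> f \<subseteq> frontier K})"

end

theory Submission
  imports Defs "HOL-Computational_Algebra.Polynomial" "HOL-Library.Function_Algebras"
begin

text \<open>Write \<open>v = u - w\<close> and split it into the difference \<open>e\<close> of the clipped parts and the difference \<open>m\<close> of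
  the remainders. At every node \<open>e\<close> and \<open>m\<close> have the same sign, so \<open>s(m, v) \<ge> s(m, m)\<close>, and
  \<open>a(e, v) = a(v, v) - a(m, v)\<close>. The consistency terms are estimated by Young's inequality from the
  flux, weighted with \<open>1 / \<sigma>\<close>, on the faces. For \<open>v\<close>, a single polynomial on each element, this flux is at
  most \<open>d / 8\<close> times the energy, by an inverse trace inequality on star-shaped elements whose sharp
  dependence on the degree matches the penalty. For \<open>m\<close>, only piecewise polynomial, the trace inequality on the
  simplices of the submesh costs the factor that \<open>\<alpha>\<close> compensates; together with the norm equivalence and
  \<open>\<gamma> \<ge> 25 C\<close> all contributions of \<open>m\<close> are absorbed by \<open>s(m, m)\<close>.

  Both trace inequalities come from a one-dimensional estimate
  \<open>p(1)\<^sup>2 \<le> (N + 1) (N + d) \<integral> p(t)\<^sup>2 t\<^sup>d\<^sup>-\<^sup>1 dt\<close> on \<open>[0, 1]\<close>, integrated along the rays of a cone over the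
  face. The norm is definite since a piecewise constant function without jumps vanishes, hence the
  finite-dimensional theory of strongly monotone Lipschitz operators applies.\<close>

section \<open>A reproducing inequality for polynomials in one variable\<close>

text \<open>The weight \<open>\<alpha>\<close> must be paid for exactly once. For piecewise
  polynomials the flux estimate yields the energy of each element times
  \<open>\<alpha> K / \<gamma>\<close>, and bounding this by the largest weight would ruin the
  constant. The norm equivalence is therefore applied to the function multiplied on each element by
  the square root of \<open>\<alpha> K\<close>, which is admissible because functions in W need not
  match across elements.

  The constants are absolute because d is 2 or 3: d / 8 is at most 3/8, and a simplex has at most
  four facets. With \<open>\<gamma> \<ge> 25 * Cequiv\<close> the energy of m, jumps included, is at
  most 1/25 of s(m, m) and its flux at most 4/25. Young's inequality then charges 14/25 to s(m, m),
  and of the coercivity constants 2/5 and 3/8 a margin of 1/5 survives, which for the jumps is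
  exact.

  Gradients are defined through a choice that is meaningful only where an element looks locally like
  one simplex. This holds almost everywhere in the elements and on their faces, so linearity and
  measurability are argued almost everywhere, with complete measures.\<close>

lemma coeff_prod_linear_top:
  fixes r :: "nat \<Rightarrow> real"
  shows "degree (\<Prod>i<m. [:- r i, 1:]) = m"
    and "coeff (\<Prod>i<m. [:- r i, 1:]) m = 1"
    and "coeff (\<Prod>i<Suc m. [:- r i, 1:]) m = - (\<Sum>i<Suc m. r i)"
proof -
  show 1: "degree (\<Prod>i<m. [:- r i, 1:]) = m" for m
    by (subst degree_prod_eq_sum_degree) auto
  have "lead_coeff (\<Prod>i<m. [:- r i, 1:]) = 1" for m
    by (subst lead_coeff_prod) simp
  then show 2: "coeff (\<Prod>i<m. [:- r i, 1:]) m = 1" for m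
    using 1[of m] by metis
  show "coeff (\<Prod>i<Suc m. [:- r i, 1:]) m = - (\<Sum>i<Suc m. r i)"
  proof (induction m)
    case (Suc m)
    have "coeff (\<Prod>i<Suc (Suc m). [:- r i, 1:]) (Suc m)
      = coeff (\<Prod>i<Suc m. [:- r i, 1:]) m - r (Suc m) * coeff (\<Prod>i<Suc m. [:- r i, 1:]) (Suc m)"
      by (subst prod.lessThan_Suc) (simp add: algebra_simps del: prod.lessThan_Suc)
    then show ?case
      using Suc 2[of "Suc m"] by (simp del: prod.lessThan_Suc)
  qed simp
qed

text \<open>The \<open>c j\<close> are the residues in the partial fraction expansion of
  \<open>1 - (\<Prod>i\<le>N. s - i) / (\<Prod>j\<le>N. s + j + d)\<close>: its zeros at \<open>s = 0, \<dots>, N\<close> give the first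
  property, its leading term at infinity the second.\<close>

lemma reproducing_coefficients:
  fixes N d :: nat
  assumes "d \<ge> 1"
  obtains c :: "nat \<Rightarrow> real" where
    "\<And>i. i \<le> N \<Longrightarrow> (\<Sum>j\<le>N. c j / real (i + j + d)) = 1"
    "(\<Sum>j\<le>N. c j) = real ((N + 1) * (N + d))"
proof -
  define x where "x j = - real (j + d)" for j
  define A where "A = (\<Prod>j<Suc N. [:- x j, 1:])"
  define B where "B = (\<Prod>i<Suc N. [:- real i, 1:])"
  define L where "L j = (\<Prod>l\<in>{..N} - {j}. [:- x l, 1:])" for j
  define c where "c j = poly (A - B) (x j) / poly (L j) (x j)" for j
  have xinj: "x i = x j \<longleftrightarrow> i = j" for i j by (auto simp: x_def)
  have AL: "A = [:- x j, 1:] * L j" if "j \<le> N" for j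
    unfolding A_def L_def lessThan_Suc_atMost
    by (rule prod.remove) (use that in auto)
  have Lj: "poly (L j) (x i) \<noteq> 0 \<longleftrightarrow> i = j" if "i \<le> N" "j \<le> N" for i j
    using that by (auto simp: L_def poly_prod xinj)
  have degL: "degree (L j) = N" if "j \<le> N" for j
    unfolding L_def by (subst degree_prod_eq_sum_degree) (use that in auto)
  have "lead_coeff (L j) = 1" for j
    unfolding L_def by (subst lead_coeff_prod) simp
  then have cL: "coeff (L j) N = 1" if "j \<le> N" for j
    using degL[OF that] by metis
  have "degree (A - B) \<le> Suc N"
    by (rule degree_diff_le) (auto simp: A_def B_def coeff_prod_linear_top(1) simp del: prod.lessThan_Suc)
  moreover have "coeff (A - B) (Suc N) = 0"
    by (simp add: A_def B_def coeff_prod_linear_top(2) del: prod.lessThan_Suc)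
  ultimately have dAB: "degree (A - B) \<le> N"
    by (metis le_Suc_eq leading_coeff_0_iff degree_0 zero_le)
  define R where "R = (\<Sum>j\<le>N. smult (c j) (L j))"
  \<comment> \<open>Lagrange interpolation: both polynomials have degree at most N and agree at the
    N + 1 distinct points \<open>x i\<close>, where every \<open>L j\<close> with
    \<open>j \<noteq> i\<close> vanishes.\<close>
  have "A - B - R = 0"
  proof (rule ccontr)
    assume nz: "A - B - R \<noteq> 0"
    have "degree R \<le> N"
      unfolding R_def by (rule degree_sum_le) (use degL in \<open>auto intro: order_trans[OF degree_smult_le]\<close>)
    then have "degree (A - B - R) \<le> N" using dAB degree_diff_le by blast
    moreover have "poly (A - B - R) (x i) = 0" if "i \<le> N" for i
    proof -
      have "poly R (x i) = (\<Sum>j\<le>N. if j = i then c i * poly (L i) (x i) else 0)"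
        unfolding R_def poly_sum poly_smult by (rule sum.cong) (use Lj[OF that] in auto)
      also have "\<dots> = c i * poly (L i) (x i)" using that by simp
      also have "\<dots> = poly (A - B) (x i)" using Lj[OF that that] by (simp add: c_def)
      finally show ?thesis by simp
    qed
    then have "x ` {..N} \<subseteq> {z. poly (A - B - R) z = 0}" by auto
    then have "card (x ` {..N}) \<le> card {z. poly (A - B - R) z = 0}"
      by (rule card_mono[OF poly_roots_finite[OF nz]])
    moreover have "card (x ` {..N}) = Suc N"
      by (subst card_image) (auto simp: inj_on_def xinj)
    moreover have "card {z. poly (A - B - R) z = 0} \<le> degree (A - B - R)"
      by (rule card_poly_roots_bound[OF nz])
    ultimately show False by linarith
  qed
  then have AB: "A - B = R" by simp
  show ?thesis
  proof
    fix i assume i: "i \<le> N"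
    have Ai: "poly A (real i) \<noteq> 0"
      unfolding A_def poly_prod using assms by (auto simp: x_def add_eq_0_iff2 simp flip: of_nat_add simp del: prod.lessThan_Suc)
    \<comment> \<open>At a zero i of B the difference \<open>A - B\<close> is just A, and A is
      \<open>L j\<close> times a linear factor with value i + j + d; division by the nonzero value
      of A leaves the required sum.\<close>
    have "poly B (real i) = 0"
      using i by (auto simp: B_def poly_prod simp del: prod.lessThan_Suc)
    then have "poly A (real i) = (\<Sum>j\<le>N. c j * poly (L j) (real i))"
      using arg_cong[OF AB, of "\<lambda>p. poly p (real i)"] by (simp add: R_def poly_sum)
    also have "\<dots> = (\<Sum>j\<le>N. poly A (real i) * (c j / real (i + j + d)))"
    proof (rule sum.cong)
      fix j assume "j \<in> {..N}"
      then have "poly A (real i) = real (i + j + d) * poly (L j) (real i)"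
        using AL[of j] by (simp add: x_def algebra_simps)
      moreover have "real (i + j + d) \<noteq> 0" using assms by simp
      ultimately show "c j * poly (L j) (real i) = poly A (real i) * (c j / real (i + j + d))"
        by (simp add: field_simps)
    qed simp
    finally have "poly A (real i) * 1 = poly A (real i) * (\<Sum>j\<le>N. c j / real (i + j + d))"
      by (simp add: sum_distrib_left)
    then show "(\<Sum>j\<le>N. c j / real (i + j + d)) = 1" using Ai by simp
  next
    \<comment> \<open>Every \<open>L j\<close> is monic of degree N. The coefficient on the right is
      the sum of the roots of B minus the sum of the roots of A, that is the sum of 2 j + d.\<close>
    have "(\<Sum>j\<le>N. c j) = coeff (A - B) N"
      unfolding AB R_def using cL by (simp add: coeff_sum)
    also have "\<dots> = (\<Sum>j<Suc N. real j) - (\<Sum>j<Suc N. x j)"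
      by (simp add: A_def B_def coeff_prod_linear_top(3) del: prod.lessThan_Suc sum.lessThan_Suc)
    also have "\<dots> = (\<Sum>j<Suc N. 2 * real j + real d)"
      by (simp add: x_def sum_subtractf[symmetric] del: sum.lessThan_Suc)
    also have "\<dots> = real ((N + 1) * (N + d))"
      by (induction N) (auto simp: algebra_simps)
    finally show "(\<Sum>j\<le>N. c j) = real ((N + 1) * (N + d))" .
  qed
qed

lemma has_integral_power_unit: "((\<lambda>t::real. t ^ m) has_integral 1 / real (Suc m)) {0..1}"
proof -
  have "((\<lambda>t::real. t ^ m) has_integral (1 ^ Suc m / real (Suc m) - 0 ^ Suc m / real (Suc m))) {0..1}"
    by (rule fundamental_theorem_of_calculus)
       (auto simp del: of_nat_Suc power_Suc simp flip: has_real_derivative_iff_has_vector_derivative intro!: derivative_eq_intros)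
  then show ?thesis by simp
qed

text \<open>In the inner product with weight \<open>t ^ (d - 1)\<close> evaluation at 1 is
  represented by the polynomial \<open>k\<close> with the coefficients just found. Its value at 1 is
  also its squared norm \<open>M\<close>, and Cauchy-Schwarz gives the bound, with equality for
  \<open>q = k\<close>. The weight is the Jacobian of polar coordinates in a cone over a
  face.\<close>

lemma poly_value_at_one_bound:
  fixes q :: "real poly"
  assumes "degree q \<le> N" "d \<ge> 1"
  shows "(poly q 1)\<^sup>2 \<le> real ((N + 1) * (N + d)) * integral {0..1} (\<lambda>t. t ^ (d - 1) * (poly q t)\<^sup>2)"
proof -
  obtain c where c1: "\<And>i. i \<le> N \<Longrightarrow> (\<Sum>j\<le>N. c j / real (i + j + d)) = 1"
    and c2: "(\<Sum>j\<le>N. c j) = real ((N + 1) * (N + d))"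
    using reproducing_coefficients[OF assms(2)] by blast
  define M where "M = real ((N + 1) * (N + d))"
  have M: "M > 0" using assms(2) by (simp add: M_def del: of_nat_add of_nat_mult)
  define k where "k = (\<Sum>j\<le>N. monom (c j) j)"
  have k1: "poly k 1 = M" using c2 by (simp add: k_def poly_sum poly_monom M_def)
  have degk: "degree k \<le> N"
    unfolding k_def by (rule degree_sum_le) (auto intro: order_trans[OF degree_monom_le])
  \<comment> \<open>The powers i, j and d - 1 of t together integrate to 1 / (i + j + d), so the
    residue identity turns each monomial of p into its coefficient.\<close>
  have rep: "integral {0..1} (\<lambda>t. t ^ (d - 1) * (poly k t * poly p t)) = poly p 1" if p: "degree p \<le> N" for p
  proof -
    have pe: "poly p t = (\<Sum>i\<le>N. coeff p i * t ^ i)" for t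
      unfolding poly_altdef
      by (rule sum.mono_neutral_left) (use p in \<open>auto simp: coeff_eq_0\<close>)
    have "t ^ (d - 1) * (poly k t * poly p t)
        = (\<Sum>i\<le>N. \<Sum>j\<le>N. coeff p i * c j * t ^ (i + j + (d - 1)))" for t
    proof -
      have "t ^ (d - 1) * (poly k t * poly p t)
          = t ^ (d - 1) * ((\<Sum>i\<le>N. coeff p i * t ^ i) * (\<Sum>j\<le>N. c j * t ^ j))"
        by (simp add: pe k_def poly_sum poly_monom)
      also have "\<dots> = (\<Sum>i\<le>N. \<Sum>j\<le>N. t ^ (d - 1) * (coeff p i * t ^ i * (c j * t ^ j)))"
        by (simp only: sum_product) (simp only: sum_distrib_left)
      finally show ?thesis by (simp add: power_add mult_ac)
    qed
    moreover have "((\<lambda>t. (\<Sum>i\<le>N. \<Sum>j\<le>N. coeff p i * c j * t ^ (i + j + (d - 1)))) has_integral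
        (\<Sum>i\<le>N. \<Sum>j\<le>N. coeff p i * c j * (1 / real (Suc (i + j + (d - 1)))))) {0..1}"
      by (intro has_integral_sum has_integral_mult_right has_integral_power_unit) auto
    ultimately have "integral {0..1} (\<lambda>t. t ^ (d - 1) * (poly k t * poly p t))
        = (\<Sum>i\<le>N. \<Sum>j\<le>N. coeff p i * c j * (1 / real (Suc (i + j + (d - 1)))))"
      by (simp add: integral_unique)
    also have "\<dots> = (\<Sum>i\<le>N. coeff p i * (\<Sum>j\<le>N. c j / real (i + j + d)))"
      using assms(2) by (simp add: sum_distrib_left mult_ac)
    also have "\<dots> = (\<Sum>i\<le>N. coeff p i)" using c1 by simp
    also have "\<dots> = poly p 1" by (simp add: pe)
    finally show ?thesis .
  qed
  have int: "(\<lambda>t. t ^ (d - 1) * (poly p t * poly r t)) integrable_on {0..1}" for p r :: "real poly"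
    by (intro integrable_continuous_real continuous_intros)
  \<comment> \<open>\<open>smult s k\<close> is the orthogonal projection of q onto the span of
    \<open>k\<close>.\<close>
  define s where "s = poly q 1 / M"
  have "0 \<le> integral {0..1} (\<lambda>t. t ^ (d - 1) * (poly (q - smult s k) t * poly (q - smult s k) t))"
    by (rule integral_nonneg[OF int]) auto
  also have "\<dots> = integral {0..1} (\<lambda>t. t ^ (d - 1) * (poly q t * poly q t)
      - 2 * s * (t ^ (d - 1) * (poly k t * poly q t)) + s\<^sup>2 * (t ^ (d - 1) * (poly k t * poly k t)))"
    by (intro integral_cong) (simp add: algebra_simps power2_eq_square)
  also have "\<dots> = integral {0..1} (\<lambda>t. t ^ (d - 1) * (poly q t * poly q t)) - 2 * s * poly q 1 + s\<^sup>2 * M"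
  proof (rule integral_unique)
    have hi: "((\<lambda>t. t ^ (d - 1) * (poly q t * poly q t)) has_integral
        integral {0..1} (\<lambda>t. t ^ (d - 1) * (poly q t * poly q t))) {0..1}"
      "((\<lambda>t. t ^ (d - 1) * (poly k t * poly q t)) has_integral poly q 1) {0..1}"
      "((\<lambda>t. t ^ (d - 1) * (poly k t * poly k t)) has_integral M) {0..1}"
      using integrable_integral[OF int[of q q]] integrable_integral[OF int[of k q]]
        integrable_integral[OF int[of k k]] rep[OF assms(1)] rep[OF degk] k1 by metis+
    show "((\<lambda>t. t ^ (d - 1) * (poly q t * poly q t)
      - 2 * s * (t ^ (d - 1) * (poly k t * poly q t)) + s\<^sup>2 * (t ^ (d - 1) * (poly k t * poly k t)))
      has_integral integral {0..1} (\<lambda>t. t ^ (d - 1) * (poly q t * poly q t)) - 2 * s * poly q 1 + s\<^sup>2 * M) {0..1}"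
      by (intro has_integral_add has_integral_diff has_integral_mult_right hi)
  qed
  also have "\<dots> = integral {0..1} (\<lambda>t. t ^ (d - 1) * (poly q t)\<^sup>2) - (poly q 1)\<^sup>2 / M"
    using M by (simp add: s_def power2_eq_square field_simps)
  finally show ?thesis using M unfolding M_def[symmetric] by (simp add: field_simps)
qed

lemma poly_value_at_one_bound_nn:
  fixes q :: "real poly"
  assumes "degree q \<le> N" "d \<ge> 1"
  shows "ennreal ((poly q 1)\<^sup>2) \<le> ennreal (real ((N + 1) * (N + d))) *
    (\<integral>\<^sup>+t. ennreal (t ^ (d - 1) * (poly q t)\<^sup>2) * indicator {0..1} t \<partial>lborel)"
proof -
  let ?f = "\<lambda>t. t ^ (d - 1) * (poly q t)\<^sup>2"
  have "?f integrable_on {0..1}"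
    by (intro integrable_continuous_real continuous_intros)
  then have hi: "(?f has_integral integral {0..1} ?f) {0..1}" by (rule integrable_integral)
  have e: "(\<integral>\<^sup>+t. ennreal (?f t) * indicator {0..1} t \<partial>lborel) = ennreal (integral {0..1} ?f)"
    by (intro nn_integral_has_integral_lebesgue'[OF _ hi]) auto
  have "0 \<le> integral {0..1} ?f"
    by (rule integral_nonneg[OF \<open>?f integrable_on {0..1}\<close>]) auto
  then show ?thesis
    using poly_value_at_one_bound[OF assms] unfolding e
    by (subst ennreal_mult[symmetric]) (auto intro!: ennreal_leI simp del: of_nat_mult of_nat_add)
qed

section \<open>Square roots of symmetric positive semidefinite matrices\<close>

lemma symmetric_inner_eq:
  fixes A :: "real^'n^'n"
  assumes "transpose A = A"
  shows "x \<bullet> (A *v y) = (A *v x) \<bullet> y"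
  by (metis assms dot_lmul_matrix transpose_matrix_vector)

text \<open>The first-order condition at a minimum in t = 0. The denominator \<open>b + 1\<close> in
  the witness avoids a case distinction for b = 0.\<close>

lemma quadratic_nonneg_linear_coeff:
  fixes a b :: real
  assumes "\<And>t. 0 \<le> 2 * t * a + t\<^sup>2 * b" "b \<ge> 0"
  shows "a = 0"
proof (rule ccontr)
  assume "a \<noteq> 0"
  define t where "t = - a / (b + 1)"
  have b1: "b + 1 > 0" using assms(2) by simp
  have "t * (b + 1) = - a" using b1 by (simp add: t_def)
  then have "t * (t * (b + 1)) = - (t * a)" by simp
  moreover have "t\<^sup>2 * b \<le> t * (t * (b + 1))" by (simp add: power2_eq_square algebra_simps)
  ultimately have "0 \<le> t * a" using assms(1)[of t] by simp
  moreover have "t * a = - (a\<^sup>2 / (b + 1))" by (simp add: t_def power2_eq_square)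
  moreover have "a\<^sup>2 / (b + 1) > 0" using \<open>a \<noteq> 0\<close> b1 by simp
  ultimately show False by linarith
qed

text \<open>A maximiser of the Rayleigh quotient over the unit sphere of an invariant subspace is an
  eigenvector.\<close>

lemma invariant_subspace_eigenvector:
  fixes A :: "real^'n^'n"
  assumes A: "transpose A = A" and S: "subspace S" "S \<noteq> {0}" and inv: "\<And>x. x \<in> S \<Longrightarrow> A *v x \<in> S"
  obtains x l where "x \<in> S" "norm x = 1" "A *v x = l *\<^sub>R x"
proof -
  let ?U = "S \<inter> sphere 0 1"
  have "compact ?U" using S(1) by (simp add: closed_Int_compact closed_subspace)
  moreover obtain v where v: "v \<in> S" "v \<noteq> 0" using S subspace_0 by fastforce
  then have "v /\<^sub>R norm v \<in> ?U" using S(1) by (simp add: subspace_scale)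
  then have "?U \<noteq> {}" by blast
  moreover have "continuous_on ?U (\<lambda>x. x \<bullet> (A *v x))"
    by (intro continuous_intros matrix_vector_mult_linear_continuous_on)
  ultimately obtain x where x: "x \<in> ?U" and max: "\<And>y. y \<in> ?U \<Longrightarrow> y \<bullet> (A *v y) \<le> x \<bullet> (A *v x)"
    using continuous_attains_sup by meson
  define l where "l = x \<bullet> (A *v x)"
  have nx: "x \<bullet> x = 1" using x by (simp add: dot_square_norm)
  have le: "y \<bullet> (A *v y) \<le> l * (y \<bullet> y)" if y: "y \<in> S" for y
  proof (cases "y = 0")
    case False
    have "y /\<^sub>R norm y \<in> ?U" using S(1) y False by (simp add: subspace_scale)
    from max[OF this] have "(y \<bullet> (A *v y)) / (norm y)\<^sup>2 \<le> l"
      by (simp add: l_def matrix_vector_mult_scaleR power2_eq_square divide_simps)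
    then show ?thesis using False by (simp add: pos_divide_le_eq dot_square_norm)
  qed simp
  define r where "r = A *v x - l *\<^sub>R x"
  have c: "x \<bullet> r = r \<bullet> x" "x \<bullet> (A *v r) = r \<bullet> (A *v x)"
    using symmetric_inner_eq[OF A, of x r] by (simp_all add: inner_commute)
  have rS: "r \<in> S" using x S(1) inv by (simp add: r_def subspace_diff subspace_scale)
  have "r \<bullet> r = 0"
  proof (rule quadratic_nonneg_linear_coeff)
    fix t :: real
    have "x - t *\<^sub>R r \<in> S" using x rS S(1) by (simp add: subspace_diff subspace_scale)
    \<comment> \<open>The absolute value only makes the quadratic coefficient nonnegative, as
      \<open>quadratic_nonneg_linear_coeff\<close> demands; adding it keeps the inequality.\<close>
    from le[OF this] show "0 \<le> 2 * t * (r \<bullet> r) + t\<^sup>2 * (l * (r \<bullet> r) - r \<bullet> (A *v r) + \<bar>l * (r \<bullet> r) - r \<bullet> (A *v r)\<bar>)"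
    proof -
      assume le: "(x - t *\<^sub>R r) \<bullet> (A *v (x - t *\<^sub>R r)) \<le> l * ((x - t *\<^sub>R r) \<bullet> (x - t *\<^sub>R r))"
      have f1: "(x - t *\<^sub>R r) \<bullet> (A *v (x - t *\<^sub>R r)) = l - 2 * t * (r \<bullet> (A *v x)) + t\<^sup>2 * (r \<bullet> (A *v r))"
        by (simp add: l_def matrix_vector_mult_diff_distrib matrix_vector_mult_scaleR inner_simps c
            power2_eq_square algebra_simps)
      have f2: "(x - t *\<^sub>R r) \<bullet> (x - t *\<^sub>R r) = 1 - 2 * t * (r \<bullet> x) + t\<^sup>2 * (r \<bullet> r)"
        by (simp add: nx inner_simps c(1) power2_eq_square algebra_simps)
      have f3: "r \<bullet> (A *v x) = r \<bullet> r + l * (r \<bullet> x)"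
        using arg_cong[OF r_def, of "inner r"] by (simp add: inner_simps)
      from le[unfolded f1 f2 f3] have "0 \<le> 2 * t * (r \<bullet> r) + t\<^sup>2 * (l * (r \<bullet> r) - r \<bullet> (A *v r))"
        by (simp add: algebra_simps)
      moreover have "0 \<le> t\<^sup>2 * \<bar>l * (r \<bullet> r) - r \<bullet> (A *v r)\<bar>" by simp
      ultimately have "0 \<le> (2 * t * (r \<bullet> r) + t\<^sup>2 * (l * (r \<bullet> r) - r \<bullet> (A *v r)))
          + t\<^sup>2 * \<bar>l * (r \<bullet> r) - r \<bullet> (A *v r)\<bar>"
        by (rule add_nonneg_nonneg)
      then show ?thesis by (simp only: distrib_left add.assoc)
    qed
  qed simp
  then have "A *v x = l *\<^sub>R x" by (simp add: r_def)
  then show ?thesis using that x by auto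
qed

text \<open>The spectral theorem, splitting off one eigenvector at a time: by symmetry its
  orthogonal complement inside S is invariant again, and the dimension drops by one. Working with
  invariant subspaces keeps the matrix fixed in the induction.\<close>

lemma symmetric_eigenbasis_subspace:
  fixes A :: "real^'n^'n"
  assumes A: "transpose A = A"
  shows "subspace S \<Longrightarrow> (\<And>x. x \<in> S \<Longrightarrow> A *v x \<in> S) \<Longrightarrow> dim S = m \<Longrightarrow>
    \<exists>B l. finite B \<and> (\<forall>e\<in>B. A *v e = l e *\<^sub>R e \<and> norm e = 1) \<and> pairwise orthogonal B \<and> B \<subseteq> S \<and> S \<subseteq> span B"
proof (induction m arbitrary: S)
  case 0
  then have "S \<subseteq> {0}" by (simp add: dim_eq_0)
  then show ?case by (intro exI[of _ "{}"]) (auto simp: pairwise_def)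
next
  case (Suc m)
  then have "S \<noteq> {0}" by auto
  then obtain x l where x: "x \<in> S" "norm x = 1" "A *v x = l *\<^sub>R x"
    using invariant_subspace_eigenvector[OF A] Suc.prems by metis
  have nx: "x \<bullet> x = 1" using x by (simp add: dot_square_norm)
  define S' where "S' = S \<inter> {y. x \<bullet> y = 0}"
  have S': "subspace S'" unfolding S'_def by (intro subspace_inter Suc.prems subspace_hyperplane)
  have inv: "A *v y \<in> S'" if "y \<in> S'" for y
    using that Suc.prems(2)[of y] symmetric_inner_eq[OF A, of x y] x(3) by (auto simp: S'_def)
  have decomp: "y - (x \<bullet> y) *\<^sub>R x \<in> S'" if "y \<in> S" for y
    using that x Suc.prems(1) nx by (simp add: S'_def subspace_diff subspace_scale inner_simps)
  have "S \<subseteq> span (insert x S')"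
  proof
    fix y assume "y \<in> S"
    from decomp[OF this] show "y \<in> span (insert x S')"
      by (metis diff_add_cancel insertI1 insertI2 span_add span_base span_scale)
  qed
  then have d1: "dim S \<le> dim (insert x S')" by (metis dim_span dim_subset)
  have "x \<notin> S'" using nx by (simp add: S'_def)
  moreover have "S' \<subseteq> S" by (auto simp: S'_def)
  ultimately have "S' \<subset> S" using x(1) by blast
  then have "dim S' < dim S"
    using Suc.prems(1) S' by (metis dim_psubset span_eq_iff)
  moreover have "dim (insert x S') \<le> dim S' + 1" by (simp add: dim_insert)
  ultimately have "dim S' = m" using Suc.prems(3) d1 by linarith
  from Suc.IH[OF S' inv this] obtain B l' where B: "finite B" "\<forall>e\<in>B. A *v e = l' e *\<^sub>R e \<and> norm e = 1"
      "pairwise orthogonal B" "B \<subseteq> S'" "S' \<subseteq> span B" by blast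
  have xB: "x \<notin> B" using B(4) nx by (auto simp: S'_def)
  show ?case
  proof (intro exI conjI)
    show "finite (insert x B)" using B by simp
    show "\<forall>e\<in>insert x B. A *v e = (l'(x := l)) e *\<^sub>R e \<and> norm e = 1"
      using B x xB by auto
    show "pairwise orthogonal (insert x B)"
      using B(3,4) by (auto simp: pairwise_insert S'_def orthogonal_def inner_commute)
    show "insert x B \<subseteq> S" using B(4) x by (auto simp: S'_def)
    have "S' \<subseteq> span (insert x B)" using B(5) span_mono[of B "insert x B"] by blast
    then have "insert x S' \<subseteq> span (insert x B)" by (simp add: span_base)
    then have "span (insert x S') \<subseteq> span (insert x B)" by (simp add: span_minimal)
    then show "S \<subseteq> span (insert x B)" using \<open>S \<subseteq> span (insert x S')\<close> by blast
  qed
qed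

text \<open>As \<open>mat_sqrt\<close> is a choice, only the existence of a root is at stake. The
  witness scales each vector of an orthonormal eigenbasis by the square root of its
  eigenvalue.\<close>

lemma mat_sqrt_properties:
  fixes A :: "real^'n^'n"
  assumes A: "transpose A = A" and pos: "\<And>y. 0 \<le> y \<bullet> (A *v y)"
  shows "transpose (mat_sqrt A) = mat_sqrt A" "mat_sqrt A ** mat_sqrt A = A"
proof -
  obtain B l where B: "finite B" "\<forall>e\<in>B. A *v e = l e *\<^sub>R e \<and> norm e = 1"
      "pairwise orthogonal B" "UNIV \<subseteq> span B"
    using symmetric_eigenbasis_subspace[OF A subspace_UNIV, of "dim (UNIV :: (real^'n) set)"] by blast
  have l: "l e \<ge> 0" if "e \<in> B" for e
    using pos[of e] B(2) that by (auto simp: dot_square_norm)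
  have BB: "e \<bullet> e' = (if e = e' then 1 else 0)" if "e \<in> B" "e' \<in> B" for e e'
    using that B(2,3) by (auto simp: pairwise_def orthogonal_def dot_square_norm)
  have repr: "y = (\<Sum>e\<in>B. (e \<bullet> y) *\<^sub>R e)" for y
  proof -
    have "y \<in> span B" using B(4) by blast
    then obtain u where u: "y = (\<Sum>e\<in>B. u e *\<^sub>R e)" using span_finite[OF B(1)] by auto
    have "e \<bullet> y = u e" if "e \<in> B" for e
    proof -
      have "e \<bullet> y = (\<Sum>e'\<in>B. if e = e' then u e' else 0)"
        unfolding u inner_sum_right by (rule sum.cong) (use BB that in auto)
      then show ?thesis using B(1) that by simp
    qed
    then show ?thesis using u by simp
  qed
  define f where "f = (\<lambda>y. \<Sum>e\<in>B. (sqrt (l e) * (e \<bullet> y)) *\<^sub>R e)"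
  have lin: "linear f"
    unfolding f_def
    by (rule linearI) (auto simp: inner_simps algebra_simps sum.distrib scaleR_sum_right)
  define S where "S = matrix f"
  have Sv: "S *v y = f y" for y using lin by (simp add: S_def matrix_works)
  have sym: "x \<bullet> f y = f x \<bullet> y" for x y
    by (simp add: f_def inner_sum_left inner_sum_right inner_commute mult_ac)
  have ffA: "f (f y) = A *v y" for y
  proof -
    have ef: "e \<bullet> f y = sqrt (l e) * (e \<bullet> y)" if "e \<in> B" for e
    proof -
      have "e \<bullet> f y = (\<Sum>e'\<in>B. if e = e' then sqrt (l e') * (e' \<bullet> y) else 0)"
        unfolding f_def inner_sum_right by (rule sum.cong) (use BB that in auto)
      then show ?thesis using B(1) that by simp
    qed
    have "f (f y) = (\<Sum>e\<in>B. (l e * (e \<bullet> y)) *\<^sub>R e)"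
      unfolding f_def[THEN fun_cong, of "f y"] by (rule sum.cong) (use ef l in \<open>auto simp: mult.assoc[symmetric]\<close>)
    also have "\<dots> = A *v (\<Sum>e\<in>B. (e \<bullet> y) *\<^sub>R e)"
      using B(2) by (simp add: linear_sum[OF matrix_vector_mul_linear] matrix_vector_mult_scaleR mult.commute)
    finally show ?thesis using repr[of y] by simp
  qed
  have "transpose S = S"
  proof -
    have "transpose S *v y = S *v y" for y
    proof (rule vector_eq_ldot[THEN iffD1, rule_format])
      fix x show "x \<bullet> (transpose S *v y) = x \<bullet> (S *v y)"
        using sym[of x y] by (metis Sv dot_lmul_matrix transpose_matrix_vector transpose_transpose)
    qed
    then show ?thesis by (simp add: matrix_eq)
  qed
  moreover have "0 \<le> y \<bullet> (S *v y)" for y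
    unfolding Sv f_def using l by (auto simp: inner_sum_right inner_commute mult.assoc intro!: sum_nonneg)
  moreover have "S ** S = A"
    by (simp add: matrix_eq matrix_vector_mul_assoc[symmetric] Sv ffA)
  ultimately have "\<exists>S. transpose S = S \<and> (\<forall>y. 0 \<le> y \<bullet> (S *v y)) \<and> S ** S = A" by blast
  then have "transpose (mat_sqrt A) = mat_sqrt A \<and> (\<forall>y. 0 \<le> y \<bullet> (mat_sqrt A *v y)) \<and> mat_sqrt A ** mat_sqrt A = A"
    unfolding mat_sqrt_def by (rule someI_ex)
  then show "transpose (mat_sqrt A) = mat_sqrt A" "mat_sqrt A ** mat_sqrt A = A" by auto
qed

lemma norm_mat_sqrt:
  fixes A :: "real^'n^'n"
  assumes A: "transpose A = A" and pos: "\<And>y. 0 \<le> y \<bullet> (A *v y)"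
  shows "(norm (mat_sqrt A *v y))\<^sup>2 = y \<bullet> (A *v y)"
  using mat_sqrt_properties[OF assms] symmetric_inner_eq[of "mat_sqrt A" y "mat_sqrt A *v y"]
  by (simp add: matrix_vector_mul_assoc dot_square_norm[symmetric])

section \<open>Operator norm and inverse of a positive definite matrix\<close>

lemma norm_matrix_vector_le: "norm (A *v y) \<le> mat_norm A * norm (y :: real^'n)"
  unfolding mat_norm_def by (rule onorm) (rule matrix_vector_mul_bounded_linear)

lemma matrix_inv_right:
  fixes A :: "real^'n^'n"
  assumes "invertible A"
  shows "A ** matrix_inv A = mat 1"
  using someI_ex[OF assms[unfolded invertible_def]] unfolding matrix_inv_def by blast

text \<open>Cauchy-Schwarz for the inner product defined by \<open>A\<close>, applied to \<open>y\<close> and \<open>A\<^sup>-\<^sup>1 y\<close>.\<close>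

lemma norm_le_mat_norm_inverse:
  fixes A :: "real^'n^'n"
  assumes A: "transpose A = A" and pos: "\<And>y. 0 \<le> y \<bullet> (A *v y)" and inv: "invertible A"
  shows "(norm y)\<^sup>2 \<le> mat_norm (matrix_inv A) * (y \<bullet> (A *v y))"
proof (cases "y = 0")
  case False
  define w where "w = matrix_inv A *v y"
  have Aw: "A *v w = y"
    by (simp add: w_def matrix_vector_mul_assoc matrix_inv_right inv)
  let ?S = "mat_sqrt A"
  have "(norm y)\<^sup>2 = y \<bullet> (A *v w)" by (simp add: Aw dot_square_norm)
  also have "\<dots> = (?S *v y) \<bullet> (?S *v w)"
    using mat_sqrt_properties[OF A pos] symmetric_inner_eq[of ?S y "?S *v w"]
    by (simp add: matrix_vector_mul_assoc)
  finally have "((norm y)\<^sup>2)\<^sup>2 \<le> (norm (?S *v y))\<^sup>2 * (norm (?S *v w))\<^sup>2"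
    using norm_cauchy_schwarz[of "?S *v y" "?S *v w"]
    by (metis power_mono power_mult_distrib zero_le_power2)
  also have "\<dots> = (y \<bullet> (A *v y)) * (w \<bullet> y)"
    by (simp add: norm_mat_sqrt[OF A pos] Aw)
  also have "w \<bullet> y \<le> mat_norm (matrix_inv A) * (norm y)\<^sup>2"
    using norm_cauchy_schwarz[of w y] norm_matrix_vector_le[of "matrix_inv A" y]
    by (smt (verit) w_def mult_right_mono norm_ge_zero power2_eq_square mult.assoc)
  then have "(y \<bullet> (A *v y)) * (w \<bullet> y) \<le> (y \<bullet> (A *v y)) * (mat_norm (matrix_inv A) * (norm y)\<^sup>2)"
    using pos by (rule mult_left_mono)
  finally have "(norm y)\<^sup>2 * (norm y)\<^sup>2 \<le> (mat_norm (matrix_inv A) * (y \<bullet> (A *v y))) * (norm y)\<^sup>2"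
    by (simp add: power2_eq_square mult_ac)
  then show ?thesis by (rule mult_right_le_imp_le) (use False in simp)
qed simp

section \<open>Integration over hyperplanes and cones\<close>

lemma nn_integral_lborel_translate:
  fixes f :: "'a::euclidean_space \<Rightarrow> ennreal"
  assumes [measurable]: "f \<in> borel_measurable borel"
  shows "(\<integral>\<^sup>+z. f (a + z) \<partial>lborel) = (\<integral>\<^sup>+z. f z \<partial>lborel)"
  by (subst (2) lborel_distr_plus[of a, symmetric]) (simp add: nn_integral_distr)

lemma nn_integral_lborel_dilate:
  fixes f :: "'a::euclidean_space \<Rightarrow> ennreal"
  assumes [measurable]: "f \<in> borel_measurable borel" and t: "t > 0"
  shows "(\<integral>\<^sup>+z. f z \<partial>lborel) = ennreal (t ^ DIM('a)) * (\<integral>\<^sup>+z. f (c + t *\<^sub>R z) \<partial>lborel)"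
  using t by (subst lborel_affine[of t c]) (auto simp: nn_integral_density nn_integral_distr nn_integral_cmult)

text \<open>The integral over the hyperplane \<open>{x. n \<bullet> x = b}\<close>, written like \<^const>\<open>face_measure\<close> as the
  integral over a layer of thickness 1.\<close>

definition surf :: "'a::euclidean_space \<Rightarrow> real \<Rightarrow> ('a \<Rightarrow> ennreal) \<Rightarrow> ennreal" where
  "surf n b \<phi> = (\<integral>\<^sup>+z. indicator {z. \<bar>n \<bullet> z - b\<bar> \<le> 1/2} z * \<phi> (z - (n \<bullet> z - b) *\<^sub>R n) \<partial>lborel)"

lemma surf_cong:
  assumes "norm n = 1" "\<And>y. n \<bullet> y = b \<Longrightarrow> \<phi> y = \<psi> y"
  shows "surf n b \<phi> = surf n b \<psi>"
proof -
  have "\<phi> (z - (n \<bullet> z - b) *\<^sub>R n) = \<psi> (z - (n \<bullet> z - b) *\<^sub>R n)" for z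
    by (rule assms(2)) (use assms(1) in \<open>simp add: inner_diff_right dot_square_norm\<close>)
  then show ?thesis by (simp add: surf_def)
qed

lemma surf_mono:
  assumes "norm n = 1" "\<And>y. n \<bullet> y = b \<Longrightarrow> \<phi> y \<le> \<psi> y"
  shows "surf n b \<phi> \<le> surf n b \<psi>"
proof -
  have "\<phi> (z - (n \<bullet> z - b) *\<^sub>R n) \<le> \<psi> (z - (n \<bullet> z - b) *\<^sub>R n)" for z
    by (rule assms(2)) (use assms(1) in \<open>simp add: inner_diff_right dot_square_norm\<close>)
  then show ?thesis unfolding surf_def by (intro nn_integral_mono mult_left_mono) auto
qed

lemma surf_cmult:
  fixes \<phi> :: "'a::euclidean_space \<Rightarrow> ennreal"
  assumes [measurable]: "\<phi> \<in> borel_measurable borel"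
  shows "surf n b (\<lambda>y. c * \<phi> y) = c * surf n b \<phi>"
  unfolding surf_def by (subst nn_integral_cmult[symmetric]) (auto simp: mult_ac)

text \<open>Separates the height over a hyperplane from the projection onto it without choosing
  coordinates. The factor 1, written as the integral over \<tau> of the indicator of a unit interval
  around the height, is inserted; after Fubini a translation by \<tau> n leaves the projection
  unchanged and moves the height, so that the integral over \<tau> splits off.\<close>

lemma nn_integral_layer:
  fixes \<psi> :: "'a::euclidean_space \<Rightarrow> ennreal" and \<rho> :: "real \<Rightarrow> ennreal"
  assumes [measurable]: "\<psi> \<in> borel_measurable borel" "\<rho> \<in> borel_measurable borel" and n: "norm n = 1"
  shows "(\<integral>\<^sup>+z. \<rho> (n \<bullet> z - b) * \<psi> (z - (n \<bullet> z - b) *\<^sub>R n) \<partial>lborel) = (\<integral>\<^sup>+s. \<rho> s \<partial>lborel) * surf n b \<psi>"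
proof -
  have nn: "n \<bullet> n = 1" using n by (simp add: dot_square_norm)
  let ?\<pi> = "\<lambda>z. z - (n \<bullet> z - b) *\<^sub>R n"
  have one: "(\<integral>\<^sup>+\<tau>. indicator {\<tau>. \<bar>s - \<tau>\<bar> \<le> 1/2} \<tau> \<partial>lborel) = 1" for s :: real
  proof -
    have "{\<tau>. \<bar>s - \<tau>\<bar> \<le> 1/2} = cball s (1/2)" by (auto simp: dist_real_def)
    also have "\<dots> = {s - 1/2..s + 1/2}" by (rule cball_eq_atLeastAtMost)
    finally have "{\<tau>. \<bar>s - \<tau>\<bar> \<le> 1/2} = {s - 1/2..s + 1/2}" .
    then show ?thesis by simp
  qed
  have "(\<integral>\<^sup>+z. \<rho> (n \<bullet> z - b) * \<psi> (?\<pi> z) \<partial>lborel)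
      = (\<integral>\<^sup>+z. (\<integral>\<^sup>+\<tau>. \<rho> (n \<bullet> z - b) * \<psi> (?\<pi> z) * indicator {\<tau>. \<bar>(n \<bullet> z - b) - \<tau>\<bar> \<le> 1/2} \<tau> \<partial>lborel) \<partial>lborel)"
    by (subst nn_integral_cmult, measurable) (simp only: one mult_1_right)
  also have "\<dots> = (\<integral>\<^sup>+z. (\<integral>\<^sup>+\<tau>. \<rho> (n \<bullet> z - b) * \<psi> (?\<pi> z) * (if \<bar>(n \<bullet> z - b) - \<tau>\<bar> \<le> 1/2 then 1 else 0) \<partial>lborel) \<partial>lborel)"
    by (intro nn_integral_cong) (auto simp: indicator_def)
  also have "\<dots> = (\<integral>\<^sup>+\<tau>. (\<integral>\<^sup>+z. \<rho> (n \<bullet> z - b) * \<psi> (?\<pi> z) * (if \<bar>(n \<bullet> z - b) - \<tau>\<bar> \<le> 1/2 then 1 else 0) \<partial>lborel) \<partial>lborel)"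
    by (rule lborel_pair.Fubini') measurable
  also have "\<dots> = (\<integral>\<^sup>+\<tau>. (\<integral>\<^sup>+z. \<rho> ((n \<bullet> z - b) + \<tau>) * \<psi> (?\<pi> z) * (if \<bar>n \<bullet> z - b\<bar> \<le> 1/2 then 1 else 0) \<partial>lborel) \<partial>lborel)"
  proof (rule nn_integral_cong)
    fix \<tau> :: real
    show "(\<integral>\<^sup>+z. \<rho> (n \<bullet> z - b) * \<psi> (?\<pi> z) * (if \<bar>(n \<bullet> z - b) - \<tau>\<bar> \<le> 1/2 then 1 else 0) \<partial>lborel)
      = (\<integral>\<^sup>+z. \<rho> ((n \<bullet> z - b) + \<tau>) * \<psi> (?\<pi> z) * (if \<bar>n \<bullet> z - b\<bar> \<le> 1/2 then 1 else 0) \<partial>lborel)"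
      by (subst nn_integral_lborel_translate[where a = "\<tau> *\<^sub>R n", symmetric])
         (auto simp: inner_add_right nn algebra_simps intro!: nn_integral_cong)
  qed
  also have "\<dots> = (\<integral>\<^sup>+z. (\<integral>\<^sup>+\<tau>. \<rho> ((n \<bullet> z - b) + \<tau>) * \<psi> (?\<pi> z) * (if \<bar>n \<bullet> z - b\<bar> \<le> 1/2 then 1 else 0) \<partial>lborel) \<partial>lborel)"
    by (rule lborel_pair.Fubini'[symmetric]) measurable
  also have "\<dots> = (\<integral>\<^sup>+z. (\<integral>\<^sup>+\<tau>. \<rho> ((n \<bullet> z - b) + \<tau>) \<partial>lborel) * (indicator {z. \<bar>n \<bullet> z - b\<bar> \<le> 1/2} z * \<psi> (?\<pi> z)) \<partial>lborel)"
    by (intro nn_integral_cong, subst nn_integral_multc[symmetric])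
       (auto simp: indicator_def mult_ac intro!: nn_integral_cong)
  also have "\<dots> = (\<integral>\<^sup>+z. (\<integral>\<^sup>+\<tau>. \<rho> \<tau> \<partial>lborel) * (indicator {z. \<bar>n \<bullet> z - b\<bar> \<le> 1/2} z * \<psi> (?\<pi> z)) \<partial>lborel)"
    by (subst nn_integral_lborel_translate) auto
  also have "\<dots> = (\<integral>\<^sup>+s. \<rho> s \<partial>lborel) * surf n b \<psi>"
    unfolding surf_def by (rule nn_integral_cmult) measurable
  finally show ?thesis .
qed

text \<open>Fubini along n. For fixed z the level is replaced by the signed distance s to it; for
  fixed s what remains is a translate of the whole integral, and s runs through an interval of
  length 1.\<close>

lemma coarea_hyperplanes:
  fixes \<phi> :: "'a::euclidean_space \<Rightarrow> ennreal"
  assumes [measurable]: "\<phi> \<in> borel_measurable borel"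
  shows "(\<integral>\<^sup>+z. \<phi> z \<partial>lborel) = (\<integral>\<^sup>+\<tau>. surf n \<tau> \<phi> \<partial>lborel)"
proof -
  have m[measurable]: "(\<lambda>x. indicator {z. \<bar>n \<bullet> z - fst x\<bar> \<le> 1/2} (snd x) * \<phi> (snd x - (n \<bullet> snd x - fst x) *\<^sub>R n))
     \<in> borel_measurable (borel \<Otimes>\<^sub>M borel)"
  proof -
    have "(\<lambda>x. indicator {z. \<bar>n \<bullet> z - fst x\<bar> \<le> 1/2} (snd x)) = (\<lambda>x. if \<bar>n \<bullet> snd x - fst x\<bar> \<le> 1/2 then 1 else (0::ennreal))"
      by (auto simp: indicator_def)
    then show ?thesis by simp
  qed
  have "(\<integral>\<^sup>+\<tau>. surf n \<tau> \<phi> \<partial>lborel)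
     = (\<integral>\<^sup>+z. (\<integral>\<^sup>+\<tau>. (if \<bar>n \<bullet> z - \<tau>\<bar> \<le> 1/2 then 1 else 0) * \<phi> (z - (n \<bullet> z - \<tau>) *\<^sub>R n) \<partial>lborel) \<partial>lborel)"
    unfolding surf_def indicator_def mem_Collect_eq of_bool_def by (rule lborel_pair.Fubini') measurable
  also have "\<dots> = (\<integral>\<^sup>+z. (\<integral>\<^sup>+s. (if \<bar>s\<bar> \<le> 1/2 then 1 else 0) * \<phi> (- s *\<^sub>R n + z) \<partial>lborel) \<partial>lborel)"
  proof (rule nn_integral_cong)
    fix z
    show "(\<integral>\<^sup>+\<tau>. (if \<bar>n \<bullet> z - \<tau>\<bar> \<le> 1/2 then 1 else 0) * \<phi> (z - (n \<bullet> z - \<tau>) *\<^sub>R n) \<partial>lborel)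
      = (\<integral>\<^sup>+s. (if \<bar>s\<bar> \<le> 1/2 then 1 else 0) * \<phi> (- s *\<^sub>R n + z) \<partial>lborel)"
      by (subst nn_integral_real_affine[where c = "-1" and t = "n \<bullet> z"]) (auto)
  qed
  also have "\<dots> = (\<integral>\<^sup>+s. (\<integral>\<^sup>+z. (if \<bar>s\<bar> \<le> 1/2 then 1 else 0) * \<phi> (- s *\<^sub>R n + z) \<partial>lborel) \<partial>lborel)"
    by (rule lborel_pair.Fubini') measurable
  also have "\<dots> = (\<integral>\<^sup>+s. (if \<bar>s\<bar> \<le> 1/2 then 1 else 0) * (\<integral>\<^sup>+z. \<phi> z \<partial>lborel) \<partial>(lborel :: real measure))"
  proof (rule nn_integral_cong)
    fix s :: real
    show "(\<integral>\<^sup>+z. (if \<bar>s\<bar> \<le> 1/2 then 1 else 0) * \<phi> (- s *\<^sub>R n + z) \<partial>lborel)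
      = (if \<bar>s\<bar> \<le> 1/2 then 1 else 0) * (\<integral>\<^sup>+z. \<phi> z \<partial>lborel)"
      by (subst nn_integral_cmult, measurable, subst nn_integral_lborel_translate) auto
  qed
  also have "\<dots> = (\<integral>\<^sup>+s. indicator {-1/2..1/2} s * (\<integral>\<^sup>+z. \<phi> z \<partial>lborel) \<partial>(lborel :: real measure))"
    by (intro nn_integral_cong) (auto simp: indicator_def)
  also have "\<dots> = (\<integral>\<^sup>+z. \<phi> z \<partial>lborel)"
    by (subst nn_integral_multc) auto
  finally show ?thesis by simp
qed

text \<open>A dilation scales volume by the power d of t, but it also changes the layer of thickness
  1 into one of thickness 1 / t; \<open>nn_integral_layer\<close> accounts for the latter, and the
  power d - 1 remains.\<close>

lemma surf_dilate:
  fixes \<phi> :: "'a::euclidean_space \<Rightarrow> ennreal"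
  assumes [measurable]: "\<phi> \<in> borel_measurable borel" and n: "norm n = 1" and t: "t > 0"
  shows "surf n (n \<bullet> c + t * (b - n \<bullet> c)) \<phi> = ennreal (t ^ (DIM('a) - 1)) * surf n b (\<lambda>y. \<phi> (c + t *\<^sub>R (y - c)))"
proof -
  have nn: "n \<bullet> n = 1" using n by (simp add: dot_square_norm)
  let ?\<tau> = "n \<bullet> c + t * (b - n \<bullet> c)"
  let ?\<pi> = "\<lambda>z. z - (n \<bullet> z - b) *\<^sub>R n"
  have "surf n ?\<tau> \<phi> = ennreal (t ^ DIM('a)) * (\<integral>\<^sup>+z. indicator {z. \<bar>n \<bullet> z - ?\<tau>\<bar> \<le> 1/2} ((c - t *\<^sub>R c) + t *\<^sub>R z)
      * \<phi> (((c - t *\<^sub>R c) + t *\<^sub>R z) - (n \<bullet> ((c - t *\<^sub>R c) + t *\<^sub>R z) - ?\<tau>) *\<^sub>R n) \<partial>lborel)"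
    unfolding surf_def by (rule nn_integral_lborel_dilate[OF _ t]) measurable
  also have "(\<integral>\<^sup>+z. indicator {z. \<bar>n \<bullet> z - ?\<tau>\<bar> \<le> 1/2} ((c - t *\<^sub>R c) + t *\<^sub>R z)
      * \<phi> (((c - t *\<^sub>R c) + t *\<^sub>R z) - (n \<bullet> ((c - t *\<^sub>R c) + t *\<^sub>R z) - ?\<tau>) *\<^sub>R n) \<partial>lborel)
    = (\<integral>\<^sup>+z. indicator {s. \<bar>s\<bar> \<le> 1 / (2 * t)} (n \<bullet> z - b) * \<phi> (c + t *\<^sub>R (?\<pi> z - c)) \<partial>lborel)"
  proof (rule nn_integral_cong)
    fix z
    have e1: "n \<bullet> ((c - t *\<^sub>R c) + t *\<^sub>R z) - ?\<tau> = t * (n \<bullet> z - b)"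
      by (simp add: inner_simps algebra_simps)
    have e2: "\<bar>t * (n \<bullet> z - b)\<bar> \<le> 1/2 \<longleftrightarrow> \<bar>n \<bullet> z - b\<bar> \<le> 1 / (2 * t)"
    proof -
      have "\<bar>t * u\<bar> \<le> 1/2 \<longleftrightarrow> \<bar>u\<bar> \<le> 1 / (2 * t)" for u using t by (simp add: abs_mult field_simps)
      then show ?thesis .
    qed
    have e3: "((c - t *\<^sub>R c) + t *\<^sub>R z) - (t * (n \<bullet> z - b)) *\<^sub>R n = c + t *\<^sub>R (?\<pi> z - c)"
      by (simp add: algebra_simps)
    show "indicator {z. \<bar>n \<bullet> z - ?\<tau>\<bar> \<le> 1/2} ((c - t *\<^sub>R c) + t *\<^sub>R z)
      * \<phi> (((c - t *\<^sub>R c) + t *\<^sub>R z) - (n \<bullet> ((c - t *\<^sub>R c) + t *\<^sub>R z) - ?\<tau>) *\<^sub>R n)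
      = indicator {s. \<bar>s\<bar> \<le> 1 / (2 * t)} (n \<bullet> z - b) * \<phi> (c + t *\<^sub>R (?\<pi> z - c))"
      by (simp only: indicator_def mem_Collect_eq e1 e2 e3)
  qed
  also have "\<dots> = (\<integral>\<^sup>+s. indicator {s. \<bar>s\<bar> \<le> 1 / (2 * t)} s \<partial>lborel) * surf n b (\<lambda>y. \<phi> (c + t *\<^sub>R (y - c)))"
    by (rule nn_integral_layer[OF _ _ n]) measurable
  also have "(\<integral>\<^sup>+s. indicator {s. \<bar>s\<bar> \<le> 1 / (2 * t)} s \<partial>lborel) = ennreal (1 / t)"
  proof -
    have "{s. \<bar>s\<bar> \<le> 1 / (2 * t)} = {- 1 / (2 * t)..1 / (2 * t)}" by (auto simp: abs_le_iff)
    then show ?thesis using t by simp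
  qed
  also have "ennreal (t ^ DIM('a)) * (ennreal (1 / t) * surf n b (\<lambda>y. \<phi> (c + t *\<^sub>R (y - c))))
      = ennreal (t ^ (DIM('a) - 1)) * surf n b (\<lambda>y. \<phi> (c + t *\<^sub>R (y - c)))"
    using t power_Suc[of t "DIM('a) - 1"] by (simp add: mult.assoc[symmetric] ennreal_mult[symmetric] del: power_Suc)
  finally show ?thesis .
qed

text \<open>Polar coordinates with apex c: the hyperplanes beyond c are the dilates of the base
  hyperplane, with Jacobian \<open>t ^ (DIM('a) - 1)\<close>, and the height of the apex over the
  base enters through the substitution of the level by t.\<close>

lemma coarea_cone:
  fixes \<phi> :: "'a::euclidean_space \<Rightarrow> ennreal"
  assumes [measurable]: "\<phi> \<in> borel_measurable borel" and n: "norm n = 1" and h: "b - n \<bullet> c > 0"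
  shows "(\<integral>\<^sup>+z. indicator {z. n \<bullet> z > n \<bullet> c} z * \<phi> z \<partial>lborel) = ennreal (b - n \<bullet> c) *
    (\<integral>\<^sup>+t. indicator {0<..} t * ennreal (t ^ (DIM('a) - 1)) * surf n b (\<lambda>y. \<phi> (c + t *\<^sub>R (y - c))) \<partial>lborel)"
proof -
  define \<psi> where "\<psi> = (\<lambda>z. indicator {z. n \<bullet> z > n \<bullet> c} z * \<phi> z)"
  have [measurable]: "\<psi> \<in> borel_measurable borel" unfolding \<psi>_def by measurable
  have m[measurable]: "(\<lambda>\<tau>. surf n \<tau> \<psi>) \<in> borel_measurable borel"
  proof -
    have "(\<lambda>x. indicator {z. \<bar>n \<bullet> z - fst x\<bar> \<le> 1/2} (snd x)) = (\<lambda>x. if \<bar>n \<bullet> snd x - fst x\<bar> \<le> 1/2 then 1 else (0::ennreal))"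
      by (auto simp: indicator_def)
    then have [measurable]: "(\<lambda>x. indicator {z. \<bar>n \<bullet> z - fst x\<bar> \<le> 1/2} (snd x) :: ennreal) \<in> borel_measurable (borel \<Otimes>\<^sub>M borel)"
      by simp
    have "(\<lambda>\<tau>. \<integral>\<^sup>+z. indicator {z. \<bar>n \<bullet> z - \<tau>\<bar> \<le> 1/2} z * \<psi> (z - (n \<bullet> z - \<tau>) *\<^sub>R n) \<partial>lborel) \<in> borel_measurable borel"
      by (rule lborel.borel_measurable_nn_integral) (auto simp: split_beta')
    then show ?thesis unfolding surf_def .
  qed
  have "(\<integral>\<^sup>+z. \<psi> z \<partial>lborel) = (\<integral>\<^sup>+\<tau>. surf n \<tau> \<psi> \<partial>lborel)"
    by (rule coarea_hyperplanes) measurable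
  also have "\<dots> = ennreal (b - n \<bullet> c) * (\<integral>\<^sup>+t. surf n (n \<bullet> c + (b - n \<bullet> c) * t) \<psi> \<partial>lborel)"
    using h by (subst nn_integral_real_affine[where c = "b - n \<bullet> c" and t = "n \<bullet> c"]) auto
  also have "(\<integral>\<^sup>+t. surf n (n \<bullet> c + (b - n \<bullet> c) * t) \<psi> \<partial>lborel)
     = (\<integral>\<^sup>+t. indicator {0<..} t * ennreal (t ^ (DIM('a) - 1)) * surf n b (\<lambda>y. \<phi> (c + t *\<^sub>R (y - c))) \<partial>lborel)"
  proof (rule nn_integral_cong)
    fix t :: real
    show "surf n (n \<bullet> c + (b - n \<bullet> c) * t) \<psi>
      = indicator {0<..} t * ennreal (t ^ (DIM('a) - 1)) * surf n b (\<lambda>y. \<phi> (c + t *\<^sub>R (y - c)))"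
    proof (cases "t > 0")
      case True
      have "surf n (n \<bullet> c + t * (b - n \<bullet> c)) \<psi> = ennreal (t ^ (DIM('a) - 1)) * surf n b (\<lambda>y. \<psi> (c + t *\<^sub>R (y - c)))"
        by (rule surf_dilate[OF _ n True]) measurable
      also have "surf n b (\<lambda>y. \<psi> (c + t *\<^sub>R (y - c))) = surf n b (\<lambda>y. \<phi> (c + t *\<^sub>R (y - c)))"
      proof (rule surf_cong[OF n])
        fix y assume "n \<bullet> y = b"
        then have "n \<bullet> (c + t *\<^sub>R (y - c)) > n \<bullet> c" using h True by (simp add: inner_simps)
        then show "\<psi> (c + t *\<^sub>R (y - c)) = \<phi> (c + t *\<^sub>R (y - c))" by (simp add: \<psi>_def)
      qed
      finally show ?thesis using True by (simp add: mult.commute)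
    next
      case False
      have "surf n (n \<bullet> c + (b - n \<bullet> c) * t) \<psi> = surf n (n \<bullet> c + (b - n \<bullet> c) * t) (\<lambda>_. 0)"
      proof (rule surf_cong[OF n])
        fix y assume "n \<bullet> y = n \<bullet> c + (b - n \<bullet> c) * t"
        moreover have "(b - n \<bullet> c) * t \<le> 0" using h False by (simp add: mult_le_0_iff)
        ultimately show "\<psi> y = 0" by (simp add: \<psi>_def)
      qed
      then show ?thesis using False by (simp add: surf_def)
    qed
  qed
  finally show ?thesis unfolding \<psi>_def .
qed

text \<open>On each ray from c the polynomial is one of a single variable whose value at t = 1 is
  the value on the base. The weight in the one-dimensional estimate is the Jacobian of
  \<open>coarea_cone\<close>, so integration over the base loses nothing.\<close>

lemma cone_polynomial_trace:
  fixes p :: "'a::euclidean_space \<Rightarrow> real"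
  assumes p[measurable]: "p \<in> borel_measurable borel" and A[measurable]: "A \<in> sets borel" and P[measurable]: "P \<in> sets borel"
    and n: "norm n = 1" and h: "b - n \<bullet> c > 0"
    and cone: "\<And>y t. y \<in> A \<Longrightarrow> 0 < t \<Longrightarrow> t \<le> 1 \<Longrightarrow> c + t *\<^sub>R (y - c) \<in> P"
    and poly: "\<And>w. \<exists>q. degree q \<le> N \<and> (\<forall>t. p (c + t *\<^sub>R w) = poly q t)"
  shows "ennreal (b - n \<bullet> c) * surf n b (\<lambda>y. indicator A y * ennreal ((p y)\<^sup>2))
    \<le> ennreal (real ((N + 1) * (N + DIM('a)))) * (\<integral>\<^sup>+z. indicator P z * ennreal ((p z)\<^sup>2) \<partial>lborel)"
proof -
  define C where "C = ennreal (real ((N + 1) * (N + DIM('a))))"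
  let ?\<pi> = "\<lambda>z. z - (n \<bullet> z - b) *\<^sub>R n"
  let ?I = "\<lambda>z. indicator {z. \<bar>n \<bullet> z - b\<bar> \<le> 1/2} z :: ennreal"
  let ?J = "\<lambda>t z. indicator {0..1} t * ennreal (t ^ (DIM('a) - 1)) * (indicator A z * ennreal ((p (c + t *\<^sub>R (z - c)))\<^sup>2))"
  have "surf n b (\<lambda>y. indicator A y * ennreal ((p y)\<^sup>2))
      \<le> surf n b (\<lambda>y. C * (\<integral>\<^sup>+t. ?J t y \<partial>lborel))"
  proof (rule surf_mono[OF n])
    fix y
    obtain q where q: "degree q \<le> N" "\<And>t. p (c + t *\<^sub>R (y - c)) = poly q t" using poly by blast
    have "p y = poly q 1" using q(2)[of 1] by simp
    then have "ennreal ((p y)\<^sup>2) \<le> C * (\<integral>\<^sup>+t. ennreal (t ^ (DIM('a) - 1) * (poly q t)\<^sup>2) * indicator {0..1} t \<partial>lborel)"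
      using poly_value_at_one_bound_nn[OF q(1), of "DIM('a)"] unfolding C_def by simp
    also have "(\<integral>\<^sup>+t. ennreal (t ^ (DIM('a) - 1) * (poly q t)\<^sup>2) * indicator {0..1} t \<partial>lborel)
      = (\<integral>\<^sup>+t. indicator {0..1} t * ennreal (t ^ (DIM('a) - 1)) * ennreal ((p (c + t *\<^sub>R (y - c)))\<^sup>2) \<partial>lborel)"
      by (intro nn_integral_cong) (auto simp: q(2) ennreal_mult indicator_def)
    finally show "indicator A y * ennreal ((p y)\<^sup>2) \<le> C * (\<integral>\<^sup>+t. ?J t y \<partial>lborel)"
      by (simp add: indicator_def)
  qed
  also have "\<dots> = (\<integral>\<^sup>+z. (\<integral>\<^sup>+t. C * (?I z * ?J t (?\<pi> z)) \<partial>lborel) \<partial>lborel)"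
    unfolding surf_def
    by (intro nn_integral_cong, subst nn_integral_cmult, measurable, subst nn_integral_cmult, measurable)
       (simp only: mult_ac)
  also have "\<dots> = (\<integral>\<^sup>+t. (\<integral>\<^sup>+z. C * (?I z * ?J t (?\<pi> z)) \<partial>lborel) \<partial>lborel)"
    by (rule lborel_pair.Fubini') measurable
  also have "\<dots> = (\<integral>\<^sup>+t. C * (indicator {0..1} t * ennreal (t ^ (DIM('a) - 1))
      * surf n b (\<lambda>y. indicator A y * ennreal ((p (c + t *\<^sub>R (y - c)))\<^sup>2))) \<partial>lborel)"
    unfolding surf_def
    by (intro nn_integral_cong, subst nn_integral_cmult[symmetric], measurable, subst nn_integral_cmult[symmetric], measurable)
       (auto intro!: nn_integral_cong simp: mult_ac)
  also have "\<dots> \<le> (\<integral>\<^sup>+t. C * (indicator {0<..} t * ennreal (t ^ (DIM('a) - 1))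
      * surf n b (\<lambda>y. indicator P (c + t *\<^sub>R (y - c)) * ennreal ((p (c + t *\<^sub>R (y - c)))\<^sup>2))) \<partial>lborel)"
  proof (rule nn_integral_mono_AE)
    \<comment> \<open>The one-dimensional integral includes t = 0, the polar coordinates do
      not.\<close>
    have "AE t in lborel. t \<noteq> (0::real)" by (rule AE_lborel_singleton)
    then show "AE t in lborel. C * (indicator {0..1} t * ennreal (t ^ (DIM('a) - 1))
      * surf n b (\<lambda>y. indicator A y * ennreal ((p (c + t *\<^sub>R (y - c)))\<^sup>2))) \<le>
      C * (indicator {0<..} t * ennreal (t ^ (DIM('a) - 1))
      * surf n b (\<lambda>y. indicator P (c + t *\<^sub>R (y - c)) * ennreal ((p (c + t *\<^sub>R (y - c)))\<^sup>2)))"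
    proof eventually_elim
      case (elim t)
      show ?case
      proof (cases "0 < t \<and> t \<le> 1")
        case True
        have "surf n b (\<lambda>y. indicator A y * ennreal ((p (c + t *\<^sub>R (y - c)))\<^sup>2))
          \<le> surf n b (\<lambda>y. indicator P (c + t *\<^sub>R (y - c)) * ennreal ((p (c + t *\<^sub>R (y - c)))\<^sup>2))"
          by (rule surf_mono[OF n]) (use cone True in \<open>auto simp: indicator_def\<close>)
        then show ?thesis using True by (auto intro!: mult_left_mono)
      qed (use elim in \<open>auto simp: indicator_def\<close>)
    qed
  qed
  finally have "ennreal (b - n \<bullet> c) * surf n b (\<lambda>y. indicator A y * ennreal ((p y)\<^sup>2))
    \<le> ennreal (b - n \<bullet> c) * (\<integral>\<^sup>+t. C * (indicator {0<..} t * ennreal (t ^ (DIM('a) - 1))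
      * surf n b (\<lambda>y. indicator P (c + t *\<^sub>R (y - c)) * ennreal ((p (c + t *\<^sub>R (y - c)))\<^sup>2))) \<partial>lborel)"
    by (rule mult_left_mono) simp
  also have "\<dots> = C * (ennreal (b - n \<bullet> c) * (\<integral>\<^sup>+t. (indicator {0<..} t * ennreal (t ^ (DIM('a) - 1))
      * surf n b (\<lambda>y. indicator P (c + t *\<^sub>R (y - c)) * ennreal ((p (c + t *\<^sub>R (y - c)))\<^sup>2))) \<partial>lborel))"
    apply (subst nn_integral_cmult)
    subgoal unfolding surf_def by measurable
    by (simp add: mult_ac)
  also have "\<dots> = C * (\<integral>\<^sup>+z. indicator {z. n \<bullet> z > n \<bullet> c} z * (indicator P z * ennreal ((p z)\<^sup>2)) \<partial>lborel)"
    by (subst coarea_cone[OF _ n h]) auto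
  also have "\<dots> \<le> C * (\<integral>\<^sup>+z. indicator P z * ennreal ((p z)\<^sup>2) \<partial>lborel)"
    by (intro mult_left_mono nn_integral_mono) (auto simp: indicator_def)
  finally show ?thesis unfolding C_def .
qed

text \<open>In polar coordinates from the apex the volume is the height times the base divided by d,
  where 1 / d is the integral of \<open>t ^ (DIM('a) - 1)\<close>. The hypothesis
  \<open>cone\<close> says that rays through P leave it at the base.\<close>

lemma cone_volume:
  fixes P :: "'a::euclidean_space set"
  assumes A[measurable]: "A \<in> sets borel" and P[measurable]: "P \<in> sets borel"
    and n: "norm n = 1" and h: "b - n \<bullet> c > 0"
    and cone: "\<And>y t. n \<bullet> y = b \<Longrightarrow> 0 < t \<Longrightarrow> c + t *\<^sub>R (y - c) \<in> P \<Longrightarrow> t \<le> 1 \<and> y \<in> A"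
  shows "emeasure lborel (P \<inter> {z. n \<bullet> z > n \<bullet> c}) \<le> ennreal ((b - n \<bullet> c) / DIM('a)) * surf n b (indicator A)"
proof -
  have "emeasure lborel (P \<inter> {z. n \<bullet> z > n \<bullet> c}) = (\<integral>\<^sup>+z. indicator {z. n \<bullet> z > n \<bullet> c} z * indicator P z \<partial>lborel)"
  proof -
    have "(\<integral>\<^sup>+z. indicator {z. n \<bullet> z > n \<bullet> c} z * indicator P z \<partial>lborel)
      = (\<integral>\<^sup>+z. indicator (P \<inter> {z. n \<bullet> z > n \<bullet> c}) z \<partial>lborel)"
      by (intro nn_integral_cong) (auto simp: indicator_def)
    also have "\<dots> = emeasure lborel (P \<inter> {z. n \<bullet> z > n \<bullet> c})"
      by (rule nn_integral_indicator) simp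
    finally show ?thesis by simp
  qed
  also have "\<dots> = ennreal (b - n \<bullet> c) *
    (\<integral>\<^sup>+t. indicator {0<..} t * ennreal (t ^ (DIM('a) - 1)) * surf n b (\<lambda>y. indicator P (c + t *\<^sub>R (y - c))) \<partial>lborel)"
    by (rule coarea_cone[OF _ n h]) measurable
  also have "\<dots> \<le> ennreal (b - n \<bullet> c) * (\<integral>\<^sup>+t. (ennreal (t ^ (DIM('a) - 1)) * indicator {0..1} t) * surf n b (indicator A) \<partial>lborel)"
  proof (intro mult_left_mono nn_integral_mono)
    fix t :: real
    show "indicator {0<..} t * ennreal (t ^ (DIM('a) - 1)) * surf n b (\<lambda>y. indicator P (c + t *\<^sub>R (y - c)))
      \<le> ennreal (t ^ (DIM('a) - 1)) * indicator {0..1} t * surf n b (indicator A)"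
    proof (cases "t > 0")
      case True
      have "surf n b (\<lambda>y. indicator P (c + t *\<^sub>R (y - c))) \<le> surf n b (\<lambda>y. indicator {0..1} t * indicator A y)"
        by (rule surf_mono[OF n]) (use cone True in \<open>auto simp: indicator_def\<close>)
      also have "\<dots> = indicator {0..1} t * surf n b (indicator A)"
        by (rule surf_cmult) measurable
      finally show ?thesis using True by (simp add: mult.assoc mult_left_mono)
    qed simp
  qed simp
  also have "\<dots> = ennreal (b - n \<bullet> c) * (ennreal (1 / DIM('a)) * surf n b (indicator A))"
  proof -
    have "(\<integral>\<^sup>+t. ennreal (t ^ (DIM('a) - 1)) * indicator {0..1} t \<partial>lborel) = ennreal (1 / Suc (DIM('a) - 1))"
      by (intro nn_integral_has_integral_lebesgue'[OF _ has_integral_power_unit]) auto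
    then show ?thesis by (subst nn_integral_multc) auto
  qed
  also have "\<dots> = ennreal ((b - n \<bullet> c) / DIM('a)) * surf n b (indicator A)"
    using h by (simp add: mult.assoc[symmetric] ennreal_mult[symmetric])
  finally show ?thesis .
qed

lemma negligible_lowaffdim:
  fixes S :: "'a::euclidean_space set"
  assumes "aff_dim S < DIM('a)"
  shows "negligible S"
proof -
  have "interior (affine hull S) = {}"
    using assms aff_dim_nonempty_interior[of "affine hull S"] by fastforce
  then have "negligible (affine hull S)"
    by (simp add: negligible_convex_interior affine_imp_convex)
  then show ?thesis by (rule negligible_subset) (rule hull_subset)
qed

text \<open>Points whose projection lies in A belong to the affine hull of A and of one point of A
  shifted by n. That hull has dimension at most d - 1 and is a null set.\<close>

lemma surf_null:
  fixes A :: "'a::euclidean_space set"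
  assumes A: "aff_dim A < int DIM('a) - 1" and n: "norm n = 1" and sub: "\<And>y. n \<bullet> y = b \<Longrightarrow> \<phi> y \<noteq> 0 \<Longrightarrow> y \<in> A"
  shows "surf n b \<phi> = 0"
proof (cases "A = {}")
  case True
  then have "surf n b \<phi> = surf n b (\<lambda>_. 0)" by (intro surf_cong[OF n]) (use sub in auto)
  then show ?thesis by (simp add: surf_def)
next
  case False
  then obtain a where a: "a \<in> A" by blast
  let ?B = "affine hull (insert (a + n) A)"
  have "aff_dim ?B \<le> aff_dim A + 1" by (simp add: aff_dim_insert)
  then have "negligible ?B" using A by (intro negligible_lowaffdim) linarith
  then have "AE z in lborel. z \<notin> ?B"
    by (metis AE_not_in AE_completion_iff negligible_iff_null_sets)
  then have "AE z in lborel. indicator {z. \<bar>n \<bullet> z - b\<bar> \<le> 1/2} z * \<phi> (z - (n \<bullet> z - b) *\<^sub>R n) = 0"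
  proof eventually_elim
    case (elim z)
    have "\<phi> (z - (n \<bullet> z - b) *\<^sub>R n) = 0"
    proof (rule ccontr)
      assume "\<phi> (z - (n \<bullet> z - b) *\<^sub>R n) \<noteq> 0"
      moreover have "n \<bullet> (z - (n \<bullet> z - b) *\<^sub>R n) = b"
        using n by (simp add: inner_diff_right dot_square_norm)
      ultimately have y: "z - (n \<bullet> z - b) *\<^sub>R n \<in> ?B" using sub by (auto intro: hull_inc)
      have "a \<in> ?B" "a + n \<in> ?B" using a by (auto intro: hull_inc)
      then have "(z - (n \<bullet> z - b) *\<^sub>R n) + (n \<bullet> z - b) *\<^sub>R ((a + n) - a) \<in> ?B"
        using y mem_affine_3_minus affine_affine_hull by blast
      then show False using elim by simp
    qed
    then show ?case by simp
  qed
  then have "surf n b \<phi> = (\<integral>\<^sup>+z. 0 \<partial>(lborel :: 'a measure))"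
    unfolding surf_def by (rule nn_integral_cong_AE)
  then show ?thesis by simp
qed

section \<open>Polynomial spaces and Lagrange interpolation on simplices\<close>

abbreviation monomial :: "('n::finite \<Rightarrow> nat) \<Rightarrow> real^'n \<Rightarrow> real" where
  "monomial a x \<equiv> \<Prod>i\<in>UNIV. (x $ i) ^ a i"

lemma finite_multi_indices: "finite {a :: 'n::finite \<Rightarrow> nat. sum a UNIV \<le> k}"
proof (rule finite_subset)
  show "{a :: 'n \<Rightarrow> nat. sum a UNIV \<le> k} \<subseteq> Pi\<^sub>E UNIV (\<lambda>_. {..k})"
  proof
    fix a :: "'n \<Rightarrow> nat" assume a: "a \<in> {a. sum a UNIV \<le> k}"
    have "a i \<le> sum a UNIV" for i by (rule member_le_sum) auto
    then show "a \<in> Pi\<^sub>E UNIV (\<lambda>_. {..k})" using a by (auto intro: order_trans)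
  qed
  show "finite (Pi\<^sub>E (UNIV :: 'n set) (\<lambda>_. {..k}))" by (rule finite_PiE) auto
qed

lemma poly_space_add: "p \<in> poly_space k \<Longrightarrow> q \<in> poly_space k \<Longrightarrow> (\<lambda>x. p x + q x) \<in> poly_space k"
  unfolding poly_space_def
proof clarify
  fix c c' :: "('a \<Rightarrow> nat) \<Rightarrow> real"
  show "\<exists>c''. (\<lambda>x. (\<Sum>a | sum a UNIV \<le> k. c a * monomial a x) + (\<Sum>a | sum a UNIV \<le> k. c' a * monomial a x))
    = (\<lambda>x. \<Sum>a | sum a UNIV \<le> k. c'' a * monomial a x)"
    by (rule exI[of _ "\<lambda>a. c a + c' a"]) (simp add: sum.distrib distrib_right)
qed

lemma poly_space_cmult: "p \<in> poly_space k \<Longrightarrow> (\<lambda>x. r * p x) \<in> poly_space k"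
  unfolding poly_space_def
proof clarify
  fix c :: "('a \<Rightarrow> nat) \<Rightarrow> real"
  show "\<exists>c''. (\<lambda>x. r * (\<Sum>a | sum a UNIV \<le> k. c a * monomial a x))
    = (\<lambda>x. \<Sum>a | sum a UNIV \<le> k. c'' a * monomial a x)"
    by (rule exI[of _ "\<lambda>a. r * c a"]) (simp add: sum_distrib_left mult.assoc)
qed

lemma poly_space_monomial: "sum a UNIV \<le> k \<Longrightarrow> monomial a \<in> poly_space k"
  unfolding poly_space_def
proof (intro CollectI exI[of _ "\<lambda>a'. if a' = a then 1 else 0"] ext)
  fix x :: "real^'a" assume a: "sum a UNIV \<le> k"
  have "(\<Sum>a' | sum a' UNIV \<le> k. (if a' = a then 1 else 0) * monomial a' x)
     = (\<Sum>a' | sum a' UNIV \<le> k. if a' = a then monomial a' x else 0)"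
    by (rule sum.cong) auto
  then show "monomial a x = (\<Sum>a' | sum a' UNIV \<le> k. (if a' = a then 1 else 0) * monomial a' x)"
    using a by (subst sum.delta[OF finite_multi_indices, of a] | simp)+
qed

lemma poly_space_zero: "(\<lambda>x. 0) \<in> poly_space k"
  using poly_space_cmult[OF poly_space_monomial[of "\<lambda>_. 0" k], of 0] by simp

lemma poly_space_induct [consumes 1, case_names zero add cmult monomial]:
  assumes p: "p \<in> poly_space k"
    and zero: "P (\<lambda>x. 0)"
    and add: "\<And>p q. P p \<Longrightarrow> P q \<Longrightarrow> P (\<lambda>x. p x + q x)"
    and cmult: "\<And>r p. P p \<Longrightarrow> P (\<lambda>x. r * p x)"
    and mon: "\<And>a. sum a UNIV \<le> k \<Longrightarrow> P (monomial a)"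
  shows "P p"
proof -
  obtain c where c: "p = (\<lambda>x. \<Sum>a | sum a UNIV \<le> k. c a * monomial a x)"
    using p by (auto simp: poly_space_def)
  have "P (\<lambda>x. \<Sum>a\<in>A. c a * monomial a x)" if "finite A" "A \<subseteq> {a. sum a UNIV \<le> k}" for A
    using that
  proof (induction A)
    case empty then show ?case using zero by simp
  next
    case (insert a A)
    then show ?case using add[OF cmult[OF mon[of a]], of "\<lambda>x. \<Sum>a\<in>A. c a * monomial a x" "c a"] by simp
  qed
  from this[OF finite_multi_indices order_refl] show ?thesis unfolding c .
qed

lemma poly_space_mult:
  assumes p: "p \<in> poly_space k" and q: "q \<in> poly_space l"
  shows "(\<lambda>x. p x * q x) \<in> poly_space (k + l)"
  using p
proof (induction rule: poly_space_induct)
  case zero then show ?case by (simp add: poly_space_zero)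
next
  case (add p q) then show ?case using poly_space_add by (fastforce simp: distrib_right)
next
  case (cmult r p) then show ?case using poly_space_cmult by (fastforce simp: mult.assoc)
next
  case (monomial a)
  show ?case using q
  proof (induction rule: poly_space_induct)
    case zero then show ?case by (simp add: poly_space_zero)
  next
    case (add p q) then show ?case using poly_space_add by (fastforce simp: distrib_left)
  next
    case (cmult r p)
    from poly_space_cmult[OF this, of r] show ?case by (simp add: mult_ac)
  next
    case (monomial b)
    have "(\<lambda>x. monomial a x * monomial b x) = monomial (\<lambda>i. a i + b i)"
      by (auto simp: prod.distrib power_add)
    then show ?case using monomial \<open>sum a UNIV \<le> k\<close>
      by (auto simp: sum.distrib intro!: poly_space_monomial)
  qed
qed

lemma poly_space_const: "(\<lambda>x. c) \<in> poly_space k"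
  using poly_space_cmult[OF poly_space_monomial[of "\<lambda>_. 0" k], of c] by simp

lemma poly_space_sum:
  assumes "\<And>i. i \<in> I \<Longrightarrow> f i \<in> poly_space k"
  shows "(\<lambda>x. \<Sum>i\<in>I. f i x) \<in> poly_space k"
  using assms
proof (induction I rule: infinite_finite_induct)
  case (insert i I)
  then show ?case by (simp add: poly_space_add)
qed (simp_all add: poly_space_zero)

lemma poly_space_coordinate: "(\<lambda>x. x $ i) \<in> poly_space 1"
proof -
  have "(\<lambda>x. x $ i) = monomial (\<lambda>j. if j = i then 1 else 0)"
  proof
    fix x :: "real^'a"
    have "monomial (\<lambda>j. if j = i then 1 else 0) x = (\<Prod>j\<in>UNIV. if j = i then x $ j else 1)"
      by (rule prod.cong) auto
    then show "x $ i = monomial (\<lambda>j. if j = i then 1 else 0) x" by simp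
  qed
  then show ?thesis by (auto intro!: poly_space_monomial)
qed

lemma poly_space_affine: "(\<lambda>x. w \<bullet> x + \<beta>) \<in> poly_space 1"
  unfolding inner_vec_def inner_real_def
  by (intro poly_space_add poly_space_sum poly_space_cmult poly_space_coordinate poly_space_const)

lemma poly_space_prod:
  assumes "finite I" "\<And>i. i \<in> I \<Longrightarrow> f i \<in> poly_space (m i)"
  shows "(\<lambda>x. \<Prod>i\<in>I. f i x) \<in> poly_space (\<Sum>i\<in>I. m i)"
  using assms by (induction I) (auto intro: poly_space_const poly_space_mult)

lemma poly_space_gradient:
  assumes "p \<in> poly_space k"
  obtains g where "\<And>x. (p has_derivative (\<lambda>h. g x \<bullet> h)) (at x)" "\<And>i. (\<lambda>x. g x $ i) \<in> poly_space (k - 1)"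
proof -
  have "\<exists>g. (\<forall>x. (p has_derivative (\<lambda>h. g x \<bullet> h)) (at x)) \<and> (\<forall>i. (\<lambda>x. g x $ i) \<in> poly_space (k - 1))"
    using assms
  proof (induction rule: poly_space_induct)
    case zero
    then show ?case by (intro exI[of _ "\<lambda>_. 0"]) (auto simp: poly_space_zero)
  next
    case (add p q)
    then obtain g g' where "\<forall>x. (p has_derivative (\<lambda>h. g x \<bullet> h)) (at x)" "\<forall>i. (\<lambda>x. g x $ i) \<in> poly_space (k - 1)"
       "\<forall>x. (q has_derivative (\<lambda>h. g' x \<bullet> h)) (at x)" "\<forall>i. (\<lambda>x. g' x $ i) \<in> poly_space (k - 1)" by blast
    then show ?case
      by (intro exI[of _ "\<lambda>x. g x + g' x"]) (auto simp: inner_add_left intro!: has_derivative_add poly_space_add)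
  next
    case (cmult r p)
    then obtain g where "\<forall>x. (p has_derivative (\<lambda>h. g x \<bullet> h)) (at x)" "\<forall>i. (\<lambda>x. g x $ i) \<in> poly_space (k - 1)" by blast
    then show ?case
      by (intro exI[of _ "\<lambda>x. r *\<^sub>R g x"]) (auto intro!: has_derivative_mult_right poly_space_cmult)
  next
    case (monomial a)
    define g :: "real^'a \<Rightarrow> real^'a" where "g x = (\<chi> i. real (a i) * monomial (a(i := a i - 1)) x)" for x
    have "(monomial a has_derivative (\<lambda>h. g x \<bullet> h)) (at x)" for x
    proof -
      have "(monomial a has_derivative
          (\<lambda>h. \<Sum>i\<in>UNIV. (real (a i) * h $ i * (x $ i) ^ (a i - 1)) * (\<Prod>j\<in>UNIV - {i}. (x $ j) ^ a j))) (at x)"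
        by (rule has_derivative_prod)
           (auto intro!: derivative_eq_intros bounded_linear_imp_has_derivative[OF bounded_linear_vec_nth] simp: mult_ac)
      moreover have "monomial (a(i := a i - 1)) x = (x $ i) ^ (a i - 1) * (\<Prod>j\<in>UNIV - {i}. (x $ j) ^ a j)" for i
      proof -
        have "monomial (a(i := a i - 1)) x
          = (x $ i) ^ (a(i := a i - 1)) i * (\<Prod>j\<in>UNIV - {i}. (x $ j) ^ (a(i := a i - 1)) j)"
          by (rule prod.remove) auto
        also have "(\<Prod>j\<in>UNIV - {i}. (x $ j) ^ (a(i := a i - 1)) j) = (\<Prod>j\<in>UNIV - {i}. (x $ j) ^ a j)"
          by (rule prod.cong) auto
        finally show ?thesis by simp
      qed
      ultimately show ?thesis by (simp add: g_def inner_vec_def mult_ac)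
    qed
    moreover have "(\<lambda>x. g x $ i) \<in> poly_space (k - 1)" for i
    proof (cases "a i = 0")
      case True then show ?thesis by (simp add: g_def poly_space_zero)
    next
      case False
      have "sum (a(i := a i - 1)) UNIV = sum a UNIV - 1"
      proof -
        have "sum (a(i := a i - 1)) UNIV = (a(i := a i - 1)) i + sum (a(i := a i - 1)) (UNIV - {i})"
          by (rule sum.remove) auto
        also have "sum (a(i := a i - 1)) (UNIV - {i}) = sum a (UNIV - {i})"
          by (rule sum.cong) auto
        also have "sum a UNIV = a i + sum a (UNIV - {i})"
          by (rule sum.remove) auto
        ultimately show ?thesis using False by simp
      qed
      then have "sum (a(i := a i - 1)) UNIV \<le> k - 1" using monomial by linarith
      then show ?thesis unfolding g_def by (simp del: fun_upd_apply add: poly_space_cmult poly_space_monomial)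
    qed
    ultimately show ?case by blast
  qed
  then show ?thesis using that by blast
qed

lemma poly_space_continuous: "p \<in> poly_space k \<Longrightarrow> continuous_on S p"
  by (metis poly_space_gradient has_derivative_continuous continuous_at_imp_continuous_on)

lemma poly_space_line:
  assumes "p \<in> poly_space k"
  shows "\<exists>q. degree q \<le> k \<and> (\<forall>t. p (c + t *\<^sub>R w) = poly q t)"
  using assms
proof (induction rule: poly_space_induct)
  case zero
  then show ?case by (intro exI[of _ 0]) auto
next
  case (add p q)
  then obtain r r' where "degree r \<le> k" "\<forall>t. p (c + t *\<^sub>R w) = poly r t"
    "degree r' \<le> k" "\<forall>t. q (c + t *\<^sub>R w) = poly r' t" by blast
  then show ?case by (intro exI[of _ "r + r'"]) (auto intro: degree_add_le)
next
  case (cmult s p)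
  then obtain r where "degree r \<le> k" "\<forall>t. p (c + t *\<^sub>R w) = poly r t" by blast
  then show ?case by (intro exI[of _ "smult s r"]) (auto intro: order_trans[OF degree_smult_le])
next
  case (monomial a)
  define r where "r = (\<Prod>i\<in>UNIV. [:c $ i, w $ i:] ^ a i)"
  have "degree ([:c $ i, w $ i:] ^ a i) \<le> a i" for i
    by (rule order_trans[OF degree_power_le]) auto
  then have "degree r \<le> sum a UNIV"
    unfolding r_def by (intro order_trans[OF degree_prod_sum_le] sum_mono) (auto simp: o_def)
  then show ?case using monomial by (intro exI[of _ r]) (auto simp: r_def poly_prod mult.commute)
qed

section \<open>Unisolvence by a dimension count\<close>

definition fun_scale :: "real \<Rightarrow> ('a \<Rightarrow> real) \<Rightarrow> 'a \<Rightarrow> real" where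
  "fun_scale r f = (\<lambda>x. r * f x)"

lemma fun_vector_space: "vector_space fun_scale"
  by (rule vector_space.intro)
     (simp_all only: fun_scale_def plus_fun_apply fun_eq_iff distrib_left distrib_right mult.assoc mult_1_left simp_thms)

text \<open>There are as many nodes as monomials. The nodal functions are independent, so they
  already span the polynomial space; in the expansion of p the coefficients are the nodal values,
  all zero.\<close>

lemma interpolation_unisolvent:
  fixes \<phi> :: "'z \<Rightarrow> real^'n \<Rightarrow> real" and pt :: "('n \<Rightarrow> nat) \<Rightarrow> real^'n"
  assumes pt: "inj_on pt {a. sum a UNIV \<le> k}"
    and \<phi>: "\<And>z. z \<in> pt ` {a. sum a UNIV \<le> k} \<Longrightarrow> \<exists>f\<in>poly_space k. \<forall>y\<in>pt ` {a. sum a UNIV \<le> k}. f y = (if y = z then 1 else 0)"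
    and p: "p \<in> poly_space k" and p0: "\<And>z. z \<in> pt ` {a. sum a UNIV \<le> k} \<Longrightarrow> p z = 0"
  shows "p = (\<lambda>x. 0)"
proof -
  interpret fv: vector_space "fun_scale :: real \<Rightarrow> (real^'n \<Rightarrow> real) \<Rightarrow> real^'n \<Rightarrow> real"
    by (rule fun_vector_space)
  define A where "A = {a :: 'n \<Rightarrow> nat. sum a UNIV \<le> k}"
  define Z where "Z = pt ` A"
  have finA: "finite A" unfolding A_def by (rule finite_multi_indices)
  have finZ: "finite Z" and cardZ: "card Z = card A"
    using finA pt by (auto simp: Z_def A_def card_image)
  have "\<forall>z\<in>Z. \<exists>f. f \<in> poly_space k \<and> (\<forall>y\<in>Z. f y = (if y = z then 1 else 0))"
    using \<phi> unfolding Z_def A_def Bex_def by (rule ballI)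
  then obtain f where f': "\<forall>z\<in>Z. f z \<in> poly_space k \<and> (\<forall>y\<in>Z. f z y = (if y = z then 1 else 0))"
    by (rule bchoice[THEN exE])
  then have f: "\<And>z. z \<in> Z \<Longrightarrow> f z \<in> poly_space k"
    "\<And>z y. z \<in> Z \<Longrightarrow> y \<in> Z \<Longrightarrow> f z y = (if y = z then 1 else 0)"
    by auto
  have sum_apply: "(\<Sum>v\<in>S. fun_scale (u v) v) x = (\<Sum>v\<in>S. u v * v x)"
    if "finite S" for S u and x :: "real^'n"
    using that by (induction S) (simp_all only: sum.empty sum.insert simp_thms zero_fun_apply plus_fun_apply fun_scale_def)
  have span: "q \<in> fv.span (monomial ` A)" if "q \<in> poly_space k" for q
    using that
  proof (induction rule: poly_space_induct)
    case zero
    show ?case using fv.span_zero unfolding zero_fun_def .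
  next
    case (add p q)
    from fv.span_add[OF this] show ?case unfolding plus_fun_def .
  next
    case (cmult r p)
    from fv.span_scale[OF this] show ?case unfolding fun_scale_def .
  next
    case (monomial a)
    then have "a \<in> A" by (simp add: A_def)
    then have "monomial a \<in> monomial ` A" by (rule image_eqI[where f = monomial, OF refl])
    then show ?case by (rule fv.span_base)
  qed
  have injf: "inj_on f Z"
  proof (rule inj_onI)
    fix y z assume "y \<in> Z" "z \<in> Z" "f y = f z"
    then show "y = z" using f(2)[of y y] f(2)[of z y] by (auto split: if_splits)
  qed
  have ind: "fv.independent (f ` Z)"
    unfolding fv.independent_explicit_finite_subsets
  proof (intro allI impI ballI)
    fix S u v assume S: "S \<subseteq> f ` Z" "finite S" and 0: "(\<Sum>v\<in>S. fun_scale (u v) v) = 0" and v: "v \<in> S"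
    then obtain z where z: "z \<in> Z" "v = f z" by blast
    have "0 = (\<Sum>v\<in>S. fun_scale (u v) v) z" using 0 by simp
    also have "\<dots> = (\<Sum>w\<in>S. u w * w z)"
      using S(2) by (rule sum_apply)
    also have "\<dots> = (\<Sum>w\<in>S. if w = v then u w else 0)"
    proof (rule sum.cong)
      fix w assume "w \<in> S"
      then obtain z' where z': "z' \<in> Z" "w = f z'" using S by blast
      show "u w * w z = (if w = v then u w else 0)"
        using z z' f(2)[OF z'(1) z(1)] inj_onD[OF injf, of z z'] by auto
    qed simp
    also have "\<dots> = u v" using v S(2) by simp
    finally show "u v = 0" by simp
  qed
  \<comment> \<open>Otherwise p together with the nodal functions would give one more independent
    element than there are spanning monomials.\<close>
  have "p \<in> fv.span (f ` Z)"
  proof (rule ccontr)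
    assume np: "p \<notin> fv.span (f ` Z)"
    then have "fv.independent (insert p (f ` Z))" using ind by (rule fv.independent_insertI)
    moreover have "insert p (f ` Z) \<subseteq> fv.span (monomial ` A)"
      using span p f(1) by auto
    ultimately have "card (insert p (f ` Z)) \<le> card (monomial ` A)"
      using fv.independent_span_bound finA by blast
    moreover have "p \<notin> f ` Z" using np fv.span_base by blast
    then have "card (insert p (f ` Z)) = Suc (card A)"
      using finZ injf cardZ by (simp add: card_image)
    ultimately show False using card_image_le[OF finA, of monomial] by linarith
  qed
  then obtain u where u: "p = (\<Sum>v\<in>f ` Z. fun_scale (u v) v)"
    using fv.span_finite[of "f ` Z"] finZ by auto
  have px: "p x = (\<Sum>z\<in>Z. u (f z) * f z x)" for x
  proof -
    have "p x = (\<Sum>v\<in>f ` Z. u v * v x)" unfolding u by (rule sum_apply) (use finZ in simp)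
    then show ?thesis using finZ injf by (simp add: sum.reindex)
  qed
  have "u (f z) = 0" if z: "z \<in> Z" for z
  proof -
    have "0 = (\<Sum>z'\<in>Z. u (f z') * f z' z)" using p0[of z] z px[of z] by (simp add: Z_def A_def)
    also have "\<dots> = (\<Sum>z'\<in>Z. if z' = z then u (f z') else 0)"
      by (rule sum.cong) (use f(2) z in auto)
    also have "\<dots> = u (f z)" using z finZ by simp
    finally show ?thesis by simp
  qed
  then show ?thesis by (auto simp: px)
qed

section \<open>Barycentric coordinates and Lagrange bases\<close>

lemma affine_interpolation:
  fixes V :: "(real^'n) set" and c :: "real^'n \<Rightarrow> real"
  assumes "\<not> affine_dependent V"
  obtains w \<beta> where "\<And>v. v \<in> V \<Longrightarrow> w \<bullet> v + \<beta> = c v"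
proof (cases "V = {}")
  case True then show ?thesis using that by auto
next
  case False
  then obtain v0 where v0: "v0 \<in> V" by blast
  have "independent ((\<lambda>x. - v0 + x) ` (V - {v0}))"
    using affine_dependent_iff_dependent2[OF v0] assms by blast
  then obtain f where f: "linear f" "\<forall>x\<in>(\<lambda>x. - v0 + x) ` (V - {v0}). f x = c (x + v0) - c v0"
    using linear_independent_extend[of _ "\<lambda>x. c (x + v0) - c v0"] by blast
  define w where "w = (\<Sum>b\<in>Basis. f b *\<^sub>R b)"
  have fw: "f x = w \<bullet> x" for x
  proof -
    have "f x = f (\<Sum>b\<in>Basis. (x \<bullet> b) *\<^sub>R b)" by (simp add: euclidean_representation)
    also have "\<dots> = (\<Sum>b\<in>Basis. (x \<bullet> b) * f b)"
      using f(1) by (simp add: linear_sum linear_scale)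
    finally show ?thesis by (simp add: w_def inner_sum_left inner_commute[of x] mult.commute)
  qed
  show ?thesis
  proof (rule that[of w "c v0 - w \<bullet> v0"])
    fix v assume "v \<in> V"
    then show "w \<bullet> v + (c v0 - w \<bullet> v0) = c v"
      using f(2) fw[of "- v0 + v"] by (cases "v = v0") (auto simp: inner_simps)
  qed
qed

lemma simplex_vertices:
  fixes T :: "(real^'n) set"
  assumes "int CARD('n) simplex T"
  defines "V \<equiv> {v. v extreme_point_of T}"
  shows "finite V" "\<not> affine_dependent V" "card V = CARD('n) + 1" "T = convex hull V" "affine hull V = UNIV"
proof -
  obtain C where C: "finite C" "\<not> affine_dependent C" "int (card C) = int CARD('n) + 1" "T = convex hull C"
    using assms(1) unfolding simplex by blast
  then have VC: "V = C"
    unfolding V_def by (auto simp: extreme_point_of_convex_hull_affine_independent)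
  show "finite V" "\<not> affine_dependent V" "T = convex hull V" using C VC by auto
  have "int (card V) = int (CARD('n) + 1)" using C(3) VC by simp
  then show "card V = CARD('n) + 1" by (simp only: of_nat_eq_iff)
  have "aff_dim C = int CARD('n)"
    using C affine_independent_iff_card[of C] by simp
  then show "affine hull V = UNIV"
    using VC aff_dim_eq_full[of C] by simp
qed

lemma barycentric_functions:
  fixes V :: "(real^'n) set"
  assumes "\<not> affine_dependent V" "finite V"
  obtains L :: "real^'n \<Rightarrow> real^'n \<Rightarrow> real" where "\<And>v. v \<in> V \<Longrightarrow> L v \<in> poly_space 1"
    "\<And>c (\<mu> :: real^'n \<Rightarrow> real) v. c \<subseteq> V \<Longrightarrow> sum \<mu> c = 1 \<Longrightarrow> v \<in> V \<Longrightarrow> L v (\<Sum>u\<in>c. \<mu> u *\<^sub>R u) = (if v \<in> c then \<mu> v else 0)"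
proof -
  have "\<exists>w \<beta>. \<forall>u\<in>V. w \<bullet> u + \<beta> = (if u = v then 1 else 0)" for v
    using affine_interpolation[OF assms(1), of "\<lambda>u. if u = v then 1 else 0"] by metis
  then obtain w \<beta> where w: "\<And>v u. u \<in> V \<Longrightarrow> w v \<bullet> u + \<beta> v = (if u = v then 1 else 0)" by metis
  show ?thesis
  proof (rule that[of "\<lambda>v x. w v \<bullet> x + \<beta> v"])
    show "(\<lambda>x. w v \<bullet> x + \<beta> v) \<in> poly_space 1" for v by (rule poly_space_affine)
    fix c v and \<mu> :: "real^'n \<Rightarrow> real" assume c: "c \<subseteq> V" "sum \<mu> c = 1" and v: "v \<in> V"
    have "w v \<bullet> (\<Sum>u\<in>c. \<mu> u *\<^sub>R u) + \<beta> v = (\<Sum>u\<in>c. \<mu> u * (w v \<bullet> u)) + sum \<mu> c * \<beta> v"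
      using c by (simp add: inner_sum_right)
    also have "\<dots> = (\<Sum>u\<in>c. \<mu> u * (w v \<bullet> u + \<beta> v))"
      by (simp add: sum.distrib distrib_left sum_distrib_right)
    also have "\<dots> = (\<Sum>u\<in>c. if u = v then \<mu> u else 0)"
      by (rule sum.cong) (use c(1) w in auto)
    also have "\<dots> = (if v \<in> c then \<mu> v else 0)"
      using finite_subset[OF c(1) assms(2)] by simp
    finally show "w v \<bullet> (\<Sum>u\<in>c. \<mu> u *\<^sub>R u) + \<beta> v = (if v \<in> c then \<mu> v else 0)" .
  qed
qed

text \<open>Requiring zero off \<open>c\<close> makes the index of a node unique, whereas in
  \<open>lagrange_nodes\<close> the function is arbitrary there. With \<open>c\<close> a set of
  vertices of a face, the indices of the face form a subset of those of the simplex.\<close>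

definition node_indices :: "nat \<Rightarrow> (real^'n) set \<Rightarrow> (real^'n \<Rightarrow> nat) set" where
  "node_indices k c = {a. (\<forall>v. v \<notin> c \<longrightarrow> a v = 0) \<and> sum a c = k}"

definition node :: "nat \<Rightarrow> (real^'n) set \<Rightarrow> (real^'n \<Rightarrow> nat) \<Rightarrow> real^'n" where
  "node k c a = (\<Sum>v\<in>c. (real (a v) / real k) *\<^sub>R v)"

text \<open>The classical basis polynomial of the principal lattice in barycentric coordinates
  \<mu>: the factor at v vanishes when k times \<open>\<mu> v\<close> is one of 0, ..., a v - 1, and
  equals 1 when it is a v.\<close>

definition node_poly :: "nat \<Rightarrow> (real^'n) set \<Rightarrow> (real^'n \<Rightarrow> nat) \<Rightarrow> (real^'n \<Rightarrow> real) \<Rightarrow> real" where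
  "node_poly k c a \<mu> = (\<Prod>v\<in>c. \<Prod>j<a v. (real k * \<mu> v - real j) / (real (a v) - real j))"

lemma lagrange_nodes_eq:
  "lagrange_nodes k T = node k {v. v extreme_point_of T} ` node_indices k {v. v extreme_point_of T}"
  (is "_ = node k ?V ` _")
proof (rule set_eqI, rule iffI)
  fix z assume "z \<in> lagrange_nodes k T"
  then obtain a where a: "z = (\<Sum>v\<in>?V. (real (a v) / real k) *\<^sub>R v)" "sum a ?V = k"
    by (auto simp: lagrange_nodes_def Let_def)
  let ?a = "\<lambda>v. if v \<in> ?V then a v else 0"
  have "z = node k ?V ?a" unfolding a node_def by (rule sum.cong) auto
  moreover have "sum ?a ?V = sum a ?V" by (rule sum.cong) auto
  then have "?a \<in> node_indices k ?V" using a(2) by (auto simp: node_indices_def)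
  ultimately show "z \<in> node k ?V ` node_indices k ?V" by blast
next
  fix z assume "z \<in> node k ?V ` node_indices k ?V"
  then show "z \<in> lagrange_nodes k T"
    by (auto simp: lagrange_nodes_def Let_def node_def node_indices_def)
qed

lemma finite_node_indices: "finite c \<Longrightarrow> finite (node_indices k c)"
proof -
  assume c: "finite c"
  have "node_indices k c \<subseteq> {a. (\<forall>v. (v \<in> c \<longrightarrow> a v \<in> {..k}) \<and> (v \<notin> c \<longrightarrow> a v = 0))}"
    using member_le_sum[of _ c] c by (fastforce simp: node_indices_def)
  then show ?thesis
    by (rule finite_subset) (rule finite_set_of_finite_funs[OF c], simp)
qed

text \<open>Both indices have sum k, so if they differ then \<open>b v < a v\<close> for some v, and
  the factor with j = b v vanishes.\<close>

lemma node_poly_at_node: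
  assumes a: "a \<in> node_indices k V" and b: "b \<in> node_indices k V" and V: "finite V" and k: "k \<ge> 1"
    and \<mu>: "\<And>v. v \<in> V \<Longrightarrow> \<mu> v = real (b v) / real k"
  shows "node_poly k V a \<mu> = (if a = b then 1 else 0)"
proof (cases "a = b")
  case True
  have "(\<Prod>j<a v. (real k * \<mu> v - real j) / (real (a v) - real j)) = 1" if "v \<in> V" for v
  proof (rule prod.neutral, rule ballI)
    fix j assume "j \<in> {..<a v}"
    then show "(real k * \<mu> v - real j) / (real (a v) - real j) = 1"
      using \<mu>[OF that] k True by (auto simp: divide_simps mult.commute)
  qed
  then show ?thesis using True by (simp add: node_poly_def)
next
  case False
  have "\<exists>v\<in>V. b v < a v"
  proof (rule ccontr)
    assume "\<not> ?thesis"
    then have le: "\<And>v. v \<in> V \<Longrightarrow> a v \<le> b v" by force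
    have "a v = b v" for v
    proof (cases "v \<in> V")
      case True
      show ?thesis
      proof (rule ccontr)
        assume "a v \<noteq> b v"
        then have "sum a V < sum b V"
          using le True V by (intro sum_strict_mono_ex1) (auto intro!: bexI[of _ v] simp: le_less)
        then show False using a b by (simp add: node_indices_def)
      qed
    qed (use a b in \<open>auto simp: node_indices_def\<close>)
    then show False using False by auto
  qed
  then obtain v where v: "v \<in> V" "b v < a v" by blast
  have "(\<Prod>j<a v. (real k * \<mu> v - real j) / (real (a v) - real j)) = 0"
    using v \<mu>[OF v(1)] k by (intro prod_zero bexI[of _ "b v"]) auto
  then show ?thesis using False v V by (auto simp: node_poly_def intro!: prod_zero)
qed

text \<open>An index with a nonzero entry at a vertex off the face contributes the factor j = 0,
  which is a multiple of the vanishing coordinate there. Hence only the nodes of the face are seen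
  on the face.\<close>

lemma node_poly_face:
  assumes V: "finite V" and c: "c \<subseteq> V" and \<mu>: "\<And>v. v \<in> V - c \<Longrightarrow> \<mu> v = 0" and a: "a \<in> node_indices k V"
  shows "node_poly k V a \<mu> = (if a \<in> node_indices k c then node_poly k c a \<mu> else 0)"
proof (cases "\<exists>v\<in>V - c. a v \<noteq> 0")
  case True
  then obtain v where v: "v \<in> V - c" "a v \<noteq> 0" by blast
  then have "(\<Prod>j<a v. (real k * \<mu> v - real j) / (real (a v) - real j)) = 0"
    using \<mu> by (intro prod_zero bexI[of _ 0]) auto
  then show ?thesis using v V by (auto simp: node_poly_def node_indices_def intro!: prod_zero)
next
  case False
  then have 0: "\<And>v. v \<in> V - c \<Longrightarrow> a v = 0" by blast
  have "sum a c = sum a V"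
    by (rule sum.mono_neutral_left) (use V c 0 in auto)
  then have "a \<in> node_indices k c" using a 0 by (auto simp: node_indices_def)
  moreover have "node_poly k c a \<mu> = node_poly k V a \<mu>"
    unfolding node_poly_def by (rule prod.mono_neutral_left) (use V c 0 in auto)
  ultimately show ?thesis by simp
qed

text \<open>The explicit polynomials in barycentric coordinates satisfy the duality with the nodes.
  Through the dimension count this duality alone gives unisolvence, which in turn identifies the
  \<open>THE\<close> in \<open>lagrange_basis\<close> with the explicit formula.\<close>

lemma lagrange_simplex:
  fixes T :: "(real^'n) set"
  assumes T: "int CARD('n) simplex T" and k: "k \<ge> 1"
  defines "V \<equiv> {v. v extreme_point_of T}"
  shows "inj_on (node k V) (node_indices k V)"
    and "a \<in> node_indices k V \<Longrightarrow> lagrange_basis k T (node k V a) \<in> poly_space k"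
    and "z \<in> lagrange_nodes k T \<Longrightarrow> y \<in> lagrange_nodes k T \<Longrightarrow> lagrange_basis k T z y = (if y = z then 1 else 0)"
    and "p \<in> poly_space k \<Longrightarrow> q \<in> poly_space k \<Longrightarrow> (\<And>z. z \<in> lagrange_nodes k T \<Longrightarrow> p z = q z) \<Longrightarrow> p = q"
    and "a \<in> node_indices k V \<Longrightarrow> c \<subseteq> V \<Longrightarrow> sum \<mu> c = 1 \<Longrightarrow> (\<And>v. v \<notin> c \<Longrightarrow> \<mu> v = 0) \<Longrightarrow>
      lagrange_basis k T (node k V a) (\<Sum>u\<in>c. \<mu> u *\<^sub>R u) = node_poly k V a \<mu>"
proof -
  note V = simplex_vertices[OF T, folded V_def]
  obtain L where L1: "\<And>v. v \<in> V \<Longrightarrow> L v \<in> poly_space 1"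
    and L2: "\<And>c (\<mu> :: real^'n \<Rightarrow> real) v. c \<subseteq> V \<Longrightarrow> sum \<mu> c = 1 \<Longrightarrow> v \<in> V \<Longrightarrow> L v (\<Sum>u\<in>c. \<mu> u *\<^sub>R u) = (if v \<in> c then \<mu> v else 0)"
    using barycentric_functions[OF V(2,1)] by blast
  have nodes: "lagrange_nodes k T = node k V ` node_indices k V"
    unfolding V_def by (rule lagrange_nodes_eq)
  have Lnode: "L v (node k V a) = real (a v) / real k" if "a \<in> node_indices k V" "v \<in> V" for a v
    unfolding node_def
  proof (subst L2)
    show "(\<Sum>v\<in>V. real (a v) / real k) = 1"
      using that k by (simp add: sum_divide_distrib[symmetric] node_indices_def flip: of_nat_sum)
  qed (use that in auto)
  show inj: "inj_on (node k V) (node_indices k V)"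
  proof (rule inj_onI, rule ext)
    fix a b v assume ab: "a \<in> node_indices k V" "b \<in> node_indices k V" "node k V a = node k V b"
    show "a v = b v"
    proof (cases "v \<in> V")
      case True then show ?thesis using Lnode[OF ab(1) True] Lnode[OF ab(2) True] ab(3) k by simp
    qed (use ab in \<open>auto simp: node_indices_def\<close>)
  qed
  define \<phi> where "\<phi> a x = node_poly k V a (\<lambda>v. L v x)" for a x
  have \<phi>poly: "\<phi> a \<in> poly_space k" if a: "a \<in> node_indices k V" for a
  proof -
    have f: "(\<lambda>x. (real k * L v x - real j) / (real (a v) - real j)) \<in> poly_space 1" if "v \<in> V" for v j
    proof -
      have "(\<lambda>x. (1 / (real (a v) - real j)) * (real k * L v x + (- real j))) \<in> poly_space 1"
        by (intro poly_space_cmult poly_space_add poly_space_const L1 that)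
      then show ?thesis by simp
    qed
    have "(\<lambda>x. \<Prod>v\<in>V. \<Prod>j<a v. (real k * L v x - real j) / (real (a v) - real j)) \<in> poly_space (\<Sum>v\<in>V. \<Sum>j<a v. 1)"
      by (intro poly_space_prod V(1) finite_lessThan f)
    then show ?thesis using a by (simp add: \<phi>_def[abs_def] node_poly_def node_indices_def)
  qed
  have \<phi>node: "\<phi> a (node k V b) = (if a = b then 1 else 0)"
    if "a \<in> node_indices k V" "b \<in> node_indices k V" for a b
    unfolding \<phi>_def using node_poly_at_node[OF that V(1) k] Lnode that by simp
  have ex: "\<exists>f\<in>poly_space k. \<forall>y\<in>lagrange_nodes k T. f y = (if y = z then 1 else 0)" if "z \<in> lagrange_nodes k T" for z
  proof -
    obtain a where a: "a \<in> node_indices k V" "z = node k V a" using \<open>z \<in> _\<close> nodes by auto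
    show ?thesis
      by (rule bexI[OF _ \<phi>poly[OF a(1)]]) (use a \<phi>node inj in \<open>auto simp: nodes inj_on_eq_iff\<close>)
  qed
  have uni0: "p = (\<lambda>x. 0)" if p: "p \<in> poly_space k" "\<And>z. z \<in> lagrange_nodes k T \<Longrightarrow> p z = 0" for p
  proof -
    obtain v0 where v0: "v0 \<in> V" using V(3) by fastforce
    have "card (V - {v0}) = card (UNIV :: 'n set)" using V(1,3) v0 by simp
    then obtain e where e: "bij_betw e (V - {v0}) (UNIV :: 'n set)"
      using V(1) by (metis finite finite_Diff finite_same_card_bij)
    \<comment> \<open>The weight at \<open>v0\<close> is the slack k minus the total degree; this
      matches nodes with exponents of monomials, as the dimension count requires.\<close>
    define idx where "idx a v = (if v = v0 then k - sum a UNIV else if v \<in> V then a (e v) else 0)" for a v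
    have idx: "idx a \<in> node_indices k V" if "sum a UNIV \<le> k" for a
    proof -
      have "sum (idx a) V = idx a v0 + sum (idx a) (V - {v0})" using V(1) v0 by (rule sum.remove)
      also have "sum (idx a) (V - {v0}) = sum (\<lambda>v. a (e v)) (V - {v0})"
        by (rule sum.cong) (auto simp: idx_def)
      also have "\<dots> = sum a UNIV" using e by (rule sum.reindex_bij_betw)
      finally show ?thesis using that v0 by (auto simp: node_indices_def idx_def)
    qed
    have idxinj: "inj_on idx {a. sum a UNIV \<le> k}"
    proof (rule inj_onI, rule ext)
      fix a b i assume ab: "idx a = idx b"
      obtain v where "v \<in> V - {v0}" "e v = i" using e by (metis UNIV_I bij_betw_iff_bijections)
      then show "a i = b i" using fun_cong[OF ab, of v] by (simp add: idx_def)
    qed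
    have sub: "(node k V \<circ> idx) ` {a. sum a UNIV \<le> k} \<subseteq> lagrange_nodes k T"
      using idx by (auto simp: nodes)
    show ?thesis
    proof (rule interpolation_unisolvent[of "node k V \<circ> idx" k])
      show "inj_on (node k V \<circ> idx) {a. sum a UNIV \<le> k}"
        by (rule comp_inj_on[OF idxinj], rule inj_on_subset[OF inj]) (use idx in auto)
      show "\<exists>f\<in>poly_space k. \<forall>y\<in>(node k V \<circ> idx) ` {a. sum a UNIV \<le> k}. f y = (if y = z then 1 else 0)"
        if "z \<in> (node k V \<circ> idx) ` {a. sum a UNIV \<le> k}" for z
        using ex[of z] sub that by blast
    qed (use p sub in auto)
  qed
  show uni: "p = q" if "p \<in> poly_space k" "q \<in> poly_space k" "\<And>z. z \<in> lagrange_nodes k T \<Longrightarrow> p z = q z" for p q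
  proof -
    have "(\<lambda>x. p x + (-1) * q x) = (\<lambda>x. 0)"
      by (rule uni0, intro poly_space_add poly_space_cmult that) (simp add: that(3))
    then have "p x + (-1) * q x = 0" for x by (rule fun_cong)
    then show ?thesis by (auto simp: fun_eq_iff)
  qed
  have basis: "lagrange_basis k T z \<in> poly_space k \<and> (\<forall>y\<in>lagrange_nodes k T. lagrange_basis k T z y = (if y = z then 1 else 0))"
    if z: "z \<in> lagrange_nodes k T" for z
  proof -
    obtain f where f: "f \<in> poly_space k" "\<forall>y\<in>lagrange_nodes k T. f y = (if y = z then 1 else 0)"
      using ex[OF z] by blast
    have "\<exists>!p. p \<in> poly_space k \<and> (\<forall>y\<in>lagrange_nodes k T. p y = (if y = z then 1 else 0))"
      by (rule ex1I[of _ f]) (use f in \<open>auto intro!: uni[of _ f]\<close>)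
    from theI'[OF this] show ?thesis unfolding lagrange_basis_def .
  qed
  have basis_eq: "lagrange_basis k T (node k V a) = \<phi> a" if a: "a \<in> node_indices k V" for a
    by (rule uni) (use a basis[of "node k V a"] \<phi>poly \<phi>node inj in \<open>auto simp: nodes inj_on_eq_iff\<close>)
  show "lagrange_basis k T (node k V a) \<in> poly_space k" if "a \<in> node_indices k V"
    using basis_eq[OF that] \<phi>poly[OF that] by simp
  show "lagrange_basis k T z y = (if y = z then 1 else 0)" if "z \<in> lagrange_nodes k T" "y \<in> lagrange_nodes k T"
    using basis that by blast
  show "lagrange_basis k T (node k V a) (\<Sum>u\<in>c. \<mu> u *\<^sub>R u) = node_poly k V a \<mu>"
    if "a \<in> node_indices k V" "c \<subseteq> V" "sum \<mu> c = 1" "\<And>v. v \<notin> c \<Longrightarrow> \<mu> v = 0"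
    unfolding basis_eq[OF that(1)] \<phi>_def node_poly_def
    by (intro prod.cong refl) (use L2[OF that(2,3)] that(4) in auto)
qed

lemma lagrange_nodes_simplex:
  fixes T :: "(real^'n) set"
  assumes T: "int CARD('n) simplex T" and k: "k \<ge> 1"
  shows "finite (lagrange_nodes k T)" "lagrange_nodes k T \<subseteq> T"
    "z \<in> lagrange_nodes k T \<Longrightarrow> lagrange_basis k T z \<in> poly_space k"
proof -
  note V = simplex_vertices[OF T]
  show "finite (lagrange_nodes k T)"
    using V(1) by (simp add: lagrange_nodes_eq finite_node_indices)
  show "lagrange_nodes k T \<subseteq> T"
  proof
    fix z assume "z \<in> lagrange_nodes k T"
    then obtain a where a: "a \<in> node_indices k {v. v extreme_point_of T}" "z = node k {v. v extreme_point_of T} a"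
      by (auto simp: lagrange_nodes_eq)
    have "z \<in> convex hull {v. v extreme_point_of T}"
      unfolding convex_hull_finite[OF V(1)] mem_Collect_eq
      using a k by (intro exI[of _ "\<lambda>v. real (a v) / real k"])
        (auto simp: node_def node_indices_def sum_divide_distrib[symmetric] simp flip: of_nat_sum)
    then show "z \<in> T" using V(4) by simp
  qed
  show "z \<in> lagrange_nodes k T \<Longrightarrow> lagrange_basis k T z \<in> poly_space k"
    using lagrange_simplex(2)[OF T k] by (auto simp: lagrange_nodes_eq)
qed

text \<open>The right-hand side no longer mentions T, only the vertices of the face. This is the
  reason why expansions on neighbouring simplices fit together.\<close>

lemma lagrange_expansion_face:
  fixes T :: "(real^'n) set"
  assumes T: "int CARD('n) simplex T" and k: "k \<ge> 1"
    and c: "c \<subseteq> {v. v extreme_point_of T}" and \<mu>: "sum \<mu> c = 1" "\<And>v. v \<notin> c \<Longrightarrow> \<mu> v = 0"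
  shows "(\<Sum>z\<in>lagrange_nodes k T. g z * lagrange_basis k T z (\<Sum>u\<in>c. \<mu> u *\<^sub>R u))
    = (\<Sum>a\<in>node_indices k c. g (node k c a) * node_poly k c a \<mu>)"
proof -
  define V where "V = {v. v extreme_point_of T}"
  note V = simplex_vertices[OF T, folded V_def]
  note L = lagrange_simplex[OF T k, folded V_def]
  have cV: "c \<subseteq> V" using c by (simp add: V_def)
  have sub: "node_indices k c \<subseteq> node_indices k V"
  proof
    fix a assume a: "a \<in> node_indices k c"
    have "sum a c = sum a V"
      by (rule sum.mono_neutral_left) (use V cV a in \<open>auto simp: node_indices_def\<close>)
    then show "a \<in> node_indices k V" using a cV by (auto simp: node_indices_def)
  qed
  have node_eq: "node k V a = node k c a" if "a \<in> node_indices k c" for a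
    unfolding node_def by (rule sum.mono_neutral_right) (use V cV that in \<open>auto simp: node_indices_def\<close>)
  have "(\<Sum>z\<in>lagrange_nodes k T. g z * lagrange_basis k T z (\<Sum>u\<in>c. \<mu> u *\<^sub>R u))
     = (\<Sum>a\<in>node_indices k V. g (node k V a) * lagrange_basis k T (node k V a) (\<Sum>u\<in>c. \<mu> u *\<^sub>R u))"
    unfolding lagrange_nodes_eq V_def[symmetric] by (simp add: sum.reindex[OF L(1)])
  also have "\<dots> = (\<Sum>a\<in>node_indices k V. g (node k V a) * node_poly k V a \<mu>)"
    by (rule sum.cong) (simp_all add: L(5)[OF _ cV \<mu>])
  also have "\<dots> = (\<Sum>a\<in>node_indices k V. if a \<in> node_indices k c then g (node k c a) * node_poly k c a \<mu> else 0)"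
    by (rule sum.cong) (use node_poly_face[OF V(1) cV, of \<mu>] \<mu>(2) node_eq in auto)
  also have "\<dots> = (\<Sum>a\<in>node_indices k c. g (node k c a) * node_poly k c a \<mu>)"
    using sub finite_node_indices[OF V(1)] by (simp add: sum.inter_restrict[symmetric] Int_absorb1)
  finally show ?thesis .
qed

lemma lagrange_expansion_conforming:
  fixes T T' :: "(real^'n) set"
  assumes T: "int CARD('n) simplex T" and T': "int CARD('n) simplex T'" and k: "k \<ge> 1"
    and face: "(T \<inter> T') face_of T" "(T \<inter> T') face_of T'" and x: "x \<in> T" "x \<in> T'"
  shows "(\<Sum>z\<in>lagrange_nodes k T. g z * lagrange_basis k T z x)
    = (\<Sum>z\<in>lagrange_nodes k T'. g z * lagrange_basis k T' z x)"
proof -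
  note V = simplex_vertices[OF T] and V' = simplex_vertices[OF T']
  obtain c where c: "c \<subseteq> {v. v extreme_point_of T}" "T \<inter> T' = convex hull c"
    using face(1) face_of_convex_hull_affine_independent[OF V(2)] V(4) by metis
  obtain c' where c': "c' \<subseteq> {v. v extreme_point_of T'}" "T \<inter> T' = convex hull c'"
    using face(2) face_of_convex_hull_affine_independent[OF V'(2)] V'(4) by metis
  \<comment> \<open>Both vertex sets consist of the extreme points of the same intersection, so they
    coincide.\<close>
  have "c = {v. v extreme_point_of (T \<inter> T')}"
    unfolding c(2) using extreme_point_of_convex_hull_affine_independent affine_independent_subset[OF V(2) c(1)] by blast
  moreover have "c' = {v. v extreme_point_of (T \<inter> T')}"
    unfolding c'(2) using extreme_point_of_convex_hull_affine_independent affine_independent_subset[OF V'(2) c'(1)] by blast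
  ultimately have cc: "c' = c" by simp
  have fin: "finite c" using c(1) V(1) finite_subset by blast
  have "x \<in> convex hull c" using x c(2) by blast
  then obtain \<nu> where \<nu>: "sum \<nu> c = 1" "(\<Sum>u\<in>c. \<nu> u *\<^sub>R u) = x"
    unfolding convex_hull_finite[OF fin] by blast
  define \<mu> where "\<mu> u = (if u \<in> c then \<nu> u else 0)" for u
  have \<mu>: "sum \<mu> c = 1" "(\<Sum>u\<in>c. \<mu> u *\<^sub>R u) = x" "\<And>u. u \<notin> c \<Longrightarrow> \<mu> u = 0"
    using \<nu> by (auto simp: \<mu>_def cong: sum.cong)
  show ?thesis
    using lagrange_expansion_face[OF T k c(1) \<mu>(1,3), of g]
      lagrange_expansion_face[OF T' k c'(1)[unfolded cc] \<mu>(1,3), of g] \<mu>(2) by simp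
qed

section \<open>The recovery operators\<close>

lemma V_space_subset_W_space:
  assumes sub: "\<And>K. K \<in> \<P> \<Longrightarrow> \<Union>(\<T> K) = K"
  shows "V_space \<P> k \<subseteq> W_space \<P> \<T> k"
proof
  fix v assume v: "v \<in> V_space \<P> k"
  have "continuous_on K (v K) \<and> (\<forall>T\<in>\<T> K. \<exists>p\<in>poly_space k. \<forall>x\<in>T. v K x = p x)" if K: "K \<in> \<P>" for K
  proof -
    obtain p where p: "p \<in> poly_space k" "\<forall>x\<in>K. v K x = p x" using v K by (auto simp: V_space_def)
    have "continuous_on K (v K)"
      using poly_space_continuous[OF p(1)] by (rule continuous_on_eq) (use p(2) in auto)
    then show ?thesis using p sub[OF K] by (metis UnionI)
  qed
  then show "v \<in> W_space \<P> \<T> k" using v by (auto simp: V_space_def W_space_def)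
qed

lemma V_space_comb:
  "u \<in> V_space \<P> k \<Longrightarrow> v \<in> V_space \<P> k \<Longrightarrow> (\<lambda>K x. a * u K x + b * v K x) \<in> V_space \<P> k"
  unfolding V_space_def mem_Collect_eq
proof (intro conjI ballI)
  assume u: "zero_outside \<P> u \<and> (\<forall>K\<in>\<P>. \<exists>p\<in>poly_space k. \<forall>x\<in>K. u K x = p x)"
    and v: "zero_outside \<P> v \<and> (\<forall>K\<in>\<P>. \<exists>p\<in>poly_space k. \<forall>x\<in>K. v K x = p x)"
  show "zero_outside \<P> (\<lambda>K x. a * u K x + b * v K x)"
    using u v by (simp add: zero_outside_def)
  fix K assume "K \<in> \<P>"
  then have "\<exists>p\<in>poly_space k. \<forall>x\<in>K. u K x = p x" "\<exists>p\<in>poly_space k. \<forall>x\<in>K. v K x = p x"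
    using u v by simp_all
  then obtain p q where "p \<in> poly_space k" "\<forall>x\<in>K. u K x = p x" "q \<in> poly_space k" "\<forall>x\<in>K. v K x = q x"
    by (elim bexE)
  then show "\<exists>p\<in>poly_space k. \<forall>x\<in>K. a * u K x + b * v K x = p x"
    by (intro bexI[of _ "\<lambda>x. a * p x + b * q x"] poly_space_add poly_space_cmult) auto
qed

text \<open>The coefficients may vary from element to element; \<open>equiv_weighted\<close>
  rescales by the weight of each element.\<close>

lemma W_space_comb:
  "u \<in> W_space \<P> \<T> k \<Longrightarrow> v \<in> W_space \<P> \<T> k \<Longrightarrow> (\<lambda>K x. a K * u K x + b K * v K x) \<in> W_space \<P> \<T> k"
  unfolding W_space_def mem_Collect_eq
proof (intro conjI ballI)
  assume u: "zero_outside \<P> u \<and> (\<forall>K\<in>\<P>. continuous_on K (u K) \<and> (\<forall>T\<in>\<T> K. \<exists>p\<in>poly_space k. \<forall>x\<in>T. u K x = p x))"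
    and v: "zero_outside \<P> v \<and> (\<forall>K\<in>\<P>. continuous_on K (v K) \<and> (\<forall>T\<in>\<T> K. \<exists>p\<in>poly_space k. \<forall>x\<in>T. v K x = p x))"
  show "zero_outside \<P> (\<lambda>K x. a K * u K x + b K * v K x)"
    using u v by (simp add: zero_outside_def)
  fix K assume K: "K \<in> \<P>"
  show "continuous_on K (\<lambda>x. a K * u K x + b K * v K x)"
    using u v K by (auto intro!: continuous_intros)
  fix T assume "T \<in> \<T> K"
  then have "\<exists>p\<in>poly_space k. \<forall>x\<in>T. u K x = p x" "\<exists>p\<in>poly_space k. \<forall>x\<in>T. v K x = p x"
    using u v K by simp_all
  then obtain p q where "p \<in> poly_space k" "\<forall>x\<in>T. u K x = p x" "q \<in> poly_space k" "\<forall>x\<in>T. v K x = q x"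
    by (elim bexE)
  then show "\<exists>p\<in>poly_space k. \<forall>x\<in>T. a K * u K x + b K * v K x = p x"
    by (intro bexI[of _ "\<lambda>x. a K * p x + b K * q x"] poly_space_add poly_space_cmult) auto
qed

lemma V_space_diff: "u \<in> V_space \<P> k \<Longrightarrow> v \<in> V_space \<P> k \<Longrightarrow> u - v \<in> V_space \<P> k"
  using V_space_comb[of u \<P> k v 1 "-1"] by (simp add: fun_diff_def)

lemma W_space_diff: "u \<in> W_space \<P> \<T> k \<Longrightarrow> v \<in> W_space \<P> \<T> k \<Longrightarrow> u - v \<in> W_space \<P> \<T> k"
  using W_space_comb[of u \<P> \<T> k v "\<lambda>_. 1" "\<lambda>_. -1"] by (simp add: fun_diff_def)

text \<open>The \<open>THE\<close> in \<open>E_plus\<close> is well posed: the local expansions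
  agree on common faces of the simplices of an element, they cover the element, and
  \<open>zero_outside\<close> fixes all other values. The nodal values follow from the duality of
  nodes and basis.\<close>

lemma E_plus_properties:
  fixes \<T> :: "(real^'n) set \<Rightarrow> (real^'n) set set"
  assumes sub: "\<And>K. K \<in> \<P> \<Longrightarrow> triangulation (\<T> K) \<and> (\<forall>T\<in>\<T> K. int CARD('n) simplex T) \<and> \<Union>(\<T> K) = K"
    and k: "k \<ge> 1"
  shows "E_plus \<P> \<T> k \<kappa> v \<in> W_space \<P> \<T> k"
    and "K \<in> \<P> \<Longrightarrow> T \<in> \<T> K \<Longrightarrow> z \<in> lagrange_nodes k T \<Longrightarrow> E_plus \<P> \<T> k \<kappa> v K z = max 0 (min (v K z) \<kappa>)"
proof -
  define S where "S K T x = (\<Sum>z\<in>lagrange_nodes k T. max 0 (min (v K z) \<kappa>) * lagrange_basis k T z x)" for K T x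
  define Q where "Q w \<longleftrightarrow> w \<in> W_space \<P> \<T> k \<and> (\<forall>K\<in>\<P>. \<forall>T\<in>\<T> K. \<forall>x\<in>T. w K x = S K T x)" for w
  have conf: "S K T x = S K T' x" if "K \<in> \<P>" "T \<in> \<T> K" "T' \<in> \<T> K" "x \<in> T" "x \<in> T'" for K T T' x
  proof -
    have "(T \<inter> T') face_of T" "(T \<inter> T') face_of T'"
      using sub[OF that(1)] that(2,3) unfolding triangulation_def by (auto, metis Int_commute)
    then show ?thesis
      unfolding S_def using that sub[OF that(1)] k by (intro lagrange_expansion_conforming) auto
  qed
  have Spoly: "S K T \<in> poly_space k" if "K \<in> \<P>" "T \<in> \<T> K" for K T
    unfolding S_def[abs_def]
    by (intro poly_space_sum poly_space_cmult lagrange_nodes_simplex(3)) (use that sub[OF that(1)] k in auto)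
  \<comment> \<open>Any simplex containing x may be chosen; \<open>conf\<close> makes the value
    independent of it.\<close>
  define w where "w K x = (if K \<in> \<P> \<and> x \<in> K then S K (SOME T. T \<in> \<T> K \<and> x \<in> T) x else 0)" for K x
  have w: "w K x = S K T x" if "K \<in> \<P>" "T \<in> \<T> K" "x \<in> T" for K T x
  proof -
    define T' where "T' = (SOME T. T \<in> \<T> K \<and> x \<in> T)"
    have T': "T' \<in> \<T> K \<and> x \<in> T'"
      unfolding T'_def by (rule someI[of _ T]) (use that in auto)
    have "x \<in> K" using that sub[OF that(1)] by blast
    then have "w K x = S K T' x" using that(1) by (simp add: w_def T'_def)
    also have "\<dots> = S K T x" by (rule conf) (use that T' in auto)
    finally show ?thesis .
  qed
  have "w \<in> W_space \<P> \<T> k"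
    unfolding W_space_def mem_Collect_eq
  proof (intro conjI ballI)
    show "zero_outside \<P> w" by (auto simp: zero_outside_def w_def)
    fix K assume K: "K \<in> \<P>"
    have "continuous_on (\<Union>T\<in>\<T> K. T) (w K)"
    proof (rule continuous_on_closed_Union)
      show "finite (\<T> K)" using sub[OF K] by (simp add: triangulation_def)
      show "closed T" if "T \<in> \<T> K" for T using sub[OF K] that closed_simplex by blast
      show "continuous_on T (w K)" if T: "T \<in> \<T> K" for T
        using poly_space_continuous[OF Spoly[OF K T]] by (rule continuous_on_eq) (use w[OF K T] in auto)
    qed
    then show "continuous_on K (w K)" using sub[OF K] by simp
    fix T assume T: "T \<in> \<T> K"
    show "\<exists>p\<in>poly_space k. \<forall>x\<in>T. w K x = p x"
      by (rule bexI[OF _ Spoly[OF K T]]) (use w[OF K T] in auto)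
  qed
  then have "Q w" using w by (auto simp: Q_def)
  moreover have "w1 = w2" if "Q w1" "Q w2" for w1 w2
  proof (intro ext)
    fix K x
    show "w1 K x = w2 K x"
    proof (cases "K \<in> \<P> \<and> x \<in> K")
      case True
      then obtain T where "T \<in> \<T> K" "x \<in> T" using sub by blast
      then show ?thesis using that True by (auto simp: Q_def)
    next
      case False
      then show ?thesis using that by (auto simp: Q_def W_space_def zero_outside_def)
    qed
  qed
  ultimately have "Q (THE w. Q w)" by (intro theI[of Q]) auto
  moreover have "E_plus \<P> \<T> k \<kappa> v = (THE w. Q w)"
    by (simp add: E_plus_def Q_def S_def)
  ultimately have QE: "Q (E_plus \<P> \<T> k \<kappa> v)" by simp
  then show "E_plus \<P> \<T> k \<kappa> v \<in> W_space \<P> \<T> k" by (simp add: Q_def)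
  show "E_plus \<P> \<T> k \<kappa> v K z = max 0 (min (v K z) \<kappa>)"
    if "K \<in> \<P>" "T \<in> \<T> K" "z \<in> lagrange_nodes k T"
  proof -
    have T: "int CARD('n) simplex T" using sub[OF that(1)] that(2) by blast
    have "z \<in> T" using lagrange_nodes_simplex(2)[OF T k] that by blast
    then have "E_plus \<P> \<T> k \<kappa> v K z = S K T z" using QE that by (auto simp: Q_def)
    also have "\<dots> = (\<Sum>z'\<in>lagrange_nodes k T. if z' = z then max 0 (min (v K z') \<kappa>) else 0)"
      unfolding S_def by (rule sum.cong) (use lagrange_simplex(3)[OF T k _ that(3)] in auto)
    also have "\<dots> = max 0 (min (v K z) \<kappa>)"
      using that lagrange_nodes_simplex(1)[OF T k] by simp
    finally show ?thesis .
  qed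
qed

text \<open>For nonnegative \<kappa> both the clip and its remainder are nondecreasing, so their
  increments have equal signs; for negative \<kappa> the clip is constantly 0.\<close>

lemma clip_product_nonneg:
  fixes x y \<kappa> :: real
  defines "c \<equiv> \<lambda>x. max 0 (min x \<kappa>)"
  shows "0 \<le> (c x - c y) * ((x - c x) - (y - c y))"
proof -
  have mono: "c x \<le> c y \<and> x - c x \<le> y - c y" if "x \<le> y" "0 \<le> \<kappa>" for x y
    using that by (auto simp: c_def max_def min_def)
  have const: "c x = 0" if "\<kappa> < 0" for x using that by (auto simp: c_def max_def min_def)
  show ?thesis
  proof (cases "\<kappa> < 0")
    case True then show ?thesis by (simp add: const)
  next
    case False
    show ?thesis
    proof (cases "x \<le> y")
      case True
      then show ?thesis using mono[OF True] False by (intro mult_nonpos_nonpos) auto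
    next
      case 2: False
      then show ?thesis using mono[of y x] False by (intro mult_nonneg_nonneg) auto
    qed
  qed
qed

section \<open>Flat faces of star-shaped elements and of simplices\<close>

text \<open>That the affine hull is the entire hyperplane expresses full dimension inside it. The
  sign of n is left open and is chosen later relative to an element.\<close>

definition flat_face :: "'a::euclidean_space set \<Rightarrow> 'a \<Rightarrow> real \<Rightarrow> bool" where
  "flat_face F n b \<longleftrightarrow> compact F \<and> convex F \<and> F \<noteq> {} \<and> norm n = 1 \<and> affine hull F = {x. n \<bullet> x = b}"

text \<open>The witness form of \<open>star_shaped_wrt_ball\<close>: the centre is exposed because
  it becomes the apex of the cones over the faces.\<close>

definition star_center :: "'a::euclidean_space set \<Rightarrow> 'a \<Rightarrow> real \<Rightarrow> bool" where
  "star_center K c \<rho> \<longleftrightarrow> \<rho> > 0 \<and> ball c \<rho> \<subseteq> K \<and> (\<forall>x\<in>K. \<forall>y\<in>ball c \<rho>. closed_segment x y \<subseteq> K)"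

lemma flat_face_exists:
  fixes F :: "'a::euclidean_space set"
  assumes "polytope F" "aff_dim F = int DIM('a) - 1" "DIM('a) \<ge> 2"
  obtains n b where "flat_face F n b"
proof -
  have ne: "F \<noteq> {}" using assms(2,3) by auto
  have "aff_dim F = DIM('a) - 1" using assms(2,3) by simp
  then obtain a b where ab: "a \<noteq> 0" "affine hull F = {x. a \<bullet> x = b}"
    using aff_dim_eq_hyperplane by blast
  have "flat_face F (a /\<^sub>R norm a) (b / norm a)"
    using assms ab ne by (auto simp: flat_face_def polytope_imp_compact polytope_imp_convex field_simps)
  then show ?thesis using that by blast
qed

lemma flat_face_uminus: "flat_face F n b \<Longrightarrow> flat_face F (- n) (- b)"
  by (auto simp: flat_face_def)

lemma flat_face_in: "flat_face F n b \<Longrightarrow> x \<in> F \<Longrightarrow> n \<bullet> x = b"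
  unfolding flat_face_def using hull_inc by fastforce

lemma flat_face_nn: "flat_face F n b \<Longrightarrow> n \<bullet> n = 1"
  by (simp add: flat_face_def dot_square_norm)

lemma flat_face_rel_interior:
  assumes "flat_face F n b" "x \<in> rel_interior F"
  obtains \<epsilon> where "\<epsilon> > 0" "\<And>y. n \<bullet> y = b \<Longrightarrow> dist x y < \<epsilon> \<Longrightarrow> y \<in> F"
  using assms unfolding mem_rel_interior_ball flat_face_def by (auto simp: subset_iff)

lemma flat_face_rel_interior_nonempty: "flat_face F n b \<Longrightarrow> rel_interior F \<noteq> {}"
  by (simp add: flat_face_def rel_interior_eq_empty)

lemma flat_face_frontier: "flat_face F n b \<Longrightarrow> closed F" by (simp add: flat_face_def compact_imp_closed)

text \<open>The segments from y to the ball sweep out a homothetic copy of the ball, of radius s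
  \<rho>, which surrounds the point.\<close>

lemma star_center_interior:
  assumes "star_center K c \<rho>" "y \<in> K" "b \<in> ball c \<rho>" "0 < s" "s \<le> 1"
  shows "(1 - s) *\<^sub>R y + s *\<^sub>R b \<in> interior K"
proof (rule interiorI)
  let ?U = "ball ((1 - s) *\<^sub>R y + s *\<^sub>R c) (s * \<rho>)"
  show "open ?U" by simp
  have "dist ((1 - s) *\<^sub>R y + s *\<^sub>R c) ((1 - s) *\<^sub>R y + s *\<^sub>R b) = s * dist c b"
  proof -
    have "((1 - s) *\<^sub>R y + s *\<^sub>R c) - ((1 - s) *\<^sub>R y + s *\<^sub>R b) = s *\<^sub>R (c - b)"
      by (simp add: scaleR_diff_right)
    then show ?thesis using assms(4) by (simp only: dist_norm norm_scaleR abs_of_pos)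
  qed
  then show "(1 - s) *\<^sub>R y + s *\<^sub>R b \<in> ?U" using assms by simp
  show "?U \<subseteq> K"
  proof
    fix z assume z: "z \<in> ?U"
    define b' where "b' = c + (1 / s) *\<^sub>R (z - ((1 - s) *\<^sub>R y + s *\<^sub>R c))"
    have "norm ((1 / s) *\<^sub>R (z - ((1 - s) *\<^sub>R y + s *\<^sub>R c))) < \<rho>"
      using z assms(4) by (simp add: dist_norm norm_minus_commute divide_less_eq mult.commute)
    then have b': "b' \<in> ball c \<rho>" by (simp add: b'_def dist_norm norm_minus_commute)
    have "z = (1 - s) *\<^sub>R y + s *\<^sub>R b'"
      using assms(4) by (simp add: b'_def algebra_simps)
    then have "z \<in> closed_segment y b'" using assms(4,5) unfolding in_segment by (intro exI[of _ s]) auto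
    then show "z \<in> K" using assms(1,2) b' unfolding star_center_def by blast
  qed
qed

lemma small_multiple:
  fixes e :: real
  assumes "e > 0"
  obtains s where "s > 0" "s * norm v < e"
proof (rule that[of "e / (norm v + 1)"])
  have np: "norm v + 1 > 0" by (simp add: add_nonneg_pos)
  then show "e / (norm v + 1) > 0" using assms by simp
  have "e * norm v < e * (norm v + 1)" using assms by simp
  then show "e / (norm v + 1) * norm v < e" using np by (simp add: pos_divide_less_eq)
qed

text \<open>If the ball reached the hyperplane of F, a relative interior point x of F would lie
  strictly between a point of F and a point of the ball, hence in the interior of K. So the cone
  over F with apex c has height at least \<rho>, which is where \<rho> enters the trace
  inequality.\<close>

lemma star_center_height:
  assumes K: "star_center K c \<rho>" and F: "flat_face F n b" "F \<subseteq> frontier K" "F \<subseteq> K"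
  shows "\<bar>n \<bullet> c - b\<bar> \<ge> \<rho>"
proof (rule ccontr)
  assume "\<not> ?thesis"
  then have lt: "\<bar>n \<bullet> c - b\<bar> < \<rho>" by simp
  note nn = flat_face_nn[OF F(1)]
  have norm: "norm n = 1" using F(1) by (simp add: flat_face_def)
  define b0 where "b0 = c - (n \<bullet> c - b) *\<^sub>R n"
  have b0: "b0 \<in> ball c \<rho>" "n \<bullet> b0 = b"
    using lt nn norm by (auto simp: b0_def dist_norm inner_diff_right)
  obtain x where x: "x \<in> rel_interior F" using flat_face_rel_interior_nonempty[OF F(1)] by blast
  then have xF: "x \<in> F" using rel_interior_subset by blast
  obtain \<epsilon> where e: "\<epsilon> > 0" "\<And>y. n \<bullet> y = b \<Longrightarrow> dist x y < \<epsilon> \<Longrightarrow> y \<in> F"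
    using flat_face_rel_interior[OF F(1) x] by blast
  obtain \<tau> where tau: "\<tau> > 0" "\<tau> * norm (x - b0) < \<epsilon>"
    using small_multiple[OF e(1)] by blast
  define x' where "x' = x + \<tau> *\<^sub>R (x - b0)"
  have "n \<bullet> x' = b" using flat_face_in[OF F(1) xF] b0 by (simp add: x'_def inner_simps)
  moreover have "dist x x' < \<epsilon>" using tau by (simp add: x'_def dist_norm)
  ultimately have "x' \<in> K" using e(2) F(3) by blast
  define s where "s = \<tau> / (1 + \<tau>)"
  have s: "0 < s" "s \<le> 1" using tau by (auto simp: s_def)
  have "(1 - s) *\<^sub>R x' + s *\<^sub>R b0 = x"
  proof -
    have "1 - s = 1 / (1 + \<tau>)" using tau by (simp add: s_def field_simps)
    then have "(1 - s) *\<^sub>R x' + s *\<^sub>R b0 = (1 / (1 + \<tau>)) *\<^sub>R (x' + \<tau> *\<^sub>R b0)"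
      by (simp add: s_def scaleR_add_right)
    also have "x' + \<tau> *\<^sub>R b0 = (1 + \<tau>) *\<^sub>R x" by (simp add: x'_def algebra_simps)
    finally show ?thesis using tau by simp
  qed
  then have "x \<in> interior K" using star_center_interior[OF K \<open>x' \<in> K\<close> b0(1) s] by simp
  then show False using xF F(2) by (auto simp: frontier_def)
qed

text \<open>Central projection \<open>g\<close> from c onto the hyperplane maps a neighbourhood of x
  into F. A point not above the hyperplane lies on the segment from its image to c, hence in K; a
  point of K above it would put its image into the interior of K, although F lies in the
  frontier.\<close>

lemma star_center_local:
  assumes K: "star_center K c \<rho>" and F: "flat_face F n b" "F \<subseteq> frontier K" "F \<subseteq> K" "n \<bullet> c < b"
    and x: "x \<in> rel_interior F"
  obtains \<delta> where "\<delta> > 0" "\<And>z. dist x z < \<delta> \<Longrightarrow> z \<in> K \<longleftrightarrow> n \<bullet> z \<le> b"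
proof -
  note nn = flat_face_nn[OF F(1)]
  have norm: "norm n = 1" using F(1) by (simp add: flat_face_def)
  have cb: "c \<in> ball c \<rho>" "c \<in> K" using K by (auto simp: star_center_def)
  define h where "h = b - n \<bullet> c"
  have h: "h > 0" using F(4) by (simp add: h_def)
  have nx: "n \<bullet> x = b" using x rel_interior_subset flat_face_in[OF F(1)] by blast
  obtain \<epsilon> where e: "\<epsilon> > 0" "\<And>y. n \<bullet> y = b \<Longrightarrow> dist x y < \<epsilon> \<Longrightarrow> y \<in> F"
    using flat_face_rel_interior[OF F(1) x] by blast
  define g where "g z = c + (h / (n \<bullet> z - n \<bullet> c)) *\<^sub>R (z - c)" for z
  have "isCont g x" unfolding g_def[abs_def]
    by (intro continuous_intros) (use h nx in \<open>auto simp: h_def\<close>)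
  moreover have gx: "g x = x" using h nx by (simp add: g_def h_def)
  ultimately obtain d1 where d1: "d1 > 0" "\<And>z. dist z x < d1 \<Longrightarrow> dist (g z) x < \<epsilon>"
    using e(1) unfolding continuous_at_eps_delta by metis
  show ?thesis
  proof (rule that[of "min d1 h"])
    show "min d1 h > 0" using d1 h by simp
    fix z assume z: "dist x z < min d1 h"
    define m where "m = n \<bullet> z - n \<bullet> c"
    have "\<bar>n \<bullet> (z - x)\<bar> \<le> norm (z - x)" using Cauchy_Schwarz_ineq2[of n "z - x"] norm by simp
    then have "\<bar>n \<bullet> z - b\<bar> < b - n \<bullet> c"
      using z nx by (simp add: h_def inner_diff_right dist_norm norm_minus_commute)
    then have m: "m > 0" unfolding m_def by linarith
    have "n \<bullet> g z = n \<bullet> c + (h / m) * m" by (simp add: g_def m_def inner_simps)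
    then have "n \<bullet> g z = b" using m by (simp add: h_def)
    moreover have "dist x (g z) < \<epsilon>" using d1(2)[of z] z by (simp add: dist_commute)
    ultimately have gF: "g z \<in> F" using e(2) by blast
    have ge: "g z - c = (h / m) *\<^sub>R (z - c)" by (simp add: g_def m_def)
    show "z \<in> K \<longleftrightarrow> n \<bullet> z \<le> b"
    proof
      assume "n \<bullet> z \<le> b"
      then have mh: "m \<le> h" by (simp add: m_def h_def)
      have "(m / h) *\<^sub>R (g z - c) = z - c" using h m by (simp add: ge)
      then have "z = c + (m / h) *\<^sub>R (g z - c)" by simp
      then have "z = (1 - (1 - m / h)) *\<^sub>R g z + (1 - m / h) *\<^sub>R c" by (simp add: algebra_simps)
      then have "z \<in> closed_segment (g z) c" using mh m h unfolding in_segment by (intro exI[of _ "1 - m / h"]) auto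
      moreover have "closed_segment (g z) c \<subseteq> K"
        using K gF F(3) cb(1) unfolding star_center_def by blast
      ultimately show "z \<in> K" by blast
    next
      assume zK: "z \<in> K"
      show "n \<bullet> z \<le> b"
      proof (rule ccontr)
        assume "\<not> n \<bullet> z \<le> b"
        then have mh: "m > h" by (simp add: m_def h_def)
        have "g z = (1 - (1 - h / m)) *\<^sub>R z + (1 - h / m) *\<^sub>R c" using ge by (simp add: algebra_simps)
        moreover have "0 < 1 - h / m" "1 - h / m \<le> 1" using mh m h by auto
        ultimately have "g z \<in> interior K" using star_center_interior[OF K zK cb(1)] by metis
        then show False using gF F(2) by (auto simp: frontier_def)
      qed
    qed
  qed
qed

lemma flat_face_small_step:
  assumes "flat_face F n b" "x \<in> F" "\<delta> > 0"
  shows "\<exists>t>0. dist x (x - t *\<^sub>R n) < \<delta> \<and> n \<bullet> (x - t *\<^sub>R n) < b \<and> dist x (x + t *\<^sub>R n) < \<delta> \<and> n \<bullet> (x + t *\<^sub>R n) > b"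
  using flat_face_nn[OF assms(1)] flat_face_in[OF assms(1,2)] assms
  by (intro exI[of _ "\<delta> / 2"]) (auto simp: dist_norm inner_simps flat_face_def)

lemma flat_face_same_hyperplane:
  assumes F: "flat_face F n b" and F': "flat_face F' n' b'" and eq: "affine hull F = affine hull F'"
  shows "n' = n \<and> b' = b \<or> n' = - n \<and> b' = - b"
proof -
  note nn = flat_face_nn[OF F] and nn' = flat_face_nn[OF F']
  have H: "{x. n \<bullet> x = b} = {x. n' \<bullet> x = b'}" using assms by (simp add: flat_face_def)
  obtain x where x: "x \<in> F" using F by (auto simp: flat_face_def)
  have nx: "n \<bullet> x = b" using flat_face_in[OF F x] .
  then have nx': "n' \<bullet> x = b'" using H by blast
  define v where "v = n' - (n' \<bullet> n) *\<^sub>R n"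
  have "n \<bullet> v = 0" using nn by (simp add: v_def inner_simps inner_commute)
  then have "n \<bullet> (x + v) = b" using nx by (simp add: inner_add_right)
  then have "n' \<bullet> (x + v) = b'" using H by blast
  then have "n' \<bullet> v = 0" using nx' by (simp add: inner_add_right)
  then have "v \<bullet> v = 0" using \<open>n \<bullet> v = 0\<close> by (simp add: v_def inner_diff_left)
  then have n': "n' = (n' \<bullet> n) *\<^sub>R n" by (simp add: v_def)
  then have "(n' \<bullet> n) * (n' \<bullet> n) = 1" using nn nn' by (metis inner_scaleR_left inner_scaleR_right mult.right_neutral)
  then have "n' \<bullet> n = 1 \<or> n' \<bullet> n = -1" by (simp add: square_eq_1_iff)
  then have "n' = n \<or> n' = - n" using n' by (metis scaleR_one scaleR_minus1_left)
  then show ?thesis using nx nx' by auto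
qed

text \<open>Resolves the \<open>THE\<close>: orthogonality to F leaves only n and its negative, and
  the half-ball description of K at a relative interior point decides the sign.\<close>

lemma outward_normal_eq:
  fixes K :: "(real^'n) set"
  assumes K: "star_center K c \<rho>" and F: "flat_face F n b" "F \<subseteq> frontier K" "F \<subseteq> K" "n \<bullet> c < b"
  shows "outward_normal K F = n"
  unfolding outward_normal_def
proof (rule the_equality)
  note nn = flat_face_nn[OF F(1)]
  have loc: "\<forall>\<^sub>F t in at_right 0. x - t *\<^sub>R n \<in> K \<and> x + t *\<^sub>R n \<notin> K" if x: "x \<in> rel_interior F" for x
  proof -
    obtain \<delta> where d: "\<delta> > 0" "\<And>z. dist x z < \<delta> \<Longrightarrow> z \<in> K \<longleftrightarrow> n \<bullet> z \<le> b"
      using star_center_local[OF K F x] by blast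
    have nx: "n \<bullet> x = b" using x rel_interior_subset flat_face_in[OF F(1)] by blast
    have "\<forall>\<^sub>F t in at_right 0. t \<in> {0<..<\<delta>}" using d(1) by (rule eventually_at_right_real)
    then show ?thesis
    proof eventually_elim
      case (elim t)
      have "norm n = 1" using F(1) by (simp add: flat_face_def)
      then show ?case using d(2)[of "x - t *\<^sub>R n"] d(2)[of "x + t *\<^sub>R n"] elim nx nn
        by (simp add: dist_norm inner_simps)
    qed
  qed
  then show "norm n = 1 \<and> (\<forall>x\<in>F. \<forall>y\<in>F. n \<bullet> (x - y) = 0) \<and>
     (\<forall>x\<in>rel_interior F. \<forall>\<^sub>F t in at_right 0. x - t *\<^sub>R n \<in> K \<and> x + t *\<^sub>R n \<notin> K)"
    using F(1) flat_face_in[OF F(1)] by (auto simp: flat_face_def inner_diff_right)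
  fix n' assume n': "norm n' = 1 \<and> (\<forall>x\<in>F. \<forall>y\<in>F. n' \<bullet> (x - y) = 0) \<and>
     (\<forall>x\<in>rel_interior F. \<forall>\<^sub>F t in at_right 0. x - t *\<^sub>R n' \<in> K \<and> x + t *\<^sub>R n' \<notin> K)"
  obtain x where x: "x \<in> rel_interior F" using flat_face_rel_interior_nonempty[OF F(1)] by blast
  then have xF: "x \<in> F" using rel_interior_subset by blast
  have nx: "n \<bullet> x = b" using flat_face_in[OF F(1) xF] .
  obtain \<epsilon> where e: "\<epsilon> > 0" "\<And>y. n \<bullet> y = b \<Longrightarrow> dist x y < \<epsilon> \<Longrightarrow> y \<in> F"
    using flat_face_rel_interior[OF F(1) x] by blast
  define v where "v = n' - (n' \<bullet> n) *\<^sub>R n"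
  have nv: "n \<bullet> v = 0" using nn by (simp add: v_def inner_simps inner_commute)
  obtain s where s: "s > 0" "s * norm v < \<epsilon>"
    using small_multiple[OF e(1)] by blast
  then have "dist x (x + s *\<^sub>R v) < \<epsilon>" by (simp add: dist_norm)
  then have "x + s *\<^sub>R v \<in> F" using e(2)[of "x + s *\<^sub>R v"] nx nv by (simp add: inner_simps)
  then have "n' \<bullet> ((x + s *\<^sub>R v) - x) = 0" using n' xF by blast
  then have "n' \<bullet> v = 0" using s by simp
  then have "v \<bullet> v = 0" using nv by (simp add: v_def inner_diff_left)
  then have n'n: "n' = (n' \<bullet> n) *\<^sub>R n" by (simp add: v_def)
  have "n' \<bullet> n' = 1" using n' by (simp add: dot_square_norm)
  then have "(n' \<bullet> n) * (n' \<bullet> n) = 1" using n'n nn by (metis inner_scaleR_left inner_scaleR_right mult.right_neutral)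
  then have "n' \<bullet> n = 1 \<or> n' \<bullet> n = -1" by (simp add: square_eq_1_iff)
  then have "n' = n \<or> n' = - n" using n'n by (metis scaleR_one scaleR_minus1_left)
  moreover have "n' \<noteq> - n"
  proof
    assume "n' = - n"
    then have "\<forall>\<^sub>F t in at_right 0. x + t *\<^sub>R n \<in> K \<and> x - t *\<^sub>R n \<notin> K" using n' x by auto
    then have "\<forall>\<^sub>F t in at_right (0::real). False" using loc[OF x] by eventually_elim auto
    then show False by (simp add: eventually_const_iff)
  qed
  ultimately show "n' = n" by blast
qed

section \<open>Facets of simplices and boundary facets of a triangulation\<close>

lemma convex_star_center:
  assumes "convex T" "interior T \<noteq> {}"
  obtains c \<rho> where "star_center T c \<rho>"
proof -
  obtain c \<rho> where "\<rho> > 0" "ball c \<rho> \<subseteq> T"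
    using assms(2) mem_interior by blast
  then have "star_center T c \<rho>"
    using closed_segment_subset[OF _ _ assms(1)] unfolding star_center_def by blast
  then show ?thesis using that by blast
qed

lemma simplex_interior_nonempty:
  fixes T :: "(real^'n) set"
  assumes "int CARD('n) simplex T"
  shows "interior T \<noteq> {}"
  using aff_dim_simplex[OF assms] convex_simplex[OF assms]
  by (metis DIM_cart DIM_real mult.right_neutral low_dim_interior order_less_irrefl aff_dim_eq_full
      interior_rel_interior rel_interior_eq_empty aff_dim_empty_eq of_nat_0_le_iff zle_iff_zadd aff_dim_empty neg_0_le_iff_le not_one_le_zero)

text \<open>A facet omits exactly one vertex, and the simplex is the cone over the facet with that
  vertex as apex. A ball inside the simplex serves to orient the normal.\<close>

lemma simplex_facet:
  fixes T :: "(real^'n) set"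
  assumes T: "int CARD('n) simplex T" and d: "CARD('n) \<ge> 2" and f: "f facet_of T"
  obtains n b v where "flat_face f n b" "\<forall>z\<in>T. n \<bullet> z \<le> b" "v \<in> T" "n \<bullet> v < b"
    "\<forall>z\<in>T. \<exists>y\<in>f. \<exists>t\<in>{0..1}. z = v + t *\<^sub>R (y - v)" "f \<subseteq> frontier T"
proof -
  note conv = convex_simplex[OF T] and dimT = aff_dim_simplex[OF T]
  obtain C where C: "finite C" "\<not> affine_dependent C" "int (card C) = int CARD('n) + 1" "T = convex hull C"
    using T unfolding simplex by blast
  have ff: "f face_of T" "f \<noteq> {}" "aff_dim f = int CARD('n) - 1"
    using f dimT by (auto simp: facet_of_def)
  obtain c where c: "c \<subseteq> C" "f = convex hull c"
    using ff(1) face_of_convex_hull_affine_independent[OF C(2)] C(4) by metis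
  have fc: "finite c" "\<not> affine_dependent c" using c(1) C(1,2) finite_subset affine_independent_subset by blast+
  have "aff_dim c = int (card c) - 1" using fc affine_independent_iff_card by blast
  then have "int (card c) = int CARD('n)" using ff(3) c(2) by (simp add: aff_dim_convex_hull)
  then have "card (C - c) = 1" using C c fc by (simp add: card_Diff_subset)
  then obtain v where v: "C - c = {v}" using card_1_singletonE by blast
  then have Cv: "C = insert v c" using c(1) by blast
  have cne: "c \<noteq> {}" using ff(2) c(2) by auto
  have polyf: "polytope f" using c fc unfolding polytope_def by blast
  obtain n0 b0 where F0: "flat_face f n0 b0"
    using flat_face_exists[OF polyf] ff(3) d by auto
  have int: "interior T \<noteq> {}" by (rule simplex_interior_nonempty[OF T])
  have fT: "f \<subseteq> T" using ff(1) by (rule face_of_imp_subset)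
  have "f \<noteq> T" using ff(3) dimT by auto
  then have fr: "f \<subseteq> frontier T"
    using face_of_disjoint_interior[OF ff(1)] fT closure_subset by (fastforce simp: frontier_def)
  obtain a \<rho> where star: "star_center T a \<rho>" using convex_star_center[OF conv int] by blast
  have "\<bar>n0 \<bullet> a - b0\<bar> \<ge> \<rho>" using star_center_height[OF star F0 fr fT] .
  then have "n0 \<bullet> a \<noteq> b0" using star by (auto simp: star_center_def)
  then obtain n b where F: "flat_face f n b" and nb: "n \<bullet> a < b"
    using F0 flat_face_uminus[OF F0] by (cases "n0 \<bullet> a < b0") (auto simp: not_less_iff_gr_or_eq)
  obtain x where x: "x \<in> rel_interior f" using flat_face_rel_interior_nonempty[OF F] by blast
  then have xf: "x \<in> f" using rel_interior_subset by blast
  then have nx: "n \<bullet> x = b" and xT: "x \<in> T" using flat_face_in[OF F] fT by auto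
  obtain \<delta> where \<delta>: "\<delta> > 0" "\<And>z. dist x z < \<delta> \<Longrightarrow> z \<in> T \<longleftrightarrow> n \<bullet> z \<le> b"
    using star_center_local[OF star F fr fT nb x] by blast
  \<comment> \<open>Near x the simplex is a half-ball. A point of T above the hyperplane would, by
    convexity, pull points of T arbitrarily close to x above it.\<close>
  have le: "\<forall>z\<in>T. n \<bullet> z \<le> b"
  proof (rule ballI, rule ccontr)
    fix z assume z: "z \<in> T" and gt: "\<not> n \<bullet> z \<le> b"
    obtain s0 where s0: "s0 > 0" "s0 * norm (z - x) < \<delta>" using small_multiple[OF \<delta>(1)] by blast
    define s where "s = min s0 1"
    have s: "0 < s" "s \<le> 1" using s0 by (auto simp: s_def)
    have "s * norm (z - x) \<le> s0 * norm (z - x)" by (intro mult_right_mono) (auto simp: s_def)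
    then have "dist x (x + s *\<^sub>R (z - x)) < \<delta>" using s s0 by (simp add: dist_norm)
    moreover have "x + s *\<^sub>R (z - x) \<in> T"
      using convexD_alt[OF conv xT z, of s] s by (simp add: algebra_simps)
    ultimately have "n \<bullet> (x + s *\<^sub>R (z - x)) \<le> b" using \<delta>(2) by blast
    then have "s * (n \<bullet> z - b) \<le> 0" using nx by (simp add: inner_simps)
    then show False using gt s by (simp add: mult_le_0_iff)
  qed
  have vT: "v \<in> T" using Cv C(4) by (simp add: hull_inc)
  have "n \<bullet> v \<noteq> b"
  proof
    assume "n \<bullet> v = b"
    then have "v \<in> affine hull f" using F by (simp add: flat_face_def)
    then have "v \<in> affine hull c" by (simp add: c(2) affine_hull_convex_hull)
    then have "affine hull C = affine hull c" by (simp add: Cv hull_redundant)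
    then have "aff_dim C = aff_dim c" by (metis aff_dim_affine_hull)
    then show False using ff(3) dimT c(2) C(4) by (simp add: aff_dim_convex_hull)
  qed
  then have nv: "n \<bullet> v < b" using le vT by fastforce
  have ex: "\<forall>z\<in>T. \<exists>y\<in>f. \<exists>t\<in>{0..1}. z = v + t *\<^sub>R (y - v)"
  proof
    fix z assume "z \<in> T"
    then have "z \<in> convex hull (insert v c)" using C(4) Cv by simp
    then obtain u y where u: "0 \<le> u" "u \<le> 1" "y \<in> f" "z = (1 - u) *\<^sub>R v + u *\<^sub>R y"
      using cne c(2) unfolding convex_hull_insert_alt by auto
    then show "\<exists>y\<in>f. \<exists>t\<in>{0..1}. z = v + t *\<^sub>R (y - v)"
      by (intro bexI[of _ y] bexI[of _ u]) (auto simp: algebra_simps)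
  qed
  show ?thesis by (rule that[OF F le vT nv ex fr])
qed

lemma simplex_facet_flat:
  fixes T :: "(real^'n) set"
  assumes T: "int CARD('n) simplex T" and d: "CARD('n) \<ge> 2" and f: "f facet_of T"
  obtains n b where "flat_face f n b" "\<forall>z\<in>T. n \<bullet> z \<le> b" "f \<subseteq> frontier T"
proof -
  show ?thesis by (rule simplex_facet[OF assms], rule that)
qed

lemma simplex_facet_local:
  fixes T :: "(real^'n) set"
  assumes T: "int CARD('n) simplex T" and d: "CARD('n) \<ge> 2" and f: "f facet_of T" and x: "x \<in> rel_interior f"
    and F: "flat_face f n b" and le: "\<forall>z\<in>T. n \<bullet> z \<le> b"
  obtains \<delta> where "\<delta> > 0" "\<And>z. dist x z < \<delta> \<Longrightarrow> z \<in> T \<longleftrightarrow> n \<bullet> z \<le> b"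
proof -
  have int: "interior T \<noteq> {}" by (rule simplex_interior_nonempty[OF T])
  obtain a \<rho> where star: "star_center T a \<rho>" using convex_star_center[OF convex_simplex[OF T] int] by blast
  have fr: "f \<subseteq> frontier T" by (rule simplex_facet_flat[OF T d f])
  have fT: "f \<subseteq> T" using f by (rule facet_of_imp_subset)
  have "\<bar>n \<bullet> a - b\<bar> \<ge> \<rho>" using star_center_height[OF star F fr fT] .
  moreover have "\<rho> > 0" "a \<in> T" using star by (auto simp: star_center_def)
  ultimately have "n \<bullet> a < b" using le by fastforce
  from star_center_local[OF star F fr fT this x] show ?thesis using that by blast
qed

lemma frontier_simplex_facet:
  fixes T :: "(real^'n) set"
  assumes T: "int CARD('n) simplex T" and x: "x \<in> T" "x \<notin> interior T"
  obtains f where "f facet_of T" "x \<in> f"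
proof -
  have "affine hull T = UNIV"
    using aff_dim_simplex[OF T] aff_dim_eq_full[of T] by simp
  then have "rel_frontier T = frontier T" by (rule rel_frontier_frontier)
  then have "x \<in> rel_frontier T" using x closure_subset by (auto simp: frontier_def)
  then show ?thesis
    using rel_frontier_of_polyhedron[OF simplex_imp_polyhedron[OF T]] that by blast
qed

text \<open>The exceptional sets are the faces of simplices of dimension below d - 1 and the parts
  of F inside facets from other hyperplanes. A point of F off these sets lies in the relative
  interior of a facet coplanar with F and belongs to no second simplex, so K coincides near it with
  a single simplex.\<close>

lemma triangulation_boundary_cover:
  fixes K :: "(real^'n) set"
  assumes tri: "triangulation \<S>" and simp: "\<And>T. T \<in> \<S> \<Longrightarrow> int CARD('n) simplex T" and K: "\<Union>\<S> = K"
    and d: "CARD('n) \<ge> 2" and F: "flat_face F n b" "F \<subseteq> frontier K"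
  obtains \<N> where "finite \<N>" "\<And>N. N \<in> \<N> \<Longrightarrow> aff_dim N < int CARD('n) - 1 \<and> closed N"
    "\<And>x. x \<in> F - \<Union>\<N> \<Longrightarrow> \<exists>T\<in>\<S>. \<exists>f. f facet_of T \<and> f \<subseteq> frontier K \<and> affine hull f = affine hull F \<and> x \<in> f \<and>
      (\<exists>U. open U \<and> x \<in> U \<and> K \<inter> U \<subseteq> T)"
proof -
  have fin: "finite \<S>" using tri by (simp add: triangulation_def)
  have cl: "closed T" if "T \<in> \<S>" for T using simp[OF that] closed_simplex by blast
  have fcl: "closed g" if "T \<in> \<S>" "g face_of T" for g T
    by (rule face_of_imp_closed[OF convex_simplex[OF simp[OF that(1)]] cl[OF that(1)] that(2)])
  define N1 where "N1 = (\<Union>T\<in>\<S>. {g. g face_of T \<and> aff_dim g < int CARD('n) - 1})"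
  define N2 where "N2 = (\<Union>T\<in>\<S>. {f \<inter> F | f. f facet_of T \<and> affine hull f \<noteq> affine hull F})"
  have finf: "finite {g. g face_of T}" if "T \<in> \<S>" for T
    using simp[OF that] by (simp add: finite_polytope_faces simplex_imp_polytope)
  have "finite (N1 \<union> N2)"
  proof -
    have "finite N1" unfolding N1_def using fin finf by (auto intro: finite_subset)
    moreover have "N2 \<subseteq> (\<Union>T\<in>\<S>. (\<lambda>f. f \<inter> F) ` {g. g face_of T})"
      unfolding N2_def using facet_of_imp_face_of by blast
    then have "finite N2" by (rule finite_subset) (use fin finf in auto)
    ultimately show ?thesis by simp
  qed
  moreover have "aff_dim N < int CARD('n) - 1 \<and> closed N" if N: "N \<in> N1 \<union> N2" for N
    using N
  proof
    assume "N \<in> N1"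
    then obtain T where T: "T \<in> \<S>" "N face_of T" "aff_dim N < int CARD('n) - 1" by (auto simp: N1_def)
    have "closed N" by (rule fcl) (use T in auto)
    then show ?thesis using T by simp
  next
    assume "N \<in> N2"
    then obtain T f where T: "T \<in> \<S>" "f facet_of T" "affine hull f \<noteq> affine hull F" "N = f \<inter> F" by (auto simp: N2_def)
    have cf: "closed f" by (rule fcl[OF T(1) facet_of_imp_face_of[OF T(2)]])
    then have "closed N" using T flat_face_frontier[OF F(1)] by auto
    obtain n' b' where f': "flat_face f n' b'" by (rule simplex_facet_flat[OF simp[OF T(1)] d T(2)])
    have dimF: "aff_dim F = int CARD('n) - 1"
    proof -
      have "aff_dim F = aff_dim (affine hull F)" by simp
      also have "\<dots> = aff_dim {x. n \<bullet> x = b}" using F(1) by (simp add: flat_face_def)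
      also have "\<dots> = int DIM(real^'n) - 1"
      proof -
        have "n \<noteq> 0" using F(1) by (auto simp: flat_face_def)
        then show ?thesis using aff_dim_hyperplane[of n b] by (simp add: of_nat_diff)
      qed
      finally show ?thesis by simp
    qed
    have dimf: "aff_dim f = int CARD('n) - 1"
      using T(2) aff_dim_simplex[OF simp[OF T(1)]] by (simp add: facet_of_def)
    have le: "aff_dim N \<le> aff_dim F" using T(4) by (simp add: aff_dim_subset)
    moreover have "aff_dim N \<noteq> aff_dim F"
    proof
      assume eq: "aff_dim N = aff_dim F"
      have ne: "N \<noteq> {}" using eq dimF d by auto
      have "affine hull N = affine hull F"
        by (rule affine_dim_equal) (use T(4) eq ne hull_mono[of N F affine] in auto)
      moreover have "affine hull N = affine hull f"
        by (rule affine_dim_equal) (use T(4) eq ne dimF dimf hull_mono[of N f affine] in auto)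
      ultimately show False using T(3) by simp
    qed
    ultimately show ?thesis using dimF \<open>closed N\<close> by simp
  qed
  moreover have "\<exists>T\<in>\<S>. \<exists>f. f facet_of T \<and> f \<subseteq> frontier K \<and> affine hull f = affine hull F \<and> x \<in> f \<and>
      (\<exists>U. open U \<and> x \<in> U \<and> K \<inter> U \<subseteq> T)" if x: "x \<in> F - \<Union>(N1 \<union> N2)" for x
  proof -
    have clK: "closed K" unfolding K[symmetric] using fin cl by blast
    have xfr: "x \<in> frontier K" using x F(2) by blast
    then have xK: "x \<in> K" "x \<notin> interior K" using clK by (auto simp: frontier_def)
    then obtain T where T: "T \<in> \<S>" "x \<in> T" using K by blast
    have "interior T \<subseteq> interior K" by (rule interior_mono) (use T K in blast)
    then have "x \<notin> interior T" using xK by blast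
    then obtain f where f: "f facet_of T" "x \<in> f" using frontier_simplex_facet[OF simp[OF T(1)] T(2)] by blast
    have aff: "affine hull f = affine hull F"
    proof (rule ccontr)
      assume "affine hull f \<noteq> affine hull F"
      then have "f \<inter> F \<in> N2" unfolding N2_def using T(1) f(1) by blast
      then show False using x f(2) by blast
    qed
    obtain n' b' where f': "flat_face f n' b'" "\<forall>z\<in>T. n' \<bullet> z \<le> b'" "f \<subseteq> frontier T"
      by (rule simplex_facet_flat[OF simp[OF T(1)] d f(1)])
    have ff: "f face_of T" using f(1) by (rule facet_of_imp_face_of)
    have dimf: "aff_dim f = int CARD('n) - 1"
      using f(1) aff_dim_simplex[OF simp[OF T(1)]] by (simp add: facet_of_def)
    have rel: "x \<in> rel_interior f"
    proof (rule ccontr)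
      assume "x \<notin> rel_interior f"
      then have "x \<in> rel_frontier f" using f(2) closure_subset by (auto simp: rel_frontier_def)
      moreover have "polyhedron f"
        using face_of_polyhedron_polyhedron[OF simplex_imp_polyhedron[OF simp[OF T(1)]] ff] .
      ultimately obtain g where g: "g facet_of f" "x \<in> g" using rel_frontier_of_polyhedron by blast
      then have "g face_of T" using ff facet_of_imp_face_of face_of_trans by blast
      moreover have "aff_dim g < int CARD('n) - 1" using g dimf by (simp add: facet_of_def)
      ultimately show False using x T(1) g(2) by (auto simp: N1_def)
    qed
    obtain \<delta> where \<delta>: "\<delta> > 0" "\<And>z. dist x z < \<delta> \<Longrightarrow> z \<in> T \<longleftrightarrow> n' \<bullet> z \<le> b'"
      using simplex_facet_local[OF simp[OF T(1)] d f(1) rel f'(1,2)] by blast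
    have face: "T \<inter> T' face_of T" "T \<inter> T' face_of T'" if "T' \<in> \<S>" for T'
    proof -
      have "T \<inter> T' face_of T" "T' \<inter> T face_of T'"
        using tri T(1) that unfolding triangulation_def by simp_all
      then show "T \<inter> T' face_of T" "T \<inter> T' face_of T'" by (simp_all add: Int_commute)
    qed
    \<comment> \<open>A second simplex would share exactly the facet f with T. On the same side of f
      the two would overlap in more than f; on opposite sides they would fill a ball around the
      boundary point x.\<close>
    have other: "x \<notin> T'" if T': "T' \<in> \<S>" "T' \<noteq> T" for T'
    proof
      assume xT': "x \<in> T'"
      have G: "T \<inter> T' face_of T" "T \<inter> T' face_of T'" using face[OF T'(1)] by auto
      have "f \<subseteq> T \<inter> T'"
        by (rule subset_of_face_of[OF G(1) facet_of_imp_subset[OF f(1)]]) (use T(2) xT' rel in blast)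
      have "T \<inter> T' \<noteq> T"
      proof
        assume "T \<inter> T' = T"
        then have "T face_of T'" using G(2) by simp
        then show False
          using face_of_aff_dim_lt[OF convex_simplex[OF simp[OF T'(1)]] \<open>T face_of T'\<close> T'(2)[symmetric]]
            aff_dim_simplex[OF simp[OF T(1)]] aff_dim_simplex[OF simp[OF T'(1)]] by linarith
      qed
      then have "aff_dim (T \<inter> T') < int CARD('n)"
        using face_of_aff_dim_lt[OF convex_simplex[OF simp[OF T(1)]] G(1)] aff_dim_simplex[OF simp[OF T(1)]] by simp
      then have dimG: "aff_dim (T \<inter> T') = aff_dim f"
        using aff_dim_subset[OF \<open>f \<subseteq> T \<inter> T'\<close>] dimf by linarith
      have fG: "f = T \<inter> T'"
      proof (rule ccontr)
        assume "f \<noteq> T \<inter> T'"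
        moreover have "f face_of (T \<inter> T')"
          using face_of_face[OF G(1)] ff \<open>f \<subseteq> T \<inter> T'\<close> by blast
        moreover have "convex (T \<inter> T')" using G(1) by (rule face_of_imp_convex)
        ultimately have "aff_dim f < aff_dim (T \<inter> T')" by (intro face_of_aff_dim_lt)
        then show False using dimG by simp
      qed
      then have fT': "f facet_of T'"
        using G(2) f(2) dimf aff_dim_simplex[OF simp[OF T'(1)]] by (auto simp: facet_of_def)
      obtain n'' b'' where f'': "flat_face f n'' b''" "\<forall>z\<in>T'. n'' \<bullet> z \<le> b''"
        by (rule simplex_facet_flat[OF simp[OF T'(1)] d fT'])
      obtain \<delta>' where \<delta>': "\<delta>' > 0" "\<And>z. dist x z < \<delta>' \<Longrightarrow> z \<in> T' \<longleftrightarrow> n'' \<bullet> z \<le> b''"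
        using simplex_facet_local[OF simp[OF T'(1)] d fT' rel f''] by blast
      consider "n'' = n'" "b'' = b'" | "n'' = - n'" "b'' = - b'"
        using flat_face_same_hyperplane[OF f'(1) f''(1) refl] by blast
      then show False
      proof cases
        case 1
        have "min \<delta> \<delta>' > 0" using \<delta>(1) \<delta>'(1) by simp
        then obtain t where t: "t > 0" "dist x (x - t *\<^sub>R n') < min \<delta> \<delta>'" "n' \<bullet> (x - t *\<^sub>R n') < b'"
          using flat_face_small_step[OF f'(1) f(2)] by blast
        then have "x - t *\<^sub>R n' \<in> T \<inter> T'" using \<delta>(2)[of "x - t *\<^sub>R n'"] \<delta>'(2)[of "x - t *\<^sub>R n'"] 1 by simp
        then have "n' \<bullet> (x - t *\<^sub>R n') = b'" using fG flat_face_in[OF f'(1)] by blast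
        then show False using t by simp
      next
        case 2
        have "ball x (min \<delta> \<delta>') \<subseteq> K"
        proof
          fix z assume "z \<in> ball x (min \<delta> \<delta>')"
          then have "z \<in> T \<or> z \<in> T'" using \<delta>(2)[of z] \<delta>'(2)[of z] 2 by auto
          then show "z \<in> K" using T(1) T'(1) K by blast
        qed
        moreover have "x \<in> ball x (min \<delta> \<delta>')" using \<delta>(1) \<delta>'(1) by simp
        ultimately have "x \<in> interior K" by (meson interiorI open_ball)
        then show False using xK by blast
      qed
    qed
    define R where "R = \<Union>(\<S> - {T})"
    have "closed R" unfolding R_def using fin cl by blast
    then have "open (- R)" "x \<in> - R" using other by (auto simp: R_def)
    moreover have "K \<inter> - R \<subseteq> T" unfolding R_def K[symmetric] by blast
    \<comment> \<open>A simplex other than T through a relative interior point y of f would contain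
      all of f, hence x. So near y only T is present, and T stays on one side of f, which excludes y
      from the interior of K; the rest of f follows by closure.\<close>
    moreover have "f \<subseteq> frontier K"
    proof -
      have "rel_interior f \<inter> interior K = {}"
      proof (rule ccontr)
        assume "rel_interior f \<inter> interior K \<noteq> {}"
        then obtain y where y: "y \<in> rel_interior f" "y \<in> interior K" by blast
        then have yf: "y \<in> f" using rel_interior_subset by blast
        have "y \<notin> R"
        proof
          assume "y \<in> R"
          then obtain T' where T': "T' \<in> \<S>" "T' \<noteq> T" "y \<in> T'" by (auto simp: R_def)
          have "f \<subseteq> T \<inter> T'"
            by (rule subset_of_face_of[OF face(1)[OF T'(1)] facet_of_imp_subset[OF f(1)]])
               (use yf facet_of_imp_subset[OF f(1)] T' y in blast)
          then show False using other[OF T'(1,2)] f(2) by blast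
        qed
        then have "y \<in> interior K \<inter> - R" using y by blast
        moreover have "open (interior K \<inter> - R)" using \<open>open (- R)\<close> by blast
        ultimately obtain e where e: "e > 0" "ball y e \<subseteq> interior K \<inter> - R" using open_contains_ball by blast
        obtain t where t: "dist y (y + t *\<^sub>R n') < e" "n' \<bullet> (y + t *\<^sub>R n') > b'"
          using flat_face_small_step[OF f'(1) yf e(1)] by blast
        then have "y + t *\<^sub>R n' \<in> K \<inter> - R" using e(2) interior_subset by (auto simp: subset_iff)
        then have "y + t *\<^sub>R n' \<in> T" using \<open>K \<inter> - R \<subseteq> T\<close> by blast
        then show False using f'(2) t(2) by fastforce
      qed
      then have "f \<inter> interior K = {}"
        using f'(1) by (metis Int_commute flat_face_def open_Int_closure_eq_empty open_interior
            convex_closure_rel_interior closure_closed compact_imp_closed)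
      then show ?thesis using facet_of_imp_subset[OF f(1)] T(1) K closure_subset by (fastforce simp: frontier_def)
    qed
    ultimately show ?thesis using T(1) f aff by blast
  qed
  ultimately show ?thesis by (rule that)
qed

section \<open>The measure on a face and the inverse trace inequalities\<close>

text \<open>Completeness transfers measurability to functions known only off a null set, such as
  gradients defined by a choice.\<close>

lemma measurable_cong_AE_complete:
  assumes M: "complete_measure M" and f: "f \<in> measurable M N" and ae: "AE x in M. f x = g x"
    and g: "\<And>x. x \<in> space M \<Longrightarrow> g x \<in> space N"
  shows "g \<in> measurable M N"
proof (rule measurableI)
  fix A assume A: "A \<in> sets N"
  obtain Z where Z: "Z \<in> null_sets M" "{x \<in> space M. f x \<noteq> g x} \<subseteq> Z"
    using ae unfolding eventually_ae_filter by auto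
  have "g -` A \<inter> space M = (f -` A \<inter> space M - Z) \<union> (g -` A \<inter> space M \<inter> Z)"
    using Z(2) by auto
  moreover have "g -` A \<inter> space M \<inter> Z \<in> sets M"
    using complete_measure.complete[OF M _ Z(1), of "g -` A \<inter> space M \<inter> Z"] by blast
  moreover have "f -` A \<inter> space M - Z \<in> sets M"
    using measurable_sets[OF f A] Z(1) by auto
  ultimately show "g -` A \<inter> space M \<in> sets M" by (metis sets.Un)
qed (use g in auto)

lemma closest_point_flat:
  assumes F: "flat_face F n b"
  shows "closest_point (affine hull F) z = z - (n \<bullet> z - b) *\<^sub>R n"
proof -
  have nn: "n \<bullet> n = 1" and n1: "norm n = 1" and H: "affine hull F = {x. n \<bullet> x = b}"
    using F flat_face_nn[OF F] by (auto simp: flat_face_def)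
  have "z - (n \<bullet> z - b) *\<^sub>R n = closest_point {x. n \<bullet> x = b} z"
  proof (rule closest_point_unique)
    show "convex {x. n \<bullet> x = b}" by (rule convex_hyperplane)
    show "closed {x. n \<bullet> x = b}" by (rule closed_hyperplane)
    show "z - (n \<bullet> z - b) *\<^sub>R n \<in> {x. n \<bullet> x = b}" using nn by (simp add: inner_simps)
    show "\<forall>w\<in>{x. n \<bullet> x = b}. dist z (z - (n \<bullet> z - b) *\<^sub>R n) \<le> dist z w"
    proof
      fix w assume "w \<in> {x. n \<bullet> x = b}"
      then have "\<bar>n \<bullet> z - b\<bar> = \<bar>n \<bullet> (z - w)\<bar>" by (simp add: inner_diff_right)
      also have "\<dots> \<le> norm (z - w)" using Cauchy_Schwarz_ineq2[of n "z - w"] n1 by simp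
      finally show "dist z (z - (n \<bullet> z - b) *\<^sub>R n) \<le> dist z w" using n1 by (simp add: dist_norm)
    qed
  qed
  then show ?thesis using H by simp
qed

lemma prism_flat:
  assumes F: "flat_face F n b"
  shows "prism F = {z. z - (n \<bullet> z - b) *\<^sub>R n \<in> F \<and> \<bar>n \<bullet> z - b\<bar> \<le> 1/2}"
  unfolding prism_def closest_point_flat[OF F] using F by (simp add: dist_norm flat_face_def)

lemma prism_borel: "flat_face F n b \<Longrightarrow> prism F \<in> sets borel"
proof -
  assume F: "flat_face F n b"
  have [measurable]: "F \<in> sets borel" using flat_face_frontier[OF F] by simp
  have "Measurable.pred borel (\<lambda>z. z - (n \<bullet> z - b) *\<^sub>R n \<in> F \<and> \<bar>n \<bullet> z - b\<bar> \<le> 1/2)" by measurable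
  then show ?thesis unfolding prism_flat[OF F] by (simp add: pred_def)
qed

lemma sets_face_measure_borel: "A \<in> sets borel \<Longrightarrow> A \<in> sets (face_measure F)"
  unfolding face_measure_def by (simp add: sets_completionI_sets)

lemma space_face_measure [simp]: "space (face_measure F) = UNIV"
  by (simp add: face_measure_def)

lemma measurable_face_measure_borel: "f \<in> borel_measurable borel \<Longrightarrow> f \<in> borel_measurable (face_measure F)"
  unfolding face_measure_def by (rule measurable_completion) simp

lemma complete_face_measure: "complete_measure (face_measure F)"
  unfolding face_measure_def by (rule completion.complete_measure_axioms)

lemma nn_integral_face_measure:
  assumes F: "flat_face F n b" and \<phi>[measurable]: "\<phi> \<in> borel_measurable borel"
  shows "(\<integral>\<^sup>+x. \<phi> x \<partial>face_measure F) = surf n b (\<lambda>y. indicator F y * \<phi> y)"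
proof -
  note pF[measurable] = prism_borel[OF F]
  have cp[measurable]: "closest_point (affine hull F) \<in> borel_measurable borel"
    using closest_point_flat[OF F, abs_def] by simp
  have cp': "closest_point (affine hull F) \<in> restrict_space lborel (prism F) \<rightarrow>\<^sub>M borel"
    by (rule measurable_restrict_space1) simp
  have "(\<integral>\<^sup>+x. \<phi> x \<partial>face_measure F) = (\<integral>\<^sup>+z. \<phi> (closest_point (affine hull F) z) \<partial>restrict_space lborel (prism F))"
    unfolding face_measure_def nn_integral_completion using cp' by (simp add: nn_integral_distr)
  also have "\<dots> = (\<integral>\<^sup>+z. \<phi> (closest_point (affine hull F) z) * indicator (prism F) z \<partial>lborel)"
    by (rule nn_integral_restrict_space) simp
  also have "\<dots> = surf n b (\<lambda>y. indicator F y * \<phi> y)"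
    unfolding surf_def
    by (intro nn_integral_cong) (auto simp: closest_point_flat[OF F] prism_flat[OF F] indicator_def)
  finally show ?thesis .
qed

lemma surf_uminus: "surf (- n) (- b) \<phi> = surf n b \<phi>"
  unfolding surf_def by (intro nn_integral_cong) (auto simp: indicator_def abs_minus_commute algebra_simps)

text \<open>The unit normal of a hyperplane is unique up to sign, and \<open>surf\<close> ignores
  the sign. Hence integrals over a mesh face and over a coplanar facet of the submesh can be
  exchanged.\<close>

lemma surf_coplanar:
  assumes "flat_face F n b" "flat_face F' n' b'" "affine hull F = affine hull F'"
  shows "surf n' b' \<phi> = surf n b \<phi>"
  using flat_face_same_hyperplane[OF assms] surf_uminus by metis

lemma AE_face_measure_in: "flat_face F n b \<Longrightarrow> AE x in face_measure F. x \<in> F"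
proof -
  assume F: "flat_face F n b"
  have B: "- F \<in> sets borel" using flat_face_frontier[OF F] by simp
  have "emeasure (face_measure F) (- F) = (\<integral>\<^sup>+x. indicator (- F) x \<partial>face_measure F)"
    using sets_face_measure_borel[OF B] by simp
  also have "\<dots> = surf n b (\<lambda>y. indicator F y * indicator (- F) y)"
    by (rule nn_integral_face_measure[OF F]) (use B in measurable)
  also have "\<dots> = surf n b (\<lambda>_. 0)" by (rule arg_cong[where f = "surf n b"]) (auto simp: indicator_def)
  also have "\<dots> = 0" by (simp add: surf_def)
  finally have "- F \<in> null_sets (face_measure F)" using sets_face_measure_borel[OF B] by (simp add: null_sets_def)
  then show ?thesis using AE_not_in by fastforce
qed

lemma AE_face_measure_avoid:
  fixes F :: "(real^'n) set"
  assumes F: "flat_face F n b" and fin: "finite \<N>"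
    and \<N>: "\<And>N. N \<in> \<N> \<Longrightarrow> aff_dim N < int CARD('n) - 1 \<and> closed N"
  shows "AE x in face_measure F. x \<notin> \<Union>\<N>"
proof -
  have "AE x in face_measure F. x \<notin> N" if N: "N \<in> \<N>" for N
  proof -
    have B: "N \<in> sets borel" using \<N>[OF N] by simp
    have "emeasure (face_measure F) N = (\<integral>\<^sup>+x. indicator N x \<partial>face_measure F)"
      using sets_face_measure_borel[OF B] by simp
    also have "\<dots> = surf n b (\<lambda>y. indicator F y * indicator N y)"
      by (rule nn_integral_face_measure[OF F]) (use B in measurable)
    also have "\<dots> = 0"
      by (rule surf_null[of N]) (use \<N>[OF N] F in \<open>auto simp: indicator_def flat_face_def split: if_splits\<close>)
    finally have "N \<in> null_sets (face_measure F)" using sets_face_measure_borel[OF B] by (simp add: null_sets_def)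
    then show ?thesis by (rule AE_not_in)
  qed
  then have "AE x in face_measure F. \<forall>N\<in>\<N>. x \<notin> N" using fin by (simp add: AE_finite_all)
  then show ?thesis by eventually_elim auto
qed

lemma emeasure_face_measure: "flat_face F n b \<Longrightarrow> emeasure (face_measure F) F = surf n b (indicator F)"
proof -
  assume F: "flat_face F n b"
  have B: "F \<in> sets borel" using flat_face_frontier[OF F] by simp
  have "emeasure (face_measure F) F = (\<integral>\<^sup>+x. indicator F x \<partial>face_measure F)"
    using sets_face_measure_borel[OF B] by simp
  also have "\<dots> = surf n b (\<lambda>y. indicator F y * indicator F y)"
    by (rule nn_integral_face_measure[OF F]) (use B in measurable)
  also have "\<dots> = surf n b (indicator F)" by (rule arg_cong[where f = "surf n b"]) (auto simp: indicator_def)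
  finally show ?thesis .
qed

lemma surf_indicator_prism: "flat_face F n b \<Longrightarrow> surf n b (indicator F) = emeasure lborel (prism F)"
proof -
  assume F: "flat_face F n b"
  have "surf n b (indicator F) = (\<integral>\<^sup>+z. indicator (prism F) z \<partial>lborel)"
    unfolding surf_def by (intro nn_integral_cong) (auto simp: prism_flat[OF F] indicator_def)
  also have "\<dots> = emeasure lborel (prism F)" by (rule nn_integral_indicator) (simp add: prism_borel[OF F])
  finally show ?thesis .
qed

lemma face_area_finite_pos:
  assumes F: "flat_face F n b"
  shows "emeasure (face_measure F) F = ennreal (face_area F)" "face_area F > 0" "finite_measure (face_measure F)"
proof -
  have n1: "norm n = 1" and nn: "n \<bullet> n = 1" using F flat_face_nn[OF F] by (auto simp: flat_face_def)
  obtain B where B: "\<And>x. x \<in> F \<Longrightarrow> norm x \<le> B"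
  proof -
    have "bounded F" using F by (simp add: flat_face_def compact_imp_bounded)
    then show ?thesis using that by (auto simp: bounded_iff)
  qed
  have "bounded (prism F)"
    unfolding bounded_iff
  proof (intro exI ballI)
    fix z assume z: "z \<in> prism F"
    have "norm z \<le> norm (z - (n \<bullet> z - b) *\<^sub>R n) + norm ((n \<bullet> z - b) *\<^sub>R n)"
      using norm_triangle_ineq[of "z - (n \<bullet> z - b) *\<^sub>R n" "(n \<bullet> z - b) *\<^sub>R n"] by simp
    also have "\<dots> \<le> B + 1/2" using z B n1 by (intro add_mono) (auto simp: prism_flat[OF F])
    finally show "norm z \<le> B + 1/2" .
  qed
  then have fin: "emeasure lborel (prism F) < \<infinity>" by (rule emeasure_bounded_finite)
  have e: "emeasure (face_measure F) F = emeasure lborel (prism F)"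
    using emeasure_face_measure[OF F] surf_indicator_prism[OF F] by simp
  then have fin': "emeasure (face_measure F) F < \<infinity>" using fin by simp
  then show a: "emeasure (face_measure F) F = ennreal (face_area F)"
    unfolding face_area_def by (simp add: emeasure_eq_ennreal_measure less_top)
  obtain x where x: "x \<in> rel_interior F" using flat_face_rel_interior_nonempty[OF F] by blast
  then have nx: "n \<bullet> x = b" using rel_interior_subset flat_face_in[OF F] by blast
  obtain \<epsilon> where eps: "\<epsilon> > 0" "\<And>y. n \<bullet> y = b \<Longrightarrow> dist x y < \<epsilon> \<Longrightarrow> y \<in> F"
    using flat_face_rel_interior[OF F x] by blast
  \<comment> \<open>The projection moves z by at most its distance from x, so the image stays within
    twice that distance of x; 1/2 is half the thickness of the prism.\<close>
  define r where "r = min (\<epsilon> / 2) (1/2)"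
  have r: "r > 0" using eps by (simp add: r_def)
  have "ball x r \<subseteq> prism F"
  proof
    fix z assume z: "z \<in> ball x r"
    have "\<bar>n \<bullet> z - b\<bar> = \<bar>n \<bullet> (z - x)\<bar>" using nx by (simp add: inner_diff_right)
    also have "\<dots> \<le> norm (z - x)" using Cauchy_Schwarz_ineq2[of n "z - x"] n1 by simp
    finally have h: "\<bar>n \<bullet> z - b\<bar> \<le> norm (z - x)" .
    have "dist x (z - (n \<bullet> z - b) *\<^sub>R n) \<le> dist x z + norm ((n \<bullet> z - b) *\<^sub>R n)"
      using norm_triangle_ineq[of "x - z" "(n \<bullet> z - b) *\<^sub>R n"] by (simp add: dist_norm algebra_simps)
    also have "\<dots> \<le> 2 * dist x z" using h n1 by (simp add: dist_norm norm_minus_commute)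
    also have "\<dots> < \<epsilon>" using z by (simp add: r_def)
    finally have "z - (n \<bullet> z - b) *\<^sub>R n \<in> F" using eps(2) nn by (simp add: inner_simps)
    moreover have "\<bar>n \<bullet> z - b\<bar> \<le> 1/2" using h z by (simp add: r_def dist_norm norm_minus_commute)
    ultimately show "z \<in> prism F" by (simp add: prism_flat[OF F])
  qed
  then have "emeasure lborel (ball x r) \<le> emeasure lborel (prism F)"
    by (rule emeasure_mono) (simp add: prism_borel[OF F])
  moreover have "emeasure lborel (ball x r) > 0"
  proof -
    have "measure lborel (ball x r) > 0" using r by (rule content_ball_pos)
    then show ?thesis by (auto simp: measure_def zero_less_iff_neq_zero)
  qed
  ultimately have "emeasure (face_measure F) F > 0" using e by simp
  then show "face_area F > 0" using a by (simp add: ennreal_less_zero_iff)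
  have "emeasure (face_measure F) UNIV = emeasure (face_measure F) F"
    by (rule emeasure_eq_AE)
       (use AE_face_measure_in[OF F] sets_face_measure_borel[of F F] sets_face_measure_borel[of UNIV F]
          flat_face_frontier[OF F] in auto)
  then show "finite_measure (face_measure F)"
    using a by (intro finite_measureI) simp
qed

text \<open>The part of an element below a face is the cone over the face with apex in the ball with respect
  to which the element is star-shaped.\<close>

lemma element_trace_inequality:
  fixes K :: "(real^'n) set"
  assumes K: "star_center K c \<rho>" "compact K" and fin: "finite \<F>"
    and F: "\<And>F. F \<in> \<F> \<Longrightarrow> F \<subseteq> frontier K \<and> (\<exists>n b. flat_face F n b)"
    and sep: "\<And>F F'. F \<in> \<F> \<Longrightarrow> F' \<in> \<F> \<Longrightarrow> F \<noteq> F' \<Longrightarrow> aff_dim (F \<inter> F') < int CARD('n) - 1"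
    and p: "p \<in> poly_space N"
  shows "ennreal \<rho> * (\<Sum>F\<in>\<F>. \<integral>\<^sup>+x. ennreal ((p x)\<^sup>2) \<partial>face_measure F)
    \<le> ennreal (real ((N + 1) * (N + CARD('n)))) * (\<integral>\<^sup>+x. indicator K x * ennreal ((p x)\<^sup>2) \<partial>lborel)"
proof -
  let ?C = "ennreal (real ((N + 1) * (N + CARD('n))))"
  have \<rho>: "\<rho> > 0" "c \<in> ball c \<rho>" "c \<in> K" using K(1) by (auto simp: star_center_def)
  have clK: "closed K" using K(2) by (rule compact_imp_closed)
  have pm[measurable]: "p \<in> borel_measurable borel"
    using poly_space_continuous[OF p, of UNIV] by (rule borel_measurable_continuous_onI)
  define P where "P F = convex hull (insert c F)" for F
  have FK: "F \<subseteq> K" if "F \<in> \<F>" for F using F[OF that] clK by (auto simp: frontier_def)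
  have Fconv: "convex F" "compact F" "F \<noteq> {}" if "F \<in> \<F>" for F using F[OF that] by (auto simp: flat_face_def)
  have Pin: "c + t *\<^sub>R (y - c) \<in> P F" if "F \<in> \<F>" "y \<in> F" "0 < t" "t \<le> 1" for F y t
  proof -
    have "(1 - t) *\<^sub>R c + t *\<^sub>R y \<in> P F" unfolding P_def
      by (rule convexD_alt[OF convex_convex_hull]) (use that in \<open>auto intro: hull_inc\<close>)
    then show ?thesis by (simp add: algebra_simps)
  qed
  have Pout: "\<exists>y\<in>F. \<exists>t\<in>{0..1}. z = c + t *\<^sub>R (y - c)" if FF: "F \<in> \<F>" and z: "z \<in> P F" for F z
  proof -
    have "F = convex hull F" using Fconv(1)[OF FF] by (simp add: hull_same)
    then obtain u y where "0 \<le> u" "u \<le> 1" "y \<in> F" "z = (1 - u) *\<^sub>R c + u *\<^sub>R y"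
      using z Fconv(3)[OF FF] unfolding P_def convex_hull_insert_alt by auto
    then show ?thesis by (intro bexI[of _ y] bexI[of _ u]) (auto simp: algebra_simps)
  qed
  have PK: "P F \<subseteq> K" if FF: "F \<in> \<F>" for F
  proof
    fix z assume "z \<in> P F"
    then obtain y t where y: "y \<in> F" "t \<in> {0..1}" "z = c + t *\<^sub>R (y - c)" using Pout[OF FF] by blast
    then have "z = (1 - (1 - t)) *\<^sub>R y + (1 - t) *\<^sub>R c" by (simp add: algebra_simps)
    then have "z \<in> closed_segment y c" using y(2) unfolding in_segment by (intro exI[of _ "1 - t"]) auto
    then show "z \<in> K" using K(1) FK[OF FF] y(1) \<rho>(2) unfolding star_center_def by blast
  qed
  have Pm: "P F \<in> sets borel" if "F \<in> \<F>" for F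
    using Fconv(2)[OF that] unfolding P_def by (intro borel_closed compact_imp_closed compact_convex_hull) simp
  \<comment> \<open>A ray from c meets the frontier at most once, so a point common to two cones is
    c or lies over the intersection of the two faces. The affine hull of c and that intersection has
    dimension below d.\<close>
  have Pnull: "AE z in lborel. \<not> (z \<in> P F \<and> z \<in> P F')" if FF: "F \<in> \<F>" "F' \<in> \<F>" "F \<noteq> F'" for F F'
  proof -
    have sub: "P F \<inter> P F' \<subseteq> affine hull (insert c (F \<inter> F'))"
    proof
      fix z assume z: "z \<in> P F \<inter> P F'"
      obtain y t where y: "y \<in> F" "t \<in> {0..1}" "z = c + t *\<^sub>R (y - c)" using z Pout[OF FF(1)] by blast
      obtain y' t' where y': "y' \<in> F'" "t' \<in> {0..1}" "z = c + t' *\<^sub>R (y' - c)" using z Pout[OF FF(2)] by blast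
      \<comment> \<open>Otherwise \<open>y2\<close> would lie strictly between a point of K and the
        centre, hence in the interior.\<close>
      have notless: "\<not> t1 < t2" if "y1 \<in> K" "y2 \<in> frontier K" "0 \<le> t1" "t1 *\<^sub>R (y1 - c) = t2 *\<^sub>R (y2 - c)" for y1 y2 t1 t2
      proof
        assume lt: "t1 < t2"
        have "(t1 / t2) *\<^sub>R (y1 - c) = (1 / t2) *\<^sub>R (t1 *\<^sub>R (y1 - c))" by simp
        also have "\<dots> = y2 - c" unfolding that(4) using lt that(3) by simp
        finally have "y2 = (1 - (1 - t1 / t2)) *\<^sub>R y1 + (1 - t1 / t2) *\<^sub>R c" by (simp add: algebra_simps)
        moreover have "0 < 1 - t1 / t2" "1 - t1 / t2 \<le> 1" using lt that(3) by auto
        ultimately have "y2 \<in> interior K" using star_center_interior[OF K(1) that(1) \<rho>(2)] by metis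
        then show False using that(2) by (simp add: frontier_def)
      qed
      have eq: "t *\<^sub>R (y - c) = t' *\<^sub>R (y' - c)" using y(3) y'(3) by simp
      have "y \<in> K" "y \<in> frontier K" "y' \<in> K" "y' \<in> frontier K"
        using y(1) y'(1) FF FK F by blast+
      then have "t = t'" using notless[of y y' t t'] notless[of y' y t' t] eq y(2) y'(2) by fastforce
      show "z \<in> affine hull (insert c (F \<inter> F'))"
      proof (cases "t = 0")
        case True
        then show ?thesis using y(3) by (simp add: hull_inc)
      next
        case False
        then have "y = y'" using eq \<open>t = t'\<close> by simp
        then have "y \<in> F \<inter> F'" using y(1) y'(1) by blast
        then have "c \<in> affine hull (insert c (F \<inter> F'))" "y \<in> affine hull (insert c (F \<inter> F'))"
          by (auto intro: hull_inc)
        then have "c + t *\<^sub>R (y - c) \<in> affine hull (insert c (F \<inter> F'))"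
          using mem_affine_3_minus[OF affine_affine_hull, of c _ y c t] by blast
        then show ?thesis using y(3) by simp
      qed
    qed
    have "aff_dim (insert c (F \<inter> F')) \<le> aff_dim (F \<inter> F') + 1" by (simp add: aff_dim_insert)
    then have "aff_dim (affine hull (insert c (F \<inter> F'))) < DIM(real^'n)" using sep[OF FF] by simp
    then have "negligible (P F \<inter> P F')" using negligible_lowaffdim negligible_subset sub by blast
    then have "AE z in lborel. z \<notin> P F \<inter> P F'"
      by (metis AE_not_in AE_completion_iff negligible_iff_null_sets)
    then show ?thesis by eventually_elim auto
  qed
  have each: "ennreal \<rho> * (\<integral>\<^sup>+x. ennreal ((p x)\<^sup>2) \<partial>face_measure F)
      \<le> ?C * (\<integral>\<^sup>+x. indicator (P F) x * ennreal ((p x)\<^sup>2) \<partial>lborel)" if FF: "F \<in> \<F>" for F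
  proof -
    obtain n0 b0 where F0: "flat_face F n0 b0" using F[OF FF] by blast
    have h0: "\<bar>n0 \<bullet> c - b0\<bar> \<ge> \<rho>" using star_center_height[OF K(1) F0 _ FK[OF FF]] F[OF FF] by blast
    obtain n b where nb: "flat_face F n b" "b - n \<bullet> c \<ge> \<rho>"
    proof (cases "n0 \<bullet> c < b0")
      case True then show ?thesis using that[OF F0] h0 by simp
    next
      case False then show ?thesis using that[OF flat_face_uminus[OF F0]] h0 by simp
    qed
    have Fm[measurable]: "F \<in> sets borel" using flat_face_frontier[OF nb(1)] by simp
    have n1: "norm n = 1" using nb(1) by (simp add: flat_face_def)
    have "ennreal \<rho> * (\<integral>\<^sup>+x. ennreal ((p x)\<^sup>2) \<partial>face_measure F)
        = ennreal \<rho> * surf n b (\<lambda>y. indicator F y * ennreal ((p y)\<^sup>2))"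
      by (subst nn_integral_face_measure[OF nb(1)]) auto
    also have "\<dots> \<le> ennreal (b - n \<bullet> c) * surf n b (\<lambda>y. indicator F y * ennreal ((p y)\<^sup>2))"
      by (intro mult_right_mono ennreal_leI nb(2)) simp
    also have "\<dots> \<le> ennreal (real ((N + 1) * (N + DIM(real^'n)))) * (\<integral>\<^sup>+x. indicator (P F) x * ennreal ((p x)\<^sup>2) \<partial>lborel)"
    proof (rule cone_polynomial_trace[OF pm Fm Pm[OF FF] n1])
      show "b - n \<bullet> c > 0" using nb(2) \<rho>(1) by simp
    qed (use Pin[OF FF] poly_space_line[OF p] in auto)
    finally show ?thesis by simp
  qed
  have "ennreal \<rho> * (\<Sum>F\<in>\<F>. \<integral>\<^sup>+x. ennreal ((p x)\<^sup>2) \<partial>face_measure F)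
      \<le> (\<Sum>F\<in>\<F>. ?C * (\<integral>\<^sup>+x. indicator (P F) x * ennreal ((p x)\<^sup>2) \<partial>lborel))"
    unfolding sum_distrib_left by (intro sum_mono each)
  also have "\<dots> = ?C * (\<integral>\<^sup>+x. (\<Sum>F\<in>\<F>. indicator (P F) x * ennreal ((p x)\<^sup>2)) \<partial>lborel)"
    unfolding sum_distrib_left[symmetric] using Pm
    by (subst nn_integral_sum) (auto intro!: borel_measurable_times_ennreal borel_measurable_indicator)
  also have "(\<integral>\<^sup>+x. (\<Sum>F\<in>\<F>. indicator (P F) x * ennreal ((p x)\<^sup>2)) \<partial>lborel)
      \<le> (\<integral>\<^sup>+x. indicator K x * ennreal ((p x)\<^sup>2) \<partial>lborel)"
  proof (rule nn_integral_mono_AE)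
    have "AE z in lborel. \<forall>F\<in>\<F>. \<forall>F'\<in>\<F>. F \<noteq> F' \<longrightarrow> \<not> (z \<in> P F \<and> z \<in> P F')"
      using fin Pnull by (simp add: AE_finite_all)
    then show "AE x in lborel. (\<Sum>F\<in>\<F>. indicator (P F) x * ennreal ((p x)\<^sup>2)) \<le> indicator K x * ennreal ((p x)\<^sup>2)"
    proof eventually_elim
      case (elim x)
      have "(\<Sum>F\<in>\<F>. indicator (P F) x :: ennreal) \<le> indicator K x"
      proof (cases "\<exists>F\<in>\<F>. x \<in> P F")
        case True
        then obtain F0 where F0: "F0 \<in> \<F>" "x \<in> P F0" by blast
        have "(\<Sum>F\<in>\<F>. indicator (P F) x :: ennreal) = (\<Sum>F\<in>\<F>. if F = F0 then 1 else 0)"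
          by (rule sum.cong) (use elim F0 in \<open>auto simp: indicator_def\<close>)
        also have "\<dots> = 1" using F0 fin by simp
        also have "1 = (indicator K x :: ennreal)" using F0 PK[of F0] by (simp add: subset_iff)
        finally show ?thesis by simp
      next
        case False then show ?thesis by simp
      qed
      then show ?case unfolding sum_distrib_right[symmetric] by (rule mult_right_mono) simp
    qed
  qed
  finally show ?thesis by (simp add: mult_left_mono)
qed

text \<open>With the apex at the opposite vertex the cone is the whole simplex. Its volume is at
  most h |f| / d, so 1 / h is at most |f| / (d |T|), which brings in the ratio that the
  stabilisation weight is built from.\<close>

lemma simplex_trace_inequality:
  fixes T :: "(real^'n) set"
  assumes T: "int CARD('n) simplex T" and d: "CARD('n) \<ge> 2" and f: "f facet_of T" and p: "p \<in> poly_space N"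
  shows "(\<integral>\<^sup>+x. ennreal ((p x)\<^sup>2) \<partial>face_measure f)
    \<le> ennreal (real ((N + 1) * (N + CARD('n))) / CARD('n) * (face_area f / measure lebesgue T)) *
      (\<integral>\<^sup>+x. indicator T x * ennreal ((p x)\<^sup>2) \<partial>lborel)"
proof -
  define C where "C = real ((N + 1) * (N + CARD('n)))"
  have pm[measurable]: "p \<in> borel_measurable borel"
    using poly_space_continuous[OF p, of UNIV] by (rule borel_measurable_continuous_onI)
  have Tm[measurable]: "T \<in> sets borel" using closed_simplex[OF T] by simp
  obtain n b v where F: "flat_face f n b" and le: "\<forall>z\<in>T. n \<bullet> z \<le> b" and v: "v \<in> T" "n \<bullet> v < b"
    and ex: "\<forall>z\<in>T. \<exists>y\<in>f. \<exists>t\<in>{0..1}. z = v + t *\<^sub>R (y - v)"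
    by (rule simplex_facet[OF T d f])
  have Fm[measurable]: "f \<in> sets borel" using flat_face_frontier[OF F] by simp
  have n1: "norm n = 1" using F by (simp add: flat_face_def)
  define h where "h = b - n \<bullet> v"
  have h: "h > 0" using v by (simp add: h_def)
  have fT: "f \<subseteq> T" using f by (rule facet_of_imp_subset)
  have cone: "v + t *\<^sub>R (y - v) \<in> T" if "y \<in> f" "0 < t" "t \<le> 1" for y t
    using convexD_alt[OF convex_simplex[OF T] v(1), of y t] that fT by (auto simp: algebra_simps)
  have tr: "ennreal h * surf n b (\<lambda>y. indicator f y * ennreal ((p y)\<^sup>2))
    \<le> ennreal C * (\<integral>\<^sup>+x. indicator T x * ennreal ((p x)\<^sup>2) \<partial>lborel)"
    using cone_polynomial_trace[OF pm Fm Tm n1, of b v N] h cone poly_space_line[OF p]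
    by (simp add: h_def C_def)
  have lev: "n \<bullet> (v + t *\<^sub>R (y - v)) = n \<bullet> v + t * h" if "n \<bullet> y = b" for y t
    using that by (simp add: inner_simps h_def)
  have vol: "emeasure lborel (T \<inter> {z. n \<bullet> z > n \<bullet> v}) \<le> ennreal (h / DIM(real^'n)) * surf n b (indicator f)"
    unfolding h_def
  proof (rule cone_volume[OF Fm Tm n1])
    show "b - n \<bullet> v > 0" using h by (simp add: h_def)
    fix y t assume y: "n \<bullet> y = b" "0 < t" "v + t *\<^sub>R (y - v) \<in> T"
    obtain y' t' where y': "y' \<in> f" "t' \<in> {0..1}" "v + t *\<^sub>R (y - v) = v + t' *\<^sub>R (y' - v)" using ex y(3) by blast
    have "n \<bullet> v + t * h = n \<bullet> v + t' * h"
      using lev[OF y(1), of t] lev[OF flat_face_in[OF F y'(1)], of t'] unfolding y'(3) by (rule trans[OF sym])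
    then have "t = t'" using h by simp
    then have "y = y'" using y'(3) y(2) by simp
    then show "t \<le> 1 \<and> y \<in> f" using y' \<open>t = t'\<close> by simp
  qed
  have "emeasure lborel T \<le> emeasure lborel (T \<inter> {z. n \<bullet> z > n \<bullet> v})"
  proof (rule emeasure_mono_AE)
    \<comment> \<open>The apex is the only point of T that is not strictly above its own
      level.\<close>
    have "AE z in lborel. z \<noteq> v" by (rule AE_lborel_singleton)
    then show "AE z in lborel. z \<in> T \<longrightarrow> z \<in> T \<inter> {z. n \<bullet> z > n \<bullet> v}"
    proof eventually_elim
      case (elim z)
      show ?case
      proof
        assume z: "z \<in> T"
        obtain y t where y: "y \<in> f" "t \<in> {0..1}" "z = v + t *\<^sub>R (y - v)" using ex z by blast
        then have "t > 0" using elim by (cases "t = 0") auto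
        then have "n \<bullet> z > n \<bullet> v" using lev[OF flat_face_in[OF F y(1)], of t] y(3) h by simp
        then show "z \<in> T \<inter> {z. n \<bullet> z > n \<bullet> v}" using z by simp
      qed
    qed
  qed simp
  also note vol
  also have "surf n b (indicator f) = ennreal (face_area f)"
    using emeasure_face_measure[OF F] face_area_finite_pos(1)[OF F] by simp
  also have "ennreal (h / DIM(real^'n)) * ennreal (face_area f) = ennreal (h / CARD('n) * face_area f)"
    using h face_area_finite_pos(2)[OF F] by (subst ennreal_mult) auto
  finally have v1: "emeasure lborel T \<le> ennreal (h / CARD('n) * face_area f)" .
  have Tfin: "emeasure lborel T < \<infinity>"
    using compact_imp_bounded[OF compact_simplex[OF T]] by (rule emeasure_bounded_finite)
  have "measure lborel T > 0"
  proof -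
    have "\<not> negligible T"
      using simplex_interior_nonempty[OF T] negligible_convex_interior[OF convex_simplex[OF T]] by simp
    then have "emeasure lebesgue T \<noteq> 0" using Tm by (simp add: negligible_iff_null_sets null_sets_def)
    then show ?thesis using Tfin by (simp add: emeasure_eq_ennreal_measure less_top zero_less_measure_iff)
  qed
  then have mT: "measure lebesgue T > 0" using Tm by simp
  have v2: "measure lebesgue T \<le> h / CARD('n) * face_area f"
    using v1 Tfin h face_area_finite_pos(2)[OF F] Tm
    by (simp add: emeasure_eq_ennreal_measure less_top)
  have dpos: "real CARD('n) > 0" by simp
  have ratio: "1 / h \<le> 1 / CARD('n) * (face_area f / measure lebesgue T)"
    using v2 h mT dpos by (simp add: field_simps)
  have "(\<integral>\<^sup>+x. ennreal ((p x)\<^sup>2) \<partial>face_measure f) = surf n b (\<lambda>y. indicator f y * ennreal ((p y)\<^sup>2))"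
    by (subst nn_integral_face_measure[OF F]) auto
  also have "\<dots> = ennreal (1 / h) * (ennreal h * surf n b (\<lambda>y. indicator f y * ennreal ((p y)\<^sup>2)))"
    using h by (simp add: mult.assoc[symmetric] ennreal_mult[symmetric])
  also have "\<dots> \<le> ennreal (1 / h) * (ennreal C * (\<integral>\<^sup>+x. indicator T x * ennreal ((p x)\<^sup>2) \<partial>lborel))"
    by (rule mult_left_mono[OF tr]) simp
  also have "\<dots> = ennreal (C * (1 / h)) * (\<integral>\<^sup>+x. indicator T x * ennreal ((p x)\<^sup>2) \<partial>lborel)"
    using h by (simp add: mult.assoc[symmetric] ennreal_mult[symmetric] C_def mult.commute del: of_nat_add of_nat_mult)
  also have "\<dots> \<le> ennreal (C * (1 / CARD('n) * (face_area f / measure lebesgue T))) * (\<integral>\<^sup>+x. indicator T x * ennreal ((p x)\<^sup>2) \<partial>lborel)"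
    by (intro mult_right_mono ennreal_leI mult_left_mono ratio) (auto simp: C_def)
  finally show ?thesis by (simp add: C_def del: of_nat_add of_nat_mult)
qed

section \<open>Traces of piecewise polynomial gradients\<close>

text \<open>Segments from x into T show that the difference of the gradients is orthogonal to y - x
  for every y in T, and a ball inside T makes these directions span the space. Uniqueness thus
  extends to boundary points, where traces are taken.\<close>

lemma gradient_unique_within_convex:
  fixes f :: "'a::euclidean_space \<Rightarrow> real"
  assumes 1: "(f has_derivative (\<lambda>h. g1 \<bullet> h)) (at x within T)" and 2: "(f has_derivative (\<lambda>h. g2 \<bullet> h)) (at x within T)"
    and T: "convex T" "interior T \<noteq> {}" "x \<in> T"
  shows "g1 = g2"
proof -
  define u where "u = g1 - g2"
  have "((\<lambda>z. f z - f z) has_derivative (\<lambda>h. g1 \<bullet> h - g2 \<bullet> h)) (at x within T)"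
    using 1 2 by (rule has_derivative_diff)
  then have d0: "((\<lambda>z. 0) has_derivative (\<lambda>h. u \<bullet> h)) (at x within T)"
    by (simp add: u_def inner_diff_left)
  have orth: "u \<bullet> (y - x) = 0" if y: "y \<in> T" for y
  proof (rule ccontr)
    assume nz: "u \<bullet> (y - x) \<noteq> 0"
    then have yx: "norm (y - x) > 0" by auto
    define e where "e = \<bar>u \<bullet> (y - x)\<bar> / (2 * norm (y - x))"
    have e: "e > 0" using nz yx by (simp add: e_def)
    then obtain d where d: "d > 0" "\<And>z. z \<in> T \<Longrightarrow> norm (z - x) < d \<Longrightarrow> norm (u \<bullet> (z - x)) \<le> e * norm (z - x)"
      using d0 unfolding has_derivative_within_alt by (auto simp: norm_minus_commute)
    obtain s0 where s0: "s0 > 0" "s0 * norm (y - x) < d" using small_multiple[OF d(1)] by blast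
    define s where "s = min s0 1"
    have s: "0 < s" "s \<le> 1" using s0 by (auto simp: s_def)
    have "s * norm (y - x) \<le> s0 * norm (y - x)" by (intro mult_right_mono) (auto simp: s_def)
    then have sd: "s * norm (y - x) < d" using s0 by simp
    have "x + s *\<^sub>R (y - x) \<in> T"
      using convexD_alt[OF T(1,3) y, of s] s by (simp add: algebra_simps)
    from d(2)[OF this] sd s have "s * \<bar>u \<bullet> (y - x)\<bar> \<le> e * (s * norm (y - x))"
      by (simp add: abs_mult)
    then have "\<bar>u \<bullet> (y - x)\<bar> \<le> e * norm (y - x)" using s by (simp add: mult.left_commute)
    also have "\<dots> = \<bar>u \<bullet> (y - x)\<bar> / 2" using yx by (simp add: e_def)
    finally show False using nz by simp
  qed
  obtain c r where r: "r > 0" "ball c r \<subseteq> T" using T(2) mem_interior by blast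
  obtain s where s: "s > 0" "s * norm u < r" using small_multiple[OF r(1)] by blast
  have "c \<in> T" "c + s *\<^sub>R u \<in> T" using r s by (auto simp: dist_norm subset_iff)
  then have "u \<bullet> (c - x) = 0" "u \<bullet> (c + s *\<^sub>R u - x) = 0" using orth by blast+
  then have "s * (u \<bullet> u) = 0" by (simp add: inner_simps)
  then show ?thesis using s by (simp add: u_def)
qed

lemma grad_in_eq:
  fixes K :: "(real^'n) set"
  assumes "(v K has_derivative (\<lambda>h. g \<bullet> h)) (at x within K)" and T: "T \<subseteq> K" "convex T" "interior T \<noteq> {}" "x \<in> T"
  shows "grad_in v K x = g"
proof -
  have "(v K has_derivative (\<lambda>h. grad_in v K x \<bullet> h)) (at x within K)"
    unfolding grad_in_def by (rule someI[of _ g]) (rule assms(1))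
  then show ?thesis
    using gradient_unique_within_convex[OF has_derivative_subset has_derivative_subset T(2-4)] assms(1) T(1) by blast
qed

text \<open>Near such a point the element consists of one simplex, so a piecewise polynomial is
  differentiable within K there and \<open>grad_in\<close> is determined.\<close>

definition regular_point :: "(real^'n) set set \<Rightarrow> (real^'n) set \<Rightarrow> real^'n \<Rightarrow> bool" where
  "regular_point \<S> K x \<longleftrightarrow> (\<exists>T\<in>\<S>. x \<in> T \<and> (\<exists>U. open U \<and> x \<in> U \<and> K \<inter> U \<subseteq> T))"

lemma regular_derivative:
  fixes K :: "(real^'n) set"
  assumes K: "\<Union>\<S> = K" and simp: "\<And>T. T \<in> \<S> \<Longrightarrow> int CARD('n) simplex T"
    and x: "regular_point \<S> K x"
    and w: "\<And>T. T \<in> \<S> \<Longrightarrow> p T \<in> poly_space k \<and> (\<forall>y\<in>T. w K y = p T y)"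
    and g: "\<And>T. T \<in> \<S> \<Longrightarrow> (p T has_derivative (\<lambda>h. g T x \<bullet> h)) (at x)"
  shows "(w K has_derivative (\<lambda>h. grad_in w K x \<bullet> h)) (at x within K)"
    and "T \<in> \<S> \<Longrightarrow> x \<in> T \<Longrightarrow> grad_in w K x = g T x"
proof -
  obtain T0 U where T0: "T0 \<in> \<S>" "x \<in> T0" "open U" "x \<in> U" "K \<inter> U \<subseteq> T0"
    using x unfolding regular_point_def by blast
  obtain r where r: "r > 0" "ball x r \<subseteq> U" using T0 open_contains_ball by blast
  have xK: "x \<in> K" using T0 K by blast
  have cx: "convex T" "interior T \<noteq> {}" "T \<subseteq> K" if "T \<in> \<S>" for T
    using convex_simplex simplex_interior_nonempty simp[OF that] K that by auto
  have der: "(w K has_derivative (\<lambda>h. g T0 x \<bullet> h)) (at x within K)"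
  proof (rule has_derivative_transform_within[OF has_derivative_at_withinI[OF g[OF T0(1)]] r(1) xK])
    fix x' assume "x' \<in> K" "dist x' x < r"
    then have "x' \<in> T0" using T0(5) r(2) by (auto simp: dist_commute subset_iff)
    then show "p T0 x' = w K x'" using w[OF T0(1)] by simp
  qed
  have gr: "grad_in w K x = g T0 x"
    by (rule grad_in_eq[where v = w and K = K, OF der cx(3,1,2)[OF T0(1)] T0(2)])
  then show D: "(w K has_derivative (\<lambda>h. grad_in w K x \<bullet> h)) (at x within K)" using der by simp
  show "grad_in w K x = g T x" if T: "T \<in> \<S>" "x \<in> T"
  proof (rule gradient_unique_within_convex[OF has_derivative_subset[OF D cx(3)[OF T(1)]] _ cx(1,2)[OF T(1)] T(2)])
    show "(w K has_derivative (\<lambda>h. g T x \<bullet> h)) (at x within T)"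
      by (rule has_derivative_transform_within[OF has_derivative_at_withinI[OF g[OF T(1)]] zero_less_one T(2)])
         (use w[OF T(1)] in simp)
  qed
qed

lemma grad_in_comb:
  fixes K :: "(real^'n) set"
  assumes K: "\<Union>\<S> = K" and simp: "\<And>T. T \<in> \<S> \<Longrightarrow> int CARD('n) simplex T" and x: "regular_point \<S> K x"
    and u: "(u K has_derivative (\<lambda>h. grad_in u K x \<bullet> h)) (at x within K)"
    and v: "(v K has_derivative (\<lambda>h. grad_in v K x \<bullet> h)) (at x within K)"
  shows "grad_in (\<lambda>K x. a K * u K x + b K * v K x) K x = a K *\<^sub>R grad_in u K x + b K *\<^sub>R grad_in v K x"
proof -
  obtain T where T: "T \<in> \<S>" "x \<in> T" using x unfolding regular_point_def by blast
  show ?thesis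
  proof (rule grad_in_eq[of _ _ _ _ T])
    show "((\<lambda>x. a K * u K x + b K * v K x) has_derivative (\<lambda>h. (a K *\<^sub>R grad_in u K x + b K *\<^sub>R grad_in v K x) \<bullet> h)) (at x within K)"
      using has_derivative_add[OF has_derivative_mult_right[OF u, of "a K"] has_derivative_mult_right[OF v, of "b K"]]
      by (simp add: inner_add_left)
  qed (use T K simp convex_simplex simplex_interior_nonempty in auto)
qed

lemma finite_cover_measurable:
  fixes g :: "'i \<Rightarrow> 'a \<Rightarrow> 'b::{real_normed_vector,second_countable_topology}"
  assumes "finite \<S>" "\<And>T. T \<in> \<S> \<Longrightarrow> A T \<in> sets M \<and> g T \<in> borel_measurable M"
  shows "\<exists>G\<in>borel_measurable M. (\<forall>x\<in>space M. (\<exists>T\<in>\<S>. x \<in> A T \<and> G x = g T x) \<or> (x \<notin> (\<Union>T\<in>\<S>. A T) \<and> G x = 0))"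
  using assms
proof (induction \<S>)
  case empty
  then show ?case by (intro bexI[of _ "\<lambda>_. 0"]) auto
next
  case (insert T \<S>)
  then obtain G where G: "G \<in> borel_measurable M"
    "\<And>x. x \<in> space M \<Longrightarrow> (\<exists>T\<in>\<S>. x \<in> A T \<and> G x = g T x) \<or> (x \<notin> (\<Union>T\<in>\<S>. A T) \<and> G x = 0)" by auto
  have AT: "A T \<in> sets M" "g T \<in> borel_measurable M" using insert.prems by auto
  show ?case
  proof (rule bexI[of _ "\<lambda>x. if x \<in> A T then g T x else G x"], rule ballI)
    fix x assume x: "x \<in> space M"
    show "(\<exists>T'\<in>insert T \<S>. x \<in> A T' \<and> (if x \<in> A T then g T x else G x) = g T' x) \<or>
      (x \<notin> (\<Union>T\<in>insert T \<S>. A T) \<and> (if x \<in> A T then g T x else G x) = 0)"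
      using G(2)[OF x] by auto
  next
    show "(\<lambda>x. if x \<in> A T then g T x else G x) \<in> borel_measurable M"
      using AT G(1) by measurable
  qed
qed

lemma poly_space_vector_measurable:
  fixes g :: "real^'n \<Rightarrow> real^'n"
  assumes "\<And>i. (\<lambda>x. g x $ i) \<in> poly_space k"
  shows "continuous_on S g"
proof -
  have "continuous_on S (\<lambda>x. \<chi> i. g x $ i)"
    by (intro continuous_on_vec_lambda poly_space_continuous[OF assms])
  then show ?thesis by simp
qed

text \<open>At points that are not regular \<open>grad_in\<close> is an unspecified choice.
  \<open>G\<close> is a bounded Borel function that agrees with it at the regular ones and carries
  measurability; \<open>g\<close> retains the polynomial on each simplex for the trace
  inequality.\<close>

lemma piecewise_gradient:
  fixes K :: "(real^'n) set"
  assumes fin: "finite \<S>" and K: "\<Union>\<S> = K" and simp: "\<And>T. T \<in> \<S> \<Longrightarrow> int CARD('n) simplex T"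
    and w: "\<And>T. T \<in> \<S> \<Longrightarrow> \<exists>p\<in>poly_space k. \<forall>y\<in>T. w K y = p y"
  obtains G C g where "G \<in> borel_measurable borel" "\<forall>x. norm (G x) \<le> C"
    "\<forall>x. regular_point \<S> K x \<longrightarrow> grad_in w K x = G x"
    "\<forall>x. regular_point \<S> K x \<longrightarrow> (w K has_derivative (\<lambda>h. grad_in w K x \<bullet> h)) (at x within K)"
    "\<forall>T\<in>\<S>. \<forall>i. (\<lambda>x. g T x $ i) \<in> poly_space (k - 1)"
    "\<forall>T\<in>\<S>. \<forall>x\<in>T. regular_point \<S> K x \<longrightarrow> grad_in w K x = g T x"
proof -
  have "\<forall>T\<in>\<S>. \<exists>p. p \<in> poly_space k \<and> (\<forall>y\<in>T. w K y = p y)" using w by blast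
  then obtain p where p: "\<forall>T\<in>\<S>. p T \<in> poly_space k \<and> (\<forall>y\<in>T. w K y = p T y)"
    by (rule bchoice[THEN exE])
  have "\<forall>T\<in>\<S>. \<exists>g. (\<forall>x. (p T has_derivative (\<lambda>h. g x \<bullet> h)) (at x)) \<and> (\<forall>i. (\<lambda>x. g x $ i) \<in> poly_space (k - 1))"
  proof
    fix T assume "T \<in> \<S>"
    then have "p T \<in> poly_space k" using p by blast
    then obtain g where "\<And>x. (p T has_derivative (\<lambda>h. g x \<bullet> h)) (at x)" "\<And>i. (\<lambda>x. g x $ i) \<in> poly_space (k - 1)"
      using poly_space_gradient by blast
    then show "\<exists>g. (\<forall>x. (p T has_derivative (\<lambda>h. g x \<bullet> h)) (at x)) \<and> (\<forall>i. (\<lambda>x. g x $ i) \<in> poly_space (k - 1))"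
      by (intro exI[of _ g]) simp
  qed
  then obtain g where g: "\<forall>T\<in>\<S>. (\<forall>x. (p T has_derivative (\<lambda>h. g T x \<bullet> h)) (at x)) \<and> (\<forall>i. (\<lambda>x. g T x $ i) \<in> poly_space (k - 1))"
    by (rule bchoice[THEN exE])
  have gc: "continuous_on S (g T)" if "T \<in> \<S>" for S T
    by (rule poly_space_vector_measurable) (use g that in blast)
  have "\<exists>G\<in>borel_measurable borel. (\<forall>x\<in>space borel. (\<exists>T\<in>\<S>. x \<in> T \<and> G x = g T x) \<or> (x \<notin> (\<Union>T\<in>\<S>. T) \<and> G x = 0))"
  proof (rule finite_cover_measurable[OF fin])
    fix T assume T: "T \<in> \<S>"
    have "closed T" using simp[OF T] by (rule closed_simplex)
    then show "T \<in> sets borel \<and> g T \<in> borel_measurable borel"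
      using borel_measurable_continuous_onI[OF gc[OF T]] by simp
  qed
  then obtain G where G: "G \<in> borel_measurable borel"
    "\<And>x. (\<exists>T\<in>\<S>. x \<in> T \<and> G x = g T x) \<or> (x \<notin> (\<Union>T\<in>\<S>. T) \<and> G x = 0)" by auto
  have reg: "(w K has_derivative (\<lambda>h. grad_in w K x \<bullet> h)) (at x within K)"
    "T \<in> \<S> \<Longrightarrow> x \<in> T \<Longrightarrow> grad_in w K x = g T x" if "regular_point \<S> K x" for x T
    by (rule regular_derivative[OF K simp that, of p k w g]; use p g in blast)+
  have "\<forall>T\<in>\<S>. \<exists>C. \<forall>x\<in>T. norm (g T x) \<le> C"
  proof
    fix T assume T: "T \<in> \<S>"
    have "compact (g T ` T)" using gc[OF T] compact_simplex[OF simp[OF T]] by (rule compact_continuous_image)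
    then have "bounded (g T ` T)" by (rule compact_imp_bounded)
    then show "\<exists>C. \<forall>x\<in>T. norm (g T x) \<le> C" by (simp add: bounded_iff)
  qed
  then obtain C where C: "\<forall>T\<in>\<S>. \<forall>x\<in>T. norm (g T x) \<le> C T" by (rule bchoice[THEN exE])
  have Cpos: "norm (G x) \<le> (\<Sum>T\<in>\<S>. \<bar>C T\<bar>)" for x
    using G(2)[of x]
  proof
    assume "\<exists>T\<in>\<S>. x \<in> T \<and> G x = g T x"
    then obtain T where T: "T \<in> \<S>" "x \<in> T" "G x = g T x" by (elim bexE conjE)
    have "norm (G x) \<le> C T" using C T by simp
    also have "C T \<le> \<bar>C T\<bar>" by simp
    also have "\<dots> \<le> (\<Sum>T\<in>\<S>. \<bar>C T\<bar>)" using T(1) fin by (intro member_le_sum) auto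
    finally show ?thesis .
  next
    assume "x \<notin> (\<Union>T\<in>\<S>. T) \<and> G x = 0"
    then show ?thesis by (simp add: sum_nonneg)
  qed
  have GG: "grad_in w K x = G x" if x: "regular_point \<S> K x" for x
  proof -
    have "\<not> (x \<notin> (\<Union>T\<in>\<S>. T) \<and> G x = 0)" using x unfolding regular_point_def by blast
    then have "\<exists>T\<in>\<S>. x \<in> T \<and> G x = g T x" using G(2)[of x] by argo
    then obtain T where "T \<in> \<S>" "x \<in> T" "G x = g T x" by (elim bexE conjE)
    then show ?thesis using reg(2)[OF x] by simp
  qed
  show ?thesis
  proof (rule that[OF G(1)])
    show "\<forall>x. norm (G x) \<le> (\<Sum>T\<in>\<S>. \<bar>C T\<bar>)" using Cpos by simp
    show "\<forall>x. regular_point \<S> K x \<longrightarrow> grad_in w K x = G x" using GG by simp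
    show "\<forall>x. regular_point \<S> K x \<longrightarrow> (w K has_derivative (\<lambda>h. grad_in w K x \<bullet> h)) (at x within K)"
      using reg(1) by simp
    show "\<forall>T\<in>\<S>. \<forall>i. (\<lambda>x. g T x $ i) \<in> poly_space (k - 1)" using g by simp
    show "\<forall>T\<in>\<S>. \<forall>x\<in>T. regular_point \<S> K x \<longrightarrow> grad_in w K x = g T x" using reg(2) by simp
  qed
qed

lemma AE_regular_volume:
  fixes K :: "(real^'n) set"
  assumes fin: "finite \<S>" and K: "\<Union>\<S> = K" and simp: "\<And>T. T \<in> \<S> \<Longrightarrow> int CARD('n) simplex T"
  shows "AE x in lebesgue. x \<in> K \<longrightarrow> regular_point \<S> K x"
proof -
  have "AE x in lebesgue. x \<notin> frontier T" if "T \<in> \<S>" for T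
    using negligible_convex_frontier[OF convex_simplex[OF simp[OF that]]]
    by (simp add: negligible_iff_null_sets AE_not_in)
  then have "AE x in lebesgue. \<forall>T\<in>\<S>. x \<notin> frontier T" using fin by (simp add: AE_finite_all)
  then show ?thesis
  proof eventually_elim
    case (elim x)
    show ?case
    proof
      assume "x \<in> K"
      then obtain T where T: "T \<in> \<S>" "x \<in> T" using K by blast
      then have "x \<in> interior T" using elim closure_subset by (auto simp: frontier_def)
      then show "regular_point \<S> K x"
        using T interior_subset unfolding regular_point_def
        by (intro bexI[of _ T] conjI exI[of _ "interior T"]) auto
    qed
  qed
qed

lemma AE_regular_face:
  fixes K :: "(real^'n) set"
  assumes tri: "triangulation \<S>" and simp: "\<And>T. T \<in> \<S> \<Longrightarrow> int CARD('n) simplex T" and K: "\<Union>\<S> = K"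
    and d: "CARD('n) \<ge> 2" and F: "flat_face F n b" "F \<subseteq> frontier K"
  shows "AE x in face_measure F. regular_point \<S> K x \<and>
    (\<exists>T\<in>\<S>. \<exists>f. f facet_of T \<and> f \<subseteq> frontier K \<and> affine hull f = affine hull F \<and> x \<in> f)"
proof (rule triangulation_boundary_cover[OF tri simp K d F])
  fix \<N> assume N: "finite \<N>" "\<And>N. N \<in> \<N> \<Longrightarrow> aff_dim N < int CARD('n) - 1 \<and> closed N"
    and cov: "\<And>x. x \<in> F - \<Union>\<N> \<Longrightarrow> \<exists>T\<in>\<S>. \<exists>f. f facet_of T \<and> f \<subseteq> frontier K \<and> affine hull f = affine hull F \<and> x \<in> f \<and>
      (\<exists>U. open U \<and> x \<in> U \<and> K \<inter> U \<subseteq> T)"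
  have "AE x in face_measure F. x \<notin> \<Union>\<N>" by (rule AE_face_measure_avoid[OF F(1) N])
  moreover have "AE x in face_measure F. x \<in> F" by (rule AE_face_measure_in[OF F(1)])
  ultimately show ?thesis
  proof eventually_elim
    case (elim x)
    then obtain T f U where T: "T \<in> \<S>" "f facet_of T" "f \<subseteq> frontier K" "affine hull f = affine hull F" "x \<in> f"
      "open U" "x \<in> U" "K \<inter> U \<subseteq> T"
      using cov[of x] by blast
    have "x \<in> T" using T facet_of_imp_subset by blast
    then have "regular_point \<S> K x" unfolding regular_point_def using T by blast
    then show ?case using T by blast
  qed
qed

section \<open>Strongly monotone equations in finite dimension\<close>

text \<open>The map x - \<tau> A x is a contraction in the Euclidean norm of the coordinates in E:
  monotonicity gains 2 \<tau> c, the Lipschitz bound costs the square of \<tau> times M', and \<tau>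
  = c / M' balances them. Points are total functions of which only the coordinates in E are
  measured, so the iterates converge coordinate by coordinate.\<close>

lemma zarantonello_finite:
  fixes A :: "('e \<Rightarrow> real) \<Rightarrow> 'e \<Rightarrow> real"
  assumes fin: "finite E" and c: "c > 0"
    and mono: "\<And>x y. c * (\<Sum>e\<in>E. (x e - y e)\<^sup>2) \<le> (\<Sum>e\<in>E. (A x e - A y e) * (x e - y e))"
    and lip: "\<And>x y. (\<Sum>e\<in>E. (A x e - A y e)\<^sup>2) \<le> M * (\<Sum>e\<in>E. (x e - y e)\<^sup>2)"
  shows "\<exists>x. \<forall>e\<in>E. A x e = 0"
proof -
  \<comment> \<open>Exceeding the square of c keeps the contraction factor \<open>q\<close>
    nonnegative, so that its square root can serve as the ratio of a geometric series.\<close>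
  define M' where "M' = \<bar>M\<bar> + c\<^sup>2 + 1"
  have M': "M' > 0" "c\<^sup>2 < M'" by (auto simp: M'_def add_nonneg_pos)
  have MM': "M \<le> M'" using abs_ge_self[of M] zero_le_power2[of c] unfolding M'_def by linarith
  define \<tau> where "\<tau> = c / M'"
  have \<tau>: "\<tau> > 0" using c M' by (simp add: \<tau>_def)
  define q where "q = 1 - c\<^sup>2 / M'"
  have q: "0 \<le> q" "q < 1" using M' c by (auto simp: q_def field_simps)
  define G where "G x e = x e - \<tau> * A x e" for x e
  define D where "D x y = (\<Sum>e\<in>E. (x e - y e)\<^sup>2)" for x y :: "'e \<Rightarrow> real"
  have Dnn: "D x y \<ge> 0" for x y by (auto simp: D_def intro: sum_nonneg)
  have contr: "D (G x) (G y) \<le> q * D x y" for x y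
  proof -
    have "D (G x) (G y) = D x y - 2 * \<tau> * (\<Sum>e\<in>E. (A x e - A y e) * (x e - y e)) + \<tau>\<^sup>2 * (\<Sum>e\<in>E. (A x e - A y e)\<^sup>2)"
      unfolding D_def G_def sum_distrib_left sum_subtractf[symmetric] sum.distrib[symmetric]
      by (rule sum.cong) (auto simp: power2_eq_square algebra_simps)
    also have "\<dots> \<le> D x y - 2 * \<tau> * (c * D x y) + \<tau>\<^sup>2 * (M' * D x y)"
    proof -
      have "2 * \<tau> * (c * D x y) \<le> 2 * \<tau> * (\<Sum>e\<in>E. (A x e - A y e) * (x e - y e))"
        using mono[of x y] \<tau> by (intro mult_left_mono) (auto simp: D_def)
      moreover have "(\<Sum>e\<in>E. (A x e - A y e)\<^sup>2) \<le> M' * D x y"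
      proof -
        have "M * D x y \<le> M' * D x y" by (rule mult_right_mono[OF MM' Dnn])
        then show ?thesis using lip[of x y] by (simp add: D_def)
      qed
      then have "\<tau>\<^sup>2 * (\<Sum>e\<in>E. (A x e - A y e)\<^sup>2) \<le> \<tau>\<^sup>2 * (M' * D x y)" by (intro mult_left_mono) auto
      ultimately show ?thesis by linarith
    qed
    also have "\<dots> = q * D x y"
    proof -
      have "\<tau>\<^sup>2 * M' = \<tau> * c" using M' by (simp add: \<tau>_def power2_eq_square)
      moreover have "\<tau> * c = c\<^sup>2 / M'" by (simp add: \<tau>_def power2_eq_square)
      ultimately have "\<tau>\<^sup>2 * (M' * D x y) = c\<^sup>2 / M' * D x y" "2 * \<tau> * (c * D x y) = 2 * (c\<^sup>2 / M' * D x y)"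
        by (simp_all only: mult.assoc[symmetric]) (simp_all add: mult.assoc)
      then show ?thesis by (simp add: q_def algebra_simps)
    qed
    finally show ?thesis .
  qed
  define X where "X m = (G ^^ m) (\<lambda>_. 0)" for m
  have XS: "X (Suc m) = G (X m)" for m by (simp add: X_def)
  define d0 where "d0 = D (X 1) (X 0)"
  have dec: "D (X (Suc m)) (X m) \<le> q ^ m * d0" for m
  proof (induction m)
    case 0 then show ?case by (simp add: d0_def)
  next
    case (Suc m)
    have "D (X (Suc (Suc m))) (X (Suc m)) \<le> q * D (X (Suc m)) (X m)" unfolding XS by (rule contr)
    also have "\<dots> \<le> q * (q ^ m * d0)" by (rule mult_left_mono[OF Suc q(1)])
    finally show ?case by (simp add: mult.assoc)
  qed
  have single: "\<bar>x e - y e\<bar> \<le> sqrt (D x y)" if "e \<in> E" for x y e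
  proof -
    have "(x e - y e)\<^sup>2 \<le> D x y" unfolding D_def using fin that by (intro member_le_sum) auto
    then have "sqrt ((x e - y e)\<^sup>2) \<le> sqrt (D x y)" by (rule real_sqrt_le_mono)
    then show ?thesis by simp
  qed
  have sq: "0 \<le> sqrt q" "sqrt q < 1" using q by auto
  have conv: "\<exists>l. (\<lambda>m. X m e) \<longlonglongrightarrow> l" if e: "e \<in> E" for e
  proof -
    have "norm (X (Suc m) e - X m e) \<le> sqrt d0 * sqrt q ^ m" for m
    proof -
      have "\<bar>X (Suc m) e - X m e\<bar> \<le> sqrt (D (X (Suc m)) (X m))" by (rule single[OF e])
      also have "\<dots> \<le> sqrt (q ^ m * d0)" by (rule real_sqrt_le_mono[OF dec])
      finally show ?thesis by (simp add: real_sqrt_mult real_sqrt_power mult.commute)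
    qed
    moreover have "summable (\<lambda>m. sqrt d0 * sqrt q ^ m)"
      by (intro summable_mult summable_geometric) (use sq in simp)
    ultimately have "summable (\<lambda>m. X (Suc m) e - X m e)"
      using summable_comparison_test'[of "\<lambda>m. sqrt d0 * sqrt q ^ m" 0 "\<lambda>m. X (Suc m) e - X m e"] by blast
    then have "(\<lambda>m. \<Sum>i<m. X (Suc i) e - X i e) \<longlonglongrightarrow> (\<Sum>m. X (Suc m) e - X m e)" by (rule summable_LIMSEQ)
    then have "(\<lambda>m. X m e - X 0 e) \<longlonglongrightarrow> (\<Sum>m. X (Suc m) e - X m e)"
      by (simp only: sum_lessThan_telescope[of "\<lambda>m. X m e"])
    then have "(\<lambda>m. (X m e - X 0 e) + X 0 e) \<longlonglongrightarrow> (\<Sum>m. X (Suc m) e - X m e) + X 0 e"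
      by (intro tendsto_add tendsto_const)
    then show ?thesis by auto
  qed
  then obtain x where x: "\<And>e. e \<in> E \<Longrightarrow> (\<lambda>m. X m e) \<longlonglongrightarrow> x e" by metis
  have "A x e = 0" if e: "e \<in> E" for e
  proof -
    have Dlim: "(\<lambda>m. D (X m) x) \<longlonglongrightarrow> 0"
    proof -
      have "(\<lambda>m. D (X m) x) \<longlonglongrightarrow> (\<Sum>e\<in>E. (x e - x e)\<^sup>2)"
        unfolding D_def by (intro tendsto_sum tendsto_power tendsto_diff x tendsto_const)
      then show ?thesis by simp
    qed
    have "(\<lambda>m. A (X m) e) \<longlonglongrightarrow> A x e"
    proof (rule Lim_null[THEN iffD2], rule Lim_null_comparison[where g = "\<lambda>m. sqrt (M' * D (X m) x)"])
      show "\<forall>\<^sub>F m in sequentially. norm (A (X m) e - A x e) \<le> sqrt (M' * D (X m) x)"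
      proof (rule always_eventually, rule allI)
        fix m
        have "\<bar>A (X m) e - A x e\<bar> \<le> sqrt (D (A (X m)) (A x))" by (rule single[OF e])
        also have "\<dots> \<le> sqrt (M' * D (X m) x)"
        proof (rule real_sqrt_le_mono)
          have "M * D (X m) x \<le> M' * D (X m) x" by (rule mult_right_mono[OF MM' Dnn])
          then show "D (A (X m)) (A x) \<le> M' * D (X m) x" using lip[of "X m" x] by (simp add: D_def)
        qed
        finally show "norm (A (X m) e - A x e) \<le> sqrt (M' * D (X m) x)" by simp
      qed
      have "(\<lambda>m. sqrt (M' * D (X m) x)) \<longlonglongrightarrow> sqrt (M' * 0)"
        by (intro tendsto_real_sqrt tendsto_mult Dlim tendsto_const)
      then show "(\<lambda>m. sqrt (M' * D (X m) x)) \<longlonglongrightarrow> 0" by simp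
    qed
    moreover have "(\<lambda>m. A (X m) e) \<longlonglongrightarrow> 0"
    proof -
      have "A (X m) e = (X m e - X (Suc m) e) / \<tau>" for m
        using \<tau> by (simp add: XS G_def)
      moreover have "(\<lambda>m. (X m e - X (Suc m) e) / \<tau>) \<longlonglongrightarrow> (x e - x e) / \<tau>"
        by (intro tendsto_divide tendsto_diff x[OF e] LIMSEQ_Suc[OF x[OF e]] tendsto_const) (use \<tau> in auto)
      ultimately show ?thesis by simp
    qed
    ultimately show ?thesis by (rule LIMSEQ_unique)
  qed
  then show ?thesis by blast
qed

section \<open>Orthonormal bases in spaces of families of functions\<close>

definition lin_closed :: "('s \<Rightarrow> 'p \<Rightarrow> real) set \<Rightarrow> bool" where
  "lin_closed V \<longleftrightarrow> (\<lambda>K x. 0) \<in> V \<and> (\<forall>u\<in>V. \<forall>v\<in>V. \<forall>a b. (\<lambda>K x. a * u K x + b * v K x) \<in> V)"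

lemma lin_closedD:
  assumes V: "lin_closed V" and u: "u \<in> V" and v: "v \<in> V"
  shows "(\<lambda>K x. a * u K x + b * v K x) \<in> V"
proof -
  have "\<forall>u\<in>V. \<forall>v\<in>V. \<forall>a b. (\<lambda>K x. a * u K x + b * v K x) \<in> V"
    using V unfolding lin_closed_def by (rule conjunct2)
  then have "\<forall>a b. (\<lambda>K x. a * u K x + b * v K x) \<in> V" by (rule bspec[OF bspec[OF _ u] v])
  then have "\<forall>b. (\<lambda>K x. a * u K x + b * v K x) \<in> V" by (rule spec)
  then show ?thesis by (rule spec)
qed

lemma lin_closed_sum:
  assumes V: "lin_closed V" and fin: "finite E" "\<And>e. e \<in> E \<Longrightarrow> f e \<in> V"
  shows "(\<lambda>K x. \<Sum>e\<in>E. c e * f e K x) \<in> V"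
  using fin
proof (induction E)
  case empty
  then show ?case using V by (simp add: lin_closed_def)
next
  case (insert e E)
  then have "f e \<in> V" "(\<lambda>K x. \<Sum>e\<in>E. c e * f e K x) \<in> V" by auto
  from lin_closedD[OF V this, of "c e" 1] show ?case using insert by simp
qed

lemma lin_functional_sum:
  assumes V: "lin_closed V" and \<phi>: "\<And>u v a b. u \<in> V \<Longrightarrow> v \<in> V \<Longrightarrow> \<phi> (\<lambda>K x. a * u K x + b * v K x) = a * \<phi> u + b * \<phi> v"
    and fin: "finite E" "\<And>e. e \<in> E \<Longrightarrow> f e \<in> V"
  shows "\<phi> (\<lambda>K x. \<Sum>e\<in>E. c e * f e K x) = (\<Sum>e\<in>E. c e * (\<phi> (f e) :: real))"
  using fin
proof (induction E)
  case empty
  have "(\<lambda>K x. 0) \<in> V" using V by (simp add: lin_closed_def)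
  from \<phi>[OF this this, of 0 0] show ?case by simp
next
  case (insert e E)
  have "f e \<in> V" using insert by simp
  moreover have "(\<lambda>K x. \<Sum>e\<in>E. c e * f e K x) \<in> V"
    by (rule lin_closed_sum[OF V]) (use insert in auto)
  ultimately have "f e \<in> V" "(\<lambda>K x. \<Sum>e\<in>E. c e * f e K x) \<in> V" .
  from \<phi>[OF this, of "c e" 1] show ?case using insert by simp
qed

text \<open>The form is an inner product on V only, and the spanning family may be dependent. Each
  member either has a residual of norm zero, which vanishes by definiteness, or contributes its
  normalised residual to the basis.\<close>

lemma gram_schmidt:
  fixes V :: "('s \<Rightarrow> 'p \<Rightarrow> real) set" and g :: "('s \<Rightarrow> 'p \<Rightarrow> real) \<Rightarrow> ('s \<Rightarrow> 'p \<Rightarrow> real) \<Rightarrow> real"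
  assumes V: "lin_closed V"
    and lin: "\<And>u v w a b. u \<in> V \<Longrightarrow> v \<in> V \<Longrightarrow> w \<in> V \<Longrightarrow> g (\<lambda>K x. a * u K x + b * v K x) w = a * g u w + b * g v w"
    and sym: "\<And>u v. u \<in> V \<Longrightarrow> v \<in> V \<Longrightarrow> g u v = g v u"
    and pos: "\<And>v. v \<in> V \<Longrightarrow> g v v \<ge> 0" and def: "\<And>v. v \<in> V \<Longrightarrow> g v v = 0 \<Longrightarrow> v = (\<lambda>K x. 0)"
    and fin: "finite I" and B: "\<And>i. i \<in> I \<Longrightarrow> B i \<in> V"
    and span: "\<And>v. v \<in> V \<Longrightarrow> \<exists>c. v = (\<lambda>K x. \<Sum>i\<in>I. c i * B i K x)"
  obtains E where "finite E" "E \<subseteq> V" "\<And>e e'. e \<in> E \<Longrightarrow> e' \<in> E \<Longrightarrow> g e e' = (if e = e' then 1 else 0)"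
    "\<And>v. v \<in> V \<Longrightarrow> v = (\<lambda>K x. \<Sum>e\<in>E. g v e * e K x)"
proof -
  have gsum: "g (\<lambda>K x. \<Sum>e\<in>E. c e * f e K x) w = (\<Sum>e\<in>E. c e * g (f e) w)"
    if "finite E" "\<And>e. e \<in> E \<Longrightarrow> f e \<in> V" "w \<in> V" for E c w and f :: "'i \<Rightarrow> 's \<Rightarrow> 'p \<Rightarrow> real"
    by (rule lin_functional_sum[OF V, of "\<lambda>u. g u w"]) (use that lin in auto)
  have gsum': "g (\<lambda>K x. \<Sum>e\<in>E. c e * e K x) w = (\<Sum>e\<in>E. c e * g e w)"
    if "finite E" "E \<subseteq> V" "w \<in> V" for E c w
    by (rule lin_functional_sum[OF V, of "\<lambda>u. g u w" E "\<lambda>e. e"]) (use that lin in auto)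
  have "\<exists>E. finite E \<and> E \<subseteq> V \<and> (\<forall>e\<in>E. \<forall>e'\<in>E. g e e' = (if e = e' then 1 else 0)) \<and>
      (\<forall>i\<in>I. B i = (\<lambda>K x. \<Sum>e\<in>E. g (B i) e * e K x))"
    using fin B
  proof (induction I)
    case empty then show ?case by (intro exI[of _ "{}"]) auto
  next
    case (insert j I)
    then obtain E where E: "finite E" "E \<subseteq> V" "\<forall>e\<in>E. \<forall>e'\<in>E. g e e' = (if e = e' then 1 else 0)"
      "\<forall>i\<in>I. B i = (\<lambda>K x. \<Sum>e\<in>E. g (B i) e * e K x)" by auto
    have Bj: "B j \<in> V" using insert by simp
    define p where "p = (\<lambda>K x. \<Sum>e\<in>E. g (B j) e * e K x)"
    have pV: "p \<in> V" unfolding p_def by (rule lin_closed_sum[OF V]) (use E in auto)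
    define r where "r = (\<lambda>K x. 1 * B j K x + (-1) * p K x)"
    have rV: "r \<in> V" unfolding r_def by (rule lin_closedD[OF V Bj pV])
    have ge: "g r e = 0" if e: "e \<in> E" for e
    proof -
      have eV: "e \<in> V" using e E by blast
      have "g p e = (\<Sum>e'\<in>E. g (B j) e' * g e' e)" unfolding p_def by (rule gsum'[OF E(1,2) eV])
      also have "\<dots> = (\<Sum>e'\<in>E. if e' = e then g (B j) e' else 0)" by (rule sum.cong) (use E(3) e in auto)
      also have "\<dots> = g (B j) e" using e E(1) by simp
      finally show ?thesis unfolding r_def using lin[OF Bj pV eV, of 1 "-1"] by simp
    qed
    show ?case
    proof (cases "g r r = 0")
      case True
      then have "r = (\<lambda>K x. 0)" using def[OF rV] by simp
      then have "B j K x - p K x = 0" for K x unfolding r_def by (simp add: fun_eq_iff)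
      then have "B j = (\<lambda>K x. \<Sum>e\<in>E. g (B j) e * e K x)" by (simp add: p_def fun_eq_iff)
      then show ?thesis using E by (intro exI[of _ E]) auto
    next
      case False
      then have rp: "g r r > 0" using pos[OF rV] by simp
      define s where "s = sqrt (g r r)"
      have s: "s > 0" "s * s = g r r" using rp by (auto simp: s_def)
      \<comment> \<open>The zero summand gives the rescaled residual the two-term shape that
        \<open>lin\<close> and \<open>lin_closedD\<close> speak about.\<close>
      define e' where "e' = (\<lambda>K x. (1 / s) * r K x + 0 * r K x)"
      have e'V: "e' \<in> V" unfolding e'_def by (rule lin_closedD[OF V rV rV])
      have ge': "g e' w = g r w / s" if "w \<in> V" for w
        unfolding e'_def using lin[OF rV rV that, of "1 / s" 0] by simp
      have g1: "g e' e' = 1"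
        using ge'[OF e'V] ge'[OF rV] sym[OF rV e'V] s rp by (simp add: field_simps)
      have g0: "g e' e = 0" "g e e' = 0" if "e \<in> E" for e
      proof -
        have eV: "e \<in> V" using that E(2) by blast
        show "g e' e = 0" using ge'[OF eV] ge[OF that] by simp
        then show "g e e' = 0" using sym[OF e'V eV] by simp
      qed
      then have ne: "e' \<notin> E" using g1 by auto
      have Bi: "B i = (\<lambda>K x. \<Sum>e\<in>insert e' E. g (B i) e * e K x)" if i: "i \<in> I" for i
      proof -
        have "g (B i) e' = g (\<lambda>K x. \<Sum>e\<in>E. g (B i) e * e K x) e'" using E(4) i by simp
        also have "\<dots> = (\<Sum>e\<in>E. g (B i) e * g e e')" by (rule gsum'[OF E(1,2) e'V])
        also have "\<dots> = 0" using g0 by simp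
        finally have "(\<lambda>K x. \<Sum>e\<in>insert e' E. g (B i) e * e K x) = (\<lambda>K x. \<Sum>e\<in>E. g (B i) e * e K x)"
          using ne E(1) by simp
        then show ?thesis using E(4) i by simp
      qed
      have Bj': "B j = (\<lambda>K x. \<Sum>e\<in>insert e' E. g (B j) e * e K x)"
      proof -
        have gp: "g p e' = 0"
        proof -
          have "g p e' = (\<Sum>e\<in>E. g (B j) e * g e e')" unfolding p_def by (rule gsum'[OF E(1,2) e'V])
          then show ?thesis using g0 by simp
        qed
        have "g r e' = g (B j) e' - g p e'" unfolding r_def using lin[OF Bj pV e'V, of 1 "-1"] by simp
        moreover have "g r e' = s"
        proof -
          have "g r e' = (s * s) / s" using sym[OF rV e'V] ge'[OF rV] s(2) by simp
          then show ?thesis using s(1) by simp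
        qed
        ultimately have gj: "g (B j) e' = s" using gp by simp
        have "(\<Sum>e\<in>insert e' E. g (B j) e * e K x) = B j K x" for K x
        proof -
          have "(\<Sum>e\<in>insert e' E. g (B j) e * e K x) = s * e' K x + p K x"
            using ne E(1) gj by (simp add: p_def)
          also have "s * e' K x = r K x" using s by (simp add: e'_def)
          finally show ?thesis by (simp add: r_def)
        qed
        then show ?thesis by simp
      qed
      show ?thesis
      proof (intro exI[of _ "insert e' E"] conjI)
        show "\<forall>e\<in>insert e' E. \<forall>e''\<in>insert e' E. g e e'' = (if e = e'' then 1 else 0)"
          using E(3) g0 g1 ne by auto
        show "\<forall>i\<in>insert j I. B i = (\<lambda>K x. \<Sum>e\<in>insert e' E. g (B i) e * e K x)"
          using Bi Bj' by blast
      qed (use E e'V in auto)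
    qed
  qed
  then obtain E where E: "finite E" "E \<subseteq> V" "\<forall>e\<in>E. \<forall>e'\<in>E. g e e' = (if e = e' then 1 else 0)"
      "\<forall>i\<in>I. B i = (\<lambda>K x. \<Sum>e\<in>E. g (B i) e * e K x)" by blast
  show ?thesis
  proof (rule that[OF E(1,2)])
    show "g e e' = (if e = e' then 1 else 0)" if "e \<in> E" "e' \<in> E" for e e' using E(3) that by blast
    fix v assume "v \<in> V"
    then obtain c where c: "v = (\<lambda>K x. \<Sum>i\<in>I. c i * B i K x)" using span by blast
    have "g v e = (\<Sum>i\<in>I. c i * g (B i) e)" if "e \<in> E" for e
      unfolding c by (rule gsum) (use fin B E that in auto)
    then have "(\<Sum>e\<in>E. g v e * e K x) = (\<Sum>e\<in>E. (\<Sum>i\<in>I. c i * g (B i) e) * e K x)" for K x by simp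
    also have "(\<Sum>e\<in>E. (\<Sum>i\<in>I. c i * g (B i) e) * e K x) = (\<Sum>i\<in>I. c i * (\<Sum>e\<in>E. g (B i) e * e K x))" for K x
      unfolding sum_distrib_right sum_distrib_left mult.assoc by (rule sum.swap)
    also have "(\<Sum>i\<in>I. c i * (\<Sum>e\<in>E. g (B i) e * e K x)) = (\<Sum>i\<in>I. c i * B i K x)" for K x
    proof (rule sum.cong)
      fix i assume "i \<in> I"
      then have "B i = (\<lambda>K x. \<Sum>e\<in>E. g (B i) e * e K x)" using E(4) by blast
      then have "B i K x = (\<Sum>e\<in>E. g (B i) e * e K x)" by metis
      then show "c i * (\<Sum>e\<in>E. g (B i) e * e K x) = c i * B i K x" by simp
    qed simp
    finally show "v = (\<lambda>K x. \<Sum>e\<in>E. g v e * e K x)" by (simp add: c)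
  qed
qed

section \<open>Bounded measurable functions and coefficients\<close>

text \<open>The class is closed under sums and bounded bilinear maps and is integrable for a finite
  measure, so the integrands of all forms below are handled by one set of closure rules.\<close>

definition bdd_meas :: "'a measure \<Rightarrow> ('a \<Rightarrow> 'b::{real_normed_vector,second_countable_topology}) \<Rightarrow> bool" where
  "bdd_meas M f \<longleftrightarrow> f \<in> borel_measurable M \<and> (\<exists>C. AE x in M. norm (f x) \<le> C)"

lemma bdd_meas_measurable: "bdd_meas M f \<Longrightarrow> f \<in> borel_measurable M"
  by (simp add: bdd_meas_def)

lemma bdd_meas_const: "bdd_meas M (\<lambda>x. c)"
  by (auto simp: bdd_meas_def)

lemma bdd_meas_bilinear:
  fixes H :: "'b::{real_normed_vector,second_countable_topology} \<Rightarrow> 'c::{real_normed_vector,second_countable_topology} \<Rightarrow> 'd::{real_normed_vector,second_countable_topology}"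
  assumes H: "bounded_bilinear H" and f: "bdd_meas M f" and g: "bdd_meas M g"
  shows "bdd_meas M (\<lambda>x. H (f x) (g x))"
proof -
  have "(\<lambda>x. H (f x) (g x)) \<in> borel_measurable M"
    by (rule borel_measurable_continuous_Pair[OF bdd_meas_measurable[OF f] bdd_meas_measurable[OF g]])
       (intro bounded_bilinear.continuous_on[OF H] continuous_intros)
  moreover obtain A where A: "AE x in M. norm (f x) \<le> A" using f by (auto simp: bdd_meas_def)
  moreover obtain B where B: "AE x in M. norm (g x) \<le> B" using g by (auto simp: bdd_meas_def)
  moreover obtain C where C: "C > 0" "\<And>a b. norm (H a b) \<le> norm a * norm b * C"
    using bounded_bilinear.pos_bounded[OF H] by blast
  have "AE x in M. norm (H (f x) (g x)) \<le> \<bar>A\<bar> * \<bar>B\<bar> * C"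
    using A B
  proof eventually_elim
    case (elim x)
    have "norm (H (f x) (g x)) \<le> norm (f x) * norm (g x) * C" by (rule C(2))
    also have "\<dots> \<le> \<bar>A\<bar> * \<bar>B\<bar> * C"
      using elim C(1) by (intro mult_right_mono mult_mono) auto
    finally show ?case .
  qed
  ultimately show ?thesis unfolding bdd_meas_def by blast
qed

lemma bdd_meas_add: "bdd_meas M f \<Longrightarrow> bdd_meas M g \<Longrightarrow> bdd_meas M (\<lambda>x. f x + g x)"
proof -
  assume f: "bdd_meas M f" and g: "bdd_meas M g"
  have "(\<lambda>x. f x + g x) \<in> borel_measurable M"
    using bdd_meas_measurable[OF f] bdd_meas_measurable[OF g] by (rule borel_measurable_add)
  moreover obtain A where A: "AE x in M. norm (f x) \<le> A" using f by (auto simp: bdd_meas_def)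
  moreover obtain B where B: "AE x in M. norm (g x) \<le> B" using g by (auto simp: bdd_meas_def)
  have "AE x in M. norm (f x + g x) \<le> A + B"
    using A B by eventually_elim (meson norm_triangle_mono)
  ultimately show ?thesis unfolding bdd_meas_def by blast
qed

lemmas bdd_meas_mult = bdd_meas_bilinear[OF bounded_bilinear_mult]
lemmas bdd_meas_scaleR = bdd_meas_bilinear[OF bounded_bilinear_scaleR]
lemmas bdd_meas_inner = bdd_meas_bilinear[OF bounded_bilinear_inner]

lemma bounded_bilinear_matvec: "bounded_bilinear (\<lambda>(A :: real^'n^'n) y. A *v y)"
  by (rule bilinear_conv_bounded_bilinear[THEN iffD1])
     (auto simp: bilinear_def matrix_vector_right_distrib matrix_vector_mult_add_rdistrib
        matrix_vector_mult_scaleR scaleR_matrix_vector_assoc intro!: linearI)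

lemmas bdd_meas_matvec = bdd_meas_bilinear[OF bounded_bilinear_matvec]

lemma bdd_meas_sum: "(\<And>i. i \<in> I \<Longrightarrow> bdd_meas M (f i)) \<Longrightarrow> bdd_meas M (\<lambda>x. \<Sum>i\<in>I. f i x)"
  by (induction I rule: infinite_finite_induct) (auto intro: bdd_meas_const bdd_meas_add)

lemma bdd_meas_cong_AE:
  assumes "complete_measure M" "bdd_meas M f" "AE x in M. f x = g x"
  shows "bdd_meas M g"
proof -
  have "g \<in> borel_measurable M"
    by (rule measurable_cong_AE_complete[OF assms(1) bdd_meas_measurable[OF assms(2)] assms(3)]) simp
  moreover obtain A where A: "AE x in M. norm (f x) \<le> A" using assms(2) by (auto simp: bdd_meas_def)
  have "AE x in M. norm (g x) \<le> A" using A assms(3) by eventually_elim simp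
  ultimately show ?thesis unfolding bdd_meas_def by blast
qed

lemma bdd_meas_integrable:
  fixes f :: "'a \<Rightarrow> 'b::{banach,second_countable_topology}"
  assumes "finite_measure M" "bdd_meas M f"
  shows "integrable M f"
proof -
  obtain A where A: "AE x in M. norm (f x) \<le> A" using assms(2) by (auto simp: bdd_meas_def)
  show ?thesis
    by (rule finite_measure.integrable_const_bound[OF assms(1) A bdd_meas_measurable[OF assms(2)]])
qed

section \<open>Essential bounds and measurability of matrix coefficients\<close>

lemma Linf_norm_properties:
  assumes g: "g \<in> borel_measurable (lebesgue_on S)" and C: "AE x in lebesgue_on S. g x \<le> C"
  shows "AE x in lebesgue_on S. g x \<le> Linf_norm S g" "Linf_norm S g \<ge> 0"
proof -
  let ?E = "esssup (lebesgue_on S) (\<lambda>x. ennreal (g x))"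
  \<comment> \<open>As \<open>enn2real\<close> sends infinity to 0, the essential supremum has to be
    finite before its real value bounds anything.\<close>
  have "?E \<le> ennreal C"
    by (rule esssup_I) (use g C in \<open>auto intro: ennreal_leI elim!: eventually_mono\<close>)
  then have E: "ennreal (enn2real ?E) = ?E" by (metis ennreal_enn2real ennreal_less_top le_less_trans)
  have "AE x in lebesgue_on S. ennreal (g x) \<le> ?E" by (rule esssup_AE)
  then show "AE x in lebesgue_on S. g x \<le> Linf_norm S g"
  proof eventually_elim
    case (elim x)
    then have "ennreal (g x) \<le> ennreal (enn2real ?E)" using E by simp
    then show ?case unfolding Linf_norm_def by (simp add: ennreal_le_iff)
  qed
  show "Linf_norm S g \<ge> 0" by (simp add: Linf_norm_def)
qed

lemma mat_norm_bound: "mat_norm (A :: real^'n^'n) \<le> C" if "\<And>y. norm (A *v y) \<le> C * norm y"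
  unfolding mat_norm_def by (rule onorm_le) (rule that)

lemma mat_norm_le_norm:
  obtains C where "C > 0" "\<And>A :: real^'n^'n. mat_norm A \<le> C * norm A"
proof -
  obtain C where C: "C > 0" "\<And>(A :: real^'n^'n) y. norm (A *v y) \<le> norm A * norm y * C"
    using bounded_bilinear.pos_bounded[OF bounded_bilinear_matvec] by blast
  have "mat_norm A \<le> C * norm A" for A :: "real^'n^'n"
    by (rule mat_norm_bound) (use C(2)[of A] in \<open>simp add: mult_ac\<close>)
  then show ?thesis using that C(1) by blast
qed

lemma continuous_on_mat_norm: "continuous_on UNIV (mat_norm :: real^'n^'n \<Rightarrow> real)"
proof -
  obtain C where C: "C > 0" "\<And>A :: real^'n^'n. mat_norm A \<le> C * norm A" using mat_norm_le_norm by blast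
  have tri: "mat_norm A \<le> mat_norm B + C * norm (A - B)" for A B :: "real^'n^'n"
  proof (rule mat_norm_bound)
    fix y
    have "norm (A *v y) \<le> norm (B *v y) + norm ((A - B) *v y)"
      using norm_triangle_ineq[of "B *v y" "(A - B) *v y"] by (simp add: matrix_vector_mult_diff_rdistrib)
    also have "\<dots> \<le> mat_norm B * norm y + mat_norm (A - B) * norm y"
      by (intro add_mono norm_matrix_vector_le)
    also have "\<dots> \<le> mat_norm B * norm y + (C * norm (A - B)) * norm y"
      by (intro add_left_mono mult_right_mono C) simp
    finally show "norm (A *v y) \<le> (mat_norm B + C * norm (A - B)) * norm y" by (simp add: distrib_right)
  qed
  have "dist (mat_norm A) (mat_norm B) \<le> C * dist A B" for A B :: "real^'n^'n"
    using tri[of A B] tri[of B A] by (simp add: dist_norm norm_minus_commute abs_le_iff)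
  then have "C-lipschitz_on UNIV (mat_norm :: real^'n^'n \<Rightarrow> real)"
    using C(1) by (auto simp: lipschitz_on_def)
  then show ?thesis by (rule lipschitz_on_continuous_on)
qed

lemma borel_measurable_mat_norm:
  fixes D :: "'a \<Rightarrow> real^'n^'n"
  assumes "D \<in> borel_measurable M"
  shows "(\<lambda>x. mat_norm (D x)) \<in> borel_measurable M"
  using borel_measurable_continuous_on[OF continuous_on_mat_norm assms] .

lemma borel_measurable_entry:
  fixes D :: "'a \<Rightarrow> real^'n^'n"
  assumes "D \<in> borel_measurable M"
  shows "(\<lambda>x. D x $ i $ j) \<in> borel_measurable M"
  by (rule borel_measurable_continuous_on[OF _ assms]) (intro continuous_intros)

lemma borel_measurable_matrix:
  fixes f :: "'n::finite \<Rightarrow> 'n \<Rightarrow> 'a \<Rightarrow> real"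
  assumes "\<And>i j. f i j \<in> borel_measurable M"
  shows "(\<lambda>x. (\<chi> i j. f i j x) :: real^'n^'n) \<in> borel_measurable M"
proof (subst borel_measurable_euclidean_space, rule ballI)
  fix b :: "real^'n^'n" assume "b \<in> Basis"
  then obtain i j where "b = axis i (axis j 1)" by (auto simp: Basis_vec_def)
  then have "(\<lambda>x. ((\<chi> i j. f i j x) :: real^'n^'n) \<bullet> b) = f i j" by (auto simp: inner_axis)
  then show "(\<lambda>x. ((\<chi> i j. f i j x) :: real^'n^'n) \<bullet> b) \<in> borel_measurable M" using assms by simp
qed

text \<open>Cramer's rule writes the inverse through determinants, which makes it measurable
  together with the matrix.\<close>

lemma matrix_inv_entry:
  fixes A :: "real^'n^'n"
  assumes "invertible A"
  shows "matrix_inv A $ k $ j = det (\<chi> i l. if l = k then axis j 1 $ i else A $ i $ l) / det A"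
proof -
  define x where "x = matrix_inv A *v axis j 1"
  have Ax: "A *v x = axis j 1" by (simp add: x_def matrix_vector_mul_assoc matrix_inv_right assms)
  have "x $ k = matrix_inv A $ k $ j" by (simp add: x_def matrix_vector_mult_basis column_def)
  moreover have "det A \<noteq> 0" using assms by (simp add: invertible_det_nz)
  ultimately show ?thesis using cramer_lemma[of k A x, unfolded Ax] by simp
qed

lemma pos_def_invertible:
  fixes A :: "real^'n^'n"
  assumes "c > 0" "\<And>y. c * (y \<bullet> y) \<le> y \<bullet> (A *v y)"
  shows "invertible A"
proof -
  have "y = 0" if "A *v y = 0" for y
  proof -
    have "c * (y \<bullet> y) \<le> 0" using assms(2)[of y] that by simp
    then have "y \<bullet> y \<le> 0" using assms(1) by (simp add: mult_le_0_iff)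
    then show ?thesis by (metis inner_eq_zero_iff inner_ge_zero order_antisym)
  qed
  then have "\<exists>B. B ** A = mat 1" unfolding matrix_left_invertible_ker by blast
  then show ?thesis by (simp add: invertible_left_inverse)
qed

lemma mat_norm_inv_pos_def:
  fixes A :: "real^'n^'n"
  assumes "c > 0" "\<And>y. c * (y \<bullet> y) \<le> y \<bullet> (A *v y)"
  shows "mat_norm (matrix_inv A) \<le> 1 / c"
proof (rule mat_norm_bound)
  fix y
  define w where "w = matrix_inv A *v y"
  have "A *v w = y"
    using matrix_inv_right[OF pos_def_invertible[OF assms]] by (simp add: w_def matrix_vector_mul_assoc)
  then have "c * (norm w * norm w) \<le> w \<bullet> y"
    using assms(2)[of w] by (simp add: norm_eq_sqrt_inner flip: power2_eq_square)
  also have "\<dots> \<le> norm w * norm y" by (rule norm_cauchy_schwarz)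
  finally have "c * norm w \<le> norm y"
    by (cases "norm w = 0") (auto simp: mult.left_commute[of c] mult_le_cancel_left_pos)
  then show "norm (matrix_inv A *v y) \<le> 1 / c * norm y"
    using assms(1) by (simp add: w_def field_simps)
qed

lemma complete_lebesgue_on:
  assumes "S \<in> sets lebesgue"
  shows "complete_measure (lebesgue_on S)"
proof
  fix A B assume AB: "A \<subseteq> B" "B \<in> null_sets (lebesgue_on S)"
  then have "B \<in> null_sets lebesgue" "B \<subseteq> S" using assms by (auto simp: null_sets_restrict_space)
  then have "A \<in> sets lebesgue" using AB(1) completion.complete by blast
  then show "A \<in> sets (lebesgue_on S)" using AB(1) \<open>B \<subseteq> S\<close> assms by (auto simp: sets_restrict_space_iff)
qed

lemma matrix_inv_measurable:
  fixes D :: "'a \<Rightarrow> real^'n^'n"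
  assumes M: "complete_measure M" and D: "D \<in> borel_measurable M" and inv: "AE x in M. invertible (D x)"
  shows "(\<lambda>x. matrix_inv (D x)) \<in> borel_measurable M"
proof -
  define R where "R x = (\<chi> k j. det (\<chi> i l. if l = k then axis j 1 $ i else D x $ i $ l) / det (D x))" for x
  note [measurable] = borel_measurable_entry[OF D]
  have e[measurable]: "(\<lambda>x. if l = k then axis j 1 $ i else D x $ i $ l) \<in> borel_measurable M" for i l j k :: 'n
    by (cases "l = k") auto
  have "R \<in> borel_measurable M"
    unfolding R_def[abs_def] det_def vec_lambda_beta by (rule borel_measurable_matrix) measurable
  moreover have "AE x in M. R x = matrix_inv (D x)"
    using inv by eventually_elim (simp add: R_def vec_eq_iff matrix_inv_entry)
  ultimately show ?thesis by (rule measurable_cong_AE_complete[OF M]) simp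
qed

text \<open>Inclusion of K in the domain is asked only up to a null set, because closed elements
  contain boundary points of the open domain.\<close>

lemma L_infty_subset:
  fixes f :: "real^'n \<Rightarrow> 'b::{real_normed_vector,second_countable_topology}"
  assumes f: "L_infty \<Omega> f" and sub: "AE x in lebesgue. x \<in> K \<longrightarrow> x \<in> \<Omega>"
    and m: "\<Omega> \<in> sets lebesgue" "K \<in> sets lebesgue"
  shows "bdd_meas (lebesgue_on K) f"
    and "AE x in lebesgue_on \<Omega>. P x \<Longrightarrow> AE x in lebesgue_on K. P x"
proof -
  show ae: "AE x in lebesgue_on K. P x" if "AE x in lebesgue_on \<Omega>. P x" for P
  proof -
    have "AE x in lebesgue. x \<in> \<Omega> \<longrightarrow> P x" using that m by (simp add: AE_restrict_space_iff)
    then have "AE x in lebesgue. x \<in> K \<longrightarrow> P x" using sub by eventually_elim auto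
    then show ?thesis using m by (simp add: AE_restrict_space_iff)
  qed
  have "(\<lambda>x. indicator \<Omega> x *\<^sub>R f x) \<in> borel_measurable lebesgue"
    using f m by (simp add: L_infty_def borel_measurable_restrict_space_iff)
  then have "(\<lambda>x. indicator \<Omega> x *\<^sub>R f x) \<in> borel_measurable (lebesgue_on K)"
    by (rule measurable_restrict_space1)
  moreover have "AE x in lebesgue. x \<in> K \<longrightarrow> indicator \<Omega> x *\<^sub>R f x = f x"
    using sub by eventually_elim auto
  then have "AE x in lebesgue_on K. indicator \<Omega> x *\<^sub>R f x = f x"
    using m by (simp add: AE_restrict_space_iff)
  ultimately have "f \<in> borel_measurable (lebesgue_on K)"
    by (rule measurable_cong_AE_complete[OF complete_lebesgue_on[OF m(2)]]) simp
  moreover obtain C where "AE x in lebesgue_on \<Omega>. norm (f x) \<le> C" using f by (auto simp: L_infty_def)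
  then have "AE x in lebesgue_on K. norm (f x) \<le> C" by (rule ae)
  ultimately show "bdd_meas (lebesgue_on K) f" by (auto simp: bdd_meas_def)
qed

lemma diffusion_bounds:
  fixes D :: "real^'n \<Rightarrow> real^'n^'n"
  assumes D: "bdd_meas (lebesgue_on K) D" and K: "K \<in> sets lebesgue" "emeasure lebesgue K \<noteq> 0"
    and sym: "AE x in lebesgue_on K. transpose (D x) = D x"
    and D0: "D0 > 0" "AE x in lebesgue_on K. \<forall>y. D0 * (y \<bullet> y) \<le> y \<bullet> (D x *v y)"
  shows "AE x in lebesgue_on K. \<forall>y. (norm y)\<^sup>2 \<le> mat_Linf_norm K (\<lambda>x. matrix_inv (D x)) * (y \<bullet> (D x *v y))"
    and "AE x in lebesgue_on K. \<forall>y. (norm (mat_sqrt (D x) *v y))\<^sup>2 = y \<bullet> (D x *v y)"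
    and "AE x in lebesgue_on K. \<forall>y. 0 \<le> y \<bullet> (D x *v y)"
    and "mat_Linf_norm K D > 0" "mat_Linf_norm K (\<lambda>x. matrix_inv (D x)) > 0"
proof -
  let ?I = "mat_Linf_norm K (\<lambda>x. matrix_inv (D x))"
  have inv: "AE x in lebesgue_on K. invertible (D x)"
    using D0(2) by eventually_elim (use pos_def_invertible[OF D0(1)] in blast)
  have "AE x in lebesgue_on K. mat_norm (matrix_inv (D x)) \<le> 1 / D0"
    using D0(2) by eventually_elim (use mat_norm_inv_pos_def[OF D0(1)] in blast)
  then have I: "AE x in lebesgue_on K. mat_norm (matrix_inv (D x)) \<le> ?I"
    unfolding mat_Linf_norm_def
    by (intro Linf_norm_properties(1) borel_measurable_mat_norm
        matrix_inv_measurable[OF complete_lebesgue_on[OF K(1)] bdd_meas_measurable[OF D] inv])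
  obtain C where C: "C > 0" "\<And>A :: real^'n^'n. mat_norm A \<le> C * norm A" using mat_norm_le_norm by blast
  obtain B where B: "AE x in lebesgue_on K. norm (D x) \<le> B" using D by (auto simp: bdd_meas_def)
  have "AE x in lebesgue_on K. mat_norm (D x) \<le> C * B"
    using B
  proof eventually_elim
    case (elim x)
    have "mat_norm (D x) \<le> C * norm (D x)" by (rule C(2))
    also have "\<dots> \<le> C * B" using elim C(1) by simp
    finally show ?case .
  qed
  then have DD: "AE x in lebesgue_on K. mat_norm (D x) \<le> mat_Linf_norm K D"
    unfolding mat_Linf_norm_def
    by (intro Linf_norm_properties(1) borel_measurable_mat_norm bdd_meas_measurable[OF D])
  show pos: "AE x in lebesgue_on K. \<forall>y. 0 \<le> y \<bullet> (D x *v y)"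
    using D0(2)
  proof eventually_elim
    case (elim x)
    show ?case
    proof
      fix y :: "real^'n"
      have "0 \<le> D0 * (y \<bullet> y)" using D0(1) by simp
      then show "0 \<le> y \<bullet> (D x *v y)" using elim by (meson order_trans)
    qed
  qed
  show bd: "AE x in lebesgue_on K. \<forall>y. (norm y)\<^sup>2 \<le> ?I * (y \<bullet> (D x *v y))"
    using sym pos inv I
  proof eventually_elim
    case (elim x)
    show ?case
    proof
      fix y
      have "(norm y)\<^sup>2 \<le> mat_norm (matrix_inv (D x)) * (y \<bullet> (D x *v y))"
        by (rule norm_le_mat_norm_inverse[OF elim(1) _ elim(3)]) (use elim(2) in blast)
      also have "\<dots> \<le> ?I * (y \<bullet> (D x *v y))" by (rule mult_right_mono[OF elim(4)]) (use elim(2) in blast)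
      finally show "(norm y)\<^sup>2 \<le> ?I * (y \<bullet> (D x *v y))" .
    qed
  qed
  show "AE x in lebesgue_on K. \<forall>y. (norm (mat_sqrt (D x) *v y))\<^sup>2 = y \<bullet> (D x *v y)"
    using sym pos by eventually_elim (simp add: norm_mat_sqrt)
  \<comment> \<open>On a set of positive measure, facts that hold almost everywhere hold together at
    some point. There a nonpositive supremum contradicts ellipticity, tested with a unit
    vector.\<close>
  have nonnull: "\<not> (AE x in lebesgue_on K. False)"
  proof
    assume "AE x in lebesgue_on K. False"
    then have "AE x in lebesgue. x \<notin> K" using K(1) by (simp add: AE_restrict_space_iff)
    then have "K \<in> null_sets lebesgue" using K(1) by (simp add: AE_iff_null_sets)
    then show False using K(2) by auto
  qed
  obtain e :: "real^'n" where e: "norm e = 1" using vector_choose_size[of 1] by auto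
  have ee: "e \<bullet> e = 1" using e by (simp add: dot_square_norm)
  show "?I > 0"
  proof (rule ccontr)
    assume "\<not> ?I > 0"
    have "AE x in lebesgue_on K. False" using bd pos
    proof eventually_elim
      case (elim x)
      have "?I * (e \<bullet> (D x *v e)) \<le> 0" using \<open>\<not> ?I > 0\<close> elim(2) by (simp add: mult_nonpos_nonneg)
      then show False using elim(1)[rule_format, of e] e by simp
    qed
    then show False using nonnull by blast
  qed
  show "mat_Linf_norm K D > 0"
  proof (rule ccontr)
    assume n: "\<not> mat_Linf_norm K D > 0"
    have "AE x in lebesgue_on K. False" using DD D0(2)
    proof eventually_elim
      case (elim x)
      have "e \<bullet> (D x *v e) \<le> norm (D x *v e)" using norm_cauchy_schwarz[of e "D x *v e"] e by simp
      also have "\<dots> \<le> mat_norm (D x)" using norm_matrix_vector_le[of "D x" e] e by simp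
      also have "\<dots> \<le> 0" using elim(1) n by simp
      finally show False using elim(2)[rule_format, of e] ee D0(1) by simp
    qed
    then show False using nonnull by blast
  qed
qed

section \<open>The discrete problem\<close>

locale dg_problem =
  fixes \<Omega> :: "(real^'n) set"
    and \<P> \<F> :: "(real^'n) set set"
    and \<T> :: "(real^'n) set \<Rightarrow> (real^'n) set set"
    and D :: "real^'n \<Rightarrow> real^'n^'n"
    and \<mu> :: "real^'n \<Rightarrow> real"
    and k :: nat
    and Cstar Cqu Csh :: real
  assumes dim: "CARD('n) \<in> {2, 3}"
    and domain: "polyhedral_domain \<Omega>"
    and mesh: "admissible_mesh \<Omega> \<P> \<F> Cstar Cqu"
    and submesh: "admissible_submesh \<P> \<T> Csh"
    and diffusion: "diffusion_coefficient \<Omega> D"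
    and traces: "traces_well_defined \<P> \<F> D"
    and reaction: "L_infty \<Omega> \<mu>" "AE x in lebesgue_on \<Omega>. 0 \<le> \<mu> x"
    and degree: "k \<ge> 1"
begin

abbreviation "V \<equiv> V_space \<P> k"
abbreviation "W \<equiv> W_space \<P> \<T> k"
abbreviation "adj \<equiv> adjacent \<P>"
abbreviation "dK K \<equiv> mat_Linf_norm K D"
abbreviation "iK K \<equiv> mat_Linf_norm K (\<lambda>x. matrix_inv (D x))"

lemma d2: "CARD('n) \<ge> 2" using dim by auto

lemma d3: "CARD('n) \<le> 3" using dim by auto

lemma finite_P: "finite \<P>" and finite_F: "finite \<F>"
  using mesh by (auto simp: admissible_mesh_def subdivision_of_def mesh_faces_def)

lemma polyhedral_cover:
  "polyhedral (S :: (real^'n) set) \<Longrightarrow> \<exists>\<Q>. finite \<Q> \<and> S = \<Union>\<Q> \<and> (\<forall>Q\<in>\<Q>. polytope Q)"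
  unfolding polyhedral_def by blast

lemma polyhedral_compact: "polyhedral (S :: (real^'n) set) \<Longrightarrow> compact S"
proof -
  assume "polyhedral S"
  then obtain \<Q> where "finite \<Q>" "S = \<Union>\<Q>" "\<forall>Q\<in>\<Q>. polytope Q" using polyhedral_cover by blast
  then show ?thesis using polytope_imp_compact by (auto intro: compact_Union)
qed

lemma compact_element: "K \<in> \<P> \<Longrightarrow> compact K"
  using mesh polyhedral_compact by (auto simp: admissible_mesh_def subdivision_of_def)

lemma closed_element: "K \<in> \<P> \<Longrightarrow> closed K"
  using compact_element compact_imp_closed by blast

lemma element_lebesgue: "K \<in> \<P> \<Longrightarrow> K \<in> sets lebesgue"
  by (rule sets_completionI_sets) (simp add: closed_element)

lemma finite_measure_element: "K \<in> \<P> \<Longrightarrow> finite_measure (lebesgue_on K)"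
  using finite_measure_lebesgue_on[OF lmeasurable_compact[OF compact_element]] .

lemma Omega_lebesgue: "\<Omega> \<in> sets lebesgue"
proof -
  have "open \<Omega>" using domain by (simp add: polyhedral_domain_def)
  then show ?thesis by (intro sets_completionI_sets) simp
qed

lemma element_star:
  assumes "K \<in> \<P>"
  obtains c \<rho> where "star_center K c \<rho>" "diameter K \<le> Cstar * \<rho>"
proof -
  obtain \<rho> where "star_shaped_wrt_ball K \<rho>" "diameter K \<le> Cstar * \<rho>"
    using mesh assms unfolding admissible_mesh_def by blast
  then show ?thesis using that unfolding star_shaped_wrt_ball_def star_center_def by blast
qed

lemma element_interior: "K \<in> \<P> \<Longrightarrow> interior K \<noteq> {}"
proof -
  assume "K \<in> \<P>"
  then obtain c \<rho> where "star_center K c \<rho>" using element_star by blast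
  then have "c \<in> interior K" unfolding star_center_def by (intro interiorI[of "ball c \<rho>"]) auto
  then show ?thesis by blast
qed

lemma diameter_pos: "K \<in> \<P> \<Longrightarrow> diameter K > 0"
proof -
  assume K: "K \<in> \<P>"
  obtain x r where x: "r > 0" "ball x r \<subseteq> K" using element_interior[OF K] mem_interior by blast
  have "0 < diameter (ball x r)" using x by simp
  also have "\<dots> \<le> diameter K"
    by (rule diameter_subset[OF x(2) compact_imp_bounded[OF compact_element[OF K]]])
  finally show ?thesis .
qed

lemma P_nonempty: "\<P> \<noteq> {}"
  using mesh domain by (auto simp: admissible_mesh_def subdivision_of_def polyhedral_domain_def)

lemma Cstar_pos: "Cstar > 0"
proof -
  obtain K where K: "K \<in> \<P>" using P_nonempty by blast
  obtain c \<rho> where r: "star_center K c \<rho>" "diameter K \<le> Cstar * \<rho>" using element_star[OF K] by blast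
  then have "0 < Cstar * \<rho>" using diameter_pos[OF K] by linarith
  then show ?thesis using r(1) by (simp add: star_center_def zero_less_mult_iff)
qed

lemma adjD: "K \<in> adj F \<Longrightarrow> K \<in> \<P>" "K \<in> adj F \<Longrightarrow> F \<subseteq> frontier K" "K \<in> adj F \<Longrightarrow> F \<subseteq> K"
  using frontier_subset_closed[OF closed_element] by (auto simp: adjacent_def)

lemma finite_adj: "finite (adj F)"
  using finite_P by (simp add: adjacent_def)

lemma adj_nonempty: "F \<in> \<F> \<Longrightarrow> adj F \<noteq> {}"
  using mesh unfolding admissible_mesh_def mesh_faces_def by (metis insert_not_empty)

lemma face_flat:
  assumes "F \<in> \<F>"
  obtains n b where "flat_face F n b"
proof -
  have "polytope F" "aff_dim F = int CARD('n) - 1"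
    using mesh assms unfolding admissible_mesh_def mesh_faces_def by auto
  then show ?thesis using flat_face_exists[of F] d2 that by auto
qed

lemma face_separation: "F \<in> \<F> \<Longrightarrow> F' \<in> \<F> \<Longrightarrow> F \<noteq> F' \<Longrightarrow> aff_dim (F \<inter> F') < int CARD('n) - 1"
  using mesh unfolding admissible_mesh_def mesh_faces_def by auto

lemma finite_measure_face: "F \<in> \<F> \<Longrightarrow> finite_measure (face_measure F)"
  using face_flat face_area_finite_pos(3) by blast

lemma AE_face: "F \<in> \<F> \<Longrightarrow> AE x in face_measure F. x \<in> F"
  using face_flat AE_face_measure_in by blast

lemma submeshD:
  assumes "K \<in> \<P>"
  shows "triangulation (\<T> K)" "finite (\<T> K)" "\<And>T. T \<in> \<T> K \<Longrightarrow> int CARD('n) simplex T" "\<Union>(\<T> K) = K"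
  using submesh assms unfolding admissible_submesh_def triangulation_def by auto

lemma submesh_bundle: "K \<in> \<P> \<Longrightarrow> triangulation (\<T> K) \<and> (\<forall>T\<in>\<T> K. int CARD('n) simplex T) \<and> \<Union>(\<T> K) = K"
  using submeshD by blast

text \<open>The coefficients live on the open domain, the elements cover its closure. Off the
  frontiers of the finitely many polytopes that form the closure a point is interior to the closure,
  and the domain is the interior of its closure.\<close>

lemma AE_element_domain: "K \<in> \<P> \<Longrightarrow> AE x in lebesgue. x \<in> K \<longrightarrow> x \<in> \<Omega>"
proof -
  assume K: "K \<in> \<P>"
  have sub: "K \<subseteq> closure \<Omega>" using mesh K by (auto simp: admissible_mesh_def subdivision_of_def)
  have int: "\<Omega> = interior (closure \<Omega>)" and poly: "polyhedral (closure \<Omega>)"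
    using domain by (auto simp: polyhedral_domain_def)
  obtain \<Q> where Q: "finite \<Q>" "closure \<Omega> = \<Union>\<Q>" "\<forall>Q\<in>\<Q>. polytope Q"
    using polyhedral_cover[OF poly] by blast
  have "AE x in lebesgue. x \<notin> frontier Q" if "Q \<in> \<Q>" for Q
    using negligible_convex_frontier[OF polytope_imp_convex[OF bspec[OF Q(3) that]]]
    by (simp add: negligible_iff_null_sets AE_not_in)
  then have "AE x in lebesgue. \<forall>Q\<in>\<Q>. x \<notin> frontier Q" using Q(1) by (simp add: AE_finite_all)
  then show ?thesis
  proof eventually_elim
    case (elim x)
    show ?case
    proof
      assume "x \<in> K"
      then obtain R where R: "R \<in> \<Q>" "x \<in> R" using sub Q(2) by blast
      then have "x \<in> interior R" using elim closure_subset by (auto simp: frontier_def)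
      moreover have "interior R \<subseteq> interior (closure \<Omega>)" by (rule interior_mono) (use R Q(2) in blast)
      ultimately show "x \<in> \<Omega>" using int by blast
    qed
  qed
qed

lemma element_not_null: "K \<in> \<P> \<Longrightarrow> emeasure lebesgue K \<noteq> 0"
proof
  assume K: "K \<in> \<P>" and "emeasure lebesgue K = 0"
  then have "negligible K" using element_lebesgue[OF K] by (simp add: negligible_iff_null_sets null_sets_def)
  then have "negligible (interior K)" by (rule negligible_subset) (rule interior_subset)
  then show False using open_not_negligible[OF open_interior element_interior[OF K]] by simp
qed

lemma coefficient_bounds:
  assumes K: "K \<in> \<P>"
  shows "bdd_meas (lebesgue_on K) D" "bdd_meas (lebesgue_on K) \<mu>"
    and "AE x in lebesgue_on K. 0 \<le> \<mu> x"
    and "AE x in lebesgue_on K. \<forall>y. (norm y)\<^sup>2 \<le> iK K * (y \<bullet> (D x *v y))"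
    and "AE x in lebesgue_on K. \<forall>y. (norm (mat_sqrt (D x) *v y))\<^sup>2 = y \<bullet> (D x *v y)"
    and "AE x in lebesgue_on K. \<forall>y. 0 \<le> y \<bullet> (D x *v y)"
    and "AE x in lebesgue_on K. transpose (D x) = D x"
    and "dK K > 0" "iK K > 0"
proof -
  note sub = AE_element_domain[OF K] and m = Omega_lebesgue element_lebesgue[OF K]
  note dif = diffusion[unfolded diffusion_coefficient_def]
  have DL: "L_infty \<Omega> D" using dif by (elim conjE)
  show D: "bdd_meas (lebesgue_on K) D" by (rule L_infty_subset(1)[OF DL sub m])
  show "bdd_meas (lebesgue_on K) \<mu>" by (rule L_infty_subset(1)[OF reaction(1) sub m])
  show "AE x in lebesgue_on K. 0 \<le> \<mu> x" by (rule L_infty_subset(2)[OF reaction(1) sub m reaction(2)])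
  have "AE x in lebesgue_on \<Omega>. transpose (D x) = D x" using dif by (elim conjE)
  then show sym: "AE x in lebesgue_on K. transpose (D x) = D x" by (rule L_infty_subset(2)[OF DL sub m])
  obtain D0 where D0: "D0 > 0" "AE x in lebesgue_on \<Omega>. \<forall>y. D0 * (y \<bullet> y) \<le> y \<bullet> (D x *v y)"
    using dif by (elim conjE exE)
  then have D0': "AE x in lebesgue_on K. \<forall>y. D0 * (y \<bullet> y) \<le> y \<bullet> (D x *v y)"
    by (intro L_infty_subset(2)[OF DL sub m])
  note DB = diffusion_bounds[OF D element_lebesgue[OF K] element_not_null[OF K] sym D0(1) D0']
  show "AE x in lebesgue_on K. \<forall>y. (norm y)\<^sup>2 \<le> iK K * (y \<bullet> (D x *v y))" by (rule DB(1))
  show "AE x in lebesgue_on K. \<forall>y. (norm (mat_sqrt (D x) *v y))\<^sup>2 = y \<bullet> (D x *v y)" by (rule DB(2))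
  show "AE x in lebesgue_on K. \<forall>y. 0 \<le> y \<bullet> (D x *v y)" by (rule DB(3))
  show "dK K > 0" "iK K > 0" by (rule DB(4), rule DB(5))
qed

lemma trace_bounds:
  assumes "F \<in> \<F>" "K \<in> adj F"
  shows "bdd_meas (face_measure F) (trace_from K D)"
    and "AE x in face_measure F. \<forall>y. norm (trace_from K D x *v y) \<le> dK K * norm y"
proof -
  note tr = bspec[OF bspec[OF traces[unfolded traces_well_defined_def] assms(1)] assms(2)]
  have m: "trace_from K D \<in> borel_measurable (face_measure F)" using tr by (elim conjE)
  have "AE x in face_measure F. (\<exists>A. has_trace D K x A) \<and> mat_norm (trace_from K D x) \<le> dK K"
    using tr by (elim conjE)
  then have ae: "AE x in face_measure F. mat_norm (trace_from K D x) \<le> dK K"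
    by (rule eventually_mono) (elim conjE)
  show le: "AE x in face_measure F. \<forall>y. norm (trace_from K D x *v y) \<le> dK K * norm y"
    using ae
  proof eventually_elim
    case (elim x)
    show ?case
    proof
      fix y
      have "norm (trace_from K D x *v y) \<le> mat_norm (trace_from K D x) * norm y" by (rule norm_matrix_vector_le)
      also have "\<dots> \<le> dK K * norm y" by (rule mult_right_mono[OF elim]) simp
      finally show "norm (trace_from K D x *v y) \<le> dK K * norm y" .
    qed
  qed
  \<comment> \<open>The hypothesis bounds the operator norm, while \<open>bdd_meas\<close> asks for
    the Euclidean norm of the matrix; the entries mediate between the two.\<close>
  have "AE x in face_measure F. norm (trace_from K D x) \<le> (\<Sum>i\<in>(UNIV::'n set). \<Sum>j\<in>(UNIV::'n set). dK K)"
    using le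
  proof eventually_elim
    case (elim x)
    have e: "\<bar>trace_from K D x $ i $ j\<bar> \<le> dK K" for i j
    proof -
      have "trace_from K D x $ i $ j = (trace_from K D x *v axis j 1) $ i"
        by (simp add: matrix_vector_mult_basis column_def)
      then have "\<bar>trace_from K D x $ i $ j\<bar> \<le> norm (trace_from K D x *v axis j 1)"
        by (simp add: component_le_norm_cart)
      also have "\<dots> \<le> dK K * norm (axis j (1::real) :: real^'n)" using elim by blast
      finally show ?thesis by simp
    qed
    have "norm (trace_from K D x) \<le> (\<Sum>i\<in>UNIV. norm (trace_from K D x $ i))"
      unfolding norm_vec_def by (rule L2_set_le_sum) simp
    also have "\<dots> \<le> (\<Sum>i\<in>UNIV. \<Sum>j\<in>UNIV. \<bar>trace_from K D x $ i $ j\<bar>)"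
      by (rule sum_mono) (rule norm_le_l1_cart)
    also have "\<dots> \<le> (\<Sum>i\<in>(UNIV::'n set). \<Sum>j\<in>(UNIV::'n set). dK K)"
      by (intro sum_mono e)
    finally show ?case .
  qed
  then show "bdd_meas (face_measure F) (trace_from K D)" using m unfolding bdd_meas_def by blast
qed

section \<open>Broken functions and their gradients in elements and on faces\<close>

lemma VW: "v \<in> V \<Longrightarrow> v \<in> W"
  using V_space_subset_W_space[of \<P> \<T> k] submeshD(4) by blast

lemma W_poly: "w \<in> W \<Longrightarrow> K \<in> \<P> \<Longrightarrow> T \<in> \<T> K \<Longrightarrow> \<exists>p\<in>poly_space k. \<forall>y\<in>T. w K y = p y"
  unfolding W_space_def by blast

lemma W_continuous: "w \<in> W \<Longrightarrow> K \<in> \<P> \<Longrightarrow> continuous_on K (w K)"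
  unfolding W_space_def by blast

lemma W_zero_outside: "w \<in> W \<Longrightarrow> x \<notin> K \<Longrightarrow> w K x = 0"
  unfolding W_space_def zero_outside_def by blast

lemma bdd_meas_W_volume: "w \<in> W \<Longrightarrow> K \<in> \<P> \<Longrightarrow> bdd_meas (lebesgue_on K) (w K)"
proof -
  assume w: "w \<in> W" and K: "K \<in> \<P>"
  have c: "continuous_on K (w K)" by (rule W_continuous[OF w K])
  then have "w K \<in> borel_measurable (lebesgue_on K)"
    by (rule continuous_imp_measurable_on_sets_lebesgue) (rule element_lebesgue[OF K])
  moreover have "bounded (w K ` K)" by (rule compact_imp_bounded[OF compact_continuous_image[OF c compact_element[OF K]]])
  then obtain C where "\<forall>x\<in>K. norm (w K x) \<le> C" by (auto simp: bounded_iff)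
  then have "AE x in lebesgue_on K. norm (w K x) \<le> C" by (intro AE_I2) simp
  ultimately show ?thesis unfolding bdd_meas_def by blast
qed

lemma bdd_meas_W_face: "w \<in> W \<Longrightarrow> F \<in> \<F> \<Longrightarrow> K \<in> adj F \<Longrightarrow> bdd_meas (face_measure F) (w K)"
proof -
  assume w: "w \<in> W" and F: "F \<in> \<F>" and K: "K \<in> adj F"
  have KP: "K \<in> \<P>" by (rule adjD(1)[OF K])
  have c: "continuous_on K (w K)" by (rule W_continuous[OF w KP])
  have "bounded (w K ` K)" by (rule compact_imp_bounded[OF compact_continuous_image[OF c compact_element[OF KP]]])
  then obtain C where C: "\<forall>x\<in>K. norm (w K x) \<le> C" by (auto simp: bounded_iff)
  have "(\<lambda>x. if x \<in> K then w K x else 0) \<in> borel_measurable borel"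
    using borel_measurable_continuous_on_if[of K "w K" "\<lambda>_. 0"] closed_element[OF KP] c by simp
  then have "(\<lambda>x. if x \<in> K then w K x else 0) \<in> borel_measurable (face_measure F)"
    by (rule measurable_face_measure_borel)
  moreover have eq: "(\<lambda>x. if x \<in> K then w K x else 0) = w K"
    using W_zero_outside[OF w] by (simp add: fun_eq_iff)
  ultimately have "w K \<in> borel_measurable (face_measure F)" by simp
  moreover have "AE x in face_measure F. norm (w K x) \<le> C"
    using AE_face[OF F] by eventually_elim (use C adjD(3)[OF K] in auto)
  ultimately show ?thesis unfolding bdd_meas_def by blast
qed

lemma gradient_representative:
  assumes w: "w \<in> W" and K: "K \<in> \<P>"
  obtains G C g where "G \<in> borel_measurable borel" "\<forall>x. norm (G x) \<le> C"
    "\<forall>x. regular_point (\<T> K) K x \<longrightarrow> grad_in w K x = G x"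
    "\<forall>x. regular_point (\<T> K) K x \<longrightarrow> (w K has_derivative (\<lambda>h. grad_in w K x \<bullet> h)) (at x within K)"
    "\<forall>T\<in>\<T> K. \<forall>i. (\<lambda>x. g T x $ i) \<in> poly_space (k - 1)"
    "\<forall>T\<in>\<T> K. \<forall>x\<in>T. regular_point (\<T> K) K x \<longrightarrow> grad_in w K x = g T x"
  by (rule piecewise_gradient[where w = w and K = K and k = k, OF submeshD(2)[OF K] submeshD(4)[OF K] submeshD(3)[OF K] W_poly[OF w K]])
     (assumption | rule that)+

lemma regular_volume: "K \<in> \<P> \<Longrightarrow> AE x in lebesgue_on K. regular_point (\<T> K) K x"
  using AE_regular_volume[OF submeshD(2,4,3)] element_lebesgue by (simp add: AE_restrict_space_iff)

lemma regular_face_full: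
  assumes "F \<in> \<F>" "K \<in> adj F"
  shows "AE x in face_measure F. regular_point (\<T> K) K x \<and>
    (\<exists>T\<in>\<T> K. \<exists>f. f facet_of T \<and> f \<subseteq> frontier K \<and> affine hull f = affine hull F \<and> x \<in> f)"
proof -
  have K: "K \<in> \<P>" "F \<subseteq> frontier K" using adjD assms by auto
  obtain n b where "flat_face F n b" using face_flat[OF assms(1)] by blast
  from AE_regular_face[OF submeshD(1,3,4)[OF K(1)] d2 this K(2)] show ?thesis .
qed

lemma regular_face:
  assumes "F \<in> \<F>" "K \<in> adj F"
  shows "AE x in face_measure F. regular_point (\<T> K) K x"
  using regular_face_full[OF assms] by eventually_elim auto

lemma bdd_meas_grad_volume: "w \<in> W \<Longrightarrow> K \<in> \<P> \<Longrightarrow> bdd_meas (lebesgue_on K) (grad_in w K)"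
proof -
  assume w: "w \<in> W" and K: "K \<in> \<P>"
  obtain G C where G: "G \<in> borel_measurable borel" "\<forall>x. norm (G x) \<le> C"
    "\<forall>x. regular_point (\<T> K) K x \<longrightarrow> grad_in w K x = G x" by (rule gradient_representative[OF w K])
  have "G \<in> borel_measurable (lebesgue_on K)"
    using G(1) by (intro measurable_restrict_space1 measurable_completion) simp
  then have "bdd_meas (lebesgue_on K) G" using G(2) by (auto simp: bdd_meas_def)
  moreover have "AE x in lebesgue_on K. G x = grad_in w K x"
    using regular_volume[OF K] by eventually_elim (use G(3) in simp)
  ultimately show ?thesis by (rule bdd_meas_cong_AE[OF complete_lebesgue_on[OF element_lebesgue[OF K]]])
qed

lemma bdd_meas_grad_face: "w \<in> W \<Longrightarrow> F \<in> \<F> \<Longrightarrow> K \<in> adj F \<Longrightarrow> bdd_meas (face_measure F) (grad_in w K)"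
proof -
  assume w: "w \<in> W" and F: "F \<in> \<F>" and K: "K \<in> adj F"
  have KP: "K \<in> \<P>" by (rule adjD(1)[OF K])
  obtain G C where G: "G \<in> borel_measurable borel" "\<forall>x. norm (G x) \<le> C"
    "\<forall>x. regular_point (\<T> K) K x \<longrightarrow> grad_in w K x = G x" by (rule gradient_representative[OF w KP])
  have "bdd_meas (face_measure F) G"
    using G(2) measurable_face_measure_borel[OF G(1)] by (auto simp: bdd_meas_def)
  moreover have "AE x in face_measure F. G x = grad_in w K x"
    using regular_face[OF F K] by eventually_elim (use G(3) in simp)
  ultimately show ?thesis by (rule bdd_meas_cong_AE[OF complete_face_measure])
qed

lemma grad_in_linear:
  assumes u: "u \<in> W" and v: "v \<in> W" and K: "K \<in> \<P>" and x: "regular_point (\<T> K) K x"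
  shows "grad_in (\<lambda>K x. a K * u K x + b K * v K x) K x = a K *\<^sub>R grad_in u K x + b K *\<^sub>R grad_in v K x"
proof (rule grad_in_comb[OF submeshD(4)[OF K] submeshD(3)[OF K] x])
  show "(u K has_derivative (\<bullet>) (grad_in u K x)) (at x within K)"
    by (rule gradient_representative[OF u K]) (use x in blast)
  show "(v K has_derivative (\<bullet>) (grad_in v K x)) (at x within K)"
    by (rule gradient_representative[OF v K]) (use x in blast)
qed

end

section \<open>The bilinear forms\<close>

text \<open>Equality almost everywhere is the right hypothesis, since \<open>grad_in\<close> is
  additive at regular points only.\<close>

lemma integral_linear_combination:
  fixes f g h :: "'a \<Rightarrow> real"
  assumes M: "finite_measure M" and f: "bdd_meas M f" and g: "bdd_meas M g" and h: "bdd_meas M h"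
    and eq: "AE x in M. h x = a * f x + b * g x"
  shows "integral\<^sup>L M h = a * integral\<^sup>L M f + b * integral\<^sup>L M g"
proof -
  have "integral\<^sup>L M h = integral\<^sup>L M (\<lambda>x. a * f x + b * g x)"
    by (rule integral_cong_AE)
       (use bdd_meas_measurable[OF f] bdd_meas_measurable[OF g] bdd_meas_measurable[OF h] eq in auto)
  also have "\<dots> = a * integral\<^sup>L M f + b * integral\<^sup>L M g"
    using bdd_meas_integrable[OF M f] bdd_meas_integrable[OF M g] by simp
  finally show ?thesis .
qed

lemma integral_mono_bdd:
  fixes f g :: "'a \<Rightarrow> real"
  assumes "finite_measure M" "bdd_meas M f" "bdd_meas M g" "AE x in M. f x \<le> g x"
  shows "integral\<^sup>L M f \<le> integral\<^sup>L M g"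
  by (rule integral_mono_AE[OF bdd_meas_integrable[OF assms(1,2)] bdd_meas_integrable[OF assms(1,3)] assms(4)])

lemma young_inner:
  fixes a b :: "'a::real_inner"
  assumes "s > 0" "e > 0"
  shows "2 * \<bar>a \<bullet> b\<bar> \<le> e * ((norm a)\<^sup>2 / s) + (1 / e) * (s * (norm b)\<^sup>2)"
proof -
  have "0 \<le> (e * norm a - s * norm b)\<^sup>2" by simp
  then have "2 * (norm a * norm b) * (e * s) \<le> (e * norm a)\<^sup>2 + (s * norm b)\<^sup>2"
    by (simp add: power2_diff algebra_simps)
  then have "2 * (norm a * norm b) \<le> ((e * norm a)\<^sup>2 + (s * norm b)\<^sup>2) / (e * s)"
    using assms by (simp add: pos_le_divide_eq)
  also have "\<dots> = e * ((norm a)\<^sup>2 / s) + (1 / e) * (s * (norm b)\<^sup>2)"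
    using assms by (simp add: field_simps power2_eq_square)
  finally show ?thesis using Cauchy_Schwarz_ineq2[of a b] by linarith
qed

context dg_problem
begin

abbreviation "nrm \<equiv> dg_norm \<P> \<F> D \<mu> k Cstar"
abbreviation "\<sigma> F \<equiv> penalty \<P> D k Cstar F"
abbreviation "jmp \<equiv> jump \<P>"
abbreviation "flx F \<equiv> flux_average \<P> F D"
abbreviation "MK K \<equiv> lebesgue_on K"
abbreviation "MF F \<equiv> face_measure F"

definition vol_density :: "(real^'n) set \<Rightarrow> 'n broken \<Rightarrow> 'n broken \<Rightarrow> real^'n \<Rightarrow> real" where
  "vol_density K w v x = (D x *v grad_in w K x) \<bullet> grad_in v K x + \<mu> x * w K x * v K x"

definition jump_density :: "(real^'n) set \<Rightarrow> 'n broken \<Rightarrow> 'n broken \<Rightarrow> real^'n \<Rightarrow> real" where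
  "jump_density F w v x = \<sigma> F * (jmp F w x \<bullet> jmp F v x)"

definition flux_density :: "(real^'n) set \<Rightarrow> 'n broken \<Rightarrow> 'n broken \<Rightarrow> real^'n \<Rightarrow> real" where
  "flux_density F w v x = flx F w x \<bullet> jmp F v x"

lemma bdd_vol_density: "w \<in> W \<Longrightarrow> v \<in> W \<Longrightarrow> K \<in> \<P> \<Longrightarrow> bdd_meas (MK K) (vol_density K w v)"
  unfolding vol_density_def[abs_def]
  by (intro bdd_meas_add bdd_meas_inner bdd_meas_matvec bdd_meas_mult coefficient_bounds bdd_meas_grad_volume bdd_meas_W_volume)

lemma bdd_jump: "w \<in> W \<Longrightarrow> F \<in> \<F> \<Longrightarrow> bdd_meas (MF F) (jmp F w)"
  unfolding jump_def[abs_def]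
  by (intro bdd_meas_sum bdd_meas_scaleR bdd_meas_W_face bdd_meas_const)

lemma bdd_flux: "w \<in> W \<Longrightarrow> F \<in> \<F> \<Longrightarrow> bdd_meas (MF F) (flx F w)"
  unfolding flux_average_def[abs_def]
  by (intro bdd_meas_sum bdd_meas_scaleR bdd_meas_matvec trace_bounds bdd_meas_grad_face bdd_meas_const)

lemma bdd_jump_density: "w \<in> W \<Longrightarrow> v \<in> W \<Longrightarrow> F \<in> \<F> \<Longrightarrow> bdd_meas (MF F) (jump_density F w v)"
  unfolding jump_density_def[abs_def] by (intro bdd_meas_mult bdd_meas_const bdd_meas_inner bdd_jump)

lemma bdd_flux_density: "w \<in> W \<Longrightarrow> v \<in> W \<Longrightarrow> F \<in> \<F> \<Longrightarrow> bdd_meas (MF F) (flux_density F w v)"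
  unfolding flux_density_def[abs_def] by (intro bdd_meas_inner bdd_flux bdd_jump)

lemma vol_set_integral:
  fixes f :: "real^'n \<Rightarrow> real"
  assumes "K \<in> \<P>"
  shows "(LINT x:K|lebesgue. f x) = integral\<^sup>L (MK K) f"
  unfolding set_lebesgue_integral_def using element_lebesgue[OF assms]
  by (simp add: integral_restrict_space)

lemma face_set_integral:
  fixes f :: "real^'n \<Rightarrow> real"
  assumes F: "F \<in> \<F>" and f: "bdd_meas (MF F) f"
  shows "(LINT x:F|MF F. f x) = integral\<^sup>L (MF F) f"
  unfolding set_lebesgue_integral_def
proof (rule integral_cong_AE)
  obtain n b where fl: "flat_face F n b" using face_flat[OF F] by blast
  have "F \<in> sets borel" using flat_face_frontier[OF fl] by simp
  then have "F \<in> sets (MF F)" by (rule sets_face_measure_borel)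
  then show "(\<lambda>x. indicator F x *\<^sub>R f x) \<in> borel_measurable (MF F)"
    using bdd_meas_measurable[OF f] by measurable
  show "f \<in> borel_measurable (MF F)" by (rule bdd_meas_measurable[OF f])
  show "AE x in MF F. indicator F x *\<^sub>R f x = f x"
    using AE_face[OF F] by eventually_elim simp
qed

definition vol_form :: "'n broken \<Rightarrow> 'n broken \<Rightarrow> real" where
  "vol_form w v = (\<Sum>K\<in>\<P>. integral\<^sup>L (MK K) (vol_density K w v))"

definition jump_form :: "'n broken \<Rightarrow> 'n broken \<Rightarrow> real" where
  "jump_form w v = (\<Sum>F\<in>\<F>. integral\<^sup>L (MF F) (jump_density F w v))"

definition flux_form :: "'n broken \<Rightarrow> 'n broken \<Rightarrow> real" where
  "flux_form w v = (\<Sum>F\<in>\<F>. integral\<^sup>L (MF F) (flux_density F w v))"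

lemma a_DG_split:
  assumes w: "w \<in> W" and v: "v \<in> W"
  shows "a_DG \<P> \<F> D \<mu> k Cstar \<theta> w v = vol_form w v + jump_form w v - (flux_form w v + \<theta> * flux_form v w)"
proof -
  have 1: "(\<Sum>K\<in>\<P>. LINT x:K|lebesgue. ((D x *v grad_in w K x) \<bullet> grad_in v K x + \<mu> x * w K x * v K x)) = vol_form w v"
    unfolding vol_form_def vol_density_def[abs_def] by (rule sum.cong[OF refl]) (rule vol_set_integral)
  have 2: "(\<Sum>F\<in>\<F>. LINT x:F|MF F. (\<sigma> F * (jmp F w x \<bullet> jmp F v x))) = jump_form w v"
    unfolding jump_form_def
    by (rule sum.cong[OF refl]) (use face_set_integral[OF _ bdd_jump_density[OF w v]] in \<open>simp add: jump_density_def[abs_def]\<close>)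
  have 3: "(\<Sum>F\<in>\<F>. LINT x:F|MF F. (flx F w x \<bullet> jmp F v x + \<theta> * (flx F v x \<bullet> jmp F w x))) = flux_form w v + \<theta> * flux_form v w"
    unfolding flux_form_def sum_distrib_left sum.distrib[symmetric]
  proof (rule sum.cong[OF refl])
    fix F assume F: "F \<in> \<F>"
    have b: "bdd_meas (MF F) (\<lambda>x. flx F w x \<bullet> jmp F v x + \<theta> * (flx F v x \<bullet> jmp F w x))"
      by (intro bdd_meas_add bdd_meas_mult bdd_meas_const bdd_meas_inner bdd_flux bdd_jump w v F)
    have "(LINT x:F|MF F. (flx F w x \<bullet> jmp F v x + \<theta> * (flx F v x \<bullet> jmp F w x)))
       = integral\<^sup>L (MF F) (\<lambda>x. flx F w x \<bullet> jmp F v x + \<theta> * (flx F v x \<bullet> jmp F w x))"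
      by (rule face_set_integral[OF F b])
    also have "\<dots> = 1 * integral\<^sup>L (MF F) (flux_density F w v) + \<theta> * integral\<^sup>L (MF F) (flux_density F v w)"
      by (rule integral_linear_combination[OF finite_measure_face[OF F] bdd_flux_density[OF w v F] bdd_flux_density[OF v w F] b])
         (simp add: flux_density_def)
    finally show "(LINT x:F|MF F. (flx F w x \<bullet> jmp F v x + \<theta> * (flx F v x \<bullet> jmp F w x)))
       = integral\<^sup>L (MF F) (flux_density F w v) + \<theta> * integral\<^sup>L (MF F) (flux_density F v w)" by simp
  qed
  show ?thesis unfolding a_DG_def 1 2 3 ..
qed

lemma penalty_pos: "F \<in> \<F> \<Longrightarrow> \<sigma> F > 0"
  and penalty_ge: "F \<in> \<F> \<Longrightarrow> K \<in> adj F \<Longrightarrow>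
    8 * Cstar * real k * (real k - 1 + real CARD('n)) / real CARD('n) * (delta D K / diameter K) \<le> \<sigma> F"
proof -
  define c0 where "c0 = 8 * Cstar * real k * (real k - 1 + real CARD('n)) / real CARD('n)"
  have c0: "c0 > 0" using Cstar_pos degree d2 by (simp add: c0_def)
  have dl: "delta D K / diameter K > 0" if "K \<in> \<P>" for K
    using coefficient_bounds(8,9)[OF that] diameter_pos[OF that] by (simp add: delta_def)
  show ge: "8 * Cstar * real k * (real k - 1 + real CARD('n)) / real CARD('n) * (delta D K / diameter K) \<le> \<sigma> F"
    if "K \<in> adj F" for K F
    unfolding penalty_def c0_def[symmetric]
    by (rule mult_left_mono[OF Max_ge]) (use finite_adj that c0 in auto)
  show "\<sigma> F > 0" if F: "F \<in> \<F>"
  proof -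
    obtain K where K: "K \<in> adj F" using adj_nonempty[OF F] by blast
    have "0 < c0 * (delta D K / diameter K)" by (rule mult_pos_pos[OF c0 dl[OF adjD(1)[OF K]]])
    then show ?thesis using ge[OF K] by (simp add: c0_def)
  qed
qed

lemma vol_density_nonneg: "K \<in> \<P> \<Longrightarrow> AE x in MK K. vol_density K w w x \<ge> 0 \<and> (D x *v grad_in w K x) \<bullet> grad_in w K x \<le> vol_density K w w x"
proof -
  assume K: "K \<in> \<P>"
  show ?thesis using coefficient_bounds(3)[OF K] coefficient_bounds(6)[OF K]
  proof eventually_elim
    case (elim x)
    have "0 \<le> grad_in w K x \<bullet> (D x *v grad_in w K x)" using elim(2) by blast
    moreover have "0 \<le> \<mu> x * w K x * w K x" using elim(1) by (simp add: mult.assoc)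
    ultimately show ?case by (simp add: vol_density_def inner_commute)
  qed
qed

text \<open>Removes the matrix square root: the squared norm becomes a sum of symmetric nonnegative
  forms, to which Young's inequality and Gram-Schmidt apply.\<close>

lemma dg_norm_sq:
  assumes v: "v \<in> W"
  shows "(dg_norm \<P> \<F> D \<mu> k Cstar v)\<^sup>2 = vol_form v v + jump_form v v"
    and "K \<in> \<P> \<Longrightarrow> 0 \<le> integral\<^sup>L (MK K) (vol_density K v v)" and "F \<in> \<F> \<Longrightarrow> 0 \<le> integral\<^sup>L (MF F) (jump_density F v v)"
    and "0 \<le> vol_form v v" "0 \<le> jump_form v v"
proof -
  show J0: "0 \<le> integral\<^sup>L (MF F) (jump_density F v v)" if "F \<in> \<F>" for F
    by (rule integral_nonneg_AE) (use penalty_pos[OF that] in \<open>simp add: jump_density_def\<close>)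
  show J: "0 \<le> jump_form v v" unfolding jump_form_def by (intro sum_nonneg J0)
  show E0: "0 \<le> integral\<^sup>L (MK K) (vol_density K v v)" if "K \<in> \<P>" for K
    by (rule integral_nonneg_AE) (use vol_density_nonneg[OF that, of v] in \<open>auto elim!: eventually_mono\<close>)
  show E: "0 \<le> vol_form v v" unfolding vol_form_def by (intro sum_nonneg E0)
  have vol: "(LINT x:K|lebesgue. ((norm (mat_sqrt (D x) *v grad_in v K x))\<^sup>2)) + (LINT x:K|lebesgue. ((sqrt (\<mu> x) * v K x)\<^sup>2))
     = integral\<^sup>L (MK K) (vol_density K v v)" if K: "K \<in> \<P>" for K
  proof -
    have b1: "bdd_meas (MK K) (\<lambda>x. (D x *v grad_in v K x) \<bullet> grad_in v K x)"
      by (intro bdd_meas_inner bdd_meas_matvec coefficient_bounds bdd_meas_grad_volume v K)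
    have b2: "bdd_meas (MK K) (\<lambda>x. \<mu> x * v K x * v K x)"
      by (intro bdd_meas_mult coefficient_bounds bdd_meas_W_volume v K)
    have e1: "AE x in MK K. (D x *v grad_in v K x) \<bullet> grad_in v K x = (norm (mat_sqrt (D x) *v grad_in v K x))\<^sup>2"
      using coefficient_bounds(5)[OF K] by eventually_elim (simp add: inner_commute)
    have e2: "AE x in MK K. \<mu> x * v K x * v K x = (sqrt (\<mu> x) * v K x)\<^sup>2"
      using coefficient_bounds(3)[OF K]
      by eventually_elim (simp add: power_mult_distrib power2_eq_square)
    note cM = complete_lebesgue_on[OF element_lebesgue[OF K]]
    note fM = finite_measure_element[OF K]
    have "integral\<^sup>L (MK K) (vol_density K v v) = 1 * integral\<^sup>L (MK K) (\<lambda>x. (norm (mat_sqrt (D x) *v grad_in v K x))\<^sup>2)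
       + 1 * integral\<^sup>L (MK K) (\<lambda>x. (sqrt (\<mu> x) * v K x)\<^sup>2)"
    proof (rule integral_linear_combination[OF fM bdd_meas_cong_AE[OF cM b1 e1] bdd_meas_cong_AE[OF cM b2 e2] bdd_vol_density[OF v v K]])
      show "AE x in MK K. vol_density K v v x = 1 * (norm (mat_sqrt (D x) *v grad_in v K x))\<^sup>2 + 1 * (sqrt (\<mu> x) * v K x)\<^sup>2"
        using e1 e2 by eventually_elim (simp add: vol_density_def)
    qed
    then show ?thesis by (simp add: vol_set_integral[OF K])
  qed
  have face: "(LINT x:F|MF F. ((norm (sqrt (\<sigma> F) *\<^sub>R jmp F v x))\<^sup>2)) = integral\<^sup>L (MF F) (jump_density F v v)" if F: "F \<in> \<F>" for F
  proof -
    have "(\<lambda>x. (norm (sqrt (\<sigma> F) *\<^sub>R jmp F v x))\<^sup>2) = jump_density F v v"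
      using penalty_pos[OF F] by (auto simp: jump_density_def power_mult_distrib dot_square_norm)
    then show ?thesis using face_set_integral[OF F bdd_jump_density[OF v v F]] by simp
  qed
  have "(\<Sum>K\<in>\<P>. LINT x:K|lebesgue. ((norm (mat_sqrt (D x) *v grad_in v K x))\<^sup>2))
      + (\<Sum>K\<in>\<P>. LINT x:K|lebesgue. ((sqrt (\<mu> x) * v K x)\<^sup>2))
      + (\<Sum>F\<in>\<F>. LINT x:F|MF F. ((norm (sqrt (\<sigma> F) *\<^sub>R jmp F v x))\<^sup>2)) = vol_form v v + jump_form v v"
    unfolding vol_form_def jump_form_def sum.distrib[symmetric] using vol face by (simp cong: sum.cong)
  then show "(dg_norm \<P> \<F> D \<mu> k Cstar v)\<^sup>2 = vol_form v v + jump_form v v"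
    unfolding dg_norm_def using E J by simp
qed

lemma jump_comb: "jmp F (\<lambda>K x. a * u K x + b * v K x) x = a *\<^sub>R jmp F u x + b *\<^sub>R jmp F v x"
  unfolding jump_def by (simp add: sum.distrib scaleR_sum_right algebra_simps)

lemma flux_comb:
  assumes u: "u \<in> W" and v: "v \<in> W" and F: "F \<in> \<F>"
  shows "AE x in MF F. flx F (\<lambda>K x. a * u K x + b * v K x) x = a *\<^sub>R flx F u x + b *\<^sub>R flx F v x"
proof -
  have "AE x in MF F. \<forall>K\<in>adj F. regular_point (\<T> K) K x"
    using regular_face[OF F] finite_adj by (simp add: AE_finite_all)
  then show ?thesis
  proof eventually_elim
    case (elim x)
    have "(\<Sum>K\<in>adj F. trace_from K D x *v grad_in (\<lambda>K x. a * u K x + b * v K x) K x)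
      = (\<Sum>K\<in>adj F. a *\<^sub>R (trace_from K D x *v grad_in u K x) + b *\<^sub>R (trace_from K D x *v grad_in v K x))"
    proof (rule sum.cong[OF refl])
      fix K assume K: "K \<in> adj F"
      then have "regular_point (\<T> K) K x" using elim by blast
      from grad_in_linear[OF u v adjD(1)[OF K] this, of "\<lambda>_. a" "\<lambda>_. b"]
      show "trace_from K D x *v grad_in (\<lambda>K x. a * u K x + b * v K x) K x
        = a *\<^sub>R (trace_from K D x *v grad_in u K x) + b *\<^sub>R (trace_from K D x *v grad_in v K x)"
        by (simp add: matrix_vector_right_distrib matrix_vector_mult_scaleR)
    qed
    then show ?case
      unfolding flux_average_def by (simp add: sum.distrib scaleR_sum_right scaleR_add_right scaleR_left_commute)
  qed
qed

lemma W_comb: "u \<in> W \<Longrightarrow> v \<in> W \<Longrightarrow> (\<lambda>K x. a * u K x + b * v K x) \<in> W"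
  by (rule W_space_comb)

lemma V_comb: "u \<in> V \<Longrightarrow> v \<in> V \<Longrightarrow> (\<lambda>K x. a * u K x + b * v K x) \<in> V"
  by (rule V_space_comb)

lemma forms_linear_left:
  assumes u: "u \<in> W" and u': "u' \<in> W" and v: "v \<in> W"
  shows "vol_form (\<lambda>K x. a * u K x + b * u' K x) v = a * vol_form u v + b * vol_form u' v"
    and "jump_form (\<lambda>K x. a * u K x + b * u' K x) v = a * jump_form u v + b * jump_form u' v"
    and "flux_form (\<lambda>K x. a * u K x + b * u' K x) v = a * flux_form u v + b * flux_form u' v"
proof -
  note c = W_comb[OF u u', of a b]
  show "vol_form (\<lambda>K x. a * u K x + b * u' K x) v = a * vol_form u v + b * vol_form u' v"
    unfolding vol_form_def sum_distrib_left sum.distrib[symmetric]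
  proof (rule sum.cong[OF refl])
    fix K assume K: "K \<in> \<P>"
    show "integral\<^sup>L (MK K) (vol_density K (\<lambda>K x. a * u K x + b * u' K x) v)
      = a * integral\<^sup>L (MK K) (vol_density K u v) + b * integral\<^sup>L (MK K) (vol_density K u' v)"
    proof (rule integral_linear_combination[OF finite_measure_element[OF K] bdd_vol_density[OF u v K] bdd_vol_density[OF u' v K] bdd_vol_density[OF c v K]])
      show "AE x in MK K. vol_density K (\<lambda>K x. a * u K x + b * u' K x) v x = a * vol_density K u v x + b * vol_density K u' v x"
        using regular_volume[OF K]
      proof eventually_elim
        case (elim x)
        from grad_in_linear[OF u u' K this, of "\<lambda>_. a" "\<lambda>_. b"]
        show ?case
          by (simp add: vol_density_def matrix_vector_right_distrib matrix_vector_mult_scaleR inner_add_left algebra_simps)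
      qed
    qed
  qed
  show "jump_form (\<lambda>K x. a * u K x + b * u' K x) v = a * jump_form u v + b * jump_form u' v"
    unfolding jump_form_def sum_distrib_left sum.distrib[symmetric]
  proof (rule sum.cong[OF refl])
    fix F assume F: "F \<in> \<F>"
    show "integral\<^sup>L (MF F) (jump_density F (\<lambda>K x. a * u K x + b * u' K x) v)
      = a * integral\<^sup>L (MF F) (jump_density F u v) + b * integral\<^sup>L (MF F) (jump_density F u' v)"
      by (rule integral_linear_combination[OF finite_measure_face[OF F] bdd_jump_density[OF u v F] bdd_jump_density[OF u' v F] bdd_jump_density[OF c v F]])
         (simp add: jump_density_def jump_comb inner_add_left algebra_simps)
  qed
  show "flux_form (\<lambda>K x. a * u K x + b * u' K x) v = a * flux_form u v + b * flux_form u' v"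
    unfolding flux_form_def sum_distrib_left sum.distrib[symmetric]
  proof (rule sum.cong[OF refl])
    fix F assume F: "F \<in> \<F>"
    show "integral\<^sup>L (MF F) (flux_density F (\<lambda>K x. a * u K x + b * u' K x) v)
      = a * integral\<^sup>L (MF F) (flux_density F u v) + b * integral\<^sup>L (MF F) (flux_density F u' v)"
    proof (rule integral_linear_combination[OF finite_measure_face[OF F] bdd_flux_density[OF u v F] bdd_flux_density[OF u' v F] bdd_flux_density[OF c v F]])
      show "AE x in MF F. flux_density F (\<lambda>K x. a * u K x + b * u' K x) v x = a * flux_density F u v x + b * flux_density F u' v x"
        using flux_comb[OF u u' F, of a b] by eventually_elim (simp add: flux_density_def inner_add_left)
    qed
  qed
qed

lemma forms_symmetric:
  assumes u: "u \<in> W" and v: "v \<in> W"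
  shows "vol_form u v = vol_form v u" "jump_form u v = jump_form v u"
proof -
  show "vol_form u v = vol_form v u"
    unfolding vol_form_def
  proof (rule sum.cong[OF refl])
    fix K assume K: "K \<in> \<P>"
    show "integral\<^sup>L (MK K) (vol_density K u v) = integral\<^sup>L (MK K) (vol_density K v u)"
    proof (rule integral_cong_AE)
      show "AE x in MK K. vol_density K u v x = vol_density K v u x"
        using coefficient_bounds(7)[OF K]
      proof eventually_elim
        case (elim x)
        from symmetric_inner_eq[OF this, of "grad_in u K x" "grad_in v K x"]
        show ?case by (simp add: vol_density_def inner_commute)
      qed
    qed (use bdd_meas_measurable bdd_vol_density u v K in blast)+
  qed
  show "jump_form u v = jump_form v u" unfolding jump_form_def jump_density_def[abs_def] by (simp add: inner_commute)
qed

lemma flux_form_linear_right: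
  assumes u: "u \<in> W" and v: "v \<in> W" and v': "v' \<in> W"
  shows "flux_form u (\<lambda>K x. a * v K x + b * v' K x) = a * flux_form u v + b * flux_form u v'"
  unfolding flux_form_def sum_distrib_left sum.distrib[symmetric]
proof (rule sum.cong[OF refl])
  fix F assume F: "F \<in> \<F>"
  show "integral\<^sup>L (MF F) (flux_density F u (\<lambda>K x. a * v K x + b * v' K x))
    = a * integral\<^sup>L (MF F) (flux_density F u v) + b * integral\<^sup>L (MF F) (flux_density F u v')"
    by (rule integral_linear_combination[OF finite_measure_face[OF F] bdd_flux_density[OF u v F] bdd_flux_density[OF u v' F]
          bdd_flux_density[OF u W_comb[OF v v'] F]])
       (simp add: flux_density_def jump_comb inner_add_right)
qed

abbreviation "adg \<theta> \<equiv> a_DG \<P> \<F> D \<mu> k Cstar \<theta>"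

lemma a_DG_linear:
  assumes u: "u \<in> W" and u': "u' \<in> W" and v: "v \<in> W"
  shows "adg \<theta> (\<lambda>K x. a * u K x + b * u' K x) v = a * adg \<theta> u v + b * adg \<theta> u' v"
    and "adg \<theta> v (\<lambda>K x. a * u K x + b * u' K x) = a * adg \<theta> v u + b * adg \<theta> v u'"
proof -
  note c = W_comb[OF u u', of a b]
  show "adg \<theta> (\<lambda>K x. a * u K x + b * u' K x) v = a * adg \<theta> u v + b * adg \<theta> u' v"
    unfolding a_DG_split[OF c v] a_DG_split[OF u v] a_DG_split[OF u' v]
      forms_linear_left[OF u u' v] flux_form_linear_right[OF v u u'] by (simp add: algebra_simps)
  show "adg \<theta> v (\<lambda>K x. a * u K x + b * u' K x) = a * adg \<theta> v u + b * adg \<theta> v u'"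
    unfolding a_DG_split[OF v c] a_DG_split[OF v u] a_DG_split[OF v u']
      forms_symmetric[OF v c] forms_linear_left[OF u u' v] flux_form_linear_right[OF v u u']
      forms_symmetric[OF v u] forms_symmetric[OF v u'] by (simp add: algebra_simps)
qed

end

section \<open>Inverse estimates for the flux\<close>

lemma norm_sq_components: "(norm (y :: real^'n))\<^sup>2 = (\<Sum>i\<in>UNIV. (y $ i)\<^sup>2)"
  unfolding power2_norm_eq_inner inner_vec_def by (simp add: power2_eq_square)

lemma nn_integral_norm_sq_components:
  fixes g :: "'a \<Rightarrow> real^'n"
  assumes "\<And>i. (\<lambda>x. g x $ i) \<in> borel_measurable M" "c \<in> borel_measurable M"
  shows "(\<integral>\<^sup>+x. c x * ennreal ((norm (g x))\<^sup>2) \<partial>M) = (\<Sum>i\<in>UNIV. \<integral>\<^sup>+x. c x * ennreal ((g x $ i)\<^sup>2) \<partial>M)"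
proof -
  note [measurable] = assms
  have "(\<integral>\<^sup>+x. c x * ennreal ((norm (g x))\<^sup>2) \<partial>M) = (\<integral>\<^sup>+x. (\<Sum>i\<in>UNIV. c x * ennreal ((g x $ i)\<^sup>2)) \<partial>M)"
    by (simp only: norm_sq_components sum_distrib_left[symmetric] sum_ennreal[symmetric] zero_le_power2)
  also have "\<dots> = (\<Sum>i\<in>UNIV. \<integral>\<^sup>+x. c x * ennreal ((g x $ i)\<^sup>2) \<partial>M)"
    by (intro nn_integral_sum) measurable
  finally show ?thesis .
qed

lemma poly_space_borel: "p \<in> poly_space k \<Longrightarrow> p \<in> borel_measurable borel"
  by (rule borel_measurable_continuous_onI[OF poly_space_continuous])

lemma poly_space_borel_face: "p \<in> poly_space k \<Longrightarrow> p \<in> borel_measurable (face_measure F)"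
  by (rule measurable_face_measure_borel[OF poly_space_borel])

lemma element_trace_vector:
  fixes K :: "(real^'n) set" and g :: "real^'n \<Rightarrow> real^'n"
  assumes K: "star_center K c \<rho>" "compact K" and fin: "finite \<F>"
    and F: "\<And>F. F \<in> \<F> \<Longrightarrow> F \<subseteq> frontier K \<and> (\<exists>n b. flat_face F n b)"
    and sep: "\<And>F F'. F \<in> \<F> \<Longrightarrow> F' \<in> \<F> \<Longrightarrow> F \<noteq> F' \<Longrightarrow> aff_dim (F \<inter> F') < int CARD('n) - 1"
    and g: "\<And>i. (\<lambda>x. g x $ i) \<in> poly_space N"
  shows "ennreal \<rho> * (\<Sum>F\<in>\<F>. \<integral>\<^sup>+x. ennreal ((norm (g x))\<^sup>2) \<partial>face_measure F)
    \<le> ennreal (real ((N + 1) * (N + CARD('n)))) * (\<integral>\<^sup>+x. indicator K x * ennreal ((norm (g x))\<^sup>2) \<partial>lborel)"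
proof -
  let ?C = "ennreal (real ((N + 1) * (N + CARD('n))))"
  have Km: "K \<in> sets lborel" using compact_imp_closed[OF K(2)] by simp
  have gm: "(\<lambda>x. g x $ i) \<in> borel_measurable lborel" for i
    using poly_space_borel[OF g] by simp
  have "(\<Sum>F\<in>\<F>. \<integral>\<^sup>+x. ennreal ((norm (g x))\<^sup>2) \<partial>face_measure F)
      = (\<Sum>F\<in>\<F>. \<Sum>i\<in>UNIV. \<integral>\<^sup>+x. ennreal ((g x $ i)\<^sup>2) \<partial>face_measure F)"
  proof (rule sum.cong[OF refl])
    fix F
    show "(\<integral>\<^sup>+x. ennreal ((norm (g x))\<^sup>2) \<partial>face_measure F) = (\<Sum>i\<in>UNIV. \<integral>\<^sup>+x. ennreal ((g x $ i)\<^sup>2) \<partial>face_measure F)"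
      using nn_integral_norm_sq_components[of g "face_measure F" "\<lambda>_. 1", OF poly_space_borel_face[OF g]] by simp
  qed
  also have "\<dots> = (\<Sum>i\<in>UNIV. \<Sum>F\<in>\<F>. \<integral>\<^sup>+x. ennreal ((g x $ i)\<^sup>2) \<partial>face_measure F)"
    by (rule sum.swap)
  finally have "ennreal \<rho> * (\<Sum>F\<in>\<F>. \<integral>\<^sup>+x. ennreal ((norm (g x))\<^sup>2) \<partial>face_measure F)
      = (\<Sum>i\<in>UNIV. ennreal \<rho> * (\<Sum>F\<in>\<F>. \<integral>\<^sup>+x. ennreal ((g x $ i)\<^sup>2) \<partial>face_measure F))"
    by (simp add: sum_distrib_left)
  also have "\<dots> \<le> (\<Sum>i\<in>UNIV. ?C * (\<integral>\<^sup>+x. indicator K x * ennreal ((g x $ i)\<^sup>2) \<partial>lborel))"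
    by (rule sum_mono) (rule element_trace_inequality[OF K fin F sep g])
  also have "\<dots> = ?C * (\<integral>\<^sup>+x. indicator K x * ennreal ((norm (g x))\<^sup>2) \<partial>lborel)"
    using nn_integral_norm_sq_components[of g lborel "indicator K", OF gm borel_measurable_indicator[OF Km]]
    by (simp add: sum_distrib_left)
  finally show ?thesis .
qed

lemma simplex_trace_vector:
  fixes T :: "(real^'n) set" and g :: "real^'n \<Rightarrow> real^'n"
  assumes T: "int CARD('n) simplex T" and d: "CARD('n) \<ge> 2" and f: "f facet_of T"
    and g: "\<And>i. (\<lambda>x. g x $ i) \<in> poly_space N"
  shows "(\<integral>\<^sup>+x. ennreal ((norm (g x))\<^sup>2) \<partial>face_measure f)
    \<le> ennreal (real ((N + 1) * (N + CARD('n))) / CARD('n) * (face_area f / measure lebesgue T)) *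
      (\<integral>\<^sup>+x. indicator T x * ennreal ((norm (g x))\<^sup>2) \<partial>lborel)"
proof -
  let ?C = "ennreal (real ((N + 1) * (N + CARD('n))) / CARD('n) * (face_area f / measure lebesgue T))"
  have Tm: "T \<in> sets lborel" using closed_simplex[OF T] by simp
  have gm: "(\<lambda>x. g x $ i) \<in> borel_measurable lborel" for i
    using poly_space_borel[OF g] by simp
  have "(\<integral>\<^sup>+x. ennreal ((norm (g x))\<^sup>2) \<partial>face_measure f) = (\<Sum>i\<in>UNIV. \<integral>\<^sup>+x. ennreal ((g x $ i)\<^sup>2) \<partial>face_measure f)"
    using nn_integral_norm_sq_components[of g "face_measure f" "\<lambda>_. 1", OF poly_space_borel_face[OF g]] by simp
  also have "\<dots> \<le> (\<Sum>i\<in>UNIV. ?C * (\<integral>\<^sup>+x. indicator T x * ennreal ((g x $ i)\<^sup>2) \<partial>lborel))"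
    by (rule sum_mono) (rule simplex_trace_inequality[OF T d f g])
  also have "\<dots> = ?C * (\<integral>\<^sup>+x. indicator T x * ennreal ((norm (g x))\<^sup>2) \<partial>lborel)"
    using nn_integral_norm_sq_components[of g lborel "indicator T", OF gm borel_measurable_indicator[OF Tm]]
    by (simp add: sum_distrib_left)
  finally show ?thesis .
qed

lemma simplex_facets_card:
  fixes T :: "(real^'n) set"
  assumes T: "int CARD('n) simplex T"
  shows "finite {f. f facet_of T}" "card {f. f facet_of T} \<le> CARD('n) + 1"
proof -
  obtain C where C: "finite C" "\<not> affine_dependent C" "int (card C) = int CARD('n) + 1" "T = convex hull C"
    using T unfolding simplex_def using aff_independent_finite by blast
  have sub: "{f. f facet_of T} \<subseteq> (\<lambda>u. convex hull (C - {u})) ` C"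
    using facet_of_convex_hull_affine_independent[OF C(2)] C(4) by auto
  show "finite {f. f facet_of T}" by (rule finite_subset[OF sub]) (use C(1) in simp)
  have "card {f. f facet_of T} \<le> card ((\<lambda>u. convex hull (C - {u})) ` C)"
    by (rule card_mono[OF _ sub]) (use C(1) in simp)
  also have "\<dots> \<le> card C" by (rule card_image_le[OF C(1)])
  finally show "card {f. f facet_of T} \<le> CARD('n) + 1" using C(3) by linarith
qed

lemma triangulation_disjoint_AE:
  fixes \<S> :: "(real^'n) set set"
  assumes tri: "triangulation \<S>" and simp: "\<And>T. T \<in> \<S> \<Longrightarrow> int CARD('n) simplex T"
  shows "AE x in lborel. \<forall>T\<in>\<S>. \<forall>T'\<in>\<S>. x \<in> T \<longrightarrow> x \<in> T' \<longrightarrow> T = T'"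
proof -
  have fin: "finite \<S>" using tri by (simp add: triangulation_def)
  have "AE x in lebesgue. x \<in> T \<longrightarrow> x \<in> T' \<longrightarrow> T = T'" if T: "T \<in> \<S>" "T' \<in> \<S>" for T T'
  proof (cases "T = T'")
    case False
    have inter: "(T1 \<inter> T2) face_of T1" if "T1 \<in> \<S>" "T2 \<in> \<S>" for T1 T2
      using tri that unfolding triangulation_def by blast
    have f: "(T \<inter> T') face_of T" "(T \<inter> T') face_of T'"
      using inter[OF T] inter[OF T(2,1)] by (simp_all add: Int_commute)
    have "aff_dim (T \<inter> T') < int CARD('n)"
    proof (cases "T \<inter> T' = T")
      case True
      then have "T \<inter> T' \<noteq> T'" using False by blast
      then show ?thesis
        using face_of_aff_dim_lt[OF convex_simplex[OF simp[OF T(2)]] f(2)] aff_dim_simplex[OF simp[OF T(2)]] by simp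
    next
      case F: False
      then show ?thesis
        using face_of_aff_dim_lt[OF convex_simplex[OF simp[OF T(1)]] f(1)] aff_dim_simplex[OF simp[OF T(1)]] by simp
    qed
    then have "negligible (T \<inter> T')" by (intro negligible_lowaffdim) simp
    then have "AE x in lebesgue. x \<notin> T \<inter> T'" by (simp only: negligible_iff_null_sets AE_not_in)
    then show ?thesis by eventually_elim blast
  qed simp
  then have "AE x in lebesgue. \<forall>T\<in>\<S>. \<forall>T'\<in>\<S>. x \<in> T \<longrightarrow> x \<in> T' \<longrightarrow> T = T'"
    by (intro AE_finite_allI fin)
  then show ?thesis by (simp only: AE_completion_iff)
qed

lemma sum_constant_ennreal: "C \<ge> 0 \<Longrightarrow> (\<Sum>f\<in>Z. ennreal C * I) = ennreal (C * real (card Z)) * I"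
  by (simp add: ennreal_mult ennreal_of_nat_eq_real_of_nat mult_ac)

text \<open>The boundary facets of the submesh of \<open>K\<close> are in general not aligned with the mesh faces, but
  both tile the same parts of hyperplanes, so that integrals over faces can be regrouped.\<close>

lemma piecewise_trace_inequality:
  fixes K :: "(real^'n) set" and g :: "(real^'n) set \<Rightarrow> real^'n \<Rightarrow> real^'n"
  assumes tri: "triangulation \<S>" and simp: "\<And>T. T \<in> \<S> \<Longrightarrow> int CARD('n) simplex T" and K: "\<Union>\<S> = K"
    and d: "CARD('n) \<ge> 2" and fin: "finite \<F>"
    and F: "\<And>F. F \<in> \<F> \<Longrightarrow> F \<subseteq> frontier K \<and> (\<exists>n b. flat_face F n b)"
    and sep: "\<And>F F'. F \<in> \<F> \<Longrightarrow> F' \<in> \<F> \<Longrightarrow> F \<noteq> F' \<Longrightarrow> aff_dim (F \<inter> F') < int CARD('n) - 1"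
    and g: "\<And>T i. T \<in> \<S> \<Longrightarrow> (\<lambda>x. g T x $ i) \<in> poly_space N"
    and R: "\<And>T f. T \<in> \<S> \<Longrightarrow> f facet_of T \<Longrightarrow> f \<subseteq> frontier K \<Longrightarrow> face_area f / measure lebesgue T \<le> R"
    and R0: "R \<ge> 0"
    and \<phi>F: "\<And>F. F \<in> \<F> \<Longrightarrow> AE x in face_measure F. \<forall>T\<in>\<S>. x \<in> T \<longrightarrow> \<phi> x = ennreal ((norm (g T x))\<^sup>2)"
    and \<phi>K: "AE x in lborel. x \<in> K \<longrightarrow> (\<forall>T\<in>\<S>. x \<in> T \<longrightarrow> \<phi> x = ennreal ((norm (g T x))\<^sup>2))"
  shows "(\<Sum>F\<in>\<F>. \<integral>\<^sup>+x. \<phi> x \<partial>face_measure F)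
    \<le> ennreal (real ((N + 1) * (N + CARD('n))) / CARD('n) * R * (CARD('n) + 1)) * (\<integral>\<^sup>+x. indicator K x * \<phi> x \<partial>lborel)"
proof -
  have disj: "AE x in lborel. \<forall>T\<in>\<S>. \<forall>T'\<in>\<S>. x \<in> T \<longrightarrow> x \<in> T' \<longrightarrow> T = T'"
    by (rule triangulation_disjoint_AE[OF tri simp])
  define Z where "Z T = {f. f facet_of T \<and> f \<subseteq> frontier K}" for T
  define \<psi> where "\<psi> T x = ennreal ((norm (g T x))\<^sup>2)" for T x
  let ?C = "real ((N + 1) * (N + CARD('n))) / CARD('n) * R"
  have finS: "finite \<S>" using tri by (simp add: triangulation_def)
  have Zfin: "finite (Z T)" and Zcard: "card (Z T) \<le> CARD('n) + 1" if "T \<in> \<S>" for T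
  proof -
    note sf = simplex_facets_card[OF simp[OF that]]
    show "finite (Z T)" unfolding Z_def by (rule finite_subset[OF _ sf(1)]) blast
    have "card (Z T) \<le> card {f. f facet_of T}" unfolding Z_def by (rule card_mono[OF sf(1)]) blast
    then show "card (Z T) \<le> CARD('n) + 1" using sf(2) by linarith
  qed
  have gm: "\<psi> T \<in> borel_measurable borel" if "T \<in> \<S>" for T
  proof -
    have "(\<lambda>x. \<Sum>i\<in>UNIV. (g T x $ i)\<^sup>2) \<in> borel_measurable borel"
      by (intro borel_measurable_sum borel_measurable_power poly_space_borel[OF g[OF that]])
    then have "(\<lambda>x. ennreal (\<Sum>i\<in>UNIV. (g T x $ i)\<^sup>2)) \<in> borel_measurable borel"
      by (rule measurable_compose[OF _ measurable_ennreal])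
    then show ?thesis unfolding \<psi>_def[abs_def] norm_sq_components .
  qed
  have facet: "\<exists>n b. flat_face f n b" if "T \<in> \<S>" "f \<in> Z T" for T f
  proof -
    have "f facet_of T" using that(2) by (simp add: Z_def)
    then show ?thesis by (rule simplex_facet_flat[OF simp[OF that(1)] d]) blast
  qed
  have fb: "f \<in> sets borel" if T: "T \<in> \<S>" and f: "f \<in> Z T" for T f
  proof -
    obtain n b where "flat_face f n b" using facet[OF T f] by blast
    then have "closed f" by (rule flat_face_frontier)
    then show ?thesis by simp
  qed
  have Fb: "F' \<in> sets borel" if F': "F' \<in> \<F>" for F'
  proof -
    obtain n b where "flat_face F' n b" using F[OF F'] by blast
    then have "closed F'" by (rule flat_face_frontier)
    then show ?thesis by simp
  qed
  \<comment> \<open>Almost every point of the mesh face lies on a boundary facet of the submesh in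
    the same hyperplane. Among coplanar sets, integrating over one with the indicator of the other
    is symmetric in the two, so the integral can be moved to the facet.\<close>
  have one: "(\<integral>\<^sup>+x. \<phi> x \<partial>face_measure F') \<le> (\<Sum>T\<in>\<S>. \<Sum>f\<in>Z T. \<integral>\<^sup>+x. indicator F' x * \<psi> T x \<partial>face_measure f)"
    if F': "F' \<in> \<F>" for F'
  proof -
    obtain n b where fl: "flat_face F' n b" and sub: "F' \<subseteq> frontier K" using F[OF F'] by blast
    have reg: "AE x in face_measure F'. regular_point \<S> K x \<and>
      (\<exists>T\<in>\<S>. \<exists>f. f facet_of T \<and> f \<subseteq> frontier K \<and> affine hull f = affine hull F' \<and> x \<in> f)"
      by (rule AE_regular_face[OF tri simp K d fl sub])
    have "(\<integral>\<^sup>+x. \<phi> x \<partial>face_measure F')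
       \<le> (\<integral>\<^sup>+x. (\<Sum>T\<in>\<S>. \<Sum>f\<in>{f\<in>Z T. affine hull f = affine hull F'}. indicator f x * \<psi> T x) \<partial>face_measure F')"
    proof (rule nn_integral_mono_AE)
      show "AE x in face_measure F'. \<phi> x \<le> (\<Sum>T\<in>\<S>. \<Sum>f\<in>{f\<in>Z T. affine hull f = affine hull F'}. indicator f x * \<psi> T x)"
        using reg \<phi>F[OF F']
      proof eventually_elim
        case (elim x)
        obtain T f where Tf: "T \<in> \<S>" "f facet_of T" "f \<subseteq> frontier K" "affine hull f = affine hull F'" "x \<in> f"
          using elim(1) by blast
        have fZ: "f \<in> Z T" using Tf by (simp add: Z_def)
        have xT: "x \<in> T" using Tf facet_of_imp_subset by blast
        have "\<phi> x = indicator f x * \<psi> T x" using elim(2) Tf xT by (simp add: \<psi>_def)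
        also have "\<dots> \<le> (\<Sum>f\<in>{f\<in>Z T. affine hull f = affine hull F'}. indicator f x * \<psi> T x)"
          by (rule member_le_sum) (use Tf fZ Zfin[OF Tf(1)] in simp_all)
        also have "\<dots> \<le> (\<Sum>T\<in>\<S>. \<Sum>f\<in>{f\<in>Z T. affine hull f = affine hull F'}. indicator f x * \<psi> T x)"
          by (rule member_le_sum[of T \<S> "\<lambda>T. \<Sum>f\<in>{f\<in>Z T. affine hull f = affine hull F'}. indicator f x * \<psi> T x"])
             (use Tf finS in auto)
        finally show ?case .
      qed
    qed
    also have "\<dots> = (\<Sum>T\<in>\<S>. \<Sum>f\<in>{f\<in>Z T. affine hull f = affine hull F'}. \<integral>\<^sup>+x. indicator f x * \<psi> T x \<partial>face_measure F')"
    proof -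
      have m: "(\<lambda>x. indicator f x * \<psi> T x) \<in> borel_measurable (face_measure F')" if "T \<in> \<S>" "f \<in> Z T" for T f
        by (rule measurable_face_measure_borel) (use fb[OF that] gm[OF that(1)] in measurable)
      show ?thesis
        by (subst nn_integral_sum) (auto intro!: sum.cong nn_integral_sum borel_measurable_sum m)
    qed
    also have "\<dots> = (\<Sum>T\<in>\<S>. \<Sum>f\<in>{f\<in>Z T. affine hull f = affine hull F'}. \<integral>\<^sup>+x. indicator F' x * \<psi> T x \<partial>face_measure f)"
    proof (intro sum.cong refl)
      fix T f assume T: "T \<in> \<S>" and "f \<in> {f\<in>Z T. affine hull f = affine hull F'}"
      then have f: "f \<in> Z T" and hull: "affine hull f = affine hull F'" by auto
      obtain n' b' where fl': "flat_face f n' b'" using facet[OF T f] by blast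
      have m1: "(\<lambda>x. indicator f x * \<psi> T x) \<in> borel_measurable borel"
        and m2: "(\<lambda>x. indicator F' x * \<psi> T x) \<in> borel_measurable borel"
        using fb[OF T f] Fb[OF F'] gm[OF T] by measurable
      have "(\<integral>\<^sup>+x. indicator f x * \<psi> T x \<partial>face_measure F') = surf n b (\<lambda>y. indicator F' y * (indicator f y * \<psi> T y))"
        by (rule nn_integral_face_measure[OF fl m1])
      also have "\<dots> = surf n' b' (\<lambda>y. indicator f y * (indicator F' y * \<psi> T y))"
        unfolding surf_coplanar[OF fl fl' hull[symmetric]] by (simp add: mult.left_commute)
      also have "\<dots> = (\<integral>\<^sup>+x. indicator F' x * \<psi> T x \<partial>face_measure f)"
        by (rule nn_integral_face_measure[OF fl' m2, symmetric])
      finally show "(\<integral>\<^sup>+x. indicator f x * \<psi> T x \<partial>face_measure F') = (\<integral>\<^sup>+x. indicator F' x * \<psi> T x \<partial>face_measure f)" .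
    qed
    also have "\<dots> \<le> (\<Sum>T\<in>\<S>. \<Sum>f\<in>Z T. \<integral>\<^sup>+x. indicator F' x * \<psi> T x \<partial>face_measure f)"
      by (intro sum_mono sum_mono2 Zfin) auto
    finally show ?thesis .
  qed
  have "(\<Sum>F\<in>\<F>. \<integral>\<^sup>+x. \<phi> x \<partial>face_measure F)
      \<le> (\<Sum>F\<in>\<F>. \<Sum>T\<in>\<S>. \<Sum>f\<in>Z T. \<integral>\<^sup>+x. indicator F x * \<psi> T x \<partial>face_measure f)"
    by (rule sum_mono) (rule one)
  also have "\<dots> = (\<Sum>T\<in>\<S>. \<Sum>f\<in>Z T. \<Sum>F\<in>\<F>. \<integral>\<^sup>+x. indicator F x * \<psi> T x \<partial>face_measure f)"
    by (subst sum.swap, rule sum.cong[OF refl], rule sum.swap)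
  \<comment> \<open>Distinct mesh faces meet in dimension below d - 1, so almost every point of a
    facet is counted at most once.\<close>
  also have "\<dots> \<le> (\<Sum>T\<in>\<S>. \<Sum>f\<in>Z T. \<integral>\<^sup>+x. \<psi> T x \<partial>face_measure f)"
  proof (intro sum_mono)
    fix T f assume T: "T \<in> \<S>" and f: "f \<in> Z T"
    obtain n b where fl: "flat_face f n b" using facet[OF T f] by blast
    have m: "(\<lambda>x. indicator F x * \<psi> T x) \<in> borel_measurable (face_measure f)" if "F \<in> \<F>" for F
      by (rule measurable_face_measure_borel) (use Fb[OF that] gm[OF T] in measurable)
    have "(\<Sum>F\<in>\<F>. \<integral>\<^sup>+x. indicator F x * \<psi> T x \<partial>face_measure f)
       = (\<integral>\<^sup>+x. (\<Sum>F\<in>\<F>. indicator F x * \<psi> T x) \<partial>face_measure f)"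
      by (rule nn_integral_sum[symmetric]) (rule m)
    also have "\<dots> \<le> (\<integral>\<^sup>+x. \<psi> T x \<partial>face_measure f)"
    proof (rule nn_integral_mono_AE)
      define \<N> where "\<N> = (\<lambda>(F, F'). F \<inter> F') ` {(F, F') \<in> \<F> \<times> \<F>. F \<noteq> F'}"
      have "finite {(F, F') \<in> \<F> \<times> \<F>. F \<noteq> F'}"
        by (rule finite_subset[of _ "\<F> \<times> \<F>"]) (use fin in auto)
      then have finN: "finite \<N>" unfolding \<N>_def by (rule finite_imageI)
      have cl: "closed F'" if F': "F' \<in> \<F>" for F'
      proof -
        obtain n b where "flat_face F' n b" using F[OF F'] by blast
        then show ?thesis by (rule flat_face_frontier)
      qed
      have "aff_dim Y < int CARD('n) - 1 \<and> closed Y" if "Y \<in> \<N>" for Y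
        using that sep cl unfolding \<N>_def by auto
      then have "AE x in face_measure f. x \<notin> \<Union>\<N>" by (rule AE_face_measure_avoid[OF fl finN])
      then show "AE x in face_measure f. (\<Sum>F\<in>\<F>. indicator F x * \<psi> T x) \<le> \<psi> T x"
      proof eventually_elim
        case (elim x)
        have uni: "F1 = F2" if "F1 \<in> \<F>" "F2 \<in> \<F>" "x \<in> F1" "x \<in> F2" for F1 F2
        proof (rule ccontr)
          assume "F1 \<noteq> F2"
          then have "(F1, F2) \<in> {(F, F') \<in> \<F> \<times> \<F>. F \<noteq> F'}" using that by simp
          then have "F1 \<inter> F2 \<in> \<N>" unfolding \<N>_def by (rule rev_image_eqI) simp
          then show False using elim that by blast
        qed
        show ?case
        proof (cases "\<exists>F1\<in>\<F>. x \<in> F1")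
          case True
          then obtain F1 where F1: "F1 \<in> \<F>" "x \<in> F1" by blast
          have "(\<Sum>F\<in>\<F>. indicator F x * \<psi> T x) = (\<Sum>F\<in>{F1}. indicator F x * \<psi> T x)"
          proof (rule sum.mono_neutral_right[OF fin])
            show "\<forall>F\<in>\<F> - {F1}. indicator F x * \<psi> T x = 0"
            proof
              fix F assume "F \<in> \<F> - {F1}"
              then have "x \<notin> F" using uni[OF _ F1(1) _ F1(2), of F] by blast
              then show "indicator F x * \<psi> T x = 0" by simp
            qed
          qed (use F1(1) in simp)
          then show ?thesis using F1 by simp
        next
          case False
          then have "\<forall>F\<in>\<F>. indicator F x * \<psi> T x = 0" by simp
          then have "(\<Sum>F\<in>\<F>. indicator F x * \<psi> T x) = 0" by (intro sum.neutral) blast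
          then show ?thesis by simp
        qed
      qed
    qed
    finally show "(\<Sum>F\<in>\<F>. \<integral>\<^sup>+x. indicator F x * \<psi> T x \<partial>face_measure f) \<le> (\<integral>\<^sup>+x. \<psi> T x \<partial>face_measure f)" .
  qed
  also have "\<dots> \<le> (\<Sum>T\<in>\<S>. \<Sum>f\<in>Z T. ennreal ?C * (\<integral>\<^sup>+x. indicator T x * \<psi> T x \<partial>lborel))"
  proof (intro sum_mono)
    fix T f assume T: "T \<in> \<S>" and "f \<in> Z T"
    then have f: "f facet_of T" "f \<subseteq> frontier K" by (auto simp: Z_def)
    have "(\<integral>\<^sup>+x. \<psi> T x \<partial>face_measure f)
      \<le> ennreal (real ((N + 1) * (N + CARD('n))) / CARD('n) * (face_area f / measure lebesgue T)) *
        (\<integral>\<^sup>+x. indicator T x * \<psi> T x \<partial>lborel)"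
      unfolding \<psi>_def by (rule simplex_trace_vector[OF simp[OF T] d f(1) g[OF T]])
    also have "\<dots> \<le> ennreal ?C * (\<integral>\<^sup>+x. indicator T x * \<psi> T x \<partial>lborel)"
      by (intro mult_right_mono ennreal_leI mult_left_mono R[OF T f]) auto
    finally show "(\<integral>\<^sup>+x. \<psi> T x \<partial>face_measure f) \<le> ennreal ?C * (\<integral>\<^sup>+x. indicator T x * \<psi> T x \<partial>lborel)" .
  qed
  \<comment> \<open>At most d + 1 facets of a simplex lie on the boundary of K, and all have been
    estimated by the same volume integral.\<close>
  also have "\<dots> \<le> (\<Sum>T\<in>\<S>. ennreal (?C * (CARD('n) + 1)) * (\<integral>\<^sup>+x. indicator T x * \<psi> T x \<partial>lborel))"
  proof (rule sum_mono)
    fix T assume T: "T \<in> \<S>"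
    have C0: "?C \<ge> 0" using R0 by simp
    have "(\<Sum>f\<in>Z T. ennreal ?C * (\<integral>\<^sup>+x. indicator T x * \<psi> T x \<partial>lborel))
       = ennreal (?C * real (card (Z T))) * (\<integral>\<^sup>+x. indicator T x * \<psi> T x \<partial>lborel)"
      by (rule sum_constant_ennreal[OF C0])
    also have "\<dots> \<le> ennreal (?C * (CARD('n) + 1)) * (\<integral>\<^sup>+x. indicator T x * \<psi> T x \<partial>lborel)"
      by (intro mult_right_mono ennreal_leI mult_left_mono C0) (use Zcard[OF T] in auto)
    finally show "(\<Sum>f\<in>Z T. ennreal ?C * (\<integral>\<^sup>+x. indicator T x * \<psi> T x \<partial>lborel))
      \<le> ennreal (?C * (CARD('n) + 1)) * (\<integral>\<^sup>+x. indicator T x * \<psi> T x \<partial>lborel)" .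
  qed
  also have "\<dots> = ennreal (?C * (CARD('n) + 1)) * (\<Sum>T\<in>\<S>. \<integral>\<^sup>+x. indicator T x * \<psi> T x \<partial>lborel)"
    by (rule sum_distrib_left[symmetric])
  also have "(\<Sum>T\<in>\<S>. \<integral>\<^sup>+x. indicator T x * \<psi> T x \<partial>lborel) = (\<integral>\<^sup>+x. (\<Sum>T\<in>\<S>. indicator T x * \<psi> T x) \<partial>lborel)"
  proof (rule nn_integral_sum[symmetric])
    fix T assume T: "T \<in> \<S>"
    have "T \<in> sets borel" using closed_simplex[OF simp[OF T]] by simp
    then show "(\<lambda>x. indicator T x * \<psi> T x) \<in> borel_measurable lborel" using gm[OF T] by measurable
  qed
  also have "\<dots> = (\<integral>\<^sup>+x. indicator K x * \<phi> x \<partial>lborel)"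
  proof (rule nn_integral_cong_AE)
    show "AE x in lborel. (\<Sum>T\<in>\<S>. indicator T x * \<psi> T x) = indicator K x * \<phi> x"
      using disj \<phi>K
    proof eventually_elim
      case (elim x)
      show ?case
      proof (cases "x \<in> K")
        case True
        then obtain T0 where T0: "T0 \<in> \<S>" "x \<in> T0" using K by blast
        have "(\<Sum>T\<in>\<S>. indicator T x * \<psi> T x) = (\<Sum>T\<in>{T0}. indicator T x * \<psi> T x)"
        proof (rule sum.mono_neutral_right[OF finS])
          show "\<forall>T\<in>\<S> - {T0}. indicator T x * \<psi> T x = 0"
          proof
            fix T assume "T \<in> \<S> - {T0}"
            then have "x \<notin> T" using elim(1) T0 by blast
            then show "indicator T x * \<psi> T x = 0" by simp
          qed
        qed (use T0(1) in simp)
        then show ?thesis using T0 True elim(2) by (simp add: \<psi>_def)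
      next
        case False
        then have "\<forall>T\<in>\<S>. x \<notin> T" using K by blast
        then show ?thesis using False by simp
      qed
    qed
  qed
  finally show ?thesis .
qed

lemma bdd_meas_norm_sq:
  fixes f :: "'a \<Rightarrow> real^'n"
  shows "bdd_meas M f \<Longrightarrow> bdd_meas M (\<lambda>x. (norm (f x))\<^sup>2)"
  unfolding power2_norm_eq_inner by (rule bdd_meas_inner)

text \<open>Convexity of the square even gives the mean of the squares. The plain sum is enough and
  treats interior faces, with two traces, and boundary faces, with one, alike.\<close>

lemma norm_average_sq_le:
  fixes a :: "'i \<Rightarrow> 'b::real_normed_vector"
  assumes "finite I"
  shows "(norm ((1 / real (card I)) *\<^sub>R (\<Sum>i\<in>I. a i)))\<^sup>2 \<le> (\<Sum>i\<in>I. (norm (a i))\<^sup>2)"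
proof (cases "I = {}")
  case False
  then have n: "real (card I) \<ge> 1" using assms by (simp add: Suc_leI card_gt_0_iff)
  have "(norm (\<Sum>i\<in>I. a i))\<^sup>2 \<le> (\<Sum>i\<in>I. norm (a i))\<^sup>2"
    by (rule power_mono[OF norm_sum]) simp
  also have "\<dots> \<le> (\<Sum>i\<in>I. (norm (a i))\<^sup>2) * card I"
    by (rule sum_squared_le_sum_of_squares)
  finally have "(norm ((1 / real (card I)) *\<^sub>R (\<Sum>i\<in>I. a i)))\<^sup>2 \<le> (\<Sum>i\<in>I. (norm (a i))\<^sup>2) / card I"
    using n by (simp add: power_divide field_simps power2_eq_square)
  also have "\<dots> \<le> (\<Sum>i\<in>I. (norm (a i))\<^sup>2)"
    using n mult_left_mono[OF n, of "\<Sum>i\<in>I. (norm (a i))\<^sup>2"] by (simp add: pos_divide_le_eq sum_nonneg)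
  finally show ?thesis .
qed simp

context dg_problem
begin

section \<open>Flux bounds for polynomials and for piecewise polynomials\<close>

definition flux_sq :: "'n broken \<Rightarrow> real" where
  "flux_sq w = (\<Sum>F\<in>\<F>. integral\<^sup>L (MF F) (\<lambda>x. (norm (flx F w x))\<^sup>2 / \<sigma> F))"

abbreviation gsq :: "'n broken \<Rightarrow> (real^'n) set \<Rightarrow> real^'n \<Rightarrow> real" where "gsq w K x \<equiv> (norm (grad_in w K x))\<^sup>2"

definition c0 :: real where "c0 = 8 * Cstar * real k * (real k - 1 + real CARD('n)) / real CARD('n)"

lemma c0_pos: "c0 > 0"
  unfolding c0_def using Cstar_pos degree d2 by simp

lemma bdd_gsq: "w \<in> W \<Longrightarrow> K \<in> \<P> \<Longrightarrow> bdd_meas (MK K) (gsq w K)"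
  "w \<in> W \<Longrightarrow> F \<in> \<F> \<Longrightarrow> K \<in> adj F \<Longrightarrow> bdd_meas (MF F) (gsq w K)"
  by (rule bdd_meas_norm_sq[OF bdd_meas_grad_volume], assumption+)
     (rule bdd_meas_norm_sq[OF bdd_meas_grad_face], assumption+)

lemma bdd_flux_sq: "w \<in> W \<Longrightarrow> F \<in> \<F> \<Longrightarrow> bdd_meas (MF F) (\<lambda>x. (norm (flx F w x))\<^sup>2 / \<sigma> F)"
  using bdd_meas_mult[OF bdd_meas_norm_sq[OF bdd_flux] bdd_meas_const[of _ "1 / \<sigma> F"]] by simp

text \<open>Because of its maximum the penalty dominates the contribution of each adjacent element:
  with H the diameter, \<sigma> is at least \<open>c0\<close> times the square of \<open>dK\<close>
  times \<open>iK\<close> / H. Division by \<sigma> therefore consumes the bound on the trace of the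
  coefficient and leaves H / (c0 iK).\<close>

lemma flux_square_integral:
  assumes w: "w \<in> W" and F: "F \<in> \<F>"
  shows "integral\<^sup>L (MF F) (\<lambda>x. (norm (flx F w x))\<^sup>2 / \<sigma> F)
    \<le> (\<Sum>K\<in>adj F. diameter K / (c0 * iK K) * integral\<^sup>L (MF F) (gsq w K))"
proof -
  have s: "\<sigma> F > 0" by (rule penalty_pos[OF F])
  have co: "(dK K)\<^sup>2 / \<sigma> F \<le> diameter K / (c0 * iK K)" if K: "K \<in> adj F" for K
  proof -
    have KP: "K \<in> \<P>" by (rule adjD(1)[OF K])
    note pos = coefficient_bounds(8,9)[OF KP] diameter_pos[OF KP] c0_pos
    have "c0 * ((dK K)\<^sup>2 * iK K / diameter K) \<le> \<sigma> F"
      using penalty_ge[OF F K] by (simp add: delta_def c0_def)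
    then have "c0 * ((dK K)\<^sup>2 * iK K) \<le> \<sigma> F * diameter K"
      using pos by (simp add: pos_divide_le_eq)
    then have le: "(dK K)\<^sup>2 * (c0 * iK K) \<le> diameter K * \<sigma> F" by (simp only: mult_ac)
    have "c0 * iK K > 0" by (rule mult_pos_pos[OF pos(4,2)])
    moreover have "((dK K)\<^sup>2 * (c0 * iK K)) / \<sigma> F \<le> diameter K" using le s by (simp only: pos_divide_le_eq)
    ultimately show ?thesis by (simp only: pos_le_divide_eq times_divide_eq_left)
  qed
  have ae: "AE x in MF F. (norm (flx F w x))\<^sup>2 / \<sigma> F \<le> (\<Sum>K\<in>adj F. diameter K / (c0 * iK K) * gsq w K x)"
  proof -
    have "AE x in MF F. \<forall>K\<in>adj F. \<forall>y. norm (trace_from K D x *v y) \<le> dK K * norm y"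
      using trace_bounds(2)[OF F] finite_adj by (intro AE_finite_allI)
    then show ?thesis
    proof eventually_elim
      case (elim x)
      have "(norm (flx F w x))\<^sup>2 \<le> (\<Sum>K\<in>adj F. (norm (trace_from K D x *v grad_in w K x))\<^sup>2)"
        unfolding flux_average_def by (rule norm_average_sq_le[OF finite_adj])
      also have "\<dots> \<le> (\<Sum>K\<in>adj F. (dK K)\<^sup>2 * gsq w K x)"
      proof (rule sum_mono)
        fix K assume K: "K \<in> adj F"
        have "(norm (trace_from K D x *v grad_in w K x))\<^sup>2 \<le> (dK K * norm (grad_in w K x))\<^sup>2"
          by (rule power_mono) (use elim K in auto)
        then show "(norm (trace_from K D x *v grad_in w K x))\<^sup>2 \<le> (dK K)\<^sup>2 * gsq w K x"
          by (simp add: power_mult_distrib)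
      qed
      finally have "(norm (flx F w x))\<^sup>2 / \<sigma> F \<le> (\<Sum>K\<in>adj F. (dK K)\<^sup>2 * gsq w K x) / \<sigma> F"
        using s by (intro divide_right_mono) auto
      also have "\<dots> = (\<Sum>K\<in>adj F. (dK K)\<^sup>2 / \<sigma> F * gsq w K x)"
        by (simp add: sum_divide_distrib)
      also have "\<dots> \<le> (\<Sum>K\<in>adj F. diameter K / (c0 * iK K) * gsq w K x)"
        by (intro sum_mono mult_right_mono co) auto
      finally show ?case .
    qed
  qed
  have b: "bdd_meas (MF F) (\<lambda>x. \<Sum>K\<in>adj F. diameter K / (c0 * iK K) * gsq w K x)"
    by (intro bdd_meas_sum bdd_meas_mult bdd_meas_const bdd_gsq(2)[OF w F])
  have "integral\<^sup>L (MF F) (\<lambda>x. (norm (flx F w x))\<^sup>2 / \<sigma> F)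
     \<le> integral\<^sup>L (MF F) (\<lambda>x. \<Sum>K\<in>adj F. diameter K / (c0 * iK K) * gsq w K x)"
    by (rule integral_mono_bdd[OF finite_measure_face[OF F] bdd_flux_sq[OF w F] b ae])
  also have "\<dots> = (\<Sum>K\<in>adj F. integral\<^sup>L (MF F) (\<lambda>x. diameter K / (c0 * iK K) * gsq w K x))"
    by (rule Bochner_Integration.integral_sum)
       (intro integrable_mult_right bdd_meas_integrable[OF finite_measure_face[OF F]] bdd_gsq(2)[OF w F])
  also have "\<dots> = (\<Sum>K\<in>adj F. diameter K / (c0 * iK K) * integral\<^sup>L (MF F) (gsq w K))"
    by simp
  finally show ?thesis .
qed

lemma gsq_energy:
  assumes w: "w \<in> W" and K: "K \<in> \<P>"
  shows "integral\<^sup>L (MK K) (gsq w K) \<le> iK K * integral\<^sup>L (MK K) (vol_density K w w)"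
proof -
  have "AE x in MK K. gsq w K x \<le> iK K * vol_density K w w x"
    using coefficient_bounds(4)[OF K] vol_density_nonneg[OF K, of w]
  proof eventually_elim
    case (elim x)
    have "gsq w K x \<le> iK K * (grad_in w K x \<bullet> (D x *v grad_in w K x))" using elim(1) by blast
    also have "\<dots> \<le> iK K * vol_density K w w x"
      using elim(2) coefficient_bounds(9)[OF K] by (intro mult_left_mono) (auto simp: inner_commute)
    finally show ?case .
  qed
  then have "integral\<^sup>L (MK K) (gsq w K) \<le> integral\<^sup>L (MK K) (\<lambda>x. iK K * vol_density K w w x)"
    by (intro integral_mono_bdd finite_measure_element bdd_gsq bdd_meas_mult bdd_meas_const bdd_vol_density w K)
  then show ?thesis by simp
qed

text \<open>Isolates what depends on the trace inequality: B is its constant in units of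
  \<open>c0\<close> divided by the diameter. Diameter and \<open>c0\<close> cancel against the
  weight left by the penalty, and \<open>iK\<close> cancels against the factor from
  \<open>gsq_energy\<close>. Polynomials give d / 8, piecewise polynomials (d + 1) \<alpha> /
  \<gamma>.\<close>

lemma flux_energy:
  assumes w: "w \<in> W"
    and B: "\<And>K. K \<in> \<P> \<Longrightarrow> B K \<ge> 0 \<and>
      (\<Sum>F\<in>{F\<in>\<F>. K \<in> adj F}. integral\<^sup>L (MF F) (gsq w K)) \<le> c0 * B K / diameter K * integral\<^sup>L (MK K) (gsq w K)"
  shows "flux_sq w \<le> (\<Sum>K\<in>\<P>. B K * integral\<^sup>L (MK K) (vol_density K w w))"
proof -
  have "flux_sq w \<le> (\<Sum>F\<in>\<F>. \<Sum>K\<in>adj F. diameter K / (c0 * iK K) * integral\<^sup>L (MF F) (gsq w K))"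
    unfolding flux_sq_def by (rule sum_mono) (rule flux_square_integral[OF w])
  also have "\<dots> = (\<Sum>F\<in>\<F>. \<Sum>K\<in>{K\<in>\<P>. K \<in> adj F}. diameter K / (c0 * iK K) * integral\<^sup>L (MF F) (gsq w K))"
    by (rule sum.cong[OF refl], rule sum.cong[OF _ refl]) (auto simp: adjacent_def)
  also have "\<dots> = (\<Sum>K\<in>\<P>. \<Sum>F\<in>{F\<in>\<F>. K \<in> adj F}. diameter K / (c0 * iK K) * integral\<^sup>L (MF F) (gsq w K))"
    by (rule sum.swap_restrict[OF finite_F finite_P])
  also have "\<dots> \<le> (\<Sum>K\<in>\<P>. B K * integral\<^sup>L (MK K) (vol_density K w w))"
  proof (rule sum_mono)
    fix K assume K: "K \<in> \<P>"
    note pos = coefficient_bounds(9)[OF K] diameter_pos[OF K] c0_pos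
    have i: "c0 * iK K > 0" by (rule mult_pos_pos[OF pos(3,1)])
    have "(\<Sum>F\<in>{F\<in>\<F>. K \<in> adj F}. diameter K / (c0 * iK K) * integral\<^sup>L (MF F) (gsq w K))
      = diameter K / (c0 * iK K) * (\<Sum>F\<in>{F\<in>\<F>. K \<in> adj F}. integral\<^sup>L (MF F) (gsq w K))"
      by (rule sum_distrib_left[symmetric])
    also have "\<dots> \<le> diameter K / (c0 * iK K) * (c0 * B K / diameter K * (iK K * integral\<^sup>L (MK K) (vol_density K w w)))"
    proof (rule mult_left_mono)
      have "c0 * B K / diameter K \<ge> 0" using B[OF K] pos by (intro divide_nonneg_nonneg mult_nonneg_nonneg) auto
      then show "(\<Sum>F\<in>{F\<in>\<F>. K \<in> adj F}. integral\<^sup>L (MF F) (gsq w K))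
        \<le> c0 * B K / diameter K * (iK K * integral\<^sup>L (MK K) (vol_density K w w))"
        using B[OF K] mult_left_mono[OF gsq_energy[OF w K]] by (meson order_trans)
      show "0 \<le> diameter K / (c0 * iK K)" using i pos by (intro divide_nonneg_nonneg) auto
    qed
    also have "\<dots> = B K * integral\<^sup>L (MK K) (vol_density K w w)"
    proof -
      have e: "h / (c * i) * (c * b / h * (i * I)) = b * I" if "h \<noteq> 0" "c \<noteq> 0" "i \<noteq> 0" for h c i b I :: real
        using that by (simp add: field_simps)
      show ?thesis by (rule e) (use pos in linarith)+
    qed
    finally show "(\<Sum>F\<in>{F\<in>\<F>. K \<in> adj F}. diameter K / (c0 * iK K) * integral\<^sup>L (MF F) (gsq w K))
      \<le> B K * integral\<^sup>L (MK K) (vol_density K w w)" .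
  qed
  finally show ?thesis .
qed

lemma nn_integral_gsq:
  assumes w: "w \<in> W" and K: "K \<in> \<P>"
  shows "(\<integral>\<^sup>+x. indicator K x * ennreal (gsq w K x) \<partial>lborel) = ennreal (integral\<^sup>L (MK K) (gsq w K))"
    and "F \<in> \<F> \<Longrightarrow> K \<in> adj F \<Longrightarrow>
      (\<integral>\<^sup>+x. ennreal (gsq w K x) \<partial>MF F) = ennreal (integral\<^sup>L (MF F) (gsq w K))"
proof -
  have "(\<integral>\<^sup>+x. indicator K x * ennreal (gsq w K x) \<partial>lborel) = (\<integral>\<^sup>+x. ennreal (gsq w K x) * indicator K x \<partial>lebesgue)"
    by (simp add: nn_integral_completion mult.commute)
  also have "\<dots> = (\<integral>\<^sup>+x. ennreal (gsq w K x) \<partial>MK K)"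
    by (rule nn_integral_restrict_space[symmetric]) (use element_lebesgue[OF K] in simp)
  also have "\<dots> = ennreal (integral\<^sup>L (MK K) (gsq w K))"
    by (rule nn_integral_eq_integral[OF bdd_meas_integrable[OF finite_measure_element[OF K] bdd_gsq(1)[OF w K]]]) simp
  finally show "(\<integral>\<^sup>+x. indicator K x * ennreal (gsq w K x) \<partial>lborel) = ennreal (integral\<^sup>L (MK K) (gsq w K))" .
  show "(\<integral>\<^sup>+x. ennreal (gsq w K x) \<partial>MF F) = ennreal (integral\<^sup>L (MF F) (gsq w K))" if F: "F \<in> \<F>" "K \<in> adj F"
    by (rule nn_integral_eq_integral[OF bdd_meas_integrable[OF finite_measure_face[OF F(1)] bdd_gsq(2)[OF w F]]]) simp
qed

lemma sum_gsq:
  assumes w: "w \<in> W" and K: "K \<in> \<P>"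
  shows "(\<Sum>F\<in>{F\<in>\<F>. K \<in> adj F}. \<integral>\<^sup>+x. ennreal (gsq w K x) \<partial>MF F)
    = ennreal (\<Sum>F\<in>{F\<in>\<F>. K \<in> adj F}. integral\<^sup>L (MF F) (gsq w K))"
proof -
  have "(\<Sum>F\<in>{F\<in>\<F>. K \<in> adj F}. \<integral>\<^sup>+x. ennreal (gsq w K x) \<partial>MF F)
    = (\<Sum>F\<in>{F\<in>\<F>. K \<in> adj F}. ennreal (integral\<^sup>L (MF F) (gsq w K)))"
    by (rule sum.cong[OF refl]) (use nn_integral_gsq(2)[OF w K] in simp)
  also have "\<dots> = ennreal (\<Sum>F\<in>{F\<in>\<F>. K \<in> adj F}. integral\<^sup>L (MF F) (gsq w K))"
    by (rule sum_ennreal) (intro integral_nonneg_AE AE_I2, simp)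
  finally show ?thesis .
qed

lemma element_faces:
  assumes K: "K \<in> \<P>"
  shows "finite {F\<in>\<F>. K \<in> adj F}"
    and "F \<in> {F\<in>\<F>. K \<in> adj F} \<Longrightarrow> F \<subseteq> frontier K \<and> (\<exists>n b. flat_face F n b)"
    and "F \<in> {F\<in>\<F>. K \<in> adj F} \<Longrightarrow> F' \<in> {F\<in>\<F>. K \<in> adj F} \<Longrightarrow> F \<noteq> F' \<Longrightarrow> aff_dim (F \<inter> F') < int CARD('n) - 1"
proof -
  show "finite {F\<in>\<F>. K \<in> adj F}" using finite_F by simp
  show "F \<subseteq> frontier K \<and> (\<exists>n b. flat_face F n b)" if "F \<in> {F\<in>\<F>. K \<in> adj F}"
  proof
    show "F \<subseteq> frontier K" using that adjD(2) by blast
    have "F \<in> \<F>" using that by simp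
    then show "\<exists>n b. flat_face F n b" by (rule face_flat) blast
  qed
  show "aff_dim (F \<inter> F') < int CARD('n) - 1"
    if "F \<in> {F\<in>\<F>. K \<in> adj F}" "F' \<in> {F\<in>\<F>. K \<in> adj F}" "F \<noteq> F'"
    using face_separation that by simp
qed

lemma gsq_integral_nonneg: "integral\<^sup>L M (gsq w K) \<ge> 0"
  by (rule integral_nonneg_AE) simp

lemma polynomial_constant: "real ((k - 1 + 1) * (k - 1 + CARD('n))) = real k * (real k - 1 + real CARD('n))"
  using degree by (simp add: of_nat_diff)

text \<open>The gradient has degree k - 1, for which the constant (N + 1) (N + d) of the trace
  inequality becomes the factor k (k - 1 + d) of the penalty. Since 1 / \<rho> is at most Cstar
  divided by the diameter, the factor 8 in the penalty leaves d / 8.\<close>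

lemma V_flux:
  assumes v: "v \<in> V"
  shows "flux_sq v \<le> 3 / 8 * vol_form v v"
proof -
  have vW: "v \<in> W" by (rule VW[OF v])
  have "flux_sq v \<le> (\<Sum>K\<in>\<P>. real CARD('n) / 8 * integral\<^sup>L (MK K) (vol_density K v v))"
  proof (rule flux_energy[OF vW], rule conjI)
    fix K assume K: "K \<in> \<P>"
    show "real CARD('n) / 8 \<ge> 0" by simp
    obtain c \<rho> where st: "star_center K c \<rho>" "diameter K \<le> Cstar * \<rho>" using element_star[OF K] by blast
    have \<rho>: "\<rho> > 0" using st(1) by (simp add: star_center_def)
    obtain p where p: "p \<in> poly_space k" "\<forall>x\<in>K. v K x = p x" using v K unfolding V_space_def by blast
    obtain g where g: "\<And>x. (p has_derivative (\<lambda>h. g x \<bullet> h)) (at x)" "\<And>i. (\<lambda>x. g x $ i) \<in> poly_space (k - 1)"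
      using poly_space_gradient[OF p(1)] by blast
    have gr: "grad_in v K x = g x" if x: "regular_point (\<T> K) K x" for x
    proof -
      obtain T where T: "T \<in> \<T> K" "x \<in> T" using x unfolding regular_point_def by blast
      show ?thesis
      proof (rule regular_derivative(2)[OF submeshD(4)[OF K] submeshD(3)[OF K] x _ _ T])
        show "p \<in> poly_space k \<and> (\<forall>y\<in>T. v K y = p y)" if "T \<in> \<T> K" for T
          using p submeshD(4)[OF K] that by blast
        show "(p has_derivative (\<lambda>h. g x \<bullet> h)) (at x)" by (rule g(1))
      qed
    qed
    have face: "(\<integral>\<^sup>+x. ennreal ((norm (g x))\<^sup>2) \<partial>MF F) = (\<integral>\<^sup>+x. ennreal (gsq v K x) \<partial>MF F)"
      if "F \<in> {F\<in>\<F>. K \<in> adj F}" for F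
    proof (rule nn_integral_cong_AE)
      show "AE x in MF F. ennreal ((norm (g x))\<^sup>2) = ennreal (gsq v K x)"
        using regular_face[of F K] that by (auto elim!: eventually_mono simp: gr)
    qed
    have reg: "AE x in lborel. x \<in> K \<longrightarrow> regular_point (\<T> K) K x"
      using AE_regular_volume[OF submeshD(2,4,3)[OF K]] by (simp only: AE_completion_iff)
    have vol: "(\<integral>\<^sup>+x. indicator K x * ennreal ((norm (g x))\<^sup>2) \<partial>lborel) = (\<integral>\<^sup>+x. indicator K x * ennreal (gsq v K x) \<partial>lborel)"
    proof (rule nn_integral_cong_AE)
      show "AE x in lborel. indicator K x * ennreal ((norm (g x))\<^sup>2) = indicator K x * ennreal (gsq v K x)"
        using reg by eventually_elim (auto simp: gr indicator_def)
    qed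
    have "ennreal \<rho> * (\<Sum>F\<in>{F\<in>\<F>. K \<in> adj F}. \<integral>\<^sup>+x. ennreal ((norm (g x))\<^sup>2) \<partial>MF F)
      \<le> ennreal (real ((k - 1 + 1) * (k - 1 + CARD('n)))) * (\<integral>\<^sup>+x. indicator K x * ennreal ((norm (g x))\<^sup>2) \<partial>lborel)"
      by (rule element_trace_vector[OF st(1) compact_element[OF K] element_faces[OF K] g(2)])
    then have le: "\<rho> * (\<Sum>F\<in>{F\<in>\<F>. K \<in> adj F}. integral\<^sup>L (MF F) (gsq v K))
      \<le> real k * (real k - 1 + real CARD('n)) * integral\<^sup>L (MK K) (gsq v K)"
      unfolding vol nn_integral_gsq(1)[OF vW K] polynomial_constant
      using \<rho> degree gsq_integral_nonneg sum_gsq[OF vW K]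
      by (simp only: sum.cong[OF refl face]) (simp add: ennreal_mult[symmetric] sum_nonneg)
    have H: "diameter K > 0" by (rule diameter_pos[OF K])
    define S where "S = (\<Sum>F\<in>{F\<in>\<F>. K \<in> adj F}. integral\<^sup>L (MF F) (gsq v K))"
    have S: "S \<ge> 0" unfolding S_def by (intro sum_nonneg gsq_integral_nonneg)
    have "diameter K * S \<le> Cstar * \<rho> * S" by (rule mult_right_mono[OF st(2) S])
    also have "\<dots> \<le> Cstar * (real k * (real k - 1 + real CARD('n)) * integral\<^sup>L (MK K) (gsq v K))"
      using mult_left_mono[OF le, of Cstar] Cstar_pos by (simp add: S_def mult.assoc)
    also have "\<dots> = c0 * (real CARD('n) / 8) * integral\<^sup>L (MK K) (gsq v K)" by (simp add: c0_def)
    finally have "S \<le> (c0 * (real CARD('n) / 8) * integral\<^sup>L (MK K) (gsq v K)) / diameter K"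
      using H by (simp only: pos_le_divide_eq mult.commute)
    then show "(\<Sum>F\<in>{F\<in>\<F>. K \<in> adj F}. integral\<^sup>L (MF F) (gsq v K))
      \<le> c0 * (real CARD('n) / 8) / diameter K * integral\<^sup>L (MK K) (gsq v K)" by (simp add: S_def)
  qed
  also have "\<dots> = real CARD('n) / 8 * vol_form v v" unfolding vol_form_def by (rule sum_distrib_left[symmetric])
  also have "\<dots> \<le> 3 / 8 * vol_form v v"
    by (rule mult_right_mono[OF _ dg_norm_sq(4)[OF vW]]) (use d3 in simp)
  finally show ?thesis .
qed

text \<open>\<open>R\<close> is the bound on |f| / |T| encoded in the weight, namely \<alpha> /
  \<gamma> times 8 Cstar divided by the diameter. This 8 Cstar is the one contained in
  \<open>c0\<close>, so apart from \<alpha> / \<gamma> only the number d + 1 of facets of a simplex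
  remains, at most 4.\<close>

lemma W_flux:
  assumes w: "w \<in> W" and \<gamma>: "\<gamma> > 0"
  shows "flux_sq w \<le> 4 / \<gamma> * (\<Sum>K\<in>\<P>. stab_weight \<T> Cstar \<gamma> K * integral\<^sup>L (MK K) (vol_density K w w))"
proof -
  let ?\<alpha> = "stab_weight \<T> Cstar \<gamma>"
  have \<alpha>: "?\<alpha> K \<ge> \<gamma>" for K using \<gamma> unfolding stab_weight_def by simp
  have "flux_sq w \<le> (\<Sum>K\<in>\<P>. (real CARD('n) + 1) * ?\<alpha> K / \<gamma> * integral\<^sup>L (MK K) (vol_density K w w))"
  proof (rule flux_energy[OF w], rule conjI)
    fix K assume K: "K \<in> \<P>"
    have H: "diameter K > 0" by (rule diameter_pos[OF K])
    show "(real CARD('n) + 1) * ?\<alpha> K / \<gamma> \<ge> 0" using \<alpha>[of K] \<gamma> by simp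
    define R where "R = ?\<alpha> K / \<gamma> * (8 * Cstar / diameter K)"
    have R0: "R \<ge> 0" unfolding R_def using \<alpha>[of K] \<gamma> Cstar_pos H by (intro mult_nonneg_nonneg divide_nonneg_nonneg) auto
    have R: "face_area f / measure lebesgue T \<le> R" if T: "T \<in> \<T> K" "f facet_of T" "f \<subseteq> frontier K" for T f
    proof -
      define S where "S = {face_area f / measure lebesgue T | T f. T \<in> \<T> K \<and> f facet_of T \<and> f \<subseteq> frontier K}"
      have "S \<subseteq> (\<Union>T\<in>\<T> K. (\<lambda>f. face_area f / measure lebesgue T) ` {f. f facet_of T})"
        unfolding S_def by blast
      moreover have "finite (\<Union>T\<in>\<T> K. (\<lambda>f. face_area f / measure lebesgue T) ` {f. f facet_of T})"
        using submeshD(2)[OF K] simplex_facets_card(1)[OF submeshD(3)[OF K]] by blast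
      ultimately have "finite S" by (rule finite_subset)
      moreover have "face_area f / measure lebesgue T \<in> S" unfolding S_def using T by blast
      ultimately have le: "face_area f / measure lebesgue T \<le> Max S" by (rule Max_ge)
      have "diameter K / (8 * Cstar) * Max S \<le> ?\<alpha> K / \<gamma>"
        using \<gamma> unfolding stab_weight_def S_def[symmetric] by simp
      then have "diameter K / (8 * Cstar) * Max S * (8 * Cstar / diameter K) \<le> R"
        unfolding R_def by (rule mult_right_mono) (use H Cstar_pos in simp)
      then have "Max S \<le> R" using H Cstar_pos by simp
      then show ?thesis using le by linarith
    qed
    obtain g where g: "\<forall>T\<in>\<T> K. \<forall>i. (\<lambda>x. g T x $ i) \<in> poly_space (k - 1)"
      "\<forall>T\<in>\<T> K. \<forall>x\<in>T. regular_point (\<T> K) K x \<longrightarrow> grad_in w K x = g T x"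
      by (rule gradient_representative[OF w K])
    have "(\<Sum>F\<in>{F\<in>\<F>. K \<in> adj F}. \<integral>\<^sup>+x. ennreal (gsq w K x) \<partial>MF F)
      \<le> ennreal (real ((k - 1 + 1) * (k - 1 + CARD('n))) / CARD('n) * R * (CARD('n) + 1)) *
        (\<integral>\<^sup>+x. indicator K x * ennreal (gsq w K x) \<partial>lborel)"
    proof (rule piecewise_trace_inequality[OF submeshD(1)[OF K] submeshD(3)[OF K] submeshD(4)[OF K] d2 element_faces[OF K] _ R R0])
      show "(\<lambda>x. g T x $ i) \<in> poly_space (k - 1)" if "T \<in> \<T> K" for T i using g(1) that by blast
      show "AE x in MF F. \<forall>T\<in>\<T> K. x \<in> T \<longrightarrow> ennreal (gsq w K x) = ennreal ((norm (g T x))\<^sup>2)"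
        if "F \<in> {F\<in>\<F>. K \<in> adj F}" for F
      proof -
        have "AE x in MF F. regular_point (\<T> K) K x" using regular_face that by simp
        then show ?thesis by eventually_elim (use g(2) in simp)
      qed
      have "AE x in lborel. x \<in> K \<longrightarrow> regular_point (\<T> K) K x"
        using AE_regular_volume[OF submeshD(2,4,3)[OF K]] by (simp only: AE_completion_iff)
      then show "AE x in lborel. x \<in> K \<longrightarrow> (\<forall>T\<in>\<T> K. x \<in> T \<longrightarrow> ennreal (gsq w K x) = ennreal ((norm (g T x))\<^sup>2))"
        by eventually_elim (use g(2) in simp)
    qed
    then have "ennreal (\<Sum>F\<in>{F\<in>\<F>. K \<in> adj F}. integral\<^sup>L (MF F) (gsq w K))
      \<le> ennreal (real k * (real k - 1 + real CARD('n)) / CARD('n) * R * (CARD('n) + 1)) *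
        ennreal (integral\<^sup>L (MK K) (gsq w K))"
      unfolding sum_gsq[OF w K] nn_integral_gsq(1)[OF w K] polynomial_constant .
    moreover have nn: "real k * (real k - 1 + real CARD('n)) / CARD('n) * R * (CARD('n) + 1) \<ge> 0"
      using R0 degree by (intro mult_nonneg_nonneg divide_nonneg_nonneg) auto
    ultimately have "(\<Sum>F\<in>{F\<in>\<F>. K \<in> adj F}. integral\<^sup>L (MF F) (gsq w K))
      \<le> real k * (real k - 1 + real CARD('n)) / CARD('n) * R * (CARD('n) + 1) * integral\<^sup>L (MK K) (gsq w K)"
      using gsq_integral_nonneg by (simp only: ennreal_mult[symmetric] ennreal_le_iff mult_nonneg_nonneg)
    also have "real k * (real k - 1 + real CARD('n)) / CARD('n) * R * (CARD('n) + 1)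
      = c0 * ((real CARD('n) + 1) * ?\<alpha> K / \<gamma>) / diameter K"
      using H \<gamma> unfolding R_def c0_def by (simp add: field_simps)
    finally show "(\<Sum>F\<in>{F\<in>\<F>. K \<in> adj F}. integral\<^sup>L (MF F) (gsq w K))
      \<le> c0 * ((real CARD('n) + 1) * ?\<alpha> K / \<gamma>) / diameter K * integral\<^sup>L (MK K) (gsq w K)" .
  qed
  also have "\<dots> \<le> (\<Sum>K\<in>\<P>. 4 / \<gamma> * (?\<alpha> K * integral\<^sup>L (MK K) (vol_density K w w)))"
  proof (rule sum_mono)
    fix K assume K: "K \<in> \<P>"
    have "(real CARD('n) + 1) * (?\<alpha> K * integral\<^sup>L (MK K) (vol_density K w w) / \<gamma>) \<le> 4 * (?\<alpha> K * integral\<^sup>L (MK K) (vol_density K w w) / \<gamma>)"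
      by (rule mult_right_mono) (use d3 \<alpha>[of K] \<gamma> dg_norm_sq(2)[OF w K] in auto)
    then show "(real CARD('n) + 1) * ?\<alpha> K / \<gamma> * integral\<^sup>L (MK K) (vol_density K w w) \<le> 4 / \<gamma> * (?\<alpha> K * integral\<^sup>L (MK K) (vol_density K w w))"
      by simp
  qed
  also have "\<dots> = 4 / \<gamma> * (\<Sum>K\<in>\<P>. ?\<alpha> K * integral\<^sup>L (MK K) (vol_density K w w))" by (rule sum_distrib_left[symmetric])
  finally show ?thesis .
qed

end

section \<open>Coercivity and mixed terms\<close>

locale dg_method = dg_problem \<Omega> \<P> \<F> \<T> D \<mu> k Cstar Cqu Csh
  for \<Omega> :: "(real^'n) set" and \<P> \<F> :: "(real^'n) set set" and \<T> :: "(real^'n) set \<Rightarrow> (real^'n) set set"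
    and D :: "real^'n \<Rightarrow> real^'n^'n" and \<mu> :: "real^'n \<Rightarrow> real" and k :: nat and Cstar Cqu Csh :: real +
  fixes \<kappa> \<theta> \<gamma> Cequiv :: real
  assumes theta: "\<theta> \<in> {-1..1}"
    and equiv_pos: "Cequiv > 0"
    and equiv: "\<And>v. v \<in> W \<Longrightarrow> (dg_norm \<P> \<F> D \<mu> k Cstar v)\<^sup>2 \<le> Cequiv *
      (stab_norm \<P> \<F> \<T> D \<mu> k (stab_weight \<T> Cstar \<gamma>) (\<lambda>K x. stab_weight \<T> Cstar \<gamma> K powr (-1/2) * v K x))\<^sup>2"
    and gamma: "\<gamma> \<ge> 25 * Cequiv"
begin

abbreviation "\<alpha> \<equiv> stab_weight \<T> Cstar \<gamma>"
abbreviation "s \<equiv> stab \<P> \<F> \<T> D \<mu> k \<alpha>"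
abbreviation "Ep \<equiv> E_plus \<P> \<T> k \<kappa>"
abbreviation "Em \<equiv> E_minus \<P> \<T> k \<kappa>"

definition node_weight :: "(real^'n) set \<Rightarrow> (real^'n) set \<Rightarrow> real" where
  "node_weight K T = mat_Linf_norm (patch \<P> \<F> K) D * diameter T ^ (CARD('n) - 2)
      + Linf_norm T (\<lambda>x. \<bar>\<mu> x\<bar>) * diameter T ^ CARD('n)"

lemma gamma_pos: "\<gamma> > 0" using gamma equiv_pos by simp

lemma alpha_ge: "\<alpha> K \<ge> \<gamma>" using gamma_pos unfolding stab_weight_def by simp

lemma alpha_pos: "\<alpha> K > 0" using alpha_ge gamma_pos by (rule less_le_trans[rotated])

lemma node_weight_nonneg: "K \<in> \<P> \<Longrightarrow> T \<in> \<T> K \<Longrightarrow> node_weight K T \<ge> 0"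
proof -
  assume "K \<in> \<P>" "T \<in> \<T> K"
  then have "compact T" using submeshD(3) compact_simplex by blast
  then have "diameter T \<ge> 0" by (rule diameter_ge_0[OF compact_imp_bounded])
  then show ?thesis unfolding node_weight_def mat_Linf_norm_def Linf_norm_def by simp
qed

lemma stab_eq: "stab \<P> \<F> \<T> D \<mu> k \<beta> w v = (\<Sum>K\<in>\<P>. \<beta> K * (\<Sum>T\<in>\<T> K. \<Sum>z\<in>lagrange_nodes k T. node_weight K T * (w K z * v K z)))"
  unfolding stab_def node_weight_def by (simp add: mult.assoc)

lemma stab_mono:
  assumes "\<And>K. K \<in> \<P> \<Longrightarrow> 0 \<le> \<beta> K"
    "\<And>K T z. K \<in> \<P> \<Longrightarrow> T \<in> \<T> K \<Longrightarrow> z \<in> lagrange_nodes k T \<Longrightarrow> w K z * v K z \<le> w' K z * v' K z"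
  shows "stab \<P> \<F> \<T> D \<mu> k \<beta> w v \<le> stab \<P> \<F> \<T> D \<mu> k \<beta> w' v'"
  unfolding stab_eq
proof (rule sum_mono)
  fix K assume K: "K \<in> \<P>"
  show "\<beta> K * (\<Sum>T\<in>\<T> K. \<Sum>z\<in>lagrange_nodes k T. node_weight K T * (w K z * v K z))
    \<le> \<beta> K * (\<Sum>T\<in>\<T> K. \<Sum>z\<in>lagrange_nodes k T. node_weight K T * (w' K z * v' K z))"
    by (rule mult_left_mono[OF _ assms(1)[OF K]], rule sum_mono, rule sum_mono)
       (rule mult_left_mono[OF assms(2)[OF K] node_weight_nonneg[OF K]], assumption+)
qed

lemma s_mono:
  assumes "\<And>K T z. K \<in> \<P> \<Longrightarrow> T \<in> \<T> K \<Longrightarrow> z \<in> lagrange_nodes k T \<Longrightarrow> w K z * v K z \<le> w' K z * v' K z"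
  shows "s w v \<le> s w' v'"
  by (rule stab_mono[OF less_imp_le[OF alpha_pos] assms])

lemma s_linear:
  "s (\<lambda>K x. a * u K x + b * u' K x) v = a * s u v + b * s u' v"
  unfolding stab_eq sum_distrib_left sum.distrib[symmetric]
  by (intro sum.cong refl) (simp add: algebra_simps)

lemma s_commute: "s u v = s v u"
  unfolding stab_eq by (intro sum.cong refl arg_cong2[where f = times] mult.commute)

lemma s_nonneg: "s v v \<ge> 0"
  using s_mono[of "\<lambda>_ _. 0" "\<lambda>_ _. 0" v v] by (simp add: stab_eq)

text \<open>The two half powers cancel the weight. In unweighted form the norm equivalence can be
  applied to functions rescaled on each element.\<close>

lemma stab_norm_scaled: "(stab_norm \<P> \<F> \<T> D \<mu> k \<alpha> (\<lambda>K x. \<alpha> K powr (-1/2) * v K x))\<^sup>2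
  = stab \<P> \<F> \<T> D \<mu> k (\<lambda>_. 1) v v"
proof -
  have "s (\<lambda>K x. \<alpha> K powr (-1/2) * v K x) (\<lambda>K x. \<alpha> K powr (-1/2) * v K x) = stab \<P> \<F> \<T> D \<mu> k (\<lambda>_. 1) v v"
    unfolding stab_eq
  proof (rule sum.cong[OF refl])
    fix K
    have "\<alpha> K powr (-1/2) * \<alpha> K powr (-1/2) = \<alpha> K powr (-1)"
      by (simp add: powr_add[symmetric])
    then have c: "\<alpha> K * (\<alpha> K powr (-1/2) * \<alpha> K powr (-1/2)) = 1"
      using alpha_pos[of K] by (simp add: powr_minus)
    have "(\<Sum>T\<in>\<T> K. \<Sum>z\<in>lagrange_nodes k T. node_weight K T * (\<alpha> K powr (-1/2) * v K z * (\<alpha> K powr (-1/2) * v K z)))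
      = (\<alpha> K powr (-1/2) * \<alpha> K powr (-1/2)) * (\<Sum>T\<in>\<T> K. \<Sum>z\<in>lagrange_nodes k T. node_weight K T * (v K z * v K z))"
      unfolding sum_distrib_left by (intro sum.cong refl) (simp only: mult_ac)
    then show "\<alpha> K * (\<Sum>T\<in>\<T> K. \<Sum>z\<in>lagrange_nodes k T. node_weight K T * (\<alpha> K powr (-1/2) * v K z * (\<alpha> K powr (-1/2) * v K z)))
      = 1 * (\<Sum>T\<in>\<T> K. \<Sum>z\<in>lagrange_nodes k T. node_weight K T * (v K z * v K z))"
      using c by (simp only: mult.assoc[symmetric])
  qed
  then show ?thesis unfolding stab_norm_def real_sqrt_pow2[OF s_nonneg] .
qed

text \<open>Every weight is at least \<gamma>, which is at least 25 Cequiv; here this lower bound on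
  the weight suffices because no trace factor has to be compensated.\<close>

lemma equiv_unweighted: "w \<in> W \<Longrightarrow> vol_form w w + jump_form w w \<le> s w w / 25"
proof -
  assume w: "w \<in> W"
  have S1: "\<gamma> * stab \<P> \<F> \<T> D \<mu> k (\<lambda>_. 1) w w \<le> s w w"
    unfolding stab_eq sum_distrib_left[of \<gamma>]
  proof (rule sum_mono)
    fix K assume K: "K \<in> \<P>"
    have "0 \<le> (\<Sum>T\<in>\<T> K. \<Sum>z\<in>lagrange_nodes k T. node_weight K T * (w K z * w K z))"
      by (intro sum_nonneg mult_nonneg_nonneg[OF node_weight_nonneg[OF K] zero_le_square])
    then show "\<gamma> * (1 * (\<Sum>T\<in>\<T> K. \<Sum>z\<in>lagrange_nodes k T. node_weight K T * (w K z * w K z)))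
      \<le> \<alpha> K * (\<Sum>T\<in>\<T> K. \<Sum>z\<in>lagrange_nodes k T. node_weight K T * (w K z * w K z))"
      using mult_right_mono[OF alpha_ge[of K]] by simp
  qed
  have n0: "stab \<P> \<F> \<T> D \<mu> k (\<lambda>_. 1) w w \<ge> 0"
    using stab_mono[of "\<lambda>_. 1" "\<lambda>_ _. 0" "\<lambda>_ _. 0" w w] by (simp add: stab_eq)
  have "25 * (vol_form w w + jump_form w w) \<le> 25 * (Cequiv * stab \<P> \<F> \<T> D \<mu> k (\<lambda>_. 1) w w)"
    using equiv[OF w] unfolding stab_norm_scaled dg_norm_sq(1)[OF w] by simp
  also have "\<dots> \<le> \<gamma> * stab \<P> \<F> \<T> D \<mu> k (\<lambda>_. 1) w w"
    using mult_right_mono[OF gamma n0] by simp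
  finally show ?thesis using S1 by simp
qed

text \<open>For the rescaled function \<open>w'\<close> the unweighted stabilisation is s(w, w) and
  the volume energy is the weighted sum. Its jumps mix the weights of two elements, but they only
  add to the norm and are dropped.\<close>

lemma equiv_weighted: "w \<in> W \<Longrightarrow> (\<Sum>K\<in>\<P>. \<alpha> K * integral\<^sup>L (MK K) (vol_density K w w)) \<le> Cequiv * s w w"
proof -
  assume w: "w \<in> W"
  define w' where "w' = (\<lambda>K x. \<alpha> K powr (1/2) * w K x + 0 * w K x)"
  have w': "w' \<in> W" unfolding w'_def by (rule W_space_comb[OF w w])
  have sq: "\<alpha> K powr (1/2) * \<alpha> K powr (1/2) = \<alpha> K" for K
    using alpha_pos[of K] by (simp add: powr_add[symmetric])
  have "\<alpha> K * integral\<^sup>L (MK K) (vol_density K w w) = integral\<^sup>L (MK K) (vol_density K w' w')" if K: "K \<in> \<P>" for K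
  proof -
    have "integral\<^sup>L (MK K) (vol_density K w' w') = \<alpha> K * integral\<^sup>L (MK K) (vol_density K w w) + 0 * integral\<^sup>L (MK K) (vol_density K w w)"
    proof (rule integral_linear_combination[OF finite_measure_element[OF K] bdd_vol_density[OF w w K] bdd_vol_density[OF w w K] bdd_vol_density[OF w' w' K]])
      show "AE x in MK K. vol_density K w' w' x = \<alpha> K * vol_density K w w x + 0 * vol_density K w w x"
        using regular_volume[OF K]
      proof eventually_elim
        case (elim x)
        have g: "grad_in w' K x = \<alpha> K powr (1/2) *\<^sub>R grad_in w K x"
          using grad_in_linear[OF w w K elim, of "\<lambda>K. \<alpha> K powr (1/2)" "\<lambda>_. 0"] by (simp add: w'_def)
        have "vol_density K w' w' x = (\<alpha> K powr (1/2) * \<alpha> K powr (1/2)) * vol_density K w w x"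
          unfolding vol_density_def g by (simp add: w'_def matrix_vector_mult_scaleR algebra_simps)
        then show ?case unfolding sq by simp
      qed
    qed
    then show ?thesis by simp
  qed
  then have "(\<Sum>K\<in>\<P>. \<alpha> K * integral\<^sup>L (MK K) (vol_density K w w)) = vol_form w' w'" unfolding vol_form_def by simp
  also have "\<dots> \<le> (nrm w')\<^sup>2" using dg_norm_sq(1,5)[OF w'] by simp
  also have "\<dots> \<le> Cequiv * stab \<P> \<F> \<T> D \<mu> k (\<lambda>_. 1) w' w'"
    using equiv[OF w'] unfolding stab_norm_scaled .
  also have "stab \<P> \<F> \<T> D \<mu> k (\<lambda>_. 1) w' w' = s w w"
    unfolding stab_eq
  proof (rule sum.cong[OF refl])
    fix K
    have "(\<Sum>T\<in>\<T> K. \<Sum>z\<in>lagrange_nodes k T. node_weight K T * (w' K z * w' K z))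
      = (\<alpha> K powr (1/2) * \<alpha> K powr (1/2)) * (\<Sum>T\<in>\<T> K. \<Sum>z\<in>lagrange_nodes k T. node_weight K T * (w K z * w K z))"
      unfolding sum_distrib_left by (intro sum.cong refl) (simp add: w'_def)
    then show "1 * (\<Sum>T\<in>\<T> K. \<Sum>z\<in>lagrange_nodes k T. node_weight K T * (w' K z * w' K z))
      = \<alpha> K * (\<Sum>T\<in>\<T> K. \<Sum>z\<in>lagrange_nodes k T. node_weight K T * (w K z * w K z))"
      unfolding sq by simp
  qed
  finally show ?thesis .
qed

lemma flux_sq_stab: "w \<in> W \<Longrightarrow> flux_sq w \<le> 4 / 25 * s w w"
proof -
  assume w: "w \<in> W"
  have "flux_sq w \<le> 4 / \<gamma> * (\<Sum>K\<in>\<P>. \<alpha> K * integral\<^sup>L (MK K) (vol_density K w w))" by (rule W_flux[OF w gamma_pos])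
  also have "\<dots> \<le> 4 / \<gamma> * (Cequiv * s w w)"
    by (rule mult_left_mono[OF equiv_weighted[OF w]]) (use gamma_pos in simp)
  also have "\<dots> = 4 * (Cequiv / \<gamma>) * s w w" by simp
  also have "\<dots> \<le> 4 * (1 / 25) * s w w"
  proof (rule mult_right_mono[OF _ s_nonneg])
    have "Cequiv / \<gamma> \<le> 1 / 25" using gamma gamma_pos by (simp add: pos_divide_le_eq)
    then show "4 * (Cequiv / \<gamma>) \<le> 4 * (1 / 25)" by simp
  qed
  finally show ?thesis by simp
qed

text \<open>Nonnegativity of the form at e v + w and at e v - w, divided by e.\<close>

lemma young_form:
  assumes lin: "\<And>u v w a b. u \<in> W \<Longrightarrow> v \<in> W \<Longrightarrow> w \<in> W \<Longrightarrow> B (\<lambda>K x. a * u K x + b * v K x) w = a * B u w + b * (B v w :: real)"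
    and sym: "\<And>u v. u \<in> W \<Longrightarrow> v \<in> W \<Longrightarrow> B u v = B v u" and pos: "\<And>v. v \<in> W \<Longrightarrow> B v v \<ge> 0"
    and w: "w \<in> W" and v: "v \<in> W" and e: "e > 0"
  shows "2 * \<bar>B w v\<bar> \<le> e * B v v + (1 / e) * B w w"
proof -
  have *: "0 \<le> e * (e * B v v) + 2 * t * e * B w v + t * t * B w w" for t
  proof -
    define z where "z = (\<lambda>K x. e * v K x + t * w K x)"
    have z: "z \<in> W" unfolding z_def by (rule W_comb[OF v w])
    have l: "B z y = e * B v y + t * B w y" if "y \<in> W" for y unfolding z_def by (rule lin[OF v w that])
    have "B z z = e * B z v + t * B z w" unfolding l[OF z] sym[OF v z] sym[OF w z] ..
    also have "\<dots> = e * (e * B v v) + 2 * t * e * B w v + t * t * B w w"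
      unfolding l[OF v] l[OF w] sym[OF v w] by (simp add: algebra_simps)
    finally have "B z z = e * (e * B v v) + 2 * t * e * B w v + t * t * B w w" .
    then show ?thesis using pos[OF z] by (simp only:)
  qed
  have "2 * e * \<bar>B w v\<bar> \<le> e * (e * B v v) + B w w"
    using *[of 1] *[of "-1"] by (simp add: abs_if)
  then have "(2 * e * \<bar>B w v\<bar>) / e \<le> (e * (e * B v v) + B w w) / e"
    using e by (intro divide_right_mono) auto
  then show ?thesis using e by (simp add: add_divide_distrib)
qed

lemma young_flux:
  assumes w: "w \<in> W" and v: "v \<in> W" and e: "e > 0"
  shows "2 * \<bar>flux_form w v\<bar> \<le> e * flux_sq w + (1 / e) * jump_form v v"
proof -
  have one: "2 * \<bar>integral\<^sup>L (MF F) (flux_density F w v)\<bar>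
    \<le> e * integral\<^sup>L (MF F) (\<lambda>x. (norm (flx F w x))\<^sup>2 / \<sigma> F) + (1 / e) * integral\<^sup>L (MF F) (jump_density F v v)"
    if F: "F \<in> \<F>" for F
  proof -
    note fM = finite_measure_face[OF F]
    have pt: "2 * \<bar>flux_density F w v x\<bar> \<le> e * ((norm (flx F w x))\<^sup>2 / \<sigma> F) + (1 / e) * jump_density F v v x" for x
      unfolding flux_density_def jump_density_def using young_inner[OF penalty_pos[OF F] e] by (simp add: power2_norm_eq_inner)
    have b: "bdd_meas (MF F) (\<lambda>x. e * ((norm (flx F w x))\<^sup>2 / \<sigma> F) + (1 / e) * jump_density F v v x)"
      by (intro bdd_meas_add bdd_meas_mult bdd_meas_const bdd_flux_sq bdd_jump_density w v F)
    have I: "integral\<^sup>L (MF F) (\<lambda>x. e * ((norm (flx F w x))\<^sup>2 / \<sigma> F) + (1 / e) * jump_density F v v x)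
      = e * integral\<^sup>L (MF F) (\<lambda>x. (norm (flx F w x))\<^sup>2 / \<sigma> F) + (1 / e) * integral\<^sup>L (MF F) (jump_density F v v)"
      by (rule integral_linear_combination[OF fM bdd_flux_sq[OF w F] bdd_jump_density[OF v v F] b]) simp
    have "c * integral\<^sup>L (MF F) (flux_density F w v) \<le> integral\<^sup>L (MF F) (\<lambda>x. e * ((norm (flx F w x))\<^sup>2 / \<sigma> F) + (1 / e) * jump_density F v v x)"
      if c: "\<bar>c\<bar> = 2" for c
    proof -
      have "integral\<^sup>L (MF F) (\<lambda>x. c * flux_density F w v x) \<le> integral\<^sup>L (MF F) (\<lambda>x. e * ((norm (flx F w x))\<^sup>2 / \<sigma> F) + (1 / e) * jump_density F v v x)"
      proof (rule integral_mono_bdd[OF fM bdd_meas_mult[OF bdd_meas_const bdd_flux_density[OF w v F]] b], rule AE_I2)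
        fix x
        have "c * flux_density F w v x \<le> \<bar>c\<bar> * \<bar>flux_density F w v x\<bar>" by (simp add: abs_mult[symmetric])
        then show "c * flux_density F w v x \<le> e * ((norm (flx F w x))\<^sup>2 / \<sigma> F) + (1 / e) * jump_density F v v x"
          using pt[of x] c by simp
      qed
      then show ?thesis by simp
    qed
    from this[of 2] this[of "-2"] show ?thesis unfolding I by (simp add: abs_if)
  qed
  have "2 * \<bar>flux_form w v\<bar> \<le> (\<Sum>F\<in>\<F>. 2 * \<bar>integral\<^sup>L (MF F) (flux_density F w v)\<bar>)"
    unfolding flux_form_def sum_distrib_left[symmetric] by (intro mult_left_mono sum_abs) simp
  also have "\<dots> \<le> (\<Sum>F\<in>\<F>. e * integral\<^sup>L (MF F) (\<lambda>x. (norm (flx F w x))\<^sup>2 / \<sigma> F) + (1 / e) * integral\<^sup>L (MF F) (jump_density F v v))"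
    by (rule sum_mono) (rule one)
  also have "\<dots> = e * flux_sq w + (1 / e) * jump_form v v"
    unfolding flux_sq_def jump_form_def sum_distrib_left sum.distrib ..
  finally show ?thesis .
qed

lemma young_E: "w \<in> W \<Longrightarrow> v \<in> W \<Longrightarrow> e > 0 \<Longrightarrow> 2 * \<bar>vol_form w v\<bar> \<le> e * vol_form v v + (1 / e) * vol_form w w"
  by (rule young_form[of vol_form]) (rule forms_linear_left(1) forms_symmetric(1) dg_norm_sq(4); assumption)+

lemma young_J: "w \<in> W \<Longrightarrow> v \<in> W \<Longrightarrow> e > 0 \<Longrightarrow> 2 * \<bar>jump_form w v\<bar> \<le> e * jump_form v v + (1 / e) * jump_form w w"
  by (rule young_form[of jump_form]) (rule forms_linear_left(2) forms_symmetric(2) dg_norm_sq(5); assumption)+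

lemma theta_mult: "\<theta> * x \<le> \<bar>x\<bar>" "- \<theta> * x \<le> \<bar>x\<bar>"
proof -
  have "\<bar>\<theta>\<bar> * \<bar>x\<bar> \<le> 1 * \<bar>x\<bar>" by (rule mult_right_mono) (use theta in auto)
  then have "\<bar>\<theta> * x\<bar> \<le> \<bar>x\<bar>" by (simp add: abs_mult)
  then show "\<theta> * x \<le> \<bar>x\<bar>" "- \<theta> * x \<le> \<bar>x\<bar>" by linarith+
qed

text \<open>The Young parameters are tuned to the reserve in \<open>coercive\<close>. For m they
  leave 5 times the volume and 6 times the jump energy, at most 6/25 of s(m, m), and twice the flux,
  at most 8/25. For v the volume part receives 1/20 directly and 3/32 through the flux of v, the
  jump part 1/20 and 1/8.\<close>

lemma mixed_bound:
  assumes m: "m \<in> W" and v: "v \<in> V"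
  shows "\<bar>adg \<theta> m v\<bar> \<le> 14 / 25 * s m m + 23 / 160 * vol_form v v + 7 / 40 * jump_form v v"
proof -
  have vW: "v \<in> W" by (rule VW[OF v])
  have e: "2 * \<bar>vol_form m v\<bar> \<le> 1 / 10 * vol_form v v + 10 * vol_form m m" using young_E[OF m vW, of "1/10"] by simp
  have j: "2 * \<bar>jump_form m v\<bar> \<le> 1 / 10 * jump_form v v + 10 * jump_form m m" using young_J[OF m vW, of "1/10"] by simp
  have f1: "2 * \<bar>flux_form m v\<bar> \<le> 4 * flux_sq m + 1 / 4 * jump_form v v" using young_flux[OF m vW, of 4] by simp
  have f2: "2 * \<bar>flux_form v m\<bar> \<le> 1 / 2 * flux_sq v + 2 * jump_form m m" using young_flux[OF vW m, of "1/2"] by simp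
  have eq: "adg \<theta> m v = vol_form m v + jump_form m v - (flux_form m v + \<theta> * flux_form v m)" by (rule a_DG_split[OF m vW])
  note facts = e j f1 f2 theta_mult[of "flux_form v m"] equiv_unweighted[OF m] flux_sq_stab[OF m] V_flux[OF v]
    dg_norm_sq(4,5)[OF m] abs_ge_self[of "vol_form m v"] abs_ge_self[of "jump_form m v"] abs_ge_self[of "flux_form m v"]
    abs_ge_minus_self[of "vol_form m v"] abs_ge_minus_self[of "jump_form m v"] abs_ge_minus_self[of "flux_form m v"]
  show ?thesis
  proof (rule abs_leI)
    show "adg \<theta> m v \<le> 14 / 25 * s m m + 23 / 160 * vol_form v v + 7 / 40 * jump_form v v"
      unfolding eq using facts by linarith
    show "- adg \<theta> m v \<le> 14 / 25 * s m m + 23 / 160 * vol_form v v + 7 / 40 * jump_form v v"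
      unfolding eq using facts by linarith
  qed
qed

text \<open>The parameter 8/5 spends 8/5 of 3/8, that is 3/5, of the volume part and 5/8 of the jump
  part. The remainders 2/5 and 3/8 exceed the corresponding losses in \<open>mixed_bound\<close> by
  at least 1/5.\<close>

lemma coercive:
  assumes v: "v \<in> V"
  shows "2 / 5 * vol_form v v + 3 / 8 * jump_form v v \<le> adg \<theta> v v"
proof -
  have vW: "v \<in> W" by (rule VW[OF v])
  have f: "2 * \<bar>flux_form v v\<bar> \<le> 8 / 5 * flux_sq v + 5 / 8 * jump_form v v" using young_flux[OF vW vW, of "8/5"] by simp
  have eq: "adg \<theta> v v = vol_form v v + jump_form v v - (flux_form v v + \<theta> * flux_form v v)" by (rule a_DG_split[OF vW vW])
  show ?thesis unfolding eq using f theta_mult(1)[of "flux_form v v"] abs_ge_self[of "flux_form v v"] V_flux[OF v] by linarith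
qed

end

section \<open>Definiteness of the norm\<close>

context dg_problem
begin

text \<open>The point is where a segment from x in an element to y outside the union meets the
  frontier of the union. Each set that it has to avoid has dimension at most d - 2 and spans with y
  at most a hyperplane, so almost every starting point x is good.\<close>

lemma generic_boundary_point:
  assumes S: "\<S> \<subseteq> \<P>" "\<S> \<noteq> {}"
  obtains z F where "z \<in> \<Union>\<S>" "z \<notin> interior (\<Union>\<S>)" "F \<in> \<F>" "z \<in> rel_interior F" "\<forall>F'\<in>\<F>. F' \<noteq> F \<longrightarrow> z \<notin> F'"
proof -
  have facesU: "\<Union>\<F> = (\<Union>K\<in>\<P>. frontier K)" and polyF: "\<And>F. F \<in> \<F> \<Longrightarrow> polytope F \<and> aff_dim F = int CARD('n) - 1"
    using mesh unfolding admissible_mesh_def mesh_faces_def by auto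
  have finS: "finite \<S>" by (rule finite_subset[OF S(1) finite_P])
  have comp: "compact (\<Union>\<S>)"
    by (rule compact_Union[OF finS]) (use S(1) compact_element in blast)
  obtain y where y: "y \<notin> \<Union>\<S>"
  proof -
    have "\<Union>\<S> \<noteq> UNIV" using compact_imp_bounded[OF comp] not_bounded_UNIV by metis
    then show ?thesis using that by blast
  qed
  define \<N> where "\<N> = (\<lambda>(F, F'). F \<inter> F') ` {(F, F') \<in> \<F> \<times> \<F>. F \<noteq> F'} \<union> (\<Union>F\<in>\<F>. {f. f facet_of F})"
  have finN: "finite \<N>"
  proof -
    have "finite {(F, F') \<in> \<F> \<times> \<F>. F \<noteq> F'}"
      by (rule finite_subset[of _ "\<F> \<times> \<F>"]) (use finite_F in auto)
    moreover have "finite {f. f facet_of F}" if "F \<in> \<F>" for F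
      using polyF[OF that] finite_polytope_facets by blast
    ultimately show ?thesis unfolding \<N>_def using finite_F by blast
  qed
  have dimN: "aff_dim N < int CARD('n) - 1" if N: "N \<in> \<N>" for N
  proof -
    consider F F' where "F \<in> \<F>" "F' \<in> \<F>" "F \<noteq> F'" "N = F \<inter> F'" | F where "F \<in> \<F>" "N facet_of F"
      using N unfolding \<N>_def by auto
    then show ?thesis
    proof cases
      case 1
      then show ?thesis using face_separation by simp
    next
      case 2
      then show ?thesis using polyF[OF 2(1)] by (simp add: facet_of_def)
    qed
  qed
  obtain K where K: "K \<in> \<S>" using S(2) by blast
  have KP: "K \<in> \<P>" using K S(1) by blast
  have neg: "negligible (\<Union>N\<in>\<N>. affine hull (insert y N))"
  proof (rule negligible_Union)
    show "finite ((\<lambda>N. affine hull (insert y N)) ` \<N>)" using finN by simp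
    fix A assume "A \<in> (\<lambda>N. affine hull (insert y N)) ` \<N>"
    then obtain N where N: "N \<in> \<N>" "A = affine hull (insert y N)" by blast
    have "aff_dim A < int CARD('n)" using dimN[OF N(1)] by (simp add: N(2) aff_dim_insert)
    then show "negligible A" by (intro negligible_lowaffdim) simp
  qed
  have "\<not> interior K \<subseteq> (\<Union>N\<in>\<N>. affine hull (insert y N))"
    using open_not_negligible[OF open_interior element_interior[OF KP]] negligible_subset[OF neg] by blast
  then obtain x where x: "x \<in> interior K" "\<forall>N\<in>\<N>. x \<notin> affine hull (insert y N)" by blast
  have xS: "x \<in> \<Union>\<S>" using x(1) K interior_subset by blast
  have "closed_segment x y \<inter> frontier (\<Union>\<S>) \<noteq> {}"
  proof (rule connected_Int_frontier[OF connected_segment(1)])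
    show "closed_segment x y \<inter> \<Union>\<S> \<noteq> {}" using xS by auto
    show "closed_segment x y - \<Union>\<S> \<noteq> {}" using y by auto
  qed
  then obtain z where z: "z \<in> closed_segment x y" "z \<in> frontier (\<Union>\<S>)" by blast
  have zS: "z \<in> \<Union>\<S>" using z(2) frontier_subset_closed[OF compact_imp_closed[OF comp]] by blast
  have zi: "z \<notin> interior (\<Union>\<S>)" using z(2) by (simp add: frontier_def)
  have zN: "z \<notin> N" if N: "N \<in> \<N>" for N
  proof
    assume "z \<in> N"
    obtain u where u: "z = (1 - u) *\<^sub>R x + u *\<^sub>R y" using z(1) by (auto simp: in_segment)
    have "u \<noteq> 1" using u zS y by auto
    \<comment> \<open>The starting point lies on the line through y and z, so z in N would place it
      in the hull that it was chosen to avoid.\<close>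
    have "x = (1 / (1 - u)) *\<^sub>R z + (- u / (1 - u)) *\<^sub>R y"
      unfolding u using \<open>u \<noteq> 1\<close> by (simp add: scaleR_right_distrib)
    moreover have "(1 / (1 - u)) + (- u / (1 - u)) = 1" using \<open>u \<noteq> 1\<close> by (simp add: diff_divide_distrib[symmetric])
    moreover have "z \<in> affine hull (insert y N)" "y \<in> affine hull (insert y N)"
      using \<open>z \<in> N\<close> by (auto intro: hull_inc)
    ultimately have "x \<in> affine hull (insert y N)"
      using affine_affine_hull[of "insert y N"] unfolding affine_def by blast
    then show False using x(2) N by blast
  qed
  obtain K1 where K1: "K1 \<in> \<S>" "z \<in> K1" using zS by blast
  have "z \<notin> interior K1" using zi interior_mono[of K1 "\<Union>\<S>"] K1(1) by blast
  then have "z \<in> frontier K1" using K1(2) closure_subset by (auto simp: frontier_def)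
  then obtain F where F: "F \<in> \<F>" "z \<in> F" using facesU K1(1) S(1) by blast
  show ?thesis
  proof (rule that[OF zS zi F(1)])
    show "\<forall>F'\<in>\<F>. F' \<noteq> F \<longrightarrow> z \<notin> F'"
    proof (intro ballI impI)
      fix F' assume F': "F' \<in> \<F>" "F' \<noteq> F"
      have "(F, F') \<in> {(F, F') \<in> \<F> \<times> \<F>. F \<noteq> F'}" using F F' by auto
      then have "F \<inter> F' \<in> (\<lambda>(F, F'). F \<inter> F') ` {(F, F') \<in> \<F> \<times> \<F>. F \<noteq> F'}" by (rule rev_image_eqI) simp
      then have "z \<notin> F \<inter> F'" using zN unfolding \<N>_def by blast
      then show "z \<notin> F'" using F(2) by blast
    qed
    show "z \<in> rel_interior F"
    proof (rule ccontr)
      assume "z \<notin> rel_interior F"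
      then have "z \<in> rel_frontier F" using F(2) closure_subset by (auto simp: rel_frontier_def)
      then obtain f where "f facet_of F" "z \<in> f"
        using rel_frontier_of_polyhedron[OF polytope_imp_polyhedron] polyF[OF F(1)] by blast
      then show False using zN F(1) unfolding \<N>_def by blast
    qed
  qed
qed

section \<open>Elements around a point interior to a single face\<close>

lemma adjacent_side:
  assumes F: "flat_face F n b" "F \<in> \<F>" and K: "K \<in> adj F" and z: "z \<in> rel_interior F"
  obtains t \<delta> where "t = 1 \<or> t = -1" "outward_normal K F = t *\<^sub>R n" "\<delta> > 0"
    "\<forall>y. dist z y < \<delta> \<longrightarrow> (y \<in> K \<longleftrightarrow> t * (n \<bullet> y) \<le> t * b)"
proof -
  obtain c \<rho> where c: "star_center K c \<rho>" using element_star[OF adjD(1)[OF K]] by blast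
  have "\<rho> > 0" using c by (simp add: star_center_def)
  then have "n \<bullet> c \<noteq> b" using star_center_height[OF c F(1) adjD(2,3)[OF K]] by auto
  then consider "n \<bullet> c < b" | "(- n) \<bullet> c < - b" by force
  then show ?thesis
  proof cases
    case 1
    have "\<exists>\<delta>>0. \<forall>y. dist z y < \<delta> \<longrightarrow> (y \<in> K \<longleftrightarrow> n \<bullet> y \<le> b)"
      by (rule star_center_local[OF c F(1) adjD(2,3)[OF K] 1 z]) blast
    then obtain \<delta> where d: "\<delta> > 0" "\<forall>y. dist z y < \<delta> \<longrightarrow> (y \<in> K \<longleftrightarrow> n \<bullet> y \<le> b)" by blast
    show ?thesis
      by (rule that[of 1 \<delta>]) (use d outward_normal_eq[OF c F(1) adjD(2,3)[OF K] 1] in simp_all)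
  next
    case 2
    note F' = flat_face_uminus[OF F(1)]
    have "\<exists>\<delta>>0. \<forall>y. dist z y < \<delta> \<longrightarrow> (y \<in> K \<longleftrightarrow> (- n) \<bullet> y \<le> - b)"
      by (rule star_center_local[OF c F' adjD(2,3)[OF K] 2 z]) blast
    then obtain \<delta> where d: "\<delta> > 0" "\<forall>y. dist z y < \<delta> \<longrightarrow> (y \<in> K \<longleftrightarrow> (- n) \<bullet> y \<le> - b)" by blast
    show ?thesis
      by (rule that[of "-1" \<delta>]) (use d outward_normal_eq[OF c F' adjD(2,3)[OF K] 2] in simp_all)
  qed
qed

lemma interiors_disjoint: "K \<in> \<P> \<Longrightarrow> K' \<in> \<P> \<Longrightarrow> y \<in> interior K \<Longrightarrow> y \<in> interior K' \<Longrightarrow> K = K'"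
  using mesh unfolding admissible_mesh_def subdivision_of_def by blast

lemma half_ball:
  assumes F: "flat_face F n b" and z: "z \<in> F" "r > 0" and t: "t = 1 \<or> t = (-1::real)"
  shows "open {y \<in> ball z r. t * (n \<bullet> y) > t * b}" "connected {y \<in> ball z r. t * (n \<bullet> y) > t * b}"
    "{y \<in> ball z r. t * (n \<bullet> y) > t * b} \<noteq> {}"
proof -
  have eq: "{y \<in> ball z r. t * (n \<bullet> y) > t * b} = ball z r \<inter> {y. (t *\<^sub>R n) \<bullet> y > t * b}" by auto
  show "open {y \<in> ball z r. t * (n \<bullet> y) > t * b}"
    unfolding eq by (intro open_Int open_ball open_halfspace_gt)
  show "connected {y \<in> ball z r. t * (n \<bullet> y) > t * b}"
    unfolding eq by (intro convex_connected convex_Int convex_ball convex_halfspace_gt)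
  obtain u where u: "u > 0" "dist z (z - u *\<^sub>R n) < r" "n \<bullet> (z - u *\<^sub>R n) < b" "dist z (z + u *\<^sub>R n) < r" "n \<bullet> (z + u *\<^sub>R n) > b"
    using flat_face_small_step[OF F z] by blast
  show "{y \<in> ball z r. t * (n \<bullet> y) > t * b} \<noteq> {}"
  proof (cases "t = 1")
    case True
    then have "z + u *\<^sub>R n \<in> {y \<in> ball z r. t * (n \<bullet> y) > t * b}" using u by simp
    then show ?thesis by blast
  next
    case False
    then have "z - u *\<^sub>R n \<in> {y \<in> ball z r. t * (n \<bullet> y) > t * b}" using u t by simp
    then show ?thesis by blast
  qed
qed

text \<open>On the same side the two elements would share an open half-ball, against the
  disjointness of interiors.\<close>

lemma adjacent_opposite:
  assumes F: "flat_face F n b" "F \<in> \<F>" and K: "K1 \<in> adj F" "K2 \<in> adj F" "K1 \<noteq> K2"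
    and z: "z \<in> rel_interior F"
    and 1: "t1 = 1 \<or> t1 = -1" "\<delta>1 > 0" "\<forall>y. dist z y < \<delta>1 \<longrightarrow> (y \<in> K1 \<longleftrightarrow> t1 * (n \<bullet> y) \<le> t1 * b)"
    and 2: "t2 = 1 \<or> t2 = -1" "\<delta>2 > 0" "\<forall>y. dist z y < \<delta>2 \<longrightarrow> (y \<in> K2 \<longleftrightarrow> t2 * (n \<bullet> y) \<le> t2 * b)"
  shows "t2 = - t1"
proof (rule ccontr)
  assume "t2 \<noteq> - t1"
  then have eq: "t2 = t1" using 1(1) 2(1) by auto
  have zF: "z \<in> F" using z rel_interior_subset by blast
  let ?H = "{y \<in> ball z (min \<delta>1 \<delta>2). (- t1) * (n \<bullet> y) > (- t1) * b}"
  have t: "- t1 = 1 \<or> - t1 = -1" using 1(1) by auto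
  note H = half_ball[OF F(1) zF _ t, of "min \<delta>1 \<delta>2"]
  have pos: "min \<delta>1 \<delta>2 > 0" using 1(2) 2(2) by simp
  obtain y where y: "y \<in> ?H" using H(3)[OF pos] by blast
  have "?H \<subseteq> K1" using 1(3) by auto
  then have y1: "y \<in> interior K1" using interior_maximal[OF _ H(1)[OF pos]] y by blast
  have "?H \<subseteq> K2" using 2(3) eq by auto
  then have y2: "y \<in> interior K2" using interior_maximal[OF _ H(1)[OF pos]] y by blast
  from interiors_disjoint[OF adjD(1)[OF K(1)] adjD(1)[OF K(2)] y1 y2] show False using K(3) by simp
qed

text \<open>Near z the frontiers of all elements lie in the hyperplane of F. An open half-ball is
  connected and misses them, so an element contains it or is disjoint from it. A star-shaped element
  through z has interior points close to z and off the hyperplane, hence contains a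
  half-ball.\<close>

lemma element_near_face:
  assumes F: "flat_face F n b" "F \<in> \<F>" and z: "z \<in> F" "\<forall>F'\<in>\<F>. F' \<noteq> F \<longrightarrow> z \<notin> F'"
  obtains r where "r > 0"
    "\<And>K t. K \<in> \<P> \<Longrightarrow> t = 1 \<or> t = -1 \<Longrightarrow> {y \<in> ball z r. t * (n \<bullet> y) > t * b} \<inter> K \<noteq> {} \<Longrightarrow>
      {y \<in> ball z r. t * (n \<bullet> y) > t * b} \<subseteq> interior K"
    "\<And>K. K \<in> \<P> \<Longrightarrow> z \<in> K \<Longrightarrow> \<exists>t. (t = 1 \<or> t = -1) \<and> {y \<in> ball z r. t * (n \<bullet> y) > t * b} \<subseteq> interior K"
proof -
  have facesU: "\<Union>\<F> = (\<Union>K\<in>\<P>. frontier K)"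
    using mesh unfolding admissible_mesh_def mesh_faces_def by auto
  have "closed F'" if F': "F' \<in> \<F>" for F'
  proof -
    obtain n b where "flat_face F' n b" using face_flat[OF F'] by blast
    then show ?thesis by (rule flat_face_frontier)
  qed
  then have "closed (\<Union>(\<F> - {F}))" using finite_F by (intro closed_Union) auto
  then have "open (- \<Union>(\<F> - {F}))" by (rule open_Compl)
  moreover have "z \<in> - \<Union>(\<F> - {F})" using z(2) by blast
  ultimately obtain r where r: "r > 0" "ball z r \<subseteq> - \<Union>(\<F> - {F})" using open_contains_ball by blast
  have fr: "n \<bullet> y = b" if "K \<in> \<P>" "y \<in> ball z r" "y \<in> frontier K" for K y
  proof -
    have "y \<in> \<Union>\<F>" using facesU that by blast
    then have "y \<in> F" using r(2) that(2) by blast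
    then show ?thesis by (rule flat_face_in[OF F(1)])
  qed
  have sub: "{y \<in> ball z r. t * (n \<bullet> y) > t * b} \<subseteq> interior K"
    if K: "K \<in> \<P>" and t: "t = 1 \<or> t = -1" and ne: "{y \<in> ball z r. t * (n \<bullet> y) > t * b} \<inter> K \<noteq> {}" for K t
  proof (rule interior_maximal[OF _ half_ball(1)[OF F(1) z(1) r(1) t]])
    show "{y \<in> ball z r. t * (n \<bullet> y) > t * b} \<subseteq> K"
    proof (rule ccontr)
      assume "\<not> ?thesis"
      then have "{y \<in> ball z r. t * (n \<bullet> y) > t * b} - K \<noteq> {}" by blast
      from connected_Int_frontier[OF half_ball(2)[OF F(1) z(1) r(1) t] ne this]
      obtain y where "y \<in> ball z r" "t * (n \<bullet> y) > t * b" "y \<in> frontier K" by blast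
      then show False using fr[OF K] by fastforce
    qed
  qed
  show ?thesis
  proof (rule that[OF r(1) sub])
    fix K assume K: "K \<in> \<P>" and zK: "z \<in> K"
    obtain c \<rho> where c: "star_center K c \<rho>" using element_star[OF K] by blast
    have cb: "c \<in> ball c \<rho>" using c by (simp add: star_center_def)
    define e where "e = r / (norm (c - z) + r)"
    have np: "norm (c - z) + r > 0" using r(1) by (simp add: add_nonneg_pos)
    have e: "0 < e" "e \<le> 1" using r(1) np by (simp_all add: e_def)
    have U: "open (ball z r \<inter> interior K)" by (intro open_Int open_ball open_interior)
    have "(1 - e) *\<^sub>R z + e *\<^sub>R c \<in> interior K" by (rule star_center_interior[OF c zK cb e])
    moreover have "dist z ((1 - e) *\<^sub>R z + e *\<^sub>R c) < r"
    proof -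
      have "z - ((1 - e) *\<^sub>R z + e *\<^sub>R c) = - (e *\<^sub>R (c - z))" by (simp add: algebra_simps)
      then have "dist z ((1 - e) *\<^sub>R z + e *\<^sub>R c) = e * norm (c - z)"
        using e by (simp add: dist_norm)
      also have "\<dots> < r" using np r(1) by (simp add: e_def pos_divide_less_eq algebra_simps)
      finally show ?thesis .
    qed
    ultimately have ne: "ball z r \<inter> interior K \<noteq> {}" by auto
    have n0: "n \<noteq> 0" using F(1) by (auto simp: flat_face_def)
    have "\<not> ball z r \<inter> interior K \<subseteq> {y. n \<bullet> y = b}"
    proof
      assume "ball z r \<inter> interior K \<subseteq> {y. n \<bullet> y = b}"
      then have "ball z r \<inter> interior K \<subseteq> interior {y. n \<bullet> y = b}" using U by (rule interior_maximal)
      then show False using ne interior_hyperplane[OF n0, of b] by simp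
    qed
    then obtain y where y: "y \<in> ball z r" "y \<in> interior K" "n \<bullet> y \<noteq> b" by blast
    define t :: real where "t = (if n \<bullet> y > b then 1 else -1)"
    have t: "t = 1 \<or> t = -1" by (simp add: t_def)
    have "t * (n \<bullet> y) > t * b" using y(3) by (simp add: t_def)
    then have "y \<in> {y \<in> ball z r. t * (n \<bullet> y) > t * b} \<inter> K" using y interior_subset by blast
    then have "{y \<in> ball z r. t * (n \<bullet> y) > t * b} \<subseteq> interior K" using sub[OF K t] by blast
    then show "\<exists>t. (t = 1 \<or> t = -1) \<and> {y \<in> ball z r. t * (n \<bullet> y) > t * b} \<subseteq> interior K" using t by blast
  qed
qed

text \<open>A generic boundary point of the union of the elements with value \<open>c K0\<close> lies in the relative interior of
  a single face. If that face is interior, both elements carry this value and their union is a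
  neighbourhood of the point; if it is a boundary face, the value is 0.\<close>

lemma constants_zero:
  fixes c :: "(real^'n) set \<Rightarrow> real"
  assumes jump0: "\<And>F. F \<in> \<F> \<Longrightarrow> (\<Sum>K\<in>adj F. c K *\<^sub>R outward_normal K F) = 0" and K0: "K0 \<in> \<P>"
  shows "c K0 = 0"
proof (rule ccontr)
  assume c0: "c K0 \<noteq> 0"
  define \<S> where "\<S> = {K \<in> \<P>. c K = c K0}"
  have S: "\<S> \<subseteq> \<P>" "\<S> \<noteq> {}" using K0 by (auto simp: \<S>_def)
  obtain z F where z: "z \<in> \<Union>\<S>" "z \<notin> interior (\<Union>\<S>)" and F: "F \<in> \<F>" "z \<in> rel_interior F"
    and uni: "\<forall>F'\<in>\<F>. F' \<noteq> F \<longrightarrow> z \<notin> F'" by (rule generic_boundary_point[OF S])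
  obtain n b where fl: "flat_face F n b" by (rule face_flat[OF F(1)])
  have n0: "n \<noteq> 0" using fl by (auto simp: flat_face_def)
  have zF: "z \<in> F" using F(2) rel_interior_subset by blast
  obtain r where r: "r > 0"
    "\<And>K t. K \<in> \<P> \<Longrightarrow> t = 1 \<or> t = -1 \<Longrightarrow> {y \<in> ball z r. t * (n \<bullet> y) > t * b} \<inter> K \<noteq> {} \<Longrightarrow>
      {y \<in> ball z r. t * (n \<bullet> y) > t * b} \<subseteq> interior K"
    "\<And>K. K \<in> \<P> \<Longrightarrow> z \<in> K \<Longrightarrow> \<exists>t. (t = 1 \<or> t = -1) \<and> {y \<in> ball z r. t * (n \<bullet> y) > t * b} \<subseteq> interior K"
    by (rule element_near_face[OF fl F(1) zF uni]) blast
  obtain K where K: "K \<in> \<P>" "c K = c K0" "z \<in> K" using z(1) by (auto simp: \<S>_def)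
  obtain t where t: "t = 1 \<or> t = -1" "{y \<in> ball z r. t * (n \<bullet> y) > t * b} \<subseteq> interior K"
    using r(3)[OF K(1,3)] by blast
  \<comment> \<open>K fills the half-ball on the side t. An element of \<open>adj F\<close> on that
    side meets it, hence contains it, and equals K because interiors are disjoint.\<close>
  have same: "K = K'" if K': "K' \<in> adj F" and d: "\<delta> > 0" "\<forall>y. dist z y < \<delta> \<longrightarrow> (y \<in> K' \<longleftrightarrow> (- t) * (n \<bullet> y) \<le> (- t) * b)" for K' \<delta>
  proof -
    have pos: "min r \<delta> > 0" using r(1) d(1) by simp
    obtain y where y: "y \<in> {y \<in> ball z (min r \<delta>). t * (n \<bullet> y) > t * b}" using half_ball(3)[OF fl zF pos t(1)] by blast
    have "y \<in> K'" using d(2) y by auto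
    then have "{y \<in> ball z r. t * (n \<bullet> y) > t * b} \<inter> K' \<noteq> {}" using y by auto
    then have "{y \<in> ball z r. t * (n \<bullet> y) > t * b} \<subseteq> interior K'" by (rule r(2)[OF adjD(1)[OF K'] t(1)])
    then have y': "y \<in> interior K'" "y \<in> interior K" using y t(2) by auto
    show ?thesis by (rule interiors_disjoint[OF K(1) adjD(1)[OF K'] y'(2,1)])
  qed
  have "mesh_faces \<Omega> \<P> \<F>" using mesh by (simp add: admissible_mesh_def)
  then have "\<forall>F\<in>\<F>. (\<exists>K1 K2. K1 \<noteq> K2 \<and> adj F = {K1, K2}) \<or> (F \<subseteq> frontier \<Omega> \<and> (\<exists>K. adj F = {K}))"
    unfolding mesh_faces_def by (elim conjE)
  from bspec[OF this F(1)]
  have "(\<exists>K1 K2. K1 \<noteq> K2 \<and> adj F = {K1, K2}) \<or> (F \<subseteq> frontier \<Omega> \<and> (\<exists>K. adj F = {K}))" .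
  then show False
  proof (elim disjE exE conjE)
    fix K1 K2 assume 1: "K1 \<noteq> K2" "adj F = {K1, K2}"
    have A: "K1 \<in> adj F" "K2 \<in> adj F" using 1(2) by simp_all
    obtain t1 \<delta>1 where 11: "t1 = 1 \<or> t1 = -1" "outward_normal K1 F = t1 *\<^sub>R n" "\<delta>1 > 0"
      "\<forall>y. dist z y < \<delta>1 \<longrightarrow> (y \<in> K1 \<longleftrightarrow> t1 * (n \<bullet> y) \<le> t1 * b)" by (rule adjacent_side[OF fl F(1) A(1) F(2)])
    obtain t2 \<delta>2 where 22: "t2 = 1 \<or> t2 = -1" "outward_normal K2 F = t2 *\<^sub>R n" "\<delta>2 > 0"
      "\<forall>y. dist z y < \<delta>2 \<longrightarrow> (y \<in> K2 \<longleftrightarrow> t2 * (n \<bullet> y) \<le> t2 * b)" by (rule adjacent_side[OF fl F(1) A(2) F(2)])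
    have opp: "t2 = - t1" by (rule adjacent_opposite[OF fl F(1) A 1(1) F(2) 11(1,3,4) 22(1,3,4)])
    have "(t1 * (c K1 - c K2)) *\<^sub>R n = 0"
      using jump0[OF F(1)] 1 11(2) 22(2) by (simp add: opp algebra_simps)
    then have ceq: "c K1 = c K2" using n0 11(1) by auto
    have "K = K1 \<or> K = K2"
    proof (cases "t1 = - t")
      case True
      then show ?thesis using same[OF A(1) 11(3)] 11(4) by simp
    next
      case False
      then have "t2 = - t" using opp 11(1) t(1) by auto
      then show ?thesis using same[OF A(2) 22(3)] 22(4) by simp
    qed
    then have cK: "c K1 = c K0" "c K2 = c K0" using K(2) ceq by auto
    have "ball z (min \<delta>1 \<delta>2) \<subseteq> K1 \<union> K2"
    proof
      fix y assume "y \<in> ball z (min \<delta>1 \<delta>2)"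
      then have "dist z y < \<delta>1" "dist z y < \<delta>2" by auto
      then show "y \<in> K1 \<union> K2" using 11(4) 22(4) opp by (cases "t1 * (n \<bullet> y) \<le> t1 * b") auto
    qed
    also have "\<dots> \<subseteq> \<Union>\<S>" using cK A adjD(1) by (auto simp: \<S>_def)
    finally have "z \<in> interior (\<Union>\<S>)"
      by (intro interiorI[of "ball z (min \<delta>1 \<delta>2)"]) (use 11(3) 22(3) in auto)
    then show False using z(2) by blast
  next
    fix K1 assume 2: "F \<subseteq> frontier \<Omega>" "adj F = {K1}"
    have A: "K1 \<in> adj F" using 2 by simp
    obtain t1 \<delta>1 where 11: "t1 = 1 \<or> t1 = -1" "outward_normal K1 F = t1 *\<^sub>R n" "\<delta>1 > 0"
      "\<forall>y. dist z y < \<delta>1 \<longrightarrow> (y \<in> K1 \<longleftrightarrow> t1 * (n \<bullet> y) \<le> t1 * b)" by (rule adjacent_side[OF fl F(1) A F(2)])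
    have "(c K1 * t1) *\<^sub>R n = 0" using jump0[OF F(1)] 2(2) 11(2) by simp
    then have c1: "c K1 = 0" using n0 11(1) by auto
    have tt: "t1 = t"
    proof (rule ccontr)
      assume "t1 \<noteq> t"
      then have "t1 = - t" using 11(1) t(1) by auto
      then have "K = K1" using same[OF A 11(3)] 11(4) by simp
      then show False using c1 c0 K(2) by simp
    qed
    \<comment> \<open>K would lie beyond the boundary face as seen from \<open>K1\<close>. Together
      the two fill a ball inside the closure of the domain, although z is a frontier point and the
      domain is the interior of its closure.\<close>
    have "ball z (min \<delta>1 r) \<subseteq> K1 \<union> K"
    proof
      fix y assume "y \<in> ball z (min \<delta>1 r)"
      then have y: "dist z y < \<delta>1" "y \<in> ball z r" by auto
      show "y \<in> K1 \<union> K"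
      proof (cases "t * (n \<bullet> y) \<le> t * b")
        case True
        then show ?thesis using 11(4) y(1) tt by blast
      next
        case False
        then have "y \<in> interior K" using t(2) y(2) by auto
        then show ?thesis using interior_subset by blast
      qed
    qed
    also have "\<dots> \<subseteq> closure \<Omega>"
      using mesh K(1) adjD(1)[OF A] by (auto simp: admissible_mesh_def subdivision_of_def)
    finally have "z \<in> interior (closure \<Omega>)"
      by (intro interiorI[of "ball z (min \<delta>1 r)"]) (use 11(3) r(1) in auto)
    moreover have "z \<in> frontier \<Omega>" using 2(1) zF by blast
    moreover have "\<Omega> = interior (closure \<Omega>)" "open \<Omega>" using domain by (auto simp: polyhedral_domain_def)
    ultimately show False by (metis DiffD2 frontier_def interior_open)
  qed
qed

text \<open>The gradient of the polynomial is continuous, so vanishing almost everywhere becomes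
  vanishing in the whole interior. Every point of K is joined to the star centre by a segment that
  runs in the interior after its starting point, and the polynomial is constant along it.\<close>

lemma zero_energy_constant:
  assumes v: "v \<in> V" and K: "K \<in> \<P>" and zero: "integral\<^sup>L (MK K) (vol_density K v v) = 0"
  shows "\<exists>c. \<forall>x\<in>K. v K x = c"
proof -
  have vW: "v \<in> W" by (rule VW[OF v])
  obtain p where p: "p \<in> poly_space k" "\<forall>x\<in>K. v K x = p x" using v K unfolding V_space_def by blast
  obtain g where g: "\<And>x. (p has_derivative (\<lambda>h. g x \<bullet> h)) (at x)" "\<And>i. (\<lambda>x. g x $ i) \<in> poly_space (k - 1)"
    using poly_space_gradient[OF p(1)] by blast
  have gc: "continuous_on UNIV g" by (rule poly_space_vector_measurable[OF g(2)])
  have "integral\<^sup>L (MK K) (gsq v K) = 0"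
    using gsq_energy[OF vW K] gsq_integral_nonneg[of "MK K" v K] zero by simp
  then have ae: "AE x in MK K. gsq v K x = 0"
    using integral_nonneg_eq_0_iff_AE[OF bdd_meas_integrable[OF finite_measure_element[OF K] bdd_gsq(1)[OF vW K]]] by simp
  have g0: "g x = 0" if x: "x \<in> interior K" for x
  proof (rule ccontr)
    assume ne: "g x \<noteq> 0"
    define U where "U = interior K \<inter> {y. g y \<noteq> 0}"
    have "open {y. g y \<noteq> 0}"
      using open_vimage[OF open_Compl[OF closed_singleton[of "0 :: real^'n"]] gc] by (simp add: vimage_def Collect_neg_eq)
    then have U: "open U" "U \<noteq> {}" unfolding U_def using x ne by auto
    have Um: "U \<in> sets lebesgue" using U(1) by (intro sets_completionI_sets) simp
    have gr: "grad_in v K y = g y" if y: "y \<in> interior K" for y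
    proof -
      obtain r where r: "r > 0" "ball y r \<subseteq> K" using y mem_interior by blast
      have yK: "y \<in> K" using y interior_subset by blast
      show ?thesis
      proof (rule grad_in_eq[OF _ r(2) convex_ball])
        show "(v K has_derivative (\<lambda>h. g y \<bullet> h)) (at y within K)"
          by (rule has_derivative_transform_within[OF has_derivative_at_withinI[OF g(1)] zero_less_one yK])
             (use p(2) in simp)
      qed (use r(1) in auto)
    qed
    have "AE y in lebesgue. y \<in> K \<longrightarrow> gsq v K y = 0"
      using ae element_lebesgue[OF K] by (simp add: AE_restrict_space_iff)
    then have "AE y in lebesgue. y \<notin> U"
    proof eventually_elim
      case (elim y)
      show ?case
      proof
        assume "y \<in> U"
        then have y: "y \<in> interior K" "g y \<noteq> 0" by (auto simp: U_def)
        then have "y \<in> K" using interior_subset by blast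
        then show False using elim gr[OF y(1)] y(2) by simp
      qed
    qed
    then have "negligible U" using Um by (simp add: negligible_iff_null_sets AE_iff_null_sets)
    then show False using open_not_negligible[OF U] by simp
  qed
  obtain c \<rho> where c: "star_center K c \<rho>" using element_star[OF K] by blast
  have cb: "c \<in> ball c \<rho>" "c \<in> K" using c by (auto simp: star_center_def)
  have "p x = p c" if x: "x \<in> K" for x
  proof -
    define f where "f u = p (x + u *\<^sub>R (c - x))" for u
    have der: "(f has_derivative (\<lambda>h. g (x + u *\<^sub>R (c - x)) \<bullet> (h *\<^sub>R (c - x)))) (at u)" for u
      unfolding f_def by (rule has_derivative_compose[OF _ g(1)]) (auto intro!: derivative_eq_intros)
    have cont: "continuous_on {0..1} f"
      by (intro continuous_at_imp_continuous_on ballI has_derivative_continuous[OF der])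
    have d0: "DERIV f u :> 0" if u: "0 < u" "u < 1" for u
    proof -
      have "(1 - u) *\<^sub>R x + u *\<^sub>R c \<in> interior K" by (rule star_center_interior[OF c x cb(1)]) (use u in auto)
      moreover have "(1 - u) *\<^sub>R x + u *\<^sub>R c = x + u *\<^sub>R (c - x)" by (simp add: algebra_simps)
      ultimately have "g (x + u *\<^sub>R (c - x)) = 0" using g0 by simp
      then show ?thesis using der[of u] by (simp add: has_field_derivative_def lambda_zero)
    qed
    have "f 1 = f 0" by (rule DERIV_isconst_end[OF zero_less_one cont d0])
    then show ?thesis by (simp add: f_def)
  qed
  then show ?thesis using p(2) by (intro exI[of _ "p c"]) simp
qed

lemma norm_definite:
  assumes v: "v \<in> V" and zero: "vol_form v v + jump_form v v = 0"
  shows "v = (\<lambda>K x. 0)"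
proof -
  have vW: "v \<in> W" by (rule VW[OF v])
  have E0: "vol_form v v = 0" and J0: "jump_form v v = 0" using zero dg_norm_sq(4,5)[OF vW] by auto
  have "vol_form v v = 0 \<longleftrightarrow> (\<forall>K\<in>\<P>. integral\<^sup>L (MK K) (vol_density K v v) = 0)"
    unfolding vol_form_def by (rule sum_nonneg_eq_0_iff[OF finite_P dg_norm_sq(2)[OF vW]])
  then have E0': "\<forall>K\<in>\<P>. integral\<^sup>L (MK K) (vol_density K v v) = 0" using E0 by simp
  have "\<forall>K\<in>\<P>. \<exists>c. \<forall>x\<in>K. v K x = c"
    by (rule ballI) (rule zero_energy_constant[OF v _ bspec[OF E0']])
  from bchoice[OF this] obtain c where c: "\<forall>K\<in>\<P>. \<forall>x\<in>K. v K x = c K" ..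
  have "jump_form v v = 0 \<longleftrightarrow> (\<forall>F\<in>\<F>. integral\<^sup>L (MF F) (jump_density F v v) = 0)"
    unfolding jump_form_def by (rule sum_nonneg_eq_0_iff[OF finite_F dg_norm_sq(3)[OF vW]])
  then have jF: "\<forall>F\<in>\<F>. integral\<^sup>L (MF F) (jump_density F v v) = 0" using J0 by simp
  have jump0: "(\<Sum>K\<in>adj F. c K *\<^sub>R outward_normal K F) = 0" if F: "F \<in> \<F>" for F
  proof (rule ccontr)
    assume ne: "\<not> ?thesis"
    have nn: "AE x in MF F. 0 \<le> jump_density F v v x" using penalty_pos[OF F] by (simp add: jump_density_def)
    have "AE x in MF F. jump_density F v v x = 0"
      using integral_nonneg_eq_0_iff_AE[OF bdd_meas_integrable[OF finite_measure_face[OF F] bdd_jump_density[OF vW vW F]] nn] jF F by simp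
    with AE_face[OF F] have "AE x in MF F. False"
    proof eventually_elim
      case (elim x)
      have "jmp F v x = (\<Sum>K\<in>adj F. c K *\<^sub>R outward_normal K F)"
        unfolding jump_def by (rule sum.cong[OF refl]) (use c adjD elim(1) in \<open>metis subsetD\<close>)
      then show False using elim(2) penalty_pos[OF F] ne by (simp add: jump_density_def)
    qed
    obtain n b where fl: "flat_face F n b" by (rule face_flat[OF F])
    have Fm: "F \<in> sets (MF F)" using flat_face_frontier[OF fl] by (intro sets_face_measure_borel) simp
    \<comment> \<open>The jump is constant on the face; if it were nonzero the face would be a null
      set, while its area is positive.\<close>
    have "emeasure (MF F) (space (MF F)) = 0"
      using \<open>AE x in MF F. False\<close> AE_iff_measurable[OF sets.top, where P = "\<lambda>_. False" and M = "MF F"] by simp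
    then have "emeasure (MF F) F = 0" using emeasure_space[of "MF F" F] by simp
    then show False using face_area_finite_pos(1,2)[OF fl] by simp
  qed
  have "c K = 0" if "K \<in> \<P>" for K by (rule constants_zero[OF jump0 that])
  then have "v K x = 0" for K x
    using c v unfolding V_space_def zero_outside_def by (cases "K \<in> \<P> \<and> x \<in> K") auto
  then show ?thesis by (simp add: fun_eq_iff)
qed

end

section \<open>Strong monotonicity and the solution\<close>

text \<open>Turns an additive estimate valid for all multiples t into a product estimate, with the
  optimal t = x / (2 S). For S = 0 a large enough multiple gives the contradiction.\<close>

lemma quadratic_bound:
  fixes x :: real
  assumes "\<And>t. t * x \<le> t\<^sup>2 * S + N" and S: "S \<ge> 0"
  shows "x\<^sup>2 \<le> 4 * S * N"
proof (cases "S = 0")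
  case True
  have "x = 0"
  proof (rule ccontr)
    assume "x \<noteq> 0"
    then show False using assms(1)[of "(N + 1) / x"] True by simp
  qed
  then show ?thesis using True by simp
next
  case False
  then have S: "S > 0" using S by simp
  have "x / (2 * S) * x \<le> (x / (2 * S))\<^sup>2 * S + N" by (rule assms(1))
  then have "x\<^sup>2 / (2 * S) \<le> x\<^sup>2 / (4 * S) + N"
    using S by (simp add: power_divide power2_eq_square)
  moreover have "x\<^sup>2 / (2 * S) = 2 * (x\<^sup>2 / (4 * S))" using S by (simp add: field_simps)
  ultimately have "x\<^sup>2 / (4 * S) \<le> N" by linarith
  then show ?thesis using S by (simp add: pos_divide_le_eq mult_ac)
qed

context dg_problem
begin

lemma V_lin_closed: "lin_closed V"
  unfolding lin_closed_def
proof (intro conjI ballI allI V_comb)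
  show "(\<lambda>K x. 0) \<in> V"
    unfolding V_space_def zero_outside_def using poly_space_zero by fastforce
qed

lemma nrm_nonneg: "nrm v \<ge> 0"
  unfolding dg_norm_def set_lebesgue_integral_def
  by (intro real_sqrt_ge_zero add_nonneg_nonneg sum_nonneg integral_nonneg_AE AE_I2) auto

lemma V_spanning:
  obtains I :: "((real^'n) set \<times> ('n \<Rightarrow> nat)) set" and B :: "(real^'n) set \<times> ('n \<Rightarrow> nat) \<Rightarrow> 'n broken"
  where "finite I" "\<forall>i\<in>I. B i \<in> V" "\<forall>v\<in>V. \<exists>c. v = (\<lambda>K x. \<Sum>i\<in>I. c i * B i K x)"
proof -
  define A where "A = {a :: 'n \<Rightarrow> nat. sum a UNIV \<le> k}"
  have finA: "finite A" unfolding A_def by (rule finite_multi_indices)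
  define B :: "(real^'n) set \<times> ('n \<Rightarrow> nat) \<Rightarrow> 'n broken"
    where "B i = (\<lambda>K x. if K = fst i \<and> x \<in> K then monomial (snd i) x else 0)" for i
  show ?thesis
  proof (rule that[of "\<P> \<times> A" B])
    show "finite (\<P> \<times> A)" using finite_P finA by simp
    show "\<forall>i\<in>\<P> \<times> A. B i \<in> V"
    proof
      fix i assume i: "i \<in> \<P> \<times> A"
      have m: "monomial (snd i) \<in> poly_space k" using i by (intro poly_space_monomial) (auto simp: A_def)
      have "\<exists>p\<in>poly_space k. \<forall>x\<in>K. B i K x = p x" for K
      proof (cases "K = fst i")
        case True
        then show ?thesis using m by (intro bexI[of _ "monomial (snd i)"]) (auto simp: B_def)
      next
        case False
        then show ?thesis using poly_space_zero by (intro bexI[of _ "\<lambda>_. 0"]) (auto simp: B_def)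
      qed
      moreover have "zero_outside \<P> (B i)" using i by (auto simp: zero_outside_def B_def)
      ultimately show "B i \<in> V" by (simp add: V_space_def)
    qed
    show "\<forall>v\<in>V. \<exists>c. v = (\<lambda>K x. \<Sum>i\<in>\<P> \<times> A. c i * B i K x)"
    proof
      fix v assume v: "v \<in> V"
      have "\<forall>K\<in>\<P>. \<exists>c. \<forall>x\<in>K. v K x = (\<Sum>a\<in>A. c a * monomial a x)"
      proof
        fix K assume "K \<in> \<P>"
        then obtain p where p: "p \<in> poly_space k" "\<forall>x\<in>K. v K x = p x" using v unfolding V_space_def by blast
        then obtain c where "p = (\<lambda>x. \<Sum>a\<in>A. c a * monomial a x)" unfolding poly_space_def A_def by blast
        then show "\<exists>c. \<forall>x\<in>K. v K x = (\<Sum>a\<in>A. c a * monomial a x)" using p(2) by auto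
      qed
      from bchoice[OF this] obtain c where c: "\<forall>K\<in>\<P>. \<forall>x\<in>K. v K x = (\<Sum>a\<in>A. c K a * monomial a x)" ..
      have "v K x = (\<Sum>i\<in>\<P> \<times> A. c (fst i) (snd i) * B i K x)" for K x
      proof -
        have "(\<Sum>i\<in>\<P> \<times> A. c (fst i) (snd i) * B i K x) = (\<Sum>K'\<in>\<P>. \<Sum>a\<in>A. c K' a * B (K', a) K x)"
          by (simp add: sum.cartesian_product case_prod_beta)
        also have "\<dots> = (\<Sum>K'\<in>\<P>. if K = K' \<and> x \<in> K then \<Sum>a\<in>A. c K' a * monomial a x else 0)"
        proof (rule sum.cong[OF refl])
          fix K'
          show "(\<Sum>a\<in>A. c K' a * B (K', a) K x) = (if K = K' \<and> x \<in> K then \<Sum>a\<in>A. c K' a * monomial a x else 0)"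
            by (cases "K = K'"; cases "x \<in> K") (simp_all add: B_def)
        qed
        also have "\<dots> = (if K \<in> \<P> \<and> x \<in> K then \<Sum>a\<in>A. c K a * monomial a x else 0)"
        proof (cases "x \<in> K")
          case True
          then show ?thesis using sum.delta'[OF finite_P, of K "\<lambda>K'. \<Sum>a\<in>A. c K' a * monomial a x"] by simp
        qed simp
        also have "\<dots> = v K x"
          using c v unfolding V_space_def zero_outside_def by (cases "K \<in> \<P> \<and> x \<in> K") auto
        finally show ?thesis by simp
      qed
      then show "\<exists>c. v = (\<lambda>K x. \<Sum>i\<in>\<P> \<times> A. c i * B i K x)"
        by (intro exI[of _ "\<lambda>i. c (fst i) (snd i)"]) (simp add: fun_eq_iff)
    qed
  qed
qed

text \<open>In these coordinates the norm is Euclidean, which is the setting of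
  \<open>zarantonello_finite\<close>; it also makes every linear functional on V bounded.\<close>

lemma orthonormal_basis:
  obtains E g where "finite E" "E \<subseteq> V" "\<forall>v\<in>V. v = (\<lambda>K x. \<Sum>e\<in>E. g v e * e K x)"
    "\<forall>c. (nrm (\<lambda>K x. \<Sum>e\<in>E. c e * e K x))\<^sup>2 = (\<Sum>e\<in>E. (c e)\<^sup>2)"
proof -
  define h where "h u v = vol_form u v + jump_form u v" for u v
  have lin: "h (\<lambda>K x. a * u K x + b * v K x) w = a * h u w + b * h v w" if "u \<in> V" "v \<in> V" "w \<in> V" for u v w a b
    using forms_linear_left(1,2)[OF VW[OF that(1)] VW[OF that(2)] VW[OF that(3)], of a b]
    by (simp add: h_def algebra_simps)
  have sym: "h u v = h v u" if "u \<in> V" "v \<in> V" for u v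
    using forms_symmetric[OF VW[OF that(1)] VW[OF that(2)]] by (simp add: h_def)
  have pos: "h v v \<ge> 0" if "v \<in> V" for v
    using dg_norm_sq(4,5)[OF VW[OF that]] by (simp add: h_def)
  have df: "v = (\<lambda>K x. 0)" if "v \<in> V" "h v v = 0" for v
    using norm_definite[OF that(1)] that(2) by (simp add: h_def)
  obtain I :: "((real^'n) set \<times> ('n \<Rightarrow> nat)) set" and B where IB: "finite I" "\<forall>i\<in>I. B i \<in> V" "\<forall>v\<in>V. \<exists>c. v = (\<lambda>K x. \<Sum>i\<in>I. c i * B i K x)"
    by (rule V_spanning)
  have "\<exists>E. finite E \<and> E \<subseteq> V \<and> (\<forall>e\<in>E. \<forall>e'\<in>E. h e e' = (if e = e' then 1 else 0)) \<and>
    (\<forall>v\<in>V. v = (\<lambda>K x. \<Sum>e\<in>E. h v e * e K x))"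
  proof (rule gram_schmidt[OF V_lin_closed, of h I B])
    show "finite I" by (rule IB(1))
    show "B i \<in> V" if "i \<in> I" for i by (rule bspec[OF IB(2) that])
    show "\<exists>c. v = (\<lambda>K x. \<Sum>i\<in>I. c i * B i K x)" if "v \<in> V" for v by (rule bspec[OF IB(3) that])
    show "h (\<lambda>K x. a * u K x + b * v K x) w = a * h u w + b * h v w" if "u \<in> V" "v \<in> V" "w \<in> V" for u v w a b
      by (rule lin[OF that])
    show "h u v = h v u" if "u \<in> V" "v \<in> V" for u v by (rule sym[OF that])
    show "h v v \<ge> 0" if "v \<in> V" for v by (rule pos[OF that])
    show "v = (\<lambda>K x. 0)" if "v \<in> V" "h v v = 0" for v by (rule df[OF that])
  qed (intro exI conjI ballI; assumption)
  then obtain E where E: "finite E" "E \<subseteq> V" and on: "\<forall>e\<in>E. \<forall>e'\<in>E. h e e' = (if e = e' then 1 else 0)"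
    and ex: "\<forall>v\<in>V. v = (\<lambda>K x. \<Sum>e\<in>E. h v e * e K x)"
    by (elim exE conjE)
  have EV: "e \<in> V" if "e \<in> E" for e using E(2) that by blast
  show ?thesis
  proof (rule that[OF E])
    show "\<forall>v\<in>V. v = (\<lambda>K x. \<Sum>e\<in>E. h v e * e K x)" by (rule ex)
    show "\<forall>c. (nrm (\<lambda>K x. \<Sum>e\<in>E. c e * e K x))\<^sup>2 = (\<Sum>e\<in>E. (c e)\<^sup>2)"
    proof
      fix c
      define v where "v = (\<lambda>K x. \<Sum>e\<in>E. c e * e K x)"
      have v: "v \<in> V" unfolding v_def by (rule lin_closed_sum[OF V_lin_closed E(1) EV])
      have s: "h v w = (\<Sum>e\<in>E. c e * h e w)" if "w \<in> V" for w
        unfolding v_def by (rule lin_functional_sum[OF V_lin_closed, of "\<lambda>u. h u w"]) (use lin that E(1) EV in auto)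
      have "h v e' = c e'" if e': "e' \<in> E" for e'
      proof -
        have "h v e' = (\<Sum>e\<in>E. if e = e' then c e else 0)"
          unfolding s[OF EV[OF e']] by (rule sum.cong[OF refl]) (use on e' in simp)
        then show ?thesis using E(1) e' by simp
      qed
      then have "h e v = c e" if "e \<in> E" for e using sym[OF EV[OF that] v] that by simp
      then have "h v v = (\<Sum>e\<in>E. (c e)\<^sup>2)" unfolding s[OF v] by (simp add: power2_eq_square)
      then show "(nrm v)\<^sup>2 = (\<Sum>e\<in>E. (c e)\<^sup>2)" using dg_norm_sq(1)[OF VW[OF v]] by (simp add: h_def)
    qed
  qed
qed

lemma linear_functional_sum:
  assumes \<phi>: "linear_functional_on V \<phi>" and E: "finite E" "E \<subseteq> V"
  shows "\<phi> (\<lambda>K x. \<Sum>e\<in>E. c e * e K x) = (\<Sum>e\<in>E. c e * \<phi> e)"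
proof (rule lin_functional_sum[OF V_lin_closed _ E(1)])
  show "\<phi> (\<lambda>K x. a * u K x + b * v K x) = a * \<phi> u + b * \<phi> v" if "u \<in> V" "v \<in> V" for u v a b
    using \<phi> that unfolding linear_functional_on_def by blast
  show "e \<in> V" if "e \<in> E" for e using E(2) that by blast
qed

lemma linear_functional_bounded:
  assumes \<phi>: "linear_functional_on V \<phi>"
  shows "\<exists>C\<ge>0. \<forall>v\<in>V. \<bar>\<phi> v\<bar> \<le> C * nrm v"
proof -
  obtain E g where E: "finite E" "E \<subseteq> V" and ex: "\<forall>v\<in>V. v = (\<lambda>K x. \<Sum>e\<in>E. g v e * e K x)"
    and nr: "\<forall>c. (nrm (\<lambda>K x. \<Sum>e\<in>E. c e * e K x))\<^sup>2 = (\<Sum>e\<in>E. (c e)\<^sup>2)" by (rule orthonormal_basis)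
  have "\<bar>\<phi> v\<bar> \<le> (\<Sum>e\<in>E. \<bar>\<phi> e\<bar>) * nrm v" if v: "v \<in> V" for v
  proof -
    note ev = bspec[OF ex v]
    have "nrm v = nrm (\<lambda>K x. \<Sum>e\<in>E. g v e * e K x)" by (rule arg_cong[OF ev, where f = nrm])
    then have sq: "(nrm v)\<^sup>2 = (\<Sum>e\<in>E. (g v e)\<^sup>2)" using nr[rule_format, of "g v"] by (simp only:)
    have le: "\<bar>g v e\<bar> \<le> nrm v" if e: "e \<in> E" for e
    proof (rule power2_le_imp_le[OF _ nrm_nonneg])
      show "\<bar>g v e\<bar>\<^sup>2 \<le> (nrm v)\<^sup>2"
        unfolding sq power2_abs by (rule member_le_sum[OF e _ E(1)]) simp
    qed
    have "\<phi> v = \<phi> (\<lambda>K x. \<Sum>e\<in>E. g v e * e K x)" by (rule arg_cong[OF ev, where f = \<phi>])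
    also have "\<dots> = (\<Sum>e\<in>E. g v e * \<phi> e)" by (rule linear_functional_sum[OF \<phi> E])
    finally have "\<bar>\<phi> v\<bar> \<le> (\<Sum>e\<in>E. \<bar>g v e * \<phi> e\<bar>)" by simp
    also have "\<dots> \<le> (\<Sum>e\<in>E. \<bar>\<phi> e\<bar> * nrm v)"
      by (rule sum_mono) (unfold abs_mult mult.commute[of "\<bar>\<phi> _\<bar>"], rule mult_right_mono[OF le], simp_all)
    finally show ?thesis by (simp only: sum_distrib_right)
  qed
  then show ?thesis by (intro exI[of _ "\<Sum>e\<in>E. \<bar>\<phi> e\<bar>"]) (simp add: sum_nonneg)
qed

end

context dg_method
begin

section \<open>The nonlinear operator\<close>

definition DG_operator :: "'n broken \<Rightarrow> 'n broken \<Rightarrow> real" where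
  "DG_operator u v = adg \<theta> (Ep u) v + s (Em u) v"

lemma Ep_W: "Ep u \<in> W"
  by (rule E_plus_properties(1)[OF submesh_bundle degree])

lemma Ep_node: "K \<in> \<P> \<Longrightarrow> T \<in> \<T> K \<Longrightarrow> z \<in> lagrange_nodes k T \<Longrightarrow> Ep v K z = max 0 (min (v K z) \<kappa>)"
  by (rule E_plus_properties(2)[OF submesh_bundle degree])

lemma Em_eq: "Em u K x = u K x - Ep u K x"
  by (simp add: E_minus_def fun_diff_def)

lemma operator_linear: "linear_functional_on V (DG_operator u)"
  unfolding linear_functional_on_def
proof (intro ballI allI)
  fix v w a b assume v: "v \<in> V" and w: "w \<in> V"
  show "DG_operator u (\<lambda>K x. a * v K x + b * w K x) = a * DG_operator u v + b * DG_operator u w"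
    unfolding DG_operator_def a_DG_linear(2)[OF VW[OF v] VW[OF w] Ep_W] s_commute[of "Em u"] s_linear
    by (simp add: algebra_simps)
qed

lemma difference_splitting:
  assumes u: "u \<in> V" and w: "w \<in> V"
  obtains e m where "e \<in> W" "m \<in> W" "u - w = (\<lambda>K x. 1 * e K x + 1 * m K x)"
    "\<forall>z\<in>V. DG_operator u z - DG_operator w z = adg \<theta> e z + s m z"
    "s m m \<le> s m (u - w)" "s e e \<le> s (u - w) (u - w)" "s m m \<le> s (u - w) (u - w)"
proof
  define e where "e = (\<lambda>K x. 1 * Ep u K x + (-1) * Ep w K x)"
  define m where "m = (\<lambda>K x. 1 * Em u K x + (-1) * Em w K x)"
  have EmW: "Em v \<in> W" if "v \<in> V" for v
    unfolding E_minus_def by (rule W_space_diff[OF VW[OF that] Ep_W])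
  show "e \<in> W" unfolding e_def by (rule W_comb[OF Ep_W Ep_W])
  show "m \<in> W" unfolding m_def by (rule W_comb[OF EmW[OF u] EmW[OF w]])
  show "u - w = (\<lambda>K x. 1 * e K x + 1 * m K x)" by (simp add: e_def m_def Em_eq fun_eq_iff)
  have "DG_operator u z - DG_operator w z = adg \<theta> e z + s m z" if "z \<in> V" for z
    unfolding DG_operator_def e_def m_def a_DG_linear(1)[OF Ep_W Ep_W VW[OF that]] s_linear by simp
  then show "\<forall>z\<in>V. DG_operator u z - DG_operator w z = adg \<theta> e z + s m z" by (rule ballI)
  have em: "0 \<le> e K z * m K z" "(u - w) K z = e K z + m K z" if "K \<in> \<P>" "T \<in> \<T> K" "z \<in> lagrange_nodes k T" for K T z
  proof -
    show "0 \<le> e K z * m K z"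
      using clip_product_nonneg[of "u K z" \<kappa> "w K z"]
      by (simp add: e_def m_def Em_eq Ep_node[OF that] diff_diff_eq2 algebra_simps)
    show "(u - w) K z = e K z + m K z" by (simp add: e_def m_def Em_eq)
  qed
  show "s m m \<le> s m (u - w)"
    by (rule s_mono) (use em in \<open>simp add: algebra_simps\<close>)
  show "s e e \<le> s (u - w) (u - w)"
  proof (rule s_mono)
    fix K T z assume a: "K \<in> \<P>" "T \<in> \<T> K" "z \<in> lagrange_nodes k T"
    show "e K z * e K z \<le> (u - w) K z * (u - w) K z"
      unfolding em(2)[OF a] using em(1)[OF a] zero_le_square[of "m K z"] by (simp add: algebra_simps)
  qed
  show "s m m \<le> s (u - w) (u - w)"
  proof (rule s_mono)
    fix K T z assume a: "K \<in> \<P>" "T \<in> \<T> K" "z \<in> lagrange_nodes k T"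
    show "m K z * m K z \<le> (u - w) K z * (u - w) K z"
      unfolding em(2)[OF a] using em(1)[OF a] zero_le_square[of "e K z"] by (simp add: algebra_simps)
  qed
qed

text \<open>Clipping is monotone, so at every node the differences of the two parts have the same sign; hence
  the stabilisation of the mixed part has the right sign.\<close>

lemma strongly_monotone:
  assumes u: "u \<in> V" and w: "w \<in> V"
  shows "1 / 5 * (nrm (u - w))\<^sup>2 \<le> DG_operator u (u - w) - DG_operator w (u - w)"
proof -
  obtain e m where em: "e \<in> W" "m \<in> W" "u - w = (\<lambda>K x. 1 * e K x + 1 * m K x)"
    and T: "\<forall>z\<in>V. DG_operator u z - DG_operator w z = adg \<theta> e z + s m z" and S: "s m m \<le> s m (u - w)"
    by (rule difference_splitting[OF u w])
  have v: "u - w \<in> V" by (rule V_space_diff[OF u w])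
  have vW: "u - w \<in> W" by (rule VW[OF v])
  have "adg \<theta> (u - w) (u - w) = adg \<theta> e (u - w) + adg \<theta> m (u - w)"
    using a_DG_linear(1)[OF em(1,2) vW, of \<theta> 1 1] em(3) by simp
  moreover have "1 / 5 * (E + J) \<le> x + S"
    if "y = x + z" "S' \<le> S" "z \<le> 14 / 25 * S' + 23 / 160 * E + 7 / 40 * J" "2 / 5 * E + 3 / 8 * J \<le> y"
      "0 \<le> E" "0 \<le> J" "0 \<le> S'" for x y z S S' E J :: real
    using that by argo
  ultimately show ?thesis
    unfolding bspec[OF T v] dg_norm_sq(1)[OF vW]
    using S abs_le_D1[OF mixed_bound[OF em(2) v]] coercive[OF v] dg_norm_sq(4,5)[OF vW] s_nonneg by blast
qed

lemma s_square:
  "s (\<lambda>K x. a * u K x + b * v K x) (\<lambda>K x. a * u K x + b * v K x) = a\<^sup>2 * s u u + 2 * a * b * s u v + b\<^sup>2 * s v v"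
proof -
  let ?y = "\<lambda>K x. a * u K x + b * v K x"
  have "s ?y ?y = a * s u ?y + b * s v ?y" by (rule s_linear)
  moreover have "s u ?y = a * s u u + b * s v u" by (rule trans[OF s_commute s_linear])
  moreover have "s v ?y = a * s u v + b * s v v" by (rule trans[OF s_commute s_linear])
  moreover have "s v u = s u v" by (rule s_commute)
  ultimately show ?thesis by (simp add: power2_eq_square algebra_simps)
qed

text \<open>A nodal value is a linear functional on a finite-dimensional normed space, hence
  bounded. The bounds \<open>C K z\<close> can be read as a broken function, and its own
  stabilisation is the constant.\<close>

lemma stab_bounded: "\<exists>C\<ge>0. \<forall>v\<in>V. s v v \<le> C * (nrm v)\<^sup>2"
proof -
  have "\<exists>C\<ge>0. \<forall>v\<in>V. \<bar>v K z\<bar> \<le> C * nrm v" for K z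
    by (rule linear_functional_bounded[of "\<lambda>v. v K z"]) (simp add: linear_functional_on_def)
  then have "\<forall>K. \<forall>z. \<exists>C\<ge>0. \<forall>v\<in>V. \<bar>v K z\<bar> \<le> C * nrm v" by blast
  then obtain C where C: "\<forall>K z. C K z \<ge> 0 \<and> (\<forall>v\<in>V. \<bar>v K z\<bar> \<le> C K z * nrm v)" by metis
  have "s v v \<le> s C C * (nrm v)\<^sup>2" if v: "v \<in> V" for v
  proof -
    let ?w = "\<lambda>K x. nrm v * C K x + 0 * C K x"
    have "s v v \<le> s ?w ?w"
    proof (rule s_mono)
      fix K z
      have "\<bar>v K z\<bar> \<le> C K z * nrm v" using C v by blast
      then have "(v K z)\<^sup>2 \<le> (C K z * nrm v)\<^sup>2" by (rule power2_le_iff_abs_le[THEN iffD2, rotated]) (use C nrm_nonneg in simp)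
      then show "v K z * v K z \<le> ?w K z * ?w K z" by (simp add: power2_eq_square mult_ac)
    qed
    also have "s ?w ?w = s C C * (nrm v)\<^sup>2" unfolding s_square by simp
    finally show ?thesis .
  qed
  then show ?thesis using s_nonneg[of C] by blast
qed

text \<open>All coefficients in \<open>mixed_bound\<close> are below 1. Applying it to t m for every
  t and using \<open>quadratic_bound\<close> replaces the sum by a product.\<close>

lemma mixed_continuous:
  assumes m: "m \<in> W" and v: "v \<in> V"
  shows "\<bar>adg \<theta> m v\<bar> \<le> 2 * sqrt (s m m) * nrm v"
proof -
  have vW: "v \<in> W" by (rule VW[OF v])
  have "(adg \<theta> m v)\<^sup>2 \<le> 4 * s m m * (nrm v)\<^sup>2"
  proof (rule quadratic_bound[OF _ s_nonneg])
    fix t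
    let ?m = "\<lambda>K x. t * m K x + 0 * m K x"
    have mW: "?m \<in> W" by (rule W_comb[OF m m])
    have "adg \<theta> ?m v = t * adg \<theta> m v" using a_DG_linear(1)[OF m m vW, of \<theta> t 0] by simp
    moreover have "s ?m ?m = t\<^sup>2 * s m m" unfolding s_square by simp
    ultimately show "t * adg \<theta> m v \<le> t\<^sup>2 * s m m + (nrm v)\<^sup>2"
      using mixed_bound[OF mW v] dg_norm_sq(1,4,5)[OF vW] s_nonneg[of ?m] abs_ge_self[of "adg \<theta> ?m v"] by linarith
  qed
  then have "sqrt ((adg \<theta> m v)\<^sup>2) \<le> sqrt (4 * s m m * (nrm v)\<^sup>2)" by (rule real_sqrt_le_mono)
  then show ?thesis using nrm_nonneg by (simp add: real_sqrt_mult)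
qed

lemma stab_Cauchy_Schwarz: "\<bar>s m v\<bar> \<le> sqrt (s m m) * sqrt (s v v)"
proof -
  have "(2 * s m v)\<^sup>2 \<le> 4 * s m m * s v v"
  proof (rule quadratic_bound[OF _ s_nonneg])
    fix t
    let ?y = "\<lambda>K x. t * m K x + (-1) * v K x"
    have "s ?y ?y = t\<^sup>2 * s m m - t * (2 * s m v) + s v v" unfolding s_square by simp
    then show "t * (2 * s m v) \<le> t\<^sup>2 * s m m + s v v" using s_nonneg[of ?y] by linarith
  qed
  then have "(s m v)\<^sup>2 \<le> s m m * s v v" by (simp add: power_mult_distrib)
  then have "sqrt ((s m v)\<^sup>2) \<le> sqrt (s m m * s v v)" by (rule real_sqrt_le_mono)
  then show ?thesis by (simp add: real_sqrt_mult)
qed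

text \<open>The parts e and m are piecewise polynomials that need not lie in V. Their stabilisation
  is compared at the nodes with that of u - w, which does lie in V, where
  \<open>stab_bounded\<close> applies; this is the form in which \<open>mixed_continuous\<close>
  asks for control of e.\<close>

lemma Lipschitz: "\<exists>M\<ge>0. \<forall>u\<in>V. \<forall>w\<in>V. \<forall>z\<in>V. \<bar>DG_operator u z - DG_operator w z\<bar> \<le> M * nrm (u - w) * nrm z"
proof -
  obtain C where C: "C \<ge> 0" "\<forall>v\<in>V. s v v \<le> C * (nrm v)\<^sup>2" using stab_bounded by blast
  have "\<bar>DG_operator u z - DG_operator w z\<bar> \<le> (2 * sqrt C + C) * nrm (u - w) * nrm z" if u: "u \<in> V" and w: "w \<in> V" and z: "z \<in> V" for u w z
  proof -
    obtain e m where em: "e \<in> W" "m \<in> W"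
      and T: "\<forall>z\<in>V. DG_operator u z - DG_operator w z = adg \<theta> e z + s m z"
      and S: "s e e \<le> s (u - w) (u - w)" "s m m \<le> s (u - w) (u - w)"
      by (rule difference_splitting[OF u w])
    have v: "u - w \<in> V" by (rule V_space_diff[OF u w])
    have sq: "sqrt x \<le> sqrt C * nrm y" if "x \<le> s y y" "y \<in> V" for x y
    proof -
      have "x \<le> C * (nrm y)\<^sup>2" using C(2) that by force
      then have "sqrt x \<le> sqrt (C * (nrm y)\<^sup>2)" by (rule real_sqrt_le_mono)
      then show ?thesis using nrm_nonneg by (simp add: real_sqrt_mult)
    qed
    have "\<bar>adg \<theta> e z\<bar> \<le> 2 * sqrt (s e e) * nrm z" by (rule mixed_continuous[OF em(1) z])
    also have "\<dots> \<le> 2 * (sqrt C * nrm (u - w)) * nrm z"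
      by (intro mult_right_mono mult_left_mono sq[OF S(1) v] nrm_nonneg) simp
    finally have 1: "\<bar>adg \<theta> e z\<bar> \<le> 2 * sqrt C * nrm (u - w) * nrm z" by simp
    have "\<bar>s m z\<bar> \<le> sqrt (s m m) * sqrt (s z z)" by (rule stab_Cauchy_Schwarz)
    also have "\<dots> \<le> (sqrt C * nrm (u - w)) * (sqrt C * nrm z)"
      by (intro mult_mono sq[OF S(2) v] sq[OF order_refl z] mult_nonneg_nonneg nrm_nonneg real_sqrt_ge_zero C(1) s_nonneg)
    also have "\<dots> = (sqrt C * sqrt C) * nrm (u - w) * nrm z" by (simp only: mult_ac)
    also have "\<dots> = C * nrm (u - w) * nrm z" using C(1) by simp
    finally have 2: "\<bar>s m z\<bar> \<le> C * nrm (u - w) * nrm z" .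
    have "\<bar>DG_operator u z - DG_operator w z\<bar> \<le> \<bar>adg \<theta> e z\<bar> + \<bar>s m z\<bar>" unfolding bspec[OF T z] by (rule abs_triangle_ineq)
    then show ?thesis using 1 2 by (simp add: algebra_simps)
  qed
  then show ?thesis using C(1) by (intro exI[of _ "2 * sqrt C + C"]) simp
qed

lemma operator_dual: "DG_operator u \<in> dual_space V nrm"
  unfolding dual_space_def using operator_linear[of u] linear_functional_bounded[OF operator_linear[of u]] by blast

lemma zero_in_V: "(\<lambda>K x. 0) \<in> V" "nrm (\<lambda>K x. 0) = 0"
proof -
  show z: "(\<lambda>K x. 0) \<in> V" using V_lin_closed unfolding lin_closed_def by (elim conjE)
  have "vol_form (\<lambda>K x. 0 * (0::real) + 0 * 0) (\<lambda>K x. 0) = 0" "jump_form (\<lambda>K x. 0 * (0::real) + 0 * 0) (\<lambda>K x. 0) = 0"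
    using forms_linear_left(1,2)[OF VW[OF z] VW[OF z] VW[OF z], of 0 0] by simp_all
  then show "nrm (\<lambda>K x. 0) = 0" using dg_norm_sq(1)[OF VW[OF z]] by simp
qed

lemma operator_continuous:
  assumes u: "u \<in> V" and \<epsilon>: "\<epsilon> > 0"
  shows "\<exists>\<delta>>0. \<forall>w\<in>V. nrm (w - u) < \<delta> \<longrightarrow> dual_norm V nrm (DG_operator w - DG_operator u) < \<epsilon>"
proof -
  obtain M where M: "M \<ge> 0" "\<forall>u\<in>V. \<forall>w\<in>V. \<forall>z\<in>V. \<bar>DG_operator u z - DG_operator w z\<bar> \<le> M * nrm (u - w) * nrm z"
    using Lipschitz by blast
  show ?thesis
  proof (intro exI conjI ballI impI)
    show "\<epsilon> / (M + 1) > 0" using \<epsilon> M(1) by simp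
    fix w assume w: "w \<in> V" and lt: "nrm (w - u) < \<epsilon> / (M + 1)"
    have "dual_norm V nrm (DG_operator w - DG_operator u) \<le> M * nrm (w - u)"
      unfolding dual_norm_def
    proof (rule cSUP_least)
      show "{v \<in> V. nrm v \<le> 1} \<noteq> {}" using zero_in_V by force
      fix z assume "z \<in> {v \<in> V. nrm v \<le> 1}"
      then have z: "z \<in> V" "nrm z \<le> 1" by auto
      have "\<bar>DG_operator w z - DG_operator u z\<bar> \<le> M * nrm (w - u) * nrm z" using M(2) w u z(1) by blast
      also have "\<dots> \<le> M * nrm (w - u) * 1" by (intro mult_left_mono z(2) mult_nonneg_nonneg M(1) nrm_nonneg)
      finally show "\<bar>(DG_operator w - DG_operator u) z\<bar> \<le> M * nrm (w - u)" by (simp add: fun_diff_def)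
    qed
    also have "\<dots> \<le> (M + 1) * nrm (w - u)" by (intro mult_right_mono nrm_nonneg) simp
    also have "\<dots> < \<epsilon>" using lt M(1) by (simp add: pos_less_divide_eq mult.commute)
    finally show "dual_norm V nrm (DG_operator w - DG_operator u) < \<epsilon>" .
  qed
qed

text \<open>In orthonormal coordinates the residual is strongly monotone with constant 1/5 and
  Lipschitz for the Euclidean norm. Its zero satisfies the equation for the basis functions, and by
  linearity in v for all test functions.\<close>

lemma solution_exists:
  assumes load: "linear_functional_on V load"
  shows "\<exists>u\<in>V. \<forall>v\<in>V. DG_operator u v = load v"
proof -
  obtain E g where E: "finite E" "E \<subseteq> V" and ex: "\<forall>v\<in>V. v = (\<lambda>K x. \<Sum>e\<in>E. g v e * e K x)"
    and nr: "\<forall>c. (nrm (\<lambda>K x. \<Sum>e\<in>E. c e * e K x))\<^sup>2 = (\<Sum>e\<in>E. (c e)\<^sup>2)" by (rule orthonormal_basis)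
  define U where "U c = (\<lambda>K x. \<Sum>e\<in>E. c e * e K x)" for c :: "'n broken \<Rightarrow> real"
  have UV: "U c \<in> V" for c unfolding U_def by (rule lin_closed_sum[OF V_lin_closed E(1)]) (use E(2) in blast)
  have Ud: "U x - U y = U (\<lambda>e. x e - y e)" for x y
    by (simp add: U_def fun_eq_iff sum_subtractf left_diff_distrib)
  have nU: "(nrm (U x - U y))\<^sup>2 = (\<Sum>e\<in>E. (x e - y e)\<^sup>2)" for x y
    unfolding Ud unfolding U_def by (rule nr[rule_format])
  have TU: "DG_operator u (U c) = (\<Sum>e\<in>E. c e * DG_operator u e)" for u c
    unfolding U_def by (rule linear_functional_sum[OF operator_linear E])
  define A where "A x e = DG_operator (U x) e - load e" for x e
  obtain M where M: "M \<ge> 0" "\<forall>u\<in>V. \<forall>w\<in>V. \<forall>z\<in>V. \<bar>DG_operator u z - DG_operator w z\<bar> \<le> M * nrm (u - w) * nrm z"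
    using Lipschitz by blast
  have "\<exists>x. \<forall>e\<in>E. A x e = 0"
  proof (rule zarantonello_finite[OF E(1)])
    show "(1 / 5 :: real) > 0" by simp
    fix x y
    have "1 / 5 * (\<Sum>e\<in>E. (x e - y e)\<^sup>2) \<le> DG_operator (U x) (U x - U y) - DG_operator (U y) (U x - U y)"
      using strongly_monotone[OF UV[of x] UV[of y]] unfolding nU .
    also have "\<dots> = (\<Sum>e\<in>E. (A x e - A y e) * (x e - y e))"
      unfolding Ud TU sum_subtractf[symmetric] A_def by (rule sum.cong[OF refl]) (simp add: algebra_simps)
    finally show "1 / 5 * (\<Sum>e\<in>E. (x e - y e)\<^sup>2) \<le> (\<Sum>e\<in>E. (A x e - A y e) * (x e - y e))" .
    have "(\<Sum>e\<in>E. (A x e - A y e)\<^sup>2) \<le> (\<Sum>e\<in>E. M\<^sup>2 * (nrm e)\<^sup>2 * (\<Sum>e\<in>E. (x e - y e)\<^sup>2))"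
    proof (rule sum_mono)
      fix e assume e: "e \<in> E"
      have "\<bar>A x e - A y e\<bar> \<le> M * nrm (U x - U y) * nrm e"
        using M(2) UV E(2) e unfolding A_def by auto
      then have "(A x e - A y e)\<^sup>2 \<le> (M * nrm (U x - U y) * nrm e)\<^sup>2"
        by (rule power2_le_iff_abs_le[THEN iffD2, rotated]) (intro mult_nonneg_nonneg M(1) nrm_nonneg)
      then show "(A x e - A y e)\<^sup>2 \<le> M\<^sup>2 * (nrm e)\<^sup>2 * (\<Sum>e\<in>E. (x e - y e)\<^sup>2)"
        unfolding nU[symmetric] by (simp add: power_mult_distrib mult_ac)
    qed
    then show "(\<Sum>e\<in>E. (A x e - A y e)\<^sup>2) \<le> (\<Sum>e\<in>E. M\<^sup>2 * (nrm e)\<^sup>2) * (\<Sum>e\<in>E. (x e - y e)\<^sup>2)"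
      by (simp add: sum_distrib_right)
  qed
  then obtain x where x: "\<forall>e\<in>E. A x e = 0" ..
  have "DG_operator (U x) v = load v" if v: "v \<in> V" for v
  proof -
    note ev = bspec[OF ex v]
    have "DG_operator (U x) v = DG_operator (U x) (\<lambda>K y. \<Sum>e\<in>E. g v e * e K y)" by (rule arg_cong[OF ev, where f = "DG_operator (U x)"])
    also have "\<dots> = (\<Sum>e\<in>E. g v e * DG_operator (U x) e)" by (rule linear_functional_sum[OF operator_linear E])
    also have "\<dots> = (\<Sum>e\<in>E. g v e * load e)" by (rule sum.cong[OF refl]) (use x in \<open>simp add: A_def\<close>)
    also have "\<dots> = load (\<lambda>K y. \<Sum>e\<in>E. g v e * e K y)" by (rule linear_functional_sum[OF load E, symmetric])
    also have "\<dots> = load v" by (rule arg_cong[OF ev, where f = load, symmetric])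
    finally show ?thesis .
  qed
  then show ?thesis using UV by blast
qed

lemma solution_unique:
  assumes u: "u \<in> V" and w: "w \<in> V" and eq: "\<And>v. v \<in> V \<Longrightarrow> DG_operator u v = DG_operator w v"
  shows "u = w"
proof -
  have v: "u - w \<in> V" by (rule V_space_diff[OF u w])
  have "(nrm (u - w))\<^sup>2 \<le> 0" using strongly_monotone[OF u w] eq[OF v] by simp
  then have "vol_form (u - w) (u - w) + jump_form (u - w) (u - w) = 0"
    using dg_norm_sq(1)[OF VW[OF v]] zero_le_power2[of "nrm (u - w)"] by linarith
  then have "u - w = (\<lambda>K x. 0)" by (rule norm_definite[OF v])
  then have "u K x - w K x = 0" for K x by (simp add: fun_eq_iff)
  then show ?thesis by (simp add: fun_eq_iff)
qed

end

theorem theorem3p7: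
  fixes \<Omega> :: "(real^'n) set"
    and \<P> \<F> :: "(real^'n) set set"
    and \<T> :: "(real^'n) set \<Rightarrow> (real^'n) set set"
    and D :: "real^'n \<Rightarrow> real^'n^'n"
    and \<mu> :: "real^'n \<Rightarrow> real"
    and load :: "'n broken \<Rightarrow> real"
    and k :: nat
    and \<kappa> \<theta> \<gamma> Cstar Cqu Csh Cequiv :: real
  defines "V \<equiv> V_space \<P> k"
    and "\<alpha> \<equiv> stab_weight \<T> Cstar \<gamma>"
    and "a \<equiv> a_DG \<P> \<F> D \<mu> k Cstar \<theta>"
  defines "s \<equiv> stab \<P> \<F> \<T> D \<mu> k \<alpha>"
    and "nrm \<equiv> dg_norm \<P> \<F> D \<mu> k Cstar"
    and "Ep \<equiv> E_plus \<P> \<T> k \<kappa>"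
    and "Em \<equiv> E_minus \<P> \<T> k \<kappa>"
  defines "Top \<equiv> \<lambda>u v. a (Ep u) v + s (Em u) v"
  assumes dim: "CARD('n) \<in> {2, 3}"
    and domain: "polyhedral_domain \<Omega>"
    and mesh: "admissible_mesh \<Omega> \<P> \<F> Cstar Cqu"
    and submesh: "admissible_submesh \<P> \<T> Csh"
    and diffusion: "diffusion_coefficient \<Omega> D"
    and traces: "traces_well_defined \<P> \<F> D"
    and reaction: "L_infty \<Omega> \<mu>" "AE x in lebesgue_on \<Omega>. 0 \<le> \<mu> x"
    and degree: "k \<ge> 1"
    and bound: "\<kappa> > 0"
    and theta: "\<theta> \<in> {-1..1}"
    and equiv_pos: "Cequiv > 0"
    and equiv: "\<And>v. v \<in> W_space \<P> \<T> k \<Longrightarrow>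
      (nrm v)\<^sup>2 \<le> Cequiv * (stab_norm \<P> \<F> \<T> D \<mu> k \<alpha> (\<lambda>K x. \<alpha> K powr (-1/2) * v K x))\<^sup>2"
    and gamma: "\<gamma> \<ge> 25 * Cequiv"
    and linear: "linear_functional_on V load"
  shows "(\<forall>u\<in>V. Top u \<in> dual_space V nrm)
    \<and> (\<forall>u\<in>V. \<forall>\<epsilon>>0. \<exists>\<delta>>0. \<forall>w\<in>V. nrm (w - u) < \<delta> \<longrightarrow> dual_norm V nrm (Top w - Top u) < \<epsilon>)
    \<and> (\<exists>c>0. \<forall>v\<in>V. \<forall>w\<in>V. (Top v - Top w) (v - w) \<ge> c * (nrm (v - w))\<^sup>2)
    \<and> (\<exists>!u. u \<in> V \<and> (\<forall>v\<in>V. a (Ep u) v + s (Em u) v = load v))"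
proof -
  note defs = V_def \<alpha>_def a_def s_def nrm_def Ep_def Em_def Top_def
  interpret dg_method \<Omega> \<P> \<F> \<T> D \<mu> k Cstar Cqu Csh \<kappa> \<theta> \<gamma> Cequiv
    by unfold_locales
       (rule dim domain mesh submesh diffusion traces reaction degree theta equiv_pos gamma
          | rule equiv[unfolded defs], assumption)+
  have top: "Top = DG_operator" by (intro ext) (simp only: defs DG_operator_def)
  show ?thesis
  proof (intro conjI)
    show "\<forall>u\<in>V. Top u \<in> dual_space V nrm"
      unfolding top unfolding defs using operator_dual by blast
    show "\<forall>u\<in>V. \<forall>\<epsilon>>0. \<exists>\<delta>>0. \<forall>w\<in>V. nrm (w - u) < \<delta> \<longrightarrow> dual_norm V nrm (Top w - Top u) < \<epsilon>"
      unfolding top unfolding defs using operator_continuous by (intro ballI allI impI)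
    show "\<exists>c>0. \<forall>v\<in>V. \<forall>w\<in>V. c * (nrm (v - w))\<^sup>2 \<le> (Top v - Top w) (v - w)"
      unfolding top unfolding defs
    proof (intro exI[of _ "1 / 5"] conjI ballI)
      show "1 / 5 * (dg_norm \<P> \<F> D \<mu> k Cstar (v - w))\<^sup>2 \<le> (DG_operator v - DG_operator w) (v - w)"
        if "v \<in> V_space \<P> k" "w \<in> V_space \<P> k" for v w
        using strongly_monotone[OF that] by (simp only: fun_diff_def)
    qed simp
    have "\<exists>!u. u \<in> V \<and> (\<forall>v\<in>V. Top u v = load v)"
      unfolding top unfolding defs
    proof (rule ex_ex1I)
      show "\<exists>u. u \<in> V_space \<P> k \<and> (\<forall>v\<in>V_space \<P> k. DG_operator u v = load v)"
        using solution_exists[OF linear[unfolded defs]] by blast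
      show "u = w" if "u \<in> V_space \<P> k \<and> (\<forall>v\<in>V_space \<P> k. DG_operator u v = load v)"
        "w \<in> V_space \<P> k \<and> (\<forall>v\<in>V_space \<P> k. DG_operator w v = load v)" for u w
        by (rule solution_unique) (use that in simp_all)
    qed
    then show "\<exists>!u. u \<in> V \<and> (\<forall>v\<in>V. a (Ep u) v + s (Em u) v = load v)"
      unfolding Top_def .
  qed
qed

end
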